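(* Let $P\in\Psi DO^m(\mathbb{R}^n)$ be properly supported, classical and elliptic of order $m$, and let $u\in\mathcal{D}'(\mathbb{R}^n)$. If $Pu\in C^\infty(\mathbb{R}^n)$ then $u\in C^\infty(\mathbb{R}^n)$. More generally, for any $u\in\mathcal{D}'(\mathbb{R}^n)$, $$\operatorname{singsupp}(Pu)=\operatorname{singsupp}(u).$$
   Context: Notation: $D_{x_j}=-i\,\partial_{x_j}$, $\langle\theta\rangle=(1+|\theta|^2)^{1/2}$. For $m\in\mathbb{R}$, $S^m(\mathbb{R}^N;\mathbb{R}^k)$ is the set of $a\in C^\infty(\mathbb{R}^N\times\mathbb{R}^k)$ such that for all multi-indices $\alpha,\beta$ and compact $K$ there is $C$ with $|D_x^\alpha D_\theta^\beta a(x,\theta)|\le C\langle\theta\rangle^{m-|\beta|}$ for $x\in K$ and all $\theta$. $\Psi DO^m(\mathbb{R}^n)$ is the set of operators whose Schwartz kernel is an oscillatory integral $(2\pi)^{-n}\int e^{i\langle x-y,\xi\rangle}a(x,y,\xi)\,d\xi$ with $a\in S^m(\mathbb{R}^n_x\times\mathbb{R}^n_y;\mathbb{R}^n_\xi)$. An operator is properly supported if both coordinate projections from the support of its kernel to $\mathbb{R}^n$ are proper; a properly supported pseudo-differential operator acts on $\mathcal{D}'(\mathbb{R}^n)$ by $\langle Pu,\phi\rangle=\langle u,P^t\phi\rangle$. Modulo a smooth kernel, $P\in\Psi DO^m$ can be written with $a=p(x,\xi)\in S^m(\mathbb{R}^n;\mathbb{R}^n)$, the total left symbol, unique modulo $S^{-\infty}=\bigcap_m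 S^m$. $P$ is classical if there are functions $p_{m-j}(x,\xi)$, $j\ge0$, smooth on $\xi\neq0$ and positively homogeneous of degree $m-j$ in $\xi$, with $p-\sum_{j<N}(1-\phi(\xi))p_{m-j}\in S^{m-N}$ for all $N$, where $\phi\in C_0^\infty(\mathbb{R}^n)$ equals $1$ near $0$. The principal symbol is $\sigma_m(P)=p_m$, and $P$ is elliptic of order $m$ if $\sigma_m(P)(x,\xi)\ne0$ for all $x$ and all $\xi\neq0$. *)

theory Defs
  imports "HOL-Analysis.Analysis"
begin

section \<open>Smooth functions\<close>

definition D :: "'a::euclidean_space \<Rightarrow> ('a \<Rightarrow> complex) \<Rightarrow> 'a \<Rightarrow> complex" where
  "D b f x = - \<i> * frechet_derivative f (at x) b"

text \<open>
  A multi-index \<open>\<alpha>\<close> is encoded by a list of basis vectors in which the \<open>j\<close>-th basis vector occurs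
  \<open>\<alpha>\<^sub>j\<close> times, so that \<open>|\<alpha>|\<close> is the length of the list. On smooth functions the order of
  the list is irrelevant. \<open>iterD\<close> is also used with lists of basis vectors of a product space.
\<close>

definition iterD :: "'a::euclidean_space list \<Rightarrow> ('a \<Rightarrow> complex) \<Rightarrow> 'a \<Rightarrow> complex" where
  "iterD \<alpha> f = foldr D \<alpha> f"

text \<open>Only meant for open \<open>U\<close>.\<close>

definition smooth_on :: "'a::euclidean_space set \<Rightarrow> ('a \<Rightarrow> complex) \<Rightarrow> bool" where
  "smooth_on U f \<longleftrightarrow> (\<forall>\<alpha>\<in>lists Basis. \<forall>x\<in>U. iterD \<alpha> f differentiable (at x))"

definition fun_supp :: "('a::euclidean_space \<Rightarrow> complex) \<Rightarrow> 'a set" where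
  "fun_supp f = closure {x. f x \<noteq> 0}"

definition test_functions :: "('a::euclidean_space \<Rightarrow> complex) set" where
  "test_functions = {\<phi>. smooth_on UNIV \<phi> \<and> compact (fun_supp \<phi>)}"

definition cutoff :: "('a::euclidean_space \<Rightarrow> complex) \<Rightarrow> bool" where
  "cutoff \<rho> \<longleftrightarrow> \<rho> \<in> test_functions \<and> (\<forall>\<^sub>F x in nhds 0. \<rho> x = 1)"


section \<open>Distributions\<close>

text \<open>
  A distribution is a function on all of \<open>'a \<Rightarrow> complex\<close>, but only its values on test functions
  carry meaning; every notion below depends on these values only.
\<close>

type_synonym 'a functional = "('a \<Rightarrow> complex) \<Rightarrow> complex"

definition distributions :: "'a::euclidean_space functional set" where
  "distributions = {u.
     (\<forall>\<phi>\<in>test_functions. \<forall>\<psi>\<in>test_functions. u (\<lambda>x. \<phi> x + \<psi> x) = u \<phi> + u \<psi>) \<and>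
     (\<forall>c. \<forall>\<phi>\<in>test_functions. u (\<lambda>x. c * \<phi> x) = c * u \<phi>) \<and>
     (\<forall>K. compact K \<longrightarrow> (\<exists>C k. \<forall>\<phi>\<in>test_functions. fun_supp \<phi> \<subseteq> K \<longrightarrow>
        cmod (u \<phi>) \<le> C * (\<Sum>\<alpha>\<in>{\<alpha> \<in> lists Basis. length \<alpha> \<le> k}. SUP x. cmod (iterD \<alpha> \<phi> x))))}"

definition dist_of_fun :: "('a::euclidean_space \<Rightarrow> complex) \<Rightarrow> 'a functional" where
  "dist_of_fun f = (\<lambda>\<phi>. LINT x|lborel. f x * \<phi> x)"

definition dist_supp :: "'a::euclidean_space functional \<Rightarrow> 'a set" where
  "dist_supp u = - \<Union>{U. open U \<and> (\<forall>\<phi>\<in>test_functions. fun_supp \<phi> \<subseteq> U \<longrightarrow> u \<phi> = 0)}"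

text \<open>The restriction of \<open>u\<close> to the open set \<open>U\<close> is a \<open>C\<^sup>\<infinity>\<close> function.\<close>

definition dist_smooth_on :: "'a::euclidean_space set \<Rightarrow> 'a functional \<Rightarrow> bool" where
  "dist_smooth_on U u \<longleftrightarrow>
     (\<exists>f. smooth_on U f \<and> (\<forall>\<phi>\<in>test_functions. fun_supp \<phi> \<subseteq> U \<longrightarrow> u \<phi> = dist_of_fun f \<phi>))"

definition singsupp :: "'a::euclidean_space functional \<Rightarrow> 'a set" where
  "singsupp u = - \<Union>{U. open U \<and> dist_smooth_on U u}"


section \<open>Symbols\<close>

definition japanese :: "'b::euclidean_space \<Rightarrow> real" where
  "japanese \<theta> = sqrt (1 + (norm \<theta>)\<^sup>2)"

text \<open>The class \<open>S\<^sup>m\<close>; the base variable \<open>x\<close> ranges over \<open>'a\<close>, the fibre variable \<open>\<theta>\<close> over \<open>'b\<close>.\<close>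

definition symbol_class :: "real \<Rightarrow> ('a::euclidean_space \<times> 'b::euclidean_space \<Rightarrow> complex) set" where
  "symbol_class m = {a. smooth_on UNIV a \<and>
     (\<forall>\<alpha>\<in>lists Basis. \<forall>\<beta>\<in>lists Basis. \<forall>K. compact K \<longrightarrow>
        (\<exists>C. \<forall>x\<in>K. \<forall>\<theta>.
           cmod (iterD (map (\<lambda>b. (b, 0)) \<alpha> @ map (\<lambda>b. (0, b)) \<beta>) a (x, \<theta>))
             \<le> C * japanese \<theta> powr (m - real (length \<beta>))))}"


section \<open>Pseudo-differential operators\<close>

text \<open>
  An operator maps test functions to distributions, so that \<open>P \<phi> \<psi>\<close> is the pairing of
  \<open>P \<phi>\<close> with \<open>\<psi>\<close>. The first variable of a kernel \<open>K(x,y)\<close> belongs to \<open>P \<phi>\<close>, the second to \<open>\<phi>\<close>.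
\<close>

type_synonym 'a operator = "('a \<Rightarrow> complex) \<Rightarrow> 'a functional"

definition schwartz_kernel :: "'a::euclidean_space operator \<Rightarrow> ('a \<times> 'a) functional \<Rightarrow> bool" where
  "schwartz_kernel P K \<longleftrightarrow> K \<in> distributions \<and>
     (\<forall>\<phi>\<in>test_functions. \<forall>\<psi>\<in>test_functions. P \<phi> \<psi> = K (\<lambda>(x, y). \<psi> x * \<phi> y))"

text \<open>
  \<open>K\<close> is the distribution given by the oscillatory integral
  \<open>(2\<pi>)\<^bsup>-n\<^esup> \<integral> e\<^bsup>i\<langle>x-y,\<xi>\<rangle>\<^esup> a(x,y,\<xi>) d\<xi>\<close>, defined by inserting \<open>\<rho>(\<epsilon>\<xi>)\<close>, pairing with a test
  function of \<open>(x,y)\<close> and letting \<open>\<epsilon>\<close> tend to \<open>0\<close>; the limit must not depend on \<open>\<rho>\<close>.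
\<close>

definition osc_integral ::
    "(('a::euclidean_space \<times> 'a) \<times> 'a \<Rightarrow> complex) \<Rightarrow> ('a \<times> 'a) functional \<Rightarrow> bool" where
  "osc_integral a K \<longleftrightarrow> K \<in> distributions \<and>
     (\<forall>\<Phi>\<in>test_functions. \<forall>\<rho>. cutoff \<rho> \<longrightarrow>
        ((\<lambda>\<epsilon>. complex_of_real (1 / (2 * pi) ^ DIM('a)) *
            (LINT ((x, y), \<xi>)|lborel.
               \<rho> (\<epsilon> *\<^sub>R \<xi>) * exp (\<i> * complex_of_real ((x - y) \<bullet> \<xi>)) * a ((x, y), \<xi>) * \<Phi> (x, y)))
          \<longlongrightarrow> K \<Phi>) (at_right 0))"

definition PsiDO :: "real \<Rightarrow> 'a::euclidean_space operator set" where
  "PsiDO m = {P. \<exists>a\<in>symbol_class m. \<exists>K. osc_integral a K \<and> schwartz_kernel P K}"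

definition properly_supported :: "'a::euclidean_space operator \<Rightarrow> bool" where
  "properly_supported P \<longleftrightarrow> (\<exists>K. schwartz_kernel P K \<and>
     proper_map (top_of_set (dist_supp K)) euclidean fst \<and>
     proper_map (top_of_set (dist_supp K)) euclidean snd)"

definition transpose_op :: "'a operator \<Rightarrow> 'a operator" where
  "transpose_op P = (\<lambda>\<phi> \<psi>. P \<psi> \<phi>)"

text \<open>
  The action of a properly supported pseudo-differential operator on a distribution. For such \<open>P\<close> the
  distribution \<open>P\<^sup>t \<phi>\<close> is given by a (unique) test function, to which \<open>u\<close> is applied.
\<close>

definition apply_op :: "'a::euclidean_space operator \<Rightarrow> 'a functional \<Rightarrow> 'a functional" where
  "apply_op P u = (\<lambda>\<phi>. u (THE g. g \<in> test_functions \<and>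
     (\<forall>\<psi>\<in>test_functions. transpose_op P \<phi> \<psi> = dist_of_fun g \<psi>)))"

text \<open>\<open>p\<close> is a total left symbol of \<open>P\<close>; it is determined modulo symbols of order \<open>-\<infinity>\<close>.\<close>

definition left_symbol ::
    "real \<Rightarrow> 'a::euclidean_space operator \<Rightarrow> ('a \<times> 'a \<Rightarrow> complex) \<Rightarrow> bool" where
  "left_symbol m P p \<longleftrightarrow> p \<in> symbol_class m \<and>
     (\<exists>K L. schwartz_kernel P K \<and> osc_integral (\<lambda>((x, y), \<xi>). p (x, \<xi>)) L \<and>
        dist_smooth_on UNIV (\<lambda>\<Phi>. K \<Phi> - L \<Phi>))"

text \<open>\<open>q j\<close> is the term of degree \<open>m - j\<close>; its values at \<open>\<xi> = 0\<close> are irrelevant.\<close>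

definition classical_expansion ::
    "real \<Rightarrow> ('a::euclidean_space \<times> 'a \<Rightarrow> complex) \<Rightarrow> (nat \<Rightarrow> 'a \<times> 'a \<Rightarrow> complex) \<Rightarrow> bool" where
  "classical_expansion m p q \<longleftrightarrow>
     (\<forall>j. smooth_on {(x, \<xi>). \<xi> \<noteq> 0} (q j)) \<and>
     (\<forall>j x \<xi> t. \<xi> \<noteq> 0 \<longrightarrow> 0 < t \<longrightarrow>
        q j (x, t *\<^sub>R \<xi>) = complex_of_real (t powr (m - real j)) * q j (x, \<xi>)) \<and>
     (\<exists>\<phi>. cutoff \<phi> \<and>
        (\<forall>N. (\<lambda>(x, \<xi>). p (x, \<xi>) - (\<Sum>j<N. (1 - \<phi> \<xi>) * q j (x, \<xi>))) \<in> symbol_class (m - real N)))"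

definition classical :: "real \<Rightarrow> 'a::euclidean_space operator \<Rightarrow> bool" where
  "classical m P \<longleftrightarrow> (\<exists>p q. left_symbol m P p \<and> classical_expansion m p q)"

text \<open>
  \<open>\<sigma>\<close> is the principal symbol \<open>\<sigma>\<^sub>m(P)\<close>. A relation, since \<open>\<sigma>\<^sub>m(P)\<close> is a well-defined function on
  \<open>\<xi> \<noteq> 0\<close> only.
\<close>

definition principal_symbol ::
    "real \<Rightarrow> 'a::euclidean_space operator \<Rightarrow> ('a \<times> 'a \<Rightarrow> complex) \<Rightarrow> bool" where
  "principal_symbol m P \<sigma> \<longleftrightarrow>
     (\<exists>p q. left_symbol m P p \<and> classical_expansion m p q \<and> \<sigma> = q 0)"

definition elliptic :: "real \<Rightarrow> 'a::euclidean_space operator \<Rightarrow> bool" where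
  "elliptic m P \<longleftrightarrow>
     (\<exists>\<sigma>. principal_symbol m P \<sigma> \<and> (\<forall>x \<xi>. \<xi> \<noteq> 0 \<longrightarrow> \<sigma> (x, \<xi>) \<noteq> 0))"

end

theory Submission
  imports Defs
begin

text \<open>
  A distribution \<open>u\<close> is smooth near \<open>x\<^sub>0\<close> iff the localized Fourier transforms
  \<open>\<xi> \<mapsto> \<langle>u, \<kappa> e\<^bsup>-i\<langle>x,\<xi>\<rangle>\<^esup>\<rangle>\<close> decrease rapidly for all cutoffs \<open>\<kappa>\<close> supported near \<open>x\<^sub>0\<close>, and they always
  grow at most polynomially. No parametrix is constructed. Instead, \<open>Pu\<close> is tested against
  \<open>h\<^sub>\<xi>(x) e\<^bsup>-i\<langle>x,\<xi>\<rangle>\<^esup>\<close> with \<open>h\<^sub>\<xi>\<close> supported near \<open>x\<^sub>0\<close> and bounded by a power of \<open>\<langle>\<xi>\<rangle>\<close> together with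
  its derivatives. Integration by parts in the frequency variable shows that the part of \<open>u\<close> away from
  the support of \<open>h\<^sub>\<xi>\<close> contributes a rapidly decreasing term, and up to this term and a constant
  \<open>\<langle>Pu, h\<^sub>\<xi> e\<^bsup>-i\<langle>x,\<xi>\<rangle>\<^esup>\<rangle> = \<integral> a\<^sub>\<xi>(\<eta>) \<langle>u, \<kappa> e\<^bsup>-i\<langle>y,\<eta>\<rangle>\<^esup>\<rangle> d\<eta>\<close>, where \<open>a\<^sub>\<xi>(\<eta>) = \<integral> e\<^bsup>i\<langle>x,\<eta>-\<xi>\<rangle>\<^esup> p(x,\<eta>) h\<^sub>\<xi>(x) dx\<close>.
  The kernel \<open>a\<^sub>\<xi>(\<eta>)\<close> decreases rapidly in \<open>\<eta> - \<xi>\<close>, so rapid decrease passes from \<open>u\<close> to \<open>Pu\<close>.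
  Conversely, take \<open>h\<^sub>\<xi> = \<kappa>\<^sub>0 / p\<^sub>m(\<cdot>,\<xi>)\<close>. Replacing \<open>p(x,\<eta>)\<close> by \<open>p\<^sub>m(x,\<xi>)\<close> turns the right-hand side
  into a multiple of \<open>\<langle>u, \<kappa>\<^sub>0 e\<^bsup>-i\<langle>x,\<xi>\<rangle>\<^esup>\<rangle>\<close>, and the error gains a factor \<open>\<langle>\<xi>\<rangle>\<^bsup>-1\<^esup>\<close>. If \<open>Pu\<close> is smooth near \<open>x\<^sub>0\<close>,
  any polynomial bound on the localized Fourier transforms of \<open>u\<close> therefore improves by one order,
  and iteration gives rapid decrease.
\<close>

section \<open>Calculus of smooth functions\<close>

text \<open>A parametrix would require composing operators and summing symbols asymptotically;
  testing \<open>Pu\<close> against oscillating amplitudes needs only the first-order remainder of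
  the symbol. The price is uniformity: the amplitudes change with \<xi>, so bounds may depend on
  them only through one number controlling finitely many derivatives, which is the purpose of
  \<open>dbound\<close> and \<open>est\<close>. A second obstacle is that \<open>u\<close> is a mere
  functional, so a frequency integral cannot be moved through it by Fubini; \<open>dist_IF\<close>
  does this with Riemann sums that converge in the seminorms bounding \<open>u\<close>. The gain of
  one order rests on p(x,\<eta>) - p(x,\<xi>) being at most <\<xi>>^(m-1) times a power of <\<eta> -
  \<xi>>. That power is harmless, since the Fourier transform of the amplitude decays faster than
  any power, and Peetre's inequality turns weights in \<eta> into weights in \<xi>. Each bootstrap
  step uses a wider cutoff than the one it treats. Decay is therefore always asserted for all
  cutoffs supported in one open ball, whose radius does not shrink.\<close>

lemma D_eq: "(f has_derivative f') (at x) \<Longrightarrow> D b f x = - \<i> * f' b"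
  unfolding D_def by (metis frechet_derivative_at)

lemma D_has_derivative:
  "f differentiable (at x) \<Longrightarrow> (f has_derivative (\<lambda>h. \<i> * D h f x)) (at x)"
  unfolding D_def by (simp add: frechet_derivative_works mult.assoc[symmetric])

lemma differentiable_cong_open:
  assumes "open U" "x \<in> U" "\<And>y. y \<in> U \<Longrightarrow> f y = g y" "f differentiable (at x)"
  shows "g differentiable (at x)"
  by (meson assms differentiable_def has_derivative_transform_within_open)

lemma D_cong_open:
  assumes "open U" "x \<in> U" "\<And>y. y \<in> U \<Longrightarrow> f y = g y"
  shows "D b f x = D b g x"
proof -
  have "(f has_derivative F) (at x) = (g has_derivative F) (at x)" for F
    using assms has_derivative_transform_within_open[of f F x UNIV U g]
      has_derivative_transform_within_open[of g F x UNIV U f] by auto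
  then show ?thesis by (simp add: D_def frechet_derivative_def)
qed

lemma D_add: "f differentiable (at x) \<Longrightarrow> g differentiable (at x) \<Longrightarrow>
    D b (\<lambda>x. f x + g x) x = D b f x + D b g x"
  by (subst D_eq[OF has_derivative_add[OF D_has_derivative D_has_derivative]])
     (auto simp: algebra_simps)

lemma D_mult: "f differentiable (at x) \<Longrightarrow> g differentiable (at x) \<Longrightarrow>
    D b (\<lambda>x. f x * g x) x = D b f x * g x + f x * D b g x"
  by (subst D_eq[OF has_derivative_mult[OF D_has_derivative D_has_derivative]])
     (auto simp: algebra_simps)

lemma D_const [simp]: "D b (\<lambda>x. c) = (\<lambda>x. 0)"
  by (simp add: D_def fun_eq_iff)

lemma iterD_Nil [simp]: "iterD [] f = f"
  by (simp add: iterD_def)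

lemma iterD_Cons: "iterD (b # \<alpha>) f = D b (iterD \<alpha> f)"
  by (simp add: iterD_def)

lemma iterD_append: "iterD (\<alpha> @ \<beta>) f = iterD \<alpha> (iterD \<beta> f)"
  by (simp add: iterD_def)

lemma iterD_snoc: "iterD (\<alpha> @ [b]) f = iterD \<alpha> (D b f)"
  by (simp add: iterD_def)

lemma lists_snoc_cases:
  assumes "\<alpha> \<in> lists A" obtains "\<alpha> = []" | \<beta> b where "\<alpha> = \<beta> @ [b]" "\<beta> \<in> lists A" "b \<in> A"
  using assms by (cases \<alpha> rule: rev_cases) auto

text \<open>Finite-order smoothness, unfolded from the innermost derivative so that closure properties go
  by induction on the order.\<close>

primrec ck :: "nat \<Rightarrow> 'a::euclidean_space set \<Rightarrow> ('a \<Rightarrow> complex) \<Rightarrow> bool" where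
  "ck 0 U f \<longleftrightarrow> True"
| "ck (Suc k) U f \<longleftrightarrow> (\<forall>x\<in>U. f differentiable (at x)) \<and> (\<forall>b\<in>Basis. ck k U (D b f))"

text \<open>\<open>iterD\<close> adds derivatives at the head of the list, on the outside, whereas
  \<open>ck\<close> peels off the innermost one; the lists are therefore split at their last
  element.\<close>

lemma ck_iff: "ck k U f \<longleftrightarrow>
    (\<forall>\<alpha>\<in>lists Basis. length \<alpha> < k \<longrightarrow> (\<forall>x\<in>U. iterD \<alpha> f differentiable (at x)))"
proof (induction k arbitrary: f)
  case (Suc k)
  show ?case
  proof
    assume L: "ck (Suc k) U f"
    show "\<forall>\<alpha>\<in>lists Basis. length \<alpha> < Suc k \<longrightarrow> (\<forall>x\<in>U. iterD \<alpha> f differentiable (at x))"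
    proof (intro ballI impI)
      fix \<alpha> :: "'a list" and x assume "\<alpha> \<in> lists Basis" "length \<alpha> < Suc k" "x \<in> U"
      then show "iterD \<alpha> f differentiable (at x)"
        using L by (cases rule: lists_snoc_cases) (auto simp: Suc iterD_snoc)
    qed
  next
    assume R: "\<forall>\<alpha>\<in>lists Basis. length \<alpha> < Suc k \<longrightarrow> (\<forall>x\<in>U. iterD \<alpha> f differentiable (at x))"
    have "ck k U (D b f)" if "b \<in> Basis" for b
      unfolding Suc
    proof (intro ballI impI)
      fix \<alpha> :: "'a list" and x assume "\<alpha> \<in> lists Basis" "length \<alpha> < k" "x \<in> U"
      then show "iterD \<alpha> (D b f) differentiable (at x)"
        using R[rule_format, of "\<alpha> @ [b]" x] that by (auto simp: iterD_snoc)
    qed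
    moreover have "\<forall>x\<in>U. f differentiable (at x)"
      using R[rule_format, of "[]"] by auto
    ultimately show "ck (Suc k) U f" by simp
  qed
qed simp

lemma smooth_on_ck: "smooth_on U f \<longleftrightarrow> (\<forall>k. ck k U f)"
  unfolding smooth_on_def ck_iff by blast

lemma smooth_on_unfold:
  "smooth_on U f \<longleftrightarrow> (\<forall>x\<in>U. f differentiable (at x)) \<and> (\<forall>b\<in>Basis. smooth_on U (D b f))"
  unfolding smooth_on_ck by (metis ck.simps not0_implies_Suc)

lemma smooth_on_differentiable: "smooth_on U f \<Longrightarrow> x \<in> U \<Longrightarrow> f differentiable (at x)"
  using smooth_on_unfold by blast

lemma smooth_on_D: "smooth_on U f \<Longrightarrow> b \<in> Basis \<Longrightarrow> smooth_on U (D b f)"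
  using smooth_on_unfold by blast

lemma smooth_on_iterD: "smooth_on U f \<Longrightarrow> \<alpha> \<in> lists Basis \<Longrightarrow> smooth_on U (iterD \<alpha> f)"
  by (induction \<alpha>) (auto simp: iterD_Cons smooth_on_D)

lemma smooth_on_subset: "smooth_on U f \<Longrightarrow> V \<subseteq> U \<Longrightarrow> smooth_on V f"
  unfolding smooth_on_def by blast

lemma smooth_on_continuous_on: "smooth_on U f \<Longrightarrow> continuous_on U f"
  by (meson continuous_at_imp_continuous_on differentiable_imp_continuous_within
      smooth_on_differentiable)

lemma ck_Suc: "ck (Suc k) U f \<Longrightarrow> ck k U f"
  unfolding ck_iff by simp

lemma ck_cong:
  assumes "open U" "\<And>x. x \<in> U \<Longrightarrow> f x = g x" "ck k U f"
  shows "ck k U g"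
  using assms(2,3)
proof (induction k arbitrary: f g)
  case (Suc k)
  have "ck k U (D b g)" if "b \<in> Basis" for b
  proof (rule Suc.IH[of "D b f"])
    show "D b f x = D b g x" if "x \<in> U" for x
      by (rule D_cong_open[OF assms(1) that Suc.prems(1)])
  qed (use Suc.prems that in auto)
  then show ?case
    using Suc.prems differentiable_cong_open[OF assms(1) _ Suc.prems(1)] by auto
qed simp

lemma smooth_on_cong:
  "open U \<Longrightarrow> (\<And>x. x \<in> U \<Longrightarrow> f x = g x) \<Longrightarrow> smooth_on U f \<Longrightarrow> smooth_on U g"
  unfolding smooth_on_ck using ck_cong by blast

lemma iterD_cong:
  assumes "open U" "\<And>x. x \<in> U \<Longrightarrow> f x = g x" "x \<in> U"
  shows "iterD \<alpha> f x = iterD \<alpha> g x"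
  using assms(3)
proof (induction \<alpha> arbitrary: x)
  case (Cons b \<alpha>)
  then show ?case unfolding iterD_Cons using D_cong_open[OF assms(1)] by blast
qed (simp add: assms)

lemma ck_const: "ck k U (\<lambda>x. c)"
  by (induction k arbitrary: c) auto

lemma ck_add:
  assumes "open U" "ck k U f" "ck k U g"
  shows "ck k U (\<lambda>x. f x + g x)"
  using assms(2,3)
proof (induction k arbitrary: f g)
  case (Suc k)
  have "ck k U (D b (\<lambda>x. f x + g x))" if "b \<in> Basis" for b
    by (rule ck_cong[OF assms(1) _ Suc.IH[of "D b f" "D b g"]])
       (use Suc.prems that in \<open>auto simp: D_add\<close>)
  then show ?case using Suc.prems by auto
qed simp

lemma ck_mult:
  assumes "open U" "ck k U f" "ck k U g"
  shows "ck k U (\<lambda>x. f x * g x)"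
  using assms(2,3)
proof (induction k arbitrary: f g)
  case (Suc k)
  have "ck k U (D b (\<lambda>x. f x * g x))" if "b \<in> Basis" for b
    by (rule ck_cong[OF assms(1) _ ck_add[OF assms(1) Suc.IH[of "D b f" g] Suc.IH[of f "D b g"]]])
       (use Suc.prems that ck_Suc[of k] in \<open>auto simp: D_mult\<close>)
  then show ?case using Suc.prems by auto
qed simp

text \<open>The derivative of \<open>exp f\<close> is a multiple of \<open>exp f\<close> itself, so
  the induction on the order closes with \<open>f\<close> fixed. \<open>ck_inverse\<close> works in
  the same way with the square of the reciprocal.\<close>

lemma ck_exp:
  assumes "open U" "ck k U f"
  shows "ck k U (\<lambda>x. exp (f x))"
  using assms(2)
proof (induction k)
  case (Suc k)
  have d: "((\<lambda>x. exp (f x)) has_derivative (\<lambda>h. exp (f x) * (\<i> * D h f x))) (at x)"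
    if "x \<in> U" for x
    by (rule has_derivative_compose[OF D_has_derivative, where g=exp])
       (use Suc.prems that DERIV_exp in \<open>auto simp: has_field_derivative_def\<close>)
  have "ck k U (D b (\<lambda>x. exp (f x)))" if "b \<in> Basis" for b
    by (rule ck_cong[OF assms(1) _ ck_mult[OF assms(1) Suc.IH, of "D b f"]])
       (use Suc.prems that ck_Suc[of k U f] in \<open>auto simp: D_eq[OF d] algebra_simps\<close>)
  then show ?case using d by (auto simp: differentiable_def)
qed simp

lemma ck_inverse:
  assumes "open U" "ck k U f" "\<And>x. x \<in> U \<Longrightarrow> f x \<noteq> 0"
  shows "ck k U (\<lambda>x. inverse (f x))"
  using assms(2)
proof (induction k)
  case (Suc k)
  have d: "((\<lambda>x. inverse (f x)) has_derivative
      (\<lambda>h. - (inverse (f x) * (\<i> * D h f x) * inverse (f x)))) (at x)"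
    if "x \<in> U" for x
    by (rule Deriv.has_derivative_inverse[where f=f, OF assms(3)[OF that] D_has_derivative])
       (use Suc.prems that in auto)
  have "ck k U (D b (\<lambda>x. inverse (f x)))" if "b \<in> Basis" for b
    by (rule ck_cong[OF assms(1) _ ck_mult[OF assms(1) ck_mult[OF assms(1) ck_const[of _ _ "-1"]]
            ck_mult[OF assms(1) Suc.IH Suc.IH], of "D b f"]])
       (use Suc.prems that ck_Suc[of k U f] in \<open>auto simp: D_eq[OF d] algebra_simps\<close>)
  then show ?case using d by (auto simp: differentiable_def)
qed simp

text \<open>A scalar inner function leaves a single term in the chain rule, in which
  \<open>g\<close> is replaced by \<open>D 1 g\<close>; hence the induction generalizes
  \<open>g\<close>. This carries a one-dimensional step function over to bumps in several
  variables.\<close>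

lemma ck_compose_real:
  fixes h :: "'a::euclidean_space \<Rightarrow> real"
  assumes "open U" "ck k UNIV g" "ck k U (\<lambda>x. complex_of_real (h x))"
  shows "ck k U (\<lambda>x. g (h x))"
  using assms(2,3)
proof (induction k arbitrary: g)
  case (Suc k)
  let ?h = "\<lambda>x. complex_of_real (h x)"
  have h: "(h has_derivative (\<lambda>v. Re (\<i> * D v ?h x))) (at x)" if "x \<in> U" for x
    using bounded_linear.has_derivative[OF bounded_linear_Re D_has_derivative[of ?h x]] Suc.prems that
    by auto
  have Dh: "D v ?h x = - \<i> * complex_of_real (Re (\<i> * D v ?h x))" if "x \<in> U" for v x
    using D_eq[OF bounded_linear.has_derivative[OF bounded_linear_of_real h[OF that]], of v]
    by (simp add: o_def)
  have g: "g differentiable (at t)" for t using Suc.prems by auto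
  have d: "((\<lambda>x. g (h x)) has_derivative (\<lambda>v. \<i> * D (Re (\<i> * D v ?h x)) g (h x))) (at x)"
    if "x \<in> U" for x
    using has_derivative_compose[OF h[OF that] D_has_derivative[OF g]] .
  have lin: "D r g t = of_real r * D 1 g t" for r t
  proof -
    have "frechet_derivative g (at t) (r *\<^sub>R 1) = r *\<^sub>R frechet_derivative g (at t) 1"
      using linear_frechet_derivative[OF g] by (rule linear_scale)
    then show ?thesis by (simp add: D_def scaleR_conv_of_real)
  qed
  have "ck k U (D b (\<lambda>x. g (h x)))" if "b \<in> Basis" for b
  proof (rule ck_cong[OF assms(1) _ ck_mult[OF assms(1) ck_mult[OF assms(1) ck_const[of _ _ "\<i>"]
          Suc.IH[of "D 1 g"]], of "D b ?h"]])
    fix x assume x: "x \<in> U"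
    show "\<i> * D 1 g (h x) * D b ?h x = D b (\<lambda>x. g (h x)) x"
      unfolding D_eq[OF d[OF x]] by (subst lin, subst Dh[OF x]) (simp add: algebra_simps)
  qed (use Suc.prems that ck_Suc[of k U ?h] in auto)
  then show ?case using d by (auto simp: differentiable_def)
qed simp

text \<open>Since \<open>L\<close> sends basis vectors to basis vectors or 0, each derivative of the
  composition is a single composition of the same kind, or zero. Projections, slices and
  translations are all of this form.\<close>

lemma ck_compose_affine:
  fixes L :: "'a::euclidean_space \<Rightarrow> 'b::euclidean_space"
  assumes "open U" "open V" "bounded_linear L" "\<And>b. b \<in> Basis \<Longrightarrow> L b \<in> insert 0 Basis"
    and "ck k V f" "\<And>x. x \<in> U \<Longrightarrow> c + L x \<in> V"
  shows "ck k U (\<lambda>x. f (c + L x))"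
  using assms(5)
proof (induction k arbitrary: f)
  case (Suc k)
  have "((\<lambda>x. c + L x) has_derivative L) (at x)" for x
    by (auto intro!: derivative_eq_intros bounded_linear_imp_has_derivative assms)
  from has_derivative_compose[OF this D_has_derivative]
  have d: "((\<lambda>x. f (c + L x)) has_derivative (\<lambda>v. \<i> * D (L v) f (c + L x))) (at x)"
    if "x \<in> U" for x using Suc.prems assms(6)[OF that] by auto
  have 0: "D 0 f y = 0" if "y \<in> V" for y
    using Suc.prems that by (simp add: D_def linear_0 linear_frechet_derivative)
  have "ck k U (D b (\<lambda>x. f (c + L x)))" if b: "b \<in> Basis" for b
  proof (cases "L b = 0")
    case True
    show ?thesis
      by (rule ck_cong[OF assms(1) _ ck_const[of _ _ 0]]) (use assms(6) in \<open>simp add: D_eq[OF d] True 0\<close>)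
  next
    case False
    show ?thesis
      by (rule ck_cong[OF assms(1) _ Suc.IH[of "D (L b) f"]])
        (use False assms(4)[OF b] Suc.prems in \<open>auto simp: D_eq[OF d]\<close>)
  qed
  then show ?case using d by (auto simp: differentiable_def)
qed simp

lemma smooth_on_const [simp]: "smooth_on U (\<lambda>x. c)"
  by (simp add: smooth_on_ck ck_const)

lemma smooth_on_add: "open U \<Longrightarrow> smooth_on U f \<Longrightarrow> smooth_on U g \<Longrightarrow> smooth_on U (\<lambda>x. f x + g x)"
  by (simp add: smooth_on_ck ck_add)

lemma smooth_on_mult: "open U \<Longrightarrow> smooth_on U f \<Longrightarrow> smooth_on U g \<Longrightarrow> smooth_on U (\<lambda>x. f x * g x)"
  by (simp add: smooth_on_ck ck_mult)

lemma smooth_on_cmult: "open U \<Longrightarrow> smooth_on U f \<Longrightarrow> smooth_on U (\<lambda>x. c * f x)"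
  by (simp add: smooth_on_mult)

lemma smooth_on_diff: "open U \<Longrightarrow> smooth_on U f \<Longrightarrow> smooth_on U g \<Longrightarrow> smooth_on U (\<lambda>x. f x - g x)"
  using smooth_on_add[of U f "\<lambda>x. -1 * g x"] smooth_on_cmult[of U g "-1"] by simp

lemma smooth_on_sum: "open U \<Longrightarrow> (\<And>i. i \<in> I \<Longrightarrow> smooth_on U (f i)) \<Longrightarrow> smooth_on U (\<lambda>x. \<Sum>i\<in>I. f i x)"
  by (induction I rule: infinite_finite_induct) (auto simp: smooth_on_add)

lemma smooth_on_exp: "open U \<Longrightarrow> smooth_on U f \<Longrightarrow> smooth_on U (\<lambda>x. exp (f x))"
  by (simp add: smooth_on_ck ck_exp)

lemma smooth_on_inverse:
  "open U \<Longrightarrow> smooth_on U f \<Longrightarrow> (\<And>x. x \<in> U \<Longrightarrow> f x \<noteq> 0) \<Longrightarrow> smooth_on U (\<lambda>x. inverse (f x))"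
  by (simp add: smooth_on_ck ck_inverse)

lemma smooth_on_compose_real:
  "open U \<Longrightarrow> smooth_on UNIV g \<Longrightarrow> smooth_on U (\<lambda>x. complex_of_real (h x)) \<Longrightarrow> smooth_on U (\<lambda>x. g (h x))"
  by (simp add: smooth_on_ck ck_compose_real)

lemma smooth_on_compose_affine:
  fixes L :: "'a::euclidean_space \<Rightarrow> 'b::euclidean_space"
  assumes "open U" "open V" "bounded_linear L" "\<And>b. b \<in> Basis \<Longrightarrow> L b \<in> insert 0 Basis"
    and "smooth_on V f" "\<And>x. x \<in> U \<Longrightarrow> c + L x \<in> V"
  shows "smooth_on U (\<lambda>x. f (c + L x))"
  using assms by (simp add: smooth_on_ck ck_compose_affine)

lemma smooth_on_linear:
  assumes "open U" "bounded_linear (f :: 'a::euclidean_space \<Rightarrow> complex)"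
  shows "smooth_on U f"
proof -
  have d: "(f has_derivative f) (at x)" for x
    by (rule bounded_linear_imp_has_derivative[OF assms(2)])
  have "D b f = (\<lambda>x. - \<i> * f b)" for b
    by (rule ext) (rule D_eq[OF d])
  then show ?thesis
    by (subst smooth_on_unfold) (use d in \<open>auto simp: differentiable_def\<close>)
qed

text \<open>One statement for inner products of affine maps: it covers squared distances, the
  coordinates of x - y and the phases of the exponentials.\<close>

lemma smooth_on_inner:
  assumes "open U" "bounded_linear (f :: 'a::euclidean_space \<Rightarrow> 'b::euclidean_space)"
    "bounded_linear (g :: 'a::euclidean_space \<Rightarrow> 'b::euclidean_space)"
  shows "smooth_on U (\<lambda>x. complex_of_real ((c + f x) \<bullet> (d + g x)))"
proof -
  have lin: "smooth_on U (\<lambda>x. complex_of_real ((c + f x) \<bullet> b))"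
    if "bounded_linear f" for b c :: 'b and f
    unfolding inner_add_left of_real_add
    by (intro smooth_on_add assms smooth_on_const smooth_on_linear bounded_linear_of_real
        bounded_linear_compose[OF bounded_linear_of_real]
        bounded_linear_compose[OF bounded_linear_inner_left that])
  show ?thesis
    by (subst euclidean_inner) (auto intro!: smooth_on_sum smooth_on_mult assms lin)
qed

text \<open>Symmetry of second derivatives by integration: the increment of \<open>f\<close> along
  \<open>b\<close> is the integral of its \<open>b\<close>-derivative. Differentiating in direction
  \<open>a\<close> under the integral expresses the increment of the \<open>a\<close>-derivative
  along \<open>b\<close> as an integral of the mixed derivative, and this is differentiated at
  0.\<close>

lemma D_D_commute:
  fixes f :: "'a::euclidean_space \<Rightarrow> complex"
  assumes f: "smooth_on UNIV f" and a: "a \<in> Basis" and b: "b \<in> Basis"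
  shows "D a (D b f) x = D b (D a f) x"
proof -
  \<comment> \<open>\<open>F\<close> is the plain directional derivative, without the factor -i of
    \<open>D\<close>.\<close>
  define F where "F v g y = \<i> * D v g y" for v :: 'a and g y
  have F: "((\<lambda>s. g (y + s *\<^sub>R v)) has_vector_derivative F v g (y + s *\<^sub>R v)) (at s within S)"
    if "smooth_on UNIV g" for g v y s S
  proof -
    have "((\<lambda>s. y + s *\<^sub>R v) has_derivative (\<lambda>h. h *\<^sub>R v)) (at s within S)"
      by (auto intro!: derivative_eq_intros)
    from has_derivative_compose[OF this D_has_derivative[OF smooth_on_differentiable[OF that UNIV_I]]]
    have *: "((\<lambda>s. g (y + s *\<^sub>R v)) has_derivative (\<lambda>h. F (h *\<^sub>R v) g (y + s *\<^sub>R v))) (at s within S)"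
      by (simp add: F_def)
    have "F (h *\<^sub>R v) g z = h *\<^sub>R F v g z" for h z
      using linear_frechet_derivative[OF smooth_on_differentiable[OF that UNIV_I, of z]]
      by (simp add: F_def D_def linear_scale)
    with * show ?thesis by (simp add: has_vector_derivative_def)
  qed
  have sm: "smooth_on UNIV (F v g)" if "smooth_on UNIV g" "v \<in> Basis" for v g
    unfolding F_def by (intro smooth_on_cmult smooth_on_D open_UNIV that)
  have cont: "continuous_on UNIV (F v g)" if "smooth_on UNIV g" "v \<in> Basis" for v g
    by (rule smooth_on_continuous_on[OF sm[OF that]])
  have ftc: "((\<lambda>\<tau>. F b f (x + s *\<^sub>R a + \<tau> *\<^sub>R b)) has_integral
      f (x + s *\<^sub>R a + t *\<^sub>R b) - f (x + s *\<^sub>R a)) {0..t}" if "0 \<le> t" for s t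
    using fundamental_theorem_of_calculus[OF that, of "\<lambda>\<tau>. f (x + s *\<^sub>R a + \<tau> *\<^sub>R b)"] F[OF f] by simp
  have step: "F a f (x + t *\<^sub>R b) - F a f x = integral {0..t} (\<lambda>\<tau>. F a (F b f) (x + \<tau> *\<^sub>R b))"
    if t: "0 \<le> t" for t
  proof -
    have "((\<lambda>s. integral (cbox 0 t) (\<lambda>\<tau>. F b f (x + s *\<^sub>R a + \<tau> *\<^sub>R b))) has_vector_derivative
        integral (cbox 0 t) (\<lambda>\<tau>. F a (F b f) (x + 0 *\<^sub>R a + \<tau> *\<^sub>R b))) (at 0 within UNIV)"
    proof (rule leibniz_rule_vector_derivative[where U=UNIV])
      show "((\<lambda>s. F b f (x + s *\<^sub>R a + \<tau> *\<^sub>R b)) has_vector_derivative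
          F a (F b f) (x + s *\<^sub>R a + \<tau> *\<^sub>R b)) (at s within UNIV)" for s \<tau>
        using F[OF sm[OF f b], of "x + \<tau> *\<^sub>R b" a s UNIV] by (simp add: algebra_simps)
      show "(\<lambda>\<tau>. F b f (x + s *\<^sub>R a + \<tau> *\<^sub>R b)) integrable_on cbox 0 t" for s
        using ftc[OF t] by (auto simp: integrable_on_def)
      show "continuous_on (UNIV \<times> cbox 0 t) (\<lambda>(s, \<tau>). F a (F b f) (x + s *\<^sub>R a + \<tau> *\<^sub>R b))"
        unfolding split_beta
        by (intro continuous_on_compose2[OF cont[OF sm[OF f b] a]] continuous_intros) auto
    qed auto
    moreover have "((\<lambda>s. f (x + t *\<^sub>R b + s *\<^sub>R a) - f (x + s *\<^sub>R a)) has_vector_derivative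
        F a f (x + t *\<^sub>R b + 0 *\<^sub>R a) - F a f (x + 0 *\<^sub>R a)) (at 0)"
      by (intro has_vector_derivative_diff F f)
    moreover have "(\<lambda>s. integral (cbox 0 t) (\<lambda>\<tau>. F b f (x + s *\<^sub>R a + \<tau> *\<^sub>R b)))
        = (\<lambda>s. f (x + t *\<^sub>R b + s *\<^sub>R a) - f (x + s *\<^sub>R a))"
      using ftc[OF t] by (auto simp: algebra_simps integral_unique)
    ultimately show ?thesis
      by (auto dest: vector_derivative_unique_at)
  qed
  \<comment> \<open>The integrals over \<open>{0..t}\<close> are used for nonnegative t only, so the
    comparison takes place between one-sided derivatives at 0.\<close>
  have "((\<lambda>t. F a f (x + t *\<^sub>R b) - F a f x) has_vector_derivative F a (F b f) x) (at 0 within {0..1})"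
  proof (rule has_vector_derivative_transform)
    have "((\<lambda>t. integral {0..t} (\<lambda>\<tau>. F a (F b f) (x + \<tau> *\<^sub>R b))) has_vector_derivative
        F a (F b f) (x + 0 *\<^sub>R b)) (at 0 within {0..1})"
      by (rule integral_has_vector_derivative)
         (auto intro!: continuous_on_compose2[OF cont[OF sm[OF f b] a]] continuous_intros)
    then show "((\<lambda>t. integral {0..t} (\<lambda>\<tau>. F a (F b f) (x + \<tau> *\<^sub>R b))) has_vector_derivative
        F a (F b f) x) (at 0 within {0..1})" by simp
    show "F a f (x + t *\<^sub>R b) - F a f x = integral {0..t} (\<lambda>\<tau>. F a (F b f) (x + \<tau> *\<^sub>R b))"
      if "t \<in> {0..1}" for t
      using step[of t] that by simp
  qed simp
  moreover have "((\<lambda>t. F a f (x + t *\<^sub>R b) - F a f x) has_vector_derivative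
      F b (F a f) (x + 0 *\<^sub>R b) - 0) (at 0 within {0..1})"
    by (intro has_vector_derivative_diff F sm f a has_vector_derivative_const)
  ultimately have "F a (F b f) x = F b (F a f) x"
    using vector_derivative_unique_within[of 0 "{0..1}" "\<lambda>t. F a f (x + t *\<^sub>R b) - F a f x"]
    by (auto simp: at_within_Icc_at_right)
  moreover have "F a (F b f) x = - D a (D b f) x" if "b \<in> Basis" for a b
    unfolding F_def using smooth_on_differentiable[OF smooth_on_D[OF f that], of x]
    by (subst D_mult) (auto simp: F_def)
  ultimately show ?thesis using a b by simp
qed

lemma iterD_D_commute:
  assumes "smooth_on UNIV f" "\<alpha> \<in> lists Basis" "b \<in> Basis"
  shows "iterD \<alpha> (D b f) = D b (iterD \<alpha> f)"
  using assms
proof (induction \<alpha>)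
  case (Cons a \<alpha>)
  then show ?case
    by (auto simp: iterD_Cons D_D_commute smooth_on_iterD)
qed simp

section \<open>Supports and test functions\<close>

lemma fun_supp_zero: "x \<notin> fun_supp f \<Longrightarrow> f x = 0"
  unfolding fun_supp_def using closure_subset[of "{x. f x \<noteq> 0}"] by auto

lemma fun_supp_subset_iff:
  assumes "closed K"
  shows "fun_supp f \<subseteq> K \<longleftrightarrow> (\<forall>x. x \<notin> K \<longrightarrow> f x = 0)"
proof
  assume "\<forall>x. x \<notin> K \<longrightarrow> f x = 0"
  then show "fun_supp f \<subseteq> K"
    unfolding fun_supp_def by (intro closure_minimal assms) auto
qed (auto intro: fun_supp_zero)


lemma closed_fun_supp [simp]: "closed (fun_supp f)"
  by (simp add: fun_supp_def)

lemma test_functions_smooth: "f \<in> test_functions \<Longrightarrow> smooth_on UNIV f"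
  by (simp add: test_functions_def)

lemma test_functions_compact: "f \<in> test_functions \<Longrightarrow> compact (fun_supp f)"
  by (simp add: test_functions_def)

lemma test_functionsI:
  assumes "smooth_on UNIV f" "compact K" "\<And>x. x \<notin> K \<Longrightarrow> f x = 0"
  shows "f \<in> test_functions"
proof -
  have "fun_supp f \<subseteq> K" using assms compact_imp_closed fun_supp_subset_iff by blast
  then show ?thesis
    unfolding test_functions_def using assms closed_fun_supp[of f]
    by (metis compact_Int_closed inf.absorb_iff2 mem_Collect_eq)
qed

text \<open>The open sets \<open>U\<close> and \<open>- K\<close> cover the space, and
  \<open>f\<close> is zero on the second one.\<close>

lemma smooth_on_vanish:
  assumes "open U" "smooth_on U f" "closed K" "K \<subseteq> U" "\<And>x. x \<notin> K \<Longrightarrow> f x = 0"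
  shows "smooth_on UNIV f"
proof -
  have "smooth_on (- K) f"
    by (rule smooth_on_cong[of _ "\<lambda>x. 0"]) (use assms in auto)
  then show ?thesis
    using assms unfolding smooth_on_def by blast
qed

lemma test_functions_mult:
  assumes "open U" "smooth_on U f" "\<phi> \<in> test_functions" "fun_supp \<phi> \<subseteq> U"
  shows "(\<lambda>x. f x * \<phi> x) \<in> test_functions"
proof (rule test_functionsI[where K="fun_supp \<phi>"])
  show "smooth_on UNIV (\<lambda>x. f x * \<phi> x)"
  proof (rule smooth_on_vanish[where U=U and K="fun_supp \<phi>"])
    show "smooth_on U (\<lambda>x. f x * \<phi> x)"
      by (intro smooth_on_mult assms smooth_on_subset[OF test_functions_smooth[OF assms(3)]]) auto
  qed (use assms fun_supp_zero in auto)
  show "compact (fun_supp \<phi>)" by (rule test_functions_compact[OF assms(3)])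
  show "f x * \<phi> x = 0" if "x \<notin> fun_supp \<phi>" for x
    using fun_supp_zero[OF that] by simp
qed

lemma test_functions_mult':
  "smooth_on UNIV f \<Longrightarrow> \<phi> \<in> test_functions \<Longrightarrow> (\<lambda>x. f x * \<phi> x) \<in> test_functions"
  using test_functions_mult[of UNIV] by simp

lemma test_functions_D: "\<phi> \<in> test_functions \<Longrightarrow> b \<in> Basis \<Longrightarrow> D b \<phi> \<in> test_functions"
proof (rule test_functionsI[where K="fun_supp \<phi>"])
  assume a: "\<phi> \<in> test_functions" "b \<in> Basis"
  then show "smooth_on UNIV (D b \<phi>)" "compact (fun_supp \<phi>)"
    by (auto simp: test_functions_smooth smooth_on_D test_functions_compact)
  show "D b \<phi> x = 0" if "x \<notin> fun_supp \<phi>" for x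
    using D_cong_open[of "- fun_supp \<phi>" x \<phi> "\<lambda>x. 0"] that by (auto simp: open_Compl fun_supp_zero)
qed

lemma test_functions_add:
  assumes "\<phi> \<in> test_functions" "\<psi> \<in> test_functions"
  shows "(\<lambda>x. \<phi> x + \<psi> x) \<in> test_functions"
  by (rule test_functionsI[where K="fun_supp \<phi> \<union> fun_supp \<psi>"])
     (use assms in \<open>auto intro!: smooth_on_add simp: test_functions_smooth test_functions_compact fun_supp_zero\<close>)

lemma test_functions_cmult: "\<phi> \<in> test_functions \<Longrightarrow> (\<lambda>x. c * \<phi> x) \<in> test_functions"
  using test_functions_mult'[of "\<lambda>x. c"] by simp

lemma test_functions_0 [simp]: "(\<lambda>x. 0) \<in> test_functions"
  by (rule test_functionsI[where K="{}"]) auto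

text \<open>One number bounds all derivatives up to order \<open>N\<close> at a point. The pointwise
  form serves compact sets and slices alike, and a single number can carry the power of the
  frequency by which a whole family of functions is bounded.\<close>

definition dbound :: "nat \<Rightarrow> ('a::euclidean_space \<Rightarrow> complex) \<Rightarrow> 'a \<Rightarrow> real \<Rightarrow> bool" where
  "dbound N f x M \<longleftrightarrow> (\<forall>\<alpha>\<in>lists Basis. length \<alpha> \<le> N \<longrightarrow> cmod (iterD \<alpha> f x) \<le> M)"

lemma dboundD: "dbound N f x M \<Longrightarrow> \<alpha> \<in> lists Basis \<Longrightarrow> length \<alpha> \<le> N \<Longrightarrow> cmod (iterD \<alpha> f x) \<le> M"
  by (simp add: dbound_def)

lemma dbound_0 [simp]: "dbound 0 f x M \<longleftrightarrow> cmod (f x) \<le> M"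
  by (simp add: dbound_def)

lemma dbound_Suc: "dbound (Suc N) f x M \<longleftrightarrow> cmod (f x) \<le> M \<and> (\<forall>b\<in>Basis. dbound N (D b f) x M)"
proof
  assume R: "cmod (f x) \<le> M \<and> (\<forall>b\<in>Basis. dbound N (D b f) x M)"
  show "dbound (Suc N) f x M"
    unfolding dbound_def
  proof (intro ballI impI)
    fix \<alpha> :: "'a list" assume "\<alpha> \<in> lists Basis" "length \<alpha> \<le> Suc N"
    then show "cmod (iterD \<alpha> f x) \<le> M"
      using R by (cases rule: lists_snoc_cases) (auto simp: iterD_snoc dbound_def)
  qed
next
  assume L: "dbound (Suc N) f x M"
  have "dbound N (D b f) x M" if b: "b \<in> Basis" for b
    unfolding dbound_def
  proof (intro ballI impI)
    fix \<alpha> :: "'a list" assume "\<alpha> \<in> lists Basis" "length \<alpha> \<le> N"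
    then show "cmod (iterD \<alpha> (D b f) x) \<le> M"
      using dboundD[OF L, of "\<alpha> @ [b]"] b by (simp add: iterD_snoc)
  qed
  then show "cmod (f x) \<le> M \<and> (\<forall>b\<in>Basis. dbound N (D b f) x M)"
    using dboundD[OF L, of "[]"] by simp
qed

lemma dbound_mono: "dbound N f x M \<Longrightarrow> n \<le> N \<Longrightarrow> M \<le> M' \<Longrightarrow> dbound n f x M'"
  unfolding dbound_def by force

lemma dbound_nonneg: "dbound N f x M \<Longrightarrow> 0 \<le> M"
  using dboundD[of N f x M "[]"] norm_ge_zero[of "f x"] by (simp del: norm_ge_zero)

lemma dbound_cong:
  assumes "open U" "\<And>x. x \<in> U \<Longrightarrow> f x = g x" "x \<in> U"
  shows "dbound N f x M = dbound N g x M"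
  unfolding dbound_def using iterD_cong[OF assms] by simp

lemma dbound_zero: "open U \<Longrightarrow> (\<And>x. x \<in> U \<Longrightarrow> f x = 0) \<Longrightarrow> x \<in> U \<Longrightarrow> 0 \<le> M \<Longrightarrow> dbound N f x M"
proof -
  assume a: "open U" "\<And>x. x \<in> U \<Longrightarrow> f x = 0" "x \<in> U" "0 \<le> M"
  have "dbound N (\<lambda>x. 0) x M" using a(4) by (induction N) (auto simp: dbound_Suc)
  then show ?thesis using dbound_cong[of U f "\<lambda>x. 0" x N M] a by auto
qed

lemma dbound_add:
  assumes "open U" "x \<in> U" "smooth_on U f" "smooth_on U g" "dbound N f x A" "dbound N g x B"
  shows "dbound N (\<lambda>x. f x + g x) x (A + B)"
  using assms(3-6)
proof (induction N arbitrary: f g)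
  case 0
  then show ?case using norm_triangle_ineq[of "f x" "g x"] by simp
next
  case (Suc N)
  have "dbound N (D b (\<lambda>x. f x + g x)) x (A + B)" if b: "b \<in> Basis" for b
  proof (subst dbound_cong[OF assms(1) _ assms(2)])
    show "dbound N (\<lambda>x. D b f x + D b g x) x (A + B)"
      by (rule Suc.IH) (use Suc.prems b in \<open>auto simp: smooth_on_D dbound_Suc\<close>)
  qed (use Suc.prems in \<open>auto intro!: D_add smooth_on_differentiable\<close>)
  then show ?case
    using Suc.prems norm_triangle_ineq[of "f x" "g x"] by (auto simp: dbound_Suc)
qed

text \<open>The factor \<open>2 ^ N\<close> counts the terms of the Leibniz rule: each derivative
  doubles the number of products.\<close>

lemma dbound_mult:
  assumes "open U" "x \<in> U" "smooth_on U f" "smooth_on U g" "dbound N f x A" "dbound N g x B"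
  shows "dbound N (\<lambda>x. f x * g x) x (2 ^ N * (A * B))"
  using assms(3-6)
proof (induction N arbitrary: f g)
  case 0
  then show ?case by (auto simp: norm_mult intro!: mult_mono elim: order_trans[OF norm_ge_zero])
next
  case (Suc N)
  have AB: "0 \<le> A" "0 \<le> B" using Suc.prems dbound_nonneg by blast+
  have "dbound N (D b (\<lambda>x. f x * g x)) x (2 ^ Suc N * (A * B))" if b: "b \<in> Basis" for b
  proof (subst dbound_cong[OF assms(1) _ assms(2)])
    have "dbound N (\<lambda>x. D b f x * g x + f x * D b g x) x (2 ^ N * (A * B) + 2 ^ N * (A * B))"
      by (intro dbound_add[OF assms(1,2)] Suc.IH smooth_on_mult assms(1) smooth_on_D b)
         (use Suc.prems b dbound_mono[of "Suc N" _ x _ N] in \<open>auto simp: dbound_Suc\<close>)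
    moreover have "2 ^ N * (A * B) + 2 ^ N * (A * B) = 2 ^ Suc N * (A * B)" by simp
    ultimately show "dbound N (\<lambda>x. D b f x * g x + f x * D b g x) x (2 ^ Suc N * (A * B))"
      by (simp only:)
  qed (use Suc.prems in \<open>auto intro!: D_mult smooth_on_differentiable\<close>)
  moreover have "cmod (f x * g x) \<le> 2 ^ Suc N * (A * B)"
  proof -
    have "cmod (f x * g x) \<le> A * B"
      using Suc.prems AB by (auto simp: norm_mult dbound_Suc intro!: mult_mono)
    also have "\<dots> \<le> 2 ^ Suc N * (A * B)"
      using AB mult_right_mono[OF one_le_power[of 2 "Suc N"], of "A * B"] by simp
    finally show ?thesis .
  qed
  ultimately show ?case by (auto simp: dbound_Suc)
qed

lemma dbound_cmult:
  assumes "open U" "x \<in> U" "smooth_on U f" "dbound N f x A"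
  shows "dbound N (\<lambda>x. c * f x) x (cmod c * A)"
  using assms(3-)
proof (induction N arbitrary: f)
  case 0
  then show ?case by (auto simp: norm_mult intro!: mult_left_mono)
next
  case (Suc N)
  have "dbound N (D b (\<lambda>x. c * f x)) x (cmod c * A)" if b: "b \<in> Basis" for b
    by (subst dbound_cong[OF assms(1) _ assms(2), of _ "\<lambda>x. c * D b f x"])
       (use Suc b in \<open>auto simp: dbound_Suc smooth_on_D D_mult smooth_on_differentiable\<close>)
  then show ?case using Suc.prems by (auto simp: dbound_Suc norm_mult intro!: mult_left_mono)
qed

lemma smooth_on_dbound_compact:
  assumes "smooth_on U f" "compact K" "K \<subseteq> U"
  obtains M where "0 \<le> M" "\<And>x. x \<in> K \<Longrightarrow> dbound N f x M"
proof -
  have bd: "\<exists>M. \<forall>x\<in>K. cmod (g x) \<le> M" if "smooth_on U g" for g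
    using compact_imp_bounded[OF compact_continuous_image[OF continuous_on_subset[OF
          smooth_on_continuous_on[OF that] assms(3)] assms(2)]]
    by (auto simp: bounded_iff)
  have "\<exists>M. 0 \<le> M \<and> (\<forall>x\<in>K. dbound N f x M)"
    using assms(1)
  proof (induction N arbitrary: f)
    case 0
    with bd[of f] show ?case by (auto intro: order_trans[OF _ max.cobounded1] max.cobounded2)
  next
    case (Suc N)
    obtain M0 where M0: "\<forall>x\<in>K. cmod (f x) \<le> M0" using bd Suc.prems by blast
    have "\<forall>b\<in>Basis. \<exists>M. 0 \<le> M \<and> (\<forall>x\<in>K. dbound N (D b f) x M)"
      using Suc.IH smooth_on_D[OF Suc.prems] by blast
    then obtain M where M: "\<And>b. b \<in> Basis \<Longrightarrow> 0 \<le> M b \<and> (\<forall>x\<in>K. dbound N (D b f) x (M b))"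
      by metis
    let ?M = "max M0 0 + sum M Basis"
    have "M b \<le> ?M" if "b \<in> Basis" for b
      using member_le_sum[of b Basis M] M that by (simp add: add_increasing)
    moreover have "M0 \<le> ?M" "0 \<le> ?M"
      using sum_nonneg[of Basis M] M by (auto simp: add_increasing2)
    ultimately have "0 \<le> ?M \<and> (\<forall>x\<in>K. dbound (Suc N) f x ?M)"
      using M M0 by (auto simp: dbound_Suc intro: dbound_mono order_trans)
    then show ?case by blast
  qed
  then show ?thesis using that by blast
qed

section \<open>Bump functions\<close>

text \<open>The powers of t in the denominator close the family under differentiation: the
  derivative of \<open>flat k\<close> is \<open>flat (k + 2)\<close> minus \<open>k\<close> times
  \<open>flat (k + 1)\<close>, so smoothness follows by an induction over all \<open>k\<close> at
  once.\<close>

definition flat :: "nat \<Rightarrow> real \<Rightarrow> complex" where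
  "flat k t = (if 0 < t then complex_of_real (exp (- 1 / t) / t ^ k) else 0)"

lemma flat_at_0: "((\<lambda>t. exp (- 1 / t) / t ^ k) \<longlongrightarrow> (0::real)) (at_right 0)"
proof -
  have "((\<lambda>t::real. inverse t ^ k / exp (inverse t)) \<longlongrightarrow> 0) (at_right 0)"
    by (rule filterlim_compose[OF tendsto_power_div_exp_0 filterlim_inverse_at_top_right])
  then show ?thesis
    by (simp add: field_simps exp_minus)
qed

lemma flat_has_derivative:
  "(flat k has_vector_derivative (flat (k + 2) t - of_nat k * flat (k + 1) t)) (at t)"
proof -
  consider "t < 0" | "t = 0" | "0 < t" by linarith
  then show ?thesis
  proof cases
    case 1
    have "((\<lambda>t. 0) has_vector_derivative 0) (at t)" by auto
    from has_vector_derivative_transform_within_open[OF this, of "{..<0}" "flat k"] 1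
    show ?thesis by (auto simp: flat_def)
  next
    case 3
    have "((\<lambda>t. inverse t ^ k) has_real_derivative - of_nat k * inverse t ^ (k + 1)) (at t)"
      using DERIV_power[OF DERIV_inverse[of t UNIV], of k] 3
      by (cases k) (simp_all add: algebra_simps)
    moreover have "((\<lambda>t. exp (- inverse t)) has_real_derivative exp (- inverse t) * inverse t ^ 2) (at t)"
      using 3 by (auto intro!: derivative_eq_intros simp: power2_eq_square)
    ultimately have "((\<lambda>t. exp (- inverse t) * inverse t ^ k) has_real_derivative
        exp (- inverse t) * inverse t ^ 2 * inverse t ^ k +
        (- of_nat k * inverse t ^ (k + 1)) * exp (- inverse t)) (at t)"
      by (rule DERIV_mult[rotated])
    then have "((\<lambda>t. exp (- 1 / t) / t ^ k) has_real_derivative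
        exp (- 1 / t) / t ^ (k + 2) - of_nat k * (exp (- 1 / t) / t ^ (k + 1))) (at t)"
      by (simp add: divide_inverse power_inverse[symmetric] power_add power2_eq_square
            algebra_simps)
    then have "((\<lambda>t. complex_of_real (exp (- 1 / t) / t ^ k)) has_vector_derivative
        complex_of_real (exp (- 1 / t) / t ^ (k + 2) - of_nat k * (exp (- 1 / t) / t ^ (k + 1)))) (at t)"
      by (intro has_vector_derivative_of_real) (simp add: has_real_derivative_iff_has_vector_derivative)
    from has_vector_derivative_transform_within_open[OF this, of "{0<..}" "flat k"] 3
    show ?thesis by (auto simp: flat_def)
  next
    case 2
    \<comment> \<open>At 0 the difference quotient from the right is \<open>flat (k + 1)\<close>,
      which tends to 0; from the left it vanishes.\<close>
    have "((\<lambda>h. norm (flat k h) / norm h) \<longlongrightarrow> 0) (at 0)"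
    proof (rule filterlim_split_at_real)
      show "((\<lambda>h. norm (flat k h) / norm h) \<longlongrightarrow> 0) (at_right 0)"
        by (rule Lim_transform_eventually[OF flat_at_0[of "k + 1"]])
           (auto simp: eventually_at_right_field flat_def norm_divide norm_power norm_of_real
             intro!: exI[of _ 1] simp del: of_real_divide of_real_power)
      show "((\<lambda>h. norm (flat k h) / norm h) \<longlongrightarrow> 0) (at_left 0)"
        by (rule Lim_transform_eventually[of "\<lambda>_. 0"])
           (auto simp: eventually_at_left_field flat_def intro!: exI[of _ "-1"])
    qed
    then show ?thesis
      by (simp add: 2 has_vector_derivative_def has_derivative_at flat_def)
  qed
qed

lemma flat_smooth: "smooth_on UNIV (flat k)"
proof -
  have "ck n UNIV (flat k)" for n
  proof (induction n arbitrary: k)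
    case (Suc n)
    have d: "flat k differentiable (at t)" for t
      using flat_has_derivative by (rule differentiableI_vector)
    have "D 1 (flat k) = (\<lambda>t. - \<i> * flat (k + 2) t + \<i> * of_nat k * flat (k + 1) t)"
    proof
      fix t
      show "D 1 (flat k) t = - \<i> * flat (k + 2) t + \<i> * of_nat k * flat (k + 1) t"
        using D_eq[OF flat_has_derivative[unfolded has_vector_derivative_def], of 1 k t]
        by (simp add: algebra_simps)
    qed
    moreover have "ck n UNIV (\<lambda>t. - \<i> * flat (k + 2) t + \<i> * of_nat k * flat (k + 1) t)"
      by (intro ck_add ck_mult ck_const Suc open_UNIV)
    ultimately show ?case using d by auto
  qed simp
  then show ?thesis by (simp add: smooth_on_ck)
qed

lemma smooth_step:
  obtains \<sigma> :: "real \<Rightarrow> real" where "smooth_on UNIV (\<lambda>t. complex_of_real (\<sigma> t))"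
    "\<And>t. 1 \<le> t \<Longrightarrow> \<sigma> t = 1" "\<And>t. 0 < \<sigma> t \<longleftrightarrow> 0 < t" "\<And>t. 0 \<le> \<sigma> t" "\<And>t. \<sigma> t \<le> 1"
proof
  define e where "e t = (if 0 < t then exp (- 1 / t) else 0)" for t :: real
  have flat: "flat 0 t = complex_of_real (e t)" for t by (simp add: flat_def e_def)
  \<comment> \<open>At least one of t and 1 - t is positive, so the denominator of the step function
    never vanishes.\<close>
  have pos: "0 < e t + e (1 - t)" for t by (auto simp: e_def add_pos_pos)
  have nz: "flat 0 t + flat 0 (1 - t) \<noteq> 0" for t
    using pos[of t] by (simp only: flat of_real_add[symmetric] of_real_eq_0_iff)
  have "smooth_on UNIV (\<lambda>t. complex_of_real (1 - t))"
    using smooth_on_diff[OF open_UNIV smooth_on_const[of _ 1] smooth_on_linear[OF open_UNIV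
        bounded_linear_of_real]] by simp
  then have "smooth_on UNIV (\<lambda>t. flat 0 (1 - t))"
    by (rule smooth_on_compose_real[OF open_UNIV flat_smooth])
  then have "smooth_on UNIV (\<lambda>t. flat 0 t * inverse (flat 0 t + flat 0 (1 - t)))"
    by (intro smooth_on_mult smooth_on_inverse smooth_on_add flat_smooth open_UNIV nz)
  then show "smooth_on UNIV (\<lambda>t. complex_of_real (e t / (e t + e (1 - t))))"
    by (simp add: flat divide_inverse)
  show "e t / (e t + e (1 - t)) = 1" if "1 \<le> t" for t using that pos[of t] by (simp add: e_def)
  show "0 < e t / (e t + e (1 - t)) \<longleftrightarrow> 0 < t" for t
    using pos[of t] by (auto simp: e_def zero_less_divide_iff)
  show "0 \<le> e t / (e t + e (1 - t))" "e t / (e t + e (1 - t)) \<le> 1" for t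
    using pos[of t] by (auto simp: e_def)
qed

lemma smooth_on_norm_sq:
  fixes x0 :: "'a::euclidean_space"
  assumes "open U"
  shows "smooth_on U (\<lambda>x. complex_of_real ((norm (x - x0))\<^sup>2))"
  using smooth_on_inner[OF assms bounded_linear_ident bounded_linear_ident, of "- x0" "- x0"]
  by (simp add: power2_norm_eq_inner)

lemma bump_exists:
  fixes x0 :: "'a::euclidean_space"
  assumes "0 \<le> r" "r < R"
  obtains \<beta> :: "'a \<Rightarrow> real" where "smooth_on UNIV (\<lambda>x. complex_of_real (\<beta> x))"
    "\<And>x. x \<in> cball x0 r \<Longrightarrow> \<beta> x = 1" "\<And>x. 0 < \<beta> x \<longleftrightarrow> x \<in> ball x0 R"
    "\<And>x. 0 \<le> \<beta> x" "\<And>x. \<beta> x \<le> 1"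
proof -
  obtain \<sigma> :: "real \<Rightarrow> real" where \<sigma>: "smooth_on UNIV (\<lambda>t. complex_of_real (\<sigma> t))"
    "\<And>t. 1 \<le> t \<Longrightarrow> \<sigma> t = 1" "\<And>t. 0 < \<sigma> t \<longleftrightarrow> 0 < t" "\<And>t. 0 \<le> \<sigma> t" "\<And>t. \<sigma> t \<le> 1"
    by (rule smooth_step) blast
  \<comment> \<open>This quotient is at least 1 on the inner ball and positive exactly on the open
    outer one; squared norms keep it smooth at the center.\<close>
  define h where "h x = (R\<^sup>2 - (norm (x - x0))\<^sup>2) / (R\<^sup>2 - r\<^sup>2)" for x
  have rR: "0 < R\<^sup>2 - r\<^sup>2" using assms by (simp add: power_strict_mono)
  have "smooth_on UNIV (\<lambda>x. inverse (complex_of_real (R\<^sup>2 - r\<^sup>2)) *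
      (complex_of_real (R\<^sup>2) - complex_of_real ((norm (x - x0))\<^sup>2)))"
    by (intro smooth_on_cmult smooth_on_diff smooth_on_const smooth_on_norm_sq open_UNIV)
  then have h: "smooth_on UNIV (\<lambda>x. complex_of_real (h x))"
    by (simp add: h_def divide_inverse mult.commute)
  show ?thesis
  proof
    show "smooth_on UNIV (\<lambda>x. complex_of_real (\<sigma> (h x)))"
      by (rule smooth_on_compose_real[OF open_UNIV \<sigma>(1) h])
    show "\<sigma> (h x) = 1" if "x \<in> cball x0 r" for x
    proof (rule \<sigma>(2))
      have "(norm (x - x0))\<^sup>2 \<le> r\<^sup>2"
        using that by (intro power_mono) (auto simp: dist_norm norm_minus_commute)
      then show "1 \<le> h x" using rR by (simp add: h_def field_simps)
    qed
    have "(norm (x - x0))\<^sup>2 < R\<^sup>2 \<longleftrightarrow> norm (x - x0) < R" for x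
      using power2_less_imp_less[of "norm (x - x0)" R] power_strict_mono[of "norm (x - x0)" R 2] assms
      by auto
    then show "0 < \<sigma> (h x) \<longleftrightarrow> x \<in> ball x0 R" for x
      using rR by (simp add: h_def zero_less_divide_iff \<sigma> dist_norm norm_minus_commute[of x0 x])
  qed (auto simp: \<sigma>)
qed

lemma bump_test_exists:
  fixes x0 :: "'a::euclidean_space"
  assumes "0 \<le> r" "r < R"
  obtains \<kappa> :: "'a \<Rightarrow> complex" where "\<kappa> \<in> test_functions"
    "\<And>x. x \<in> cball x0 r \<Longrightarrow> \<kappa> x = 1" "\<And>x. x \<notin> ball x0 R \<Longrightarrow> \<kappa> x = 0"
    "fun_supp \<kappa> \<subseteq> cball x0 R" "\<And>x. cmod (\<kappa> x) \<le> 1"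
proof -
  obtain \<beta> :: "'a \<Rightarrow> real" where \<beta>: "smooth_on UNIV (\<lambda>x. complex_of_real (\<beta> x))"
    "\<And>x. x \<in> cball x0 r \<Longrightarrow> \<beta> x = 1" "\<And>x. 0 < \<beta> x \<longleftrightarrow> x \<in> ball x0 R"
    "\<And>x. 0 \<le> \<beta> x" "\<And>x. \<beta> x \<le> 1"
    by (rule bump_exists[OF assms]) blast
  have 0: "\<beta> x = 0" if "x \<notin> ball x0 R" for x
    using \<beta>(3)[of x] \<beta>(4)[of x] that by auto
  show ?thesis
  proof
    show "(\<lambda>x. complex_of_real (\<beta> x)) \<in> test_functions"
      by (rule test_functionsI[where K="cball x0 R"]) (use \<beta> 0 in auto)
    show "fun_supp (\<lambda>x. complex_of_real (\<beta> x)) \<subseteq> cball x0 R"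
      by (subst fun_supp_subset_iff) (use 0 in auto)
  qed (use \<beta> 0 in auto)
qed

section \<open>Integration\<close>

lemma pair_in_Basis [simp]:
  "b \<in> Basis \<Longrightarrow> (0, b) \<in> Basis" "b \<in> Basis \<Longrightarrow> (b, 0) \<in> Basis"
  by (auto simp: Basis_prod_def)

lemma integral_affine:
  fixes f :: "'a::euclidean_space \<Rightarrow> 'b::{banach, second_countable_topology}"
  assumes [measurable]: "f \<in> borel_measurable borel" and c: "c \<noteq> 0"
  shows "(LINT x|lborel. f x) = \<bar>c\<bar> ^ DIM('a) *\<^sub>R (LINT x|lborel. f (t + c *\<^sub>R x))"
    and "integrable lborel f \<longleftrightarrow> integrable lborel (\<lambda>x. f (t + c *\<^sub>R x))"
proof -
  have l: "(lborel :: 'a measure) = density (distr lborel borel (\<lambda>x. t + c *\<^sub>R x)) (\<lambda>_. ennreal (\<bar>c\<bar> ^ DIM('a)))"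
    using lborel_affine[OF c, of t] by simp
  show "(LINT x|lborel. f x) = \<bar>c\<bar> ^ DIM('a) *\<^sub>R (LINT x|lborel. f (t + c *\<^sub>R x))"
    by (subst l) (simp add: integral_density integral_distr)
  show "integrable lborel f \<longleftrightarrow> integrable lborel (\<lambda>x. f (t + c *\<^sub>R x))"
    using c integrable_scaleR_right[of "inverse (\<bar>c\<bar> ^ DIM('a))" lborel "\<lambda>x. \<bar>c\<bar> ^ DIM('a) *\<^sub>R f (t + c *\<^sub>R x)"]
    by (subst l) (auto simp add: integrable_density integrable_distr_eq)
qed

lemma integral_translate:
  fixes f :: "'a::euclidean_space \<Rightarrow> 'b::{banach, second_countable_topology}"
  assumes "f \<in> borel_measurable borel"
  shows "(LINT x|lborel. f (x + t)) = (LINT x|lborel. f x)"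
    and "integrable lborel (\<lambda>x. f (x + t)) \<longleftrightarrow> integrable lborel f"
  using integral_affine[OF assms, of 1 t] by (simp_all add: add.commute)

lemma integrable_compact_supp:
  fixes f :: "'a::euclidean_space \<Rightarrow> 'b::{banach, second_countable_topology}"
  assumes "compact K" "continuous_on K f" "\<And>x. x \<notin> K \<Longrightarrow> f x = 0"
  shows "integrable lborel f"
proof -
  have "(\<lambda>x. indicator K x *\<^sub>R f x) = f" using assms(3) by (auto simp: indicator_def)
  then show ?thesis using borel_integrable_compact[OF assms(1,2)] by simp
qed

lemma test_functions_continuous: "\<phi> \<in> test_functions \<Longrightarrow> continuous_on S \<phi>"
  by (meson continuous_on_subset smooth_on_continuous_on subset_UNIV test_functions_smooth)

lemma integrable_test: "\<phi> \<in> test_functions \<Longrightarrow> integrable lborel \<phi>"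
  using integrable_compact_supp[of "fun_supp \<phi>" \<phi>]
  by (auto simp: test_functions_compact fun_supp_zero test_functions_continuous)

lemma integral_pos:
  fixes f :: "'a::euclidean_space \<Rightarrow> real"
  assumes "integrable lborel f" "\<And>x. 0 \<le> f x" "\<And>x. x \<in> ball y r \<Longrightarrow> \<delta> \<le> f x" "0 < \<delta>" "0 < r"
  shows "0 < (LINT x|lborel. f x)"
proof -
  have "0 < \<delta> * measure lborel (ball y r)" using assms content_ball_pos[of r y] by simp
  also have "\<dots> = (LINT x|lborel. \<delta> * indicator (ball y r) x)"
    by simp
  also have "\<dots> \<le> (LINT x|lborel. f x)"
  proof (rule integral_mono)
    show "integrable lborel (\<lambda>x. \<delta> * indicator (ball y r) x :: real)"
      using emeasure_lborel_ball_finite[of y r] by (intro integrable_mult_right integrable_real_indicator) auto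
  qed (use assms in \<open>auto simp: indicator_def\<close>)
  finally show ?thesis .
qed

lemma fundamental_lemma:
  fixes g :: "'a::euclidean_space \<Rightarrow> complex"
  assumes "open W" "continuous_on W g"
    and 0: "\<And>\<phi>. \<phi> \<in> test_functions \<Longrightarrow> fun_supp \<phi> \<subseteq> W \<Longrightarrow> (LINT x|lborel. g x * \<phi> x) = 0"
    and y: "y \<in> W"
  shows "g y = 0"
proof (rule ccontr)
  assume ny: "g y \<noteq> 0"
  \<comment> \<open>Rotation by the conjugate of \<open>g y\<close> makes the real part positive
    near y, so a bump supported there has a positive pairing with it.\<close>
  define h where "h x = Re (cnj (g y) * g x)" for x
  have hy: "0 < h y" using ny by (simp add: h_def complex_norm_square[symmetric] mult.commute)
  have hc: "continuous_on W h" unfolding h_def by (intro continuous_intros assms)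
  have "open (W \<inter> h -` {h y / 2<..})"
    by (rule continuous_open_preimage[OF hc assms(1)]) simp
  moreover have "y \<in> W \<inter> h -` {h y / 2<..}" using hy y by auto
  ultimately obtain R where R: "0 < R" "cball y R \<subseteq> W \<inter> h -` {h y / 2<..}"
    by (meson open_contains_cball)
  obtain \<beta> :: "'a \<Rightarrow> real" where \<beta>: "smooth_on UNIV (\<lambda>x. complex_of_real (\<beta> x))"
    "\<And>x. x \<in> cball y (R / 2) \<Longrightarrow> \<beta> x = 1" "\<And>x. 0 < \<beta> x \<longleftrightarrow> x \<in> ball y R"
    "\<And>x. 0 \<le> \<beta> x" "\<And>x. \<beta> x \<le> 1"
    using R(1) by (rule_tac bump_exists[of "R/2" R y]) auto
  have \<beta>0: "\<beta> x = 0" if "x \<notin> ball y R" for x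
    using \<beta>(3)[of x] \<beta>(4)[of x] that by auto
  have bc: "continuous_on S \<beta>" for S
    using continuous_on_Re[OF continuous_on_subset[OF smooth_on_continuous_on[OF \<beta>(1)] subset_UNIV[of S]]]
    by simp
  have test: "(\<lambda>x. complex_of_real (\<beta> x)) \<in> test_functions"
    by (rule test_functionsI[where K="cball y R"]) (use \<beta> \<beta>0 in auto)
  have sub: "fun_supp (\<lambda>x. complex_of_real (\<beta> x)) \<subseteq> W"
    using fun_supp_subset_iff[of "cball y R" "\<lambda>x. complex_of_real (\<beta> x)"] \<beta>0 R by auto
  have int: "integrable lborel (\<lambda>x. g x * complex_of_real (\<beta> x))"
    by (rule integrable_compact_supp[of "cball y R"])
       (use R \<beta>0 in \<open>auto intro!: continuous_intros bc continuous_on_subset[OF assms(2)]\<close>)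
  have "(LINT x|lborel. h x * \<beta> x) = (LINT x|lborel. Re (cnj (g y) * (g x * complex_of_real (\<beta> x))))"
    by (simp add: h_def algebra_simps)
  also have "\<dots> = Re (cnj (g y) * (LINT x|lborel. g x * complex_of_real (\<beta> x)))"
    by (subst integral_Re) (use int in auto)
  also have "\<dots> = 0" using 0[OF test sub] by simp
  finally have z: "(LINT x|lborel. h x * \<beta> x) = 0" .
  have "0 < (LINT x|lborel. h x * \<beta> x)"
  proof (rule integral_pos[of _ y "R/2" "h y / 2"])
    show "integrable lborel (\<lambda>x. h x * \<beta> x)"
      by (rule integrable_compact_supp[of "cball y R"])
         (use R \<beta>0 in \<open>auto intro!: continuous_intros bc continuous_on_subset[OF hc]\<close>)
    show "0 \<le> h x * \<beta> x" for x
      using R \<beta>0[of x] \<beta>(4)[of x] hy by (cases "x \<in> cball y R") (auto intro!: mult_nonneg_nonneg)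
    show "h y / 2 \<le> h x * \<beta> x" if "x \<in> ball y (R/2)" for x
    proof -
      have "x \<in> cball y R" "x \<in> cball y (R/2)" using that R(1) by auto
      then show ?thesis using R(2) \<beta>(2)[of x] by auto
    qed
  qed (use R hy in auto)
  with z show False by simp
qed

text \<open>This must cover integrands that are merely integrable, such as rapidly decreasing ones.
  Averaging the derivative over the segment from x to x + b gives a multiple of f (x + b) - f x,
  whose integral vanishes by translation invariance; Fubini relates the average to the integral of
  the derivative itself.\<close>

lemma integral_D_eq_0:
  fixes f :: "'a::euclidean_space \<Rightarrow> complex"
  assumes f: "\<And>x. f differentiable (at x)" "continuous_on UNIV (D b f)"
    and int: "integrable lborel f" "integrable lborel (D b f)"
  shows "(LINT x|lborel. D b f x) = 0"
proof -
  define F where "F x s = indicator {0..1} s *\<^sub>R D b f (x + s *\<^sub>R b)" for x and s :: real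
  have [measurable]: "D b f \<in> borel_measurable borel" "f \<in> borel_measurable borel"
    using f(2) int(1) by (auto intro: borel_measurable_continuous_onI)
  have [measurable]: "case_prod F \<in> borel_measurable (borel \<Otimes>\<^sub>M borel)"
    unfolding F_def by measurable
  have ftc: "(LINT s|lborel. F x s) = - \<i> * (f (x + b) - f x)" for x
  proof -
    have "((\<lambda>s. f (x + s *\<^sub>R b)) has_vector_derivative \<i> * D b f (x + s *\<^sub>R b)) (at s)" for s
    proof -
      have "((\<lambda>s. x + s *\<^sub>R b) has_derivative (\<lambda>h. h *\<^sub>R b)) (at s)"
        by (auto intro!: derivative_eq_intros)
      from has_derivative_compose[OF this D_has_derivative[OF f(1)]]
      have *: "((\<lambda>s. f (x + s *\<^sub>R b)) has_derivative (\<lambda>h. \<i> * D (h *\<^sub>R b) f (x + s *\<^sub>R b))) (at s)"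
        by simp
      have "\<i> * D (h *\<^sub>R b) f z = h *\<^sub>R (\<i> * D b f z)" for h z
        using linear_frechet_derivative[OF f(1)[of z]] by (simp add: D_def linear_scale)
      with * show ?thesis by (simp add: has_vector_derivative_def)
    qed
    then have "((\<lambda>s. \<i> * D b f (x + s *\<^sub>R b)) has_integral f (x + 1 *\<^sub>R b) - f (x + 0 *\<^sub>R b)) {0..1}"
      by (intro fundamental_theorem_of_calculus) (auto intro: has_vector_derivative_at_within)
    from has_integral_mult_right[OF this, of "- \<i>"]
    have "((\<lambda>s. D b f (x + s *\<^sub>R b)) has_integral - \<i> * (f (x + b) - f x)) {0..1}"
      by (simp add: mult.assoc[symmetric])
    moreover have "set_integrable lborel {0..1} (\<lambda>s. D b f (x + s *\<^sub>R b))"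
      unfolding set_integrable_def
      by (intro borel_integrable_compact continuous_on_compose2[OF f(2)] continuous_intros) auto
    ultimately show ?thesis
      using set_borel_integral_eq_integral(2)[of "{0..1}" "\<lambda>s. D b f (x + s *\<^sub>R b)"]
      by (simp add: F_def set_lebesgue_integral_def integral_unique)
  qed
  have intF: "integrable (lborel \<Otimes>\<^sub>M lborel) (\<lambda>(s, x). F x s)"
  proof (rule lborel_pair.Fubini_integrable)
    have "(LINT x|lborel. norm (F x s)) = indicator {0..1} s *\<^sub>R (LINT x|lborel. norm (D b f x))" for s
      using integral_translate(1)[of "\<lambda>x. norm (D b f x)" "s *\<^sub>R b"]
      by (simp add: F_def indicator_def)
    then show "integrable lborel (\<lambda>s. LINT x|lborel. norm (case (s, x) of (s, x) \<Rightarrow> F x s))"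
      by (simp add: integrable_real_mult_indicator mult.commute)
    show "AE s in lborel. integrable lborel (\<lambda>x. case (s, x) of (s, x) \<Rightarrow> F x s)"
      using integral_translate(2)[of "D b f"] int by (auto simp: F_def indicator_def)
  qed measurable
  have "(LINT s|lborel. LINT x|lborel. F x s) = (LINT x|lborel. LINT s|lborel. F x s)"
    by (rule lborel_pair.Fubini_integral[OF intF, symmetric])
  also have "\<dots> = - \<i> * ((LINT x|lborel. f (x + b)) - (LINT x|lborel. f x))"
    unfolding ftc using int integral_translate(2)[of f b] by simp
  also have "\<dots> = 0" using integral_translate(1)[of f b] by simp
  finally have "(LINT s|lborel. LINT x|lborel. F x s) = 0" .
  moreover have "(LINT x|lborel. F x s) = indicator {0..1} s *\<^sub>R (LINT x|lborel. D b f x)" for s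
    using integral_translate(1)[of "D b f" "s *\<^sub>R b"] by (simp add: F_def indicator_def)
  \<comment> \<open>The segment parameter runs over an interval of length 1, so the averaged
    integral is the integral of the derivative.\<close>
  ultimately show ?thesis by (simp add: measure_def)
qed

text \<open>The common compact support in x turns the Lebesgue integral into an integral over one
  fixed box, where the Leibniz rule for continuous derivatives applies. Its result
  \<open>D (0, b) F\<close> satisfies the same hypotheses, so all orders follow by
  induction.\<close>

lemma smooth_param_integral:
  fixes F :: "'a::euclidean_space \<times> 'b::euclidean_space \<Rightarrow> complex"
  assumes F: "smooth_on UNIV F" and K: "compact K" "\<And>x y. x \<notin> K \<Longrightarrow> F (x, y) = 0"
  shows "smooth_on UNIV (\<lambda>y. LINT x|lborel. F (x, y))"
    and "b \<in> Basis \<Longrightarrow> D b (\<lambda>y. LINT x|lborel. F (x, y)) = (\<lambda>y. LINT x|lborel. D (0, b) F (x, y))"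
proof -
  have main: "(\<lambda>y. LINT x|lborel. F (x, y)) differentiable (at y)
      \<and> (\<forall>b\<in>Basis. D b (\<lambda>y. LINT x|lborel. F (x, y)) y = (LINT x|lborel. D (0, b) F (x, y)))"
    if F: "smooth_on UNIV F" and K0: "\<And>x y. x \<notin> K \<Longrightarrow> F (x, y) = 0" for F :: "'a \<times> 'b \<Rightarrow> complex" and y
  proof -
    obtain a c where ac: "K \<subseteq> cbox a c"
      using bounded_subset_cbox_symmetric[OF compact_imp_bounded[OF K(1)]] by blast
    have cont: "continuous_on S (\<lambda>x. G (x, y))" if "smooth_on UNIV G" for G :: "'a \<times> 'b \<Rightarrow> complex" and y S
      by (intro continuous_on_compose2[OF smooth_on_continuous_on[OF that]] continuous_intros) auto
    have hk: "(LINT x|lborel. G (x, y)) = integral (cbox a c) (\<lambda>x. G (x, y))"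
      if "smooth_on UNIV G" "\<And>x y. x \<notin> K \<Longrightarrow> G (x, y) = 0" for G :: "'a \<times> 'b \<Rightarrow> complex" and y
    proof -
      have "integrable lborel (\<lambda>x. G (x, y))"
        by (rule integrable_compact_supp[OF K(1)]) (use that cont in auto)
      then have "(LINT x|lborel. G (x, y)) = integral UNIV (\<lambda>x. G (x, y))"
        by (simp add: integral_lborel)
      also have "\<dots> = integral UNIV (\<lambda>x. if x \<in> cbox a c then G (x, y) else 0)"
        using that(2) ac by (intro arg_cong[of _ _ "integral UNIV"] ext) auto
      also have "\<dots> = integral (cbox a c) (\<lambda>x. G (x, y))"
        by (rule integral_restrict_UNIV)
      finally show ?thesis .
    qed
    have hkF: "(\<lambda>y. LINT x|lborel. F (x, y)) = (\<lambda>y. integral (cbox a c) (\<lambda>x. F (x, y)))"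
      using hk[of F] F K0 by blast
    have d: "((\<lambda>y. F (x, y)) has_derivative (\<lambda>h. \<i> * D (0, h) F (x, y))) (at y)" for x y
    proof -
      have "((\<lambda>y. (x, y)) has_derivative (\<lambda>h. (0, h))) (at y)"
        by (auto intro!: has_derivative_Pair derivative_intros)
      from has_derivative_compose[OF this D_has_derivative[OF smooth_on_differentiable[OF F UNIV_I]]]
      show ?thesis by simp
    qed
    \<comment> \<open>The Leibniz rule asks for the whole derivative in y as a bounded linear map
      depending continuously on the point; continuity is checked on basis vectors.\<close>
    define L where "L y x = Blinfun (\<lambda>h. \<i> * D (0, h) F (x, y))" for x y
    have L: "blinfun_apply (L y x) = (\<lambda>h. \<i> * D (0, h) F (x, y))" for x y
      unfolding L_def by (rule bounded_linear_Blinfun_apply[OF has_derivative_bounded_linear[OF d]])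
    have Lc: "continuous_on UNIV (\<lambda>(y, x). L y x)"
    proof (rule continuous_on_blinfun_componentwise)
      fix b :: 'b assume "b \<in> Basis"
      then have "smooth_on UNIV (D (0, b) F)" using F by (intro smooth_on_D) auto
      then have c: "continuous_on UNIV (D (0, b) F)" by (rule smooth_on_continuous_on)
      have sw: "continuous_on UNIV (\<lambda>z :: 'b \<times> 'a. (snd z, fst z))"
        by (intro continuous_intros)
      have "continuous_on UNIV (\<lambda>z. D (0, b) F (snd z, fst z))"
        by (rule continuous_on_compose2[OF c sw]) auto
      then show "continuous_on UNIV (\<lambda>z. blinfun_apply (case z of (y, x) \<Rightarrow> L y x) b)"
        unfolding split_beta L by (intro continuous_intros)
    qed
    have lz: "((\<lambda>y. integral (cbox a c) (\<lambda>x. F (x, y))) has_derivative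
        blinfun_apply (integral (cbox a c) (L y))) (at y within UNIV)"
    proof (rule leibniz_rule[where U=UNIV])
      show "continuous_on (UNIV \<times> cbox a c) (\<lambda>(y, x). L y x)"
        by (rule continuous_on_subset[OF Lc]) auto
      show "((\<lambda>y. F (x, y)) has_derivative blinfun_apply (L y x)) (at y within UNIV)" for x y
        using d unfolding L by simp
      show "(\<lambda>x. F (x, y)) integrable_on cbox a c" for y
        by (rule integrable_continuous[OF cont[OF F]])
    qed auto
    have Li: "L y integrable_on cbox a c"
    proof (rule integrable_continuous)
      have pr: "continuous_on (cbox a c) (\<lambda>x. (y, x))" by (intro continuous_intros)
      show "continuous_on (cbox a c) (L y)"
        using continuous_on_compose2[OF Lc pr] by simp
    qed
    have "D b (\<lambda>y. LINT x|lborel. F (x, y)) y = (LINT x|lborel. D (0, b) F (x, y))"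
      if b: "b \<in> Basis" for b
    proof -
      have z: "D (0, b) F (x, y) = 0" if "x \<notin> K" for x y
        using D_cong_open[of "(- K) \<times> UNIV" "(x, y)" F "\<lambda>_. 0"] K0 that compact_imp_closed[OF K(1)]
        by (auto simp: open_Times open_Compl)
      have "D b (\<lambda>y. LINT x|lborel. F (x, y)) y = - \<i> * blinfun_apply (integral (cbox a c) (L y)) b"
        unfolding hkF by (rule D_eq) (use lz in simp)
      also have "blinfun_apply (integral (cbox a c) (L y)) b = integral (cbox a c) (\<lambda>x. blinfun_apply (L y x) b)"
        using integral_linear[OF Li blinfun.bounded_linear_left[of b]] by (simp add: o_def)
      also have "\<dots> = \<i> * integral (cbox a c) (\<lambda>x. D (0, b) F (x, y))"
        unfolding L by simp
      finally show ?thesis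
        by (subst hk) (use F b z in \<open>auto intro!: smooth_on_D simp: mult.assoc[symmetric]\<close>)
    qed
    moreover have "(\<lambda>y. LINT x|lborel. F (x, y)) differentiable (at y)"
      unfolding hkF using lz by (auto simp: differentiable_def)
    ultimately show ?thesis by blast
  qed
  have z: "D (0, b) F (x, y) = 0" if "x \<notin> K" "\<And>x y. x \<notin> K \<Longrightarrow> F (x, y) = 0" for b x y and F :: "'a \<times> 'b \<Rightarrow> complex"
    using D_cong_open[of "(- K) \<times> UNIV" "(x, y)" F "\<lambda>_. 0"] that compact_imp_closed[OF K(1)]
    by (auto simp: open_Times open_Compl)
  have "ck n UNIV (\<lambda>y. LINT x|lborel. F (x, y))"
    if "smooth_on UNIV F" "\<And>x y. x \<notin> K \<Longrightarrow> F (x, y) = 0" for n and F :: "'a \<times> 'b \<Rightarrow> complex"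
    using that
  proof (induction n arbitrary: F)
    case (Suc n)
    have m: "(\<lambda>y. LINT x|lborel. F (x, y)) differentiable (at y)
        \<and> (\<forall>b\<in>Basis. D b (\<lambda>y. LINT x|lborel. F (x, y)) y = (LINT x|lborel. D (0, b) F (x, y)))" for y
      using main[of F y] Suc.prems by blast
    have "ck n UNIV (D b (\<lambda>y. LINT x|lborel. F (x, y)))" if b: "b \<in> Basis" for b
    proof (rule ck_cong[OF open_UNIV])
      show "ck n UNIV (\<lambda>y. LINT x|lborel. D (0, b) F (x, y))"
        by (rule Suc.IH) (use b Suc.prems z in \<open>auto intro!: smooth_on_D\<close>)
    qed (use m b in auto)
    then show ?case using m by auto
  qed simp
  then show "smooth_on UNIV (\<lambda>y. LINT x|lborel. F (x, y))"
    using F K by (simp add: smooth_on_ck)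
  show "D b (\<lambda>y. LINT x|lborel. F (x, y)) = (\<lambda>y. LINT x|lborel. D (0, b) F (x, y))" if "b \<in> Basis"
    using main[of F] F K(2) that by (intro ext) blast
qed

section \<open>The weight \<open>\<langle>\<xi>\<rangle>\<close>\<close>

lemma japanese_ge_1: "1 \<le> japanese x"
  by (simp add: japanese_def)

lemma japanese_pos [simp]: "0 < japanese x" "0 \<le> japanese x" "japanese x \<noteq> 0"
  using japanese_ge_1[of x] by linarith+

lemma norm_le_japanese: "norm x \<le> japanese x"
  unfolding japanese_def by (rule real_le_rsqrt) simp

lemma inner_le_japanese: "b \<in> Basis \<Longrightarrow> \<bar>x \<bullet> b\<bar> \<le> japanese x"
  using Basis_le_norm norm_le_japanese order_trans by blast

lemma japanese_le: "japanese x \<le> 1 + norm x"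
  unfolding japanese_def by (rule real_le_lsqrt) (auto simp: power2_sum)

lemma japanese_minus [simp]: "japanese (- x) = japanese x"
  by (simp add: japanese_def)

lemma japanese_diff_commute: "japanese (x - y) = japanese (y - x)"
  by (simp add: japanese_def norm_minus_commute)

lemma continuous_on_japanese [continuous_intros]:
  "continuous_on S f \<Longrightarrow> continuous_on S (\<lambda>x. japanese (f x))"
  unfolding japanese_def by (intro continuous_intros)

lemma measurable_japanese [measurable]: "japanese \<in> borel_measurable borel"
  by (intro borel_measurable_continuous_onI continuous_intros)

lemma japanese_powr_mono: "s \<le> t \<Longrightarrow> japanese x powr s \<le> japanese x powr t"
  by (rule powr_mono) (auto simp: japanese_ge_1)

lemma japanese_submult: "japanese a \<le> 2 * (japanese b * japanese (a - b))"
proof -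
  have "japanese a \<le> 1 + norm a" by (rule japanese_le)
  also have "\<dots> \<le> 1 + norm b + norm (a - b)" using norm_triangle_sub[of a b] by simp
  also have "\<dots> \<le> japanese b * japanese (a - b) + japanese b * japanese (a - b)"
  proof -
    have "(1 + norm b + norm (a - b))\<^sup>2 \<le> (2 * (japanese b * japanese (a - b)))\<^sup>2"
    proof -
      let ?s = "norm b" and ?t = "norm (a - b)"
      have "2 * ?s \<le> 1 + ?s\<^sup>2" "2 * ?t \<le> 1 + ?t\<^sup>2" "2 * ?s * ?t \<le> ?s\<^sup>2 + ?t\<^sup>2"
        using sum_squares_bound[of ?s 1] sum_squares_bound[of ?t 1] sum_squares_bound[of ?s ?t] by auto
      moreover have "(1 + ?s + ?t)\<^sup>2 = 1 + ?s\<^sup>2 + ?t\<^sup>2 + 2 * ?s + 2 * ?t + 2 * ?s * ?t"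
        by (simp add: power2_eq_square algebra_simps)
      moreover have "0 \<le> ?s\<^sup>2 * ?t\<^sup>2" by simp
      moreover have "(2 * (japanese b * japanese (a - b)))\<^sup>2 = 4 * (1 + ?s\<^sup>2 + ?t\<^sup>2 + ?s\<^sup>2 * ?t\<^sup>2)"
        by (simp add: japanese_def power_mult_distrib algebra_simps)
      moreover have "0 \<le> ?s\<^sup>2" "0 \<le> ?t\<^sup>2" by simp_all
      ultimately show ?thesis by argo
    qed
    then have "1 + norm b + norm (a - b) \<le> 2 * (japanese b * japanese (a - b))"
      by (rule power2_le_imp_le) simp
    then show ?thesis by simp
  qed
  finally show ?thesis by simp
qed

text \<open>Moves a weight from one frequency to another at the price of a power of their distance.
  For negative exponents the bound \<open>japanese_submult\<close> is used with \<xi> and \<eta>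
  exchanged.\<close>

lemma Peetre:
  "japanese \<eta> powr s \<le> 2 powr \<bar>s\<bar> * (japanese \<xi> powr s * japanese (\<eta> - \<xi>) powr \<bar>s\<bar>)"
proof (cases "0 \<le> s")
  case True
  have "japanese \<eta> powr s \<le> (2 * (japanese \<xi> * japanese (\<eta> - \<xi>))) powr s"
    by (intro powr_mono2 japanese_submult True) auto
  with True show ?thesis by (simp add: powr_mult)
next
  case False
  have "japanese \<xi> powr (- s) \<le> (2 * (japanese \<eta> * japanese (\<eta> - \<xi>))) powr (- s)"
    using False japanese_submult[of \<xi> \<eta>] by (intro powr_mono2) (auto simp: japanese_diff_commute)
  with False show ?thesis by (simp add: powr_mult powr_minus field_simps)
qed

lemma inverse_1_plus_square_finite: "(\<integral>\<^sup>+t. ennreal (inverse (1 + t\<^sup>2)) \<partial>lborel) < \<infinity>"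
proof -
  let ?f = "\<lambda>t::real. inverse (1 + t\<^sup>2)"
  have half: "(\<integral>\<^sup>+t. ennreal (?f t) * indicator {0..} t \<partial>lborel) = ennreal (pi / 2 - arctan 0)"
    by (rule nn_integral_FTC_atLeast)
       (auto intro!: DERIV_arctan tendsto_arctan_at_top simp: add_nonneg_nonneg)
  have "(\<integral>\<^sup>+t. ennreal (?f t) \<partial>lborel)
      \<le> (\<integral>\<^sup>+t. ennreal (?f t) * indicator {0..} t + ennreal (?f (- t)) * indicator {0..} (- t) \<partial>lborel)"
    by (intro nn_integral_mono) (auto simp: indicator_def)
  also have "\<dots> = (\<integral>\<^sup>+t. ennreal (?f t) * indicator {0..} t \<partial>lborel)
      + (\<integral>\<^sup>+t. ennreal (?f (- t)) * indicator {0..} (- t) \<partial>lborel)"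
    by (intro nn_integral_add) auto
  also have "(\<integral>\<^sup>+t. ennreal (?f (- t)) * indicator {0..} (- t) \<partial>lborel)
      = (\<integral>\<^sup>+t. ennreal (?f t) * indicator {0..} t \<partial>lborel)"
    using nn_integral_real_affine[of "\<lambda>t. ennreal (?f t) * indicator {0..} t" "-1" 0] by simp
  finally have "(\<integral>\<^sup>+t. ennreal (?f t) \<partial>lborel)
      \<le> ennreal (pi / 2 - arctan 0) + ennreal (pi / 2 - arctan 0)"
    unfolding half .
  also have "\<dots> < \<infinity>" by (simp add: less_top[symmetric] ennreal_add_eq_top)
  finally show ?thesis .
qed

text \<open>At exponent -2n, n the dimension, the weight is at most the product over the coordinates
  t of 1/(1 + t^2), which reduces integrability to one dimension. The exponent is crude, but decay
  of any order is at hand wherever it is needed.\<close>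

lemma integrable_japanese:
  assumes "s \<le> - 2 * real DIM('a::euclidean_space)"
  shows "integrable lborel (\<lambda>\<eta>::'a. japanese \<eta> powr s)"
proof (rule integrableI_bounded)
  have "(\<integral>\<^sup>+\<eta>. ennreal (norm (japanese (\<eta>::'a) powr s)) \<partial>lborel)
      \<le> (\<integral>\<^sup>+\<eta>. (\<Prod>b\<in>Basis. ennreal (inverse (1 + ((\<eta>::'a) \<bullet> b)\<^sup>2))) \<partial>lborel)"
  proof (rule nn_integral_mono)
    fix \<eta> :: 'a
    have "japanese \<eta> powr s \<le> japanese \<eta> powr (- real (2 * DIM('a)))"
      using assms by (intro japanese_powr_mono) simp
    also have "\<dots> = inverse ((japanese \<eta>)\<^sup>2) ^ DIM('a)"
      by (subst powr_minus, subst powr_realpow) (auto simp: power_mult power_inverse)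
    also have "\<dots> = (\<Prod>b\<in>(Basis::'a set). inverse (1 + (norm \<eta>)\<^sup>2))"
      by (simp add: japanese_def add_nonneg_nonneg)
    also have "\<dots> \<le> (\<Prod>b\<in>(Basis::'a set). inverse (1 + (\<eta> \<bullet> b)\<^sup>2))"
    proof (intro prod_mono conjI le_imp_inverse_le add_left_mono)
      show "(\<eta> \<bullet> b)\<^sup>2 \<le> (norm \<eta>)\<^sup>2" if "b \<in> Basis" for b
        using power_mono[OF Basis_le_norm[OF that, of \<eta>], of 2] by simp
    qed (auto simp: add_pos_nonneg)
    finally show "ennreal (norm (japanese \<eta> powr s)) \<le> (\<Prod>b\<in>Basis. ennreal (inverse (1 + (\<eta> \<bullet> b)\<^sup>2)))"
      by (subst prod_ennreal) (auto simp: add_nonneg_nonneg intro!: ennreal_leI)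
  qed
  also have "\<dots> = (\<Prod>b\<in>(Basis::'a set). (\<integral>\<^sup>+t. ennreal (inverse (1 + t\<^sup>2)) \<partial>lborel))"
    by (rule nn_integral_lborel_prod) auto
  also have "\<dots> < \<infinity>"
    using inverse_1_plus_square_finite by (simp add: power_less_top_ennreal)
  finally show "(\<integral>\<^sup>+\<eta>. ennreal (norm (japanese (\<eta>::'a) powr s)) \<partial>lborel) < \<infinity>" .
qed measurable

text \<open>If \<open>f\<close> fails to be integrable its integral is 0 by convention and the bound
  is trivial. This keeps measurability obligations out of the estimates.\<close>

lemma norm_integral_le:
  fixes f :: "'a \<Rightarrow> 'b::{banach, second_countable_topology}"
  assumes "integrable M g" "\<And>x. norm (f x) \<le> g x"
  shows "norm (LINT x|M. f x) \<le> (LINT x|M. g x)"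
proof (cases "integrable M f")
  case True
  have "norm (LINT x|M. f x) \<le> (LINT x|M. norm (f x))" by (rule integral_norm_bound)
  also have "\<dots> \<le> (LINT x|M. g x)" using True assms by (intro integral_mono) auto
  finally show ?thesis .
next
  case False
  have "0 \<le> g x" for x using assms(2)[of x] norm_ge_zero order_trans by blast
  then show ?thesis using False by (simp add: not_integrable_integral_eq)
qed

section \<open>Fourier integrals\<close>

definition ex :: "'a::euclidean_space \<Rightarrow> 'a \<Rightarrow> complex" where
  "ex z x = exp (\<i> * complex_of_real (x \<bullet> z))"

lemma norm_ex [simp]: "cmod (ex z x) = 1"
  by (simp add: ex_def norm_exp_i_times)

lemma ex_commute: "ex z x = ex x z"
  by (simp add: ex_def inner_commute)

lemma ex_add: "ex (z + w) x = ex z x * ex w x" "ex z (x + y) = ex z x * ex z y"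
  by (simp_all add: ex_def inner_add_left inner_add_right distrib_left exp_add)

lemma ex_minus: "ex (- z) x = ex z (- x)"
  by (simp add: ex_def)

lemma ex_0 [simp]: "ex 0 x = 1" "ex z 0 = 1"
  by (simp_all add: ex_def)

lemma ex_cancel: "ex (- z) x * ex z x = 1" "ex z x * ex (- z) x = 1"
  using ex_add(1)[of "-z" z x] ex_add(1)[of z "-z" x] by simp_all

lemma cnj_ex: "cnj (ex z x) = ex (- z) x"
  by (simp add: ex_def exp_cnj)

lemma smooth_on_ex: "open U \<Longrightarrow> smooth_on U (ex z)"
  unfolding ex_def
  using smooth_on_inner[OF _ bounded_linear_ident bounded_linear_zero, of U 0 z]
  by (intro smooth_on_exp smooth_on_cmult) auto

lemma continuous_on_ex [continuous_intros]:
  "continuous_on S f \<Longrightarrow> continuous_on S g \<Longrightarrow> continuous_on S (\<lambda>x. ex (f x) (g x))"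
  unfolding ex_def by (intro continuous_intros)

lemma measurable_ex [measurable]:
  "(\<lambda>x. ex z x) \<in> borel_measurable borel" "(\<lambda>z. ex z x) \<in> borel_measurable borel"
  by (auto intro!: borel_measurable_continuous_onI continuous_intros)

lemma ex_has_derivative:
  "(ex z has_derivative (\<lambda>h. \<i> * complex_of_real (h \<bullet> z) * ex z x)) (at x)"
proof -
  have l: "((\<lambda>x. \<i> * complex_of_real (x \<bullet> z)) has_derivative (\<lambda>h. \<i> * complex_of_real (h \<bullet> z))) (at x)"
    by (auto intro!: derivative_eq_intros)
  have e: "(exp has_derivative (\<lambda>h. h * exp w)) (at w)" for w :: complex
    by (rule has_derivative_eq_rhs[OF DERIV_exp[unfolded has_field_derivative_def]])
       (simp add: fun_eq_iff mult.commute)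
  from has_derivative_compose[OF l e] show ?thesis
    by (simp add: ex_def[abs_def])
qed

lemma D_ex: "D b (ex z) = (\<lambda>x. complex_of_real (b \<bullet> z) * ex z x)"
  by (rule ext, subst D_eq[OF ex_has_derivative]) (simp add: mult.assoc[symmetric])

text \<open>Decay alone, with no condition on derivatives: the class is stable under multiplication
  by indicators and by measurable functions of polynomial growth, and its members still have smooth
  transforms \<open>IF\<close>.\<close>

definition rapid :: "('a::euclidean_space \<Rightarrow> complex) \<Rightarrow> bool" where
  "rapid B \<longleftrightarrow> B \<in> borel_measurable borel \<and>
     (\<forall>s. \<exists>C. \<forall>\<eta>. cmod (B \<eta>) \<le> C * japanese \<eta> powr s)"

lemma rapid_measurable [measurable_dest]: "rapid B \<Longrightarrow> B \<in> borel_measurable borel"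
  by (simp add: rapid_def)

lemma rapid_bound:
  assumes "rapid B" obtains C where "0 \<le> C" "\<And>\<eta>. cmod (B \<eta>) \<le> C * japanese \<eta> powr s"
proof -
  obtain C where C: "\<And>\<eta>. cmod (B \<eta>) \<le> C * japanese \<eta> powr s" using assms rapid_def by blast
  have "0 \<le> C * japanese (0::'a) powr s" using C[of 0] norm_ge_zero order_trans by blast
  then have "0 \<le> C" by (simp add: zero_le_mult_iff)
  then show ?thesis using C that by blast
qed

lemma rapid_mult:
  assumes B: "rapid B" and g: "g \<in> borel_measurable borel" "\<And>\<eta>. cmod (g \<eta>) \<le> C * japanese \<eta> powr t"
  shows "rapid (\<lambda>\<eta>. g \<eta> * B \<eta>)"
  unfolding rapid_def
proof (intro conjI allI)
  show "(\<lambda>\<eta>. g \<eta> * B \<eta>) \<in> borel_measurable borel" using B g by measurable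
  fix s
  obtain C' where C': "0 \<le> C'" "\<And>\<eta>. cmod (B \<eta>) \<le> C' * japanese \<eta> powr (s - t)"
    by (rule rapid_bound[OF B]) blast
  have "0 \<le> C * japanese (0::'a) powr t" using g(2)[of 0] norm_ge_zero order_trans by blast
  then have "0 \<le> C" by (simp add: zero_le_mult_iff)
  have "cmod (g \<eta> * B \<eta>) \<le> (C * C') * japanese \<eta> powr s" for \<eta>
  proof -
    have "cmod (g \<eta> * B \<eta>) \<le> (C * japanese \<eta> powr t) * (C' * japanese \<eta> powr (s - t))"
      unfolding norm_mult using g C' \<open>0 \<le> C\<close> by (intro mult_mono) auto
    also have "\<dots> = (C * C') * (japanese \<eta> powr t * japanese \<eta> powr (s - t))" by simp
    also have "japanese \<eta> powr t * japanese \<eta> powr (s - t) = japanese \<eta> powr s"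
      by (simp add: powr_add[symmetric])
    finally show ?thesis .
  qed
  then show "\<exists>C. \<forall>\<eta>. cmod (g \<eta> * B \<eta>) \<le> C * japanese \<eta> powr s" by blast
qed

lemma rapid_mult_bounded:
  "rapid B \<Longrightarrow> g \<in> borel_measurable borel \<Longrightarrow> (\<And>\<eta>. cmod (g \<eta>) \<le> C) \<Longrightarrow> rapid (\<lambda>\<eta>. g \<eta> * B \<eta>)"
  by (rule rapid_mult[of _ _ C 0]) auto

lemma rapid_integrable: 
  assumes "rapid (B :: 'a::euclidean_space \<Rightarrow> complex)"
  shows "integrable lborel B"
proof -
  obtain C where C: "\<And>\<eta>. cmod (B \<eta>) \<le> C * japanese \<eta> powr (- 2 * real DIM('a))"
    by (rule rapid_bound[OF assms]) blast
  show ?thesis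
  proof (rule Bochner_Integration.integrable_bound)
    show "integrable lborel (\<lambda>\<eta>::'a. C * japanese \<eta> powr (- 2 * real DIM('a)))"
      by (intro integrable_mult_right integrable_japanese) simp
    show "AE \<eta> in lborel. cmod (B \<eta>) \<le> norm (C * japanese \<eta> powr (- 2 * real DIM('a)))"
      using order_trans[OF C abs_ge_self] by (auto intro!: AE_I2)
  qed (use assms in measurable)
qed

lemma rapid_inner_mult: "rapid B \<Longrightarrow> rapid (\<lambda>\<eta>. complex_of_real (c * (\<eta> \<bullet> b)) * B \<eta>)"
proof (rule rapid_mult[of _ _ "\<bar>c\<bar> * norm b" 1])
  show "cmod (complex_of_real (c * (\<eta> \<bullet> b))) \<le> \<bar>c\<bar> * norm b * japanese \<eta> powr 1" for \<eta>
  proof -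
    have "\<bar>\<eta> \<bullet> b\<bar> \<le> norm b * japanese \<eta>"
      using Cauchy_Schwarz_ineq2[of \<eta> b] mult_left_mono[OF norm_le_japanese[of \<eta>], of "norm b"]
      by (simp add: mult.commute)
    then show ?thesis by (simp add: norm_mult abs_mult mult.assoc mult_left_mono)
  qed
qed auto

text \<open>The sign is opposite to the usual Fourier transform. In the phase <x - y, \<xi>> the
  variable x carries the plus sign, and the transposed operator integrates over x first; it
  therefore applies \<open>Fh\<close>, then \<open>IF\<close>. Neither is normalized by a power of 2
  pi.\<close>

definition Fh :: "('a::euclidean_space \<Rightarrow> complex) \<Rightarrow> 'a \<Rightarrow> complex" where
  "Fh g z = (LINT x|lborel. ex z x * g x)"

definition IF :: "('a::euclidean_space \<Rightarrow> complex) \<Rightarrow> 'a \<Rightarrow> complex" where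
  "IF B y = (LINT \<eta>|lborel. ex (- \<eta>) y * B \<eta>)"

lemma rapid_ex_mult: "rapid B \<Longrightarrow> rapid (\<lambda>\<eta>. ex (- \<eta>) y * B \<eta>)" "rapid B \<Longrightarrow> rapid (\<lambda>\<eta>. ex \<eta> y * B \<eta>)"
  by (auto intro!: rapid_mult_bounded[of _ _ 1] borel_measurable_continuous_onI continuous_intros)

lemma exp_i_second_order: "cmod (exp (\<i> * complex_of_real t) - 1 - \<i> * complex_of_real t) \<le> t\<^sup>2"
  using Taylor_exp[of "\<i> * complex_of_real t" 1] by (simp add: norm_mult power2_eq_square algebra_simps)

text \<open>The second-order Taylor remainder of the exponential is at most the square of the phase,
  and |\<eta>|^2 |B(\<eta>)| is integrable. The error of the linear approximation is thus explicitly
  O(|h|^2).\<close>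

lemma IF_derivative:
  assumes B: "rapid B"
  shows "IF B differentiable (at y)"
    and "D b (IF B) y = IF (\<lambda>\<eta>. complex_of_real (- (\<eta> \<bullet> b)) * B \<eta>) y"
proof -
  define L where "L h = (LINT \<eta>|lborel. (- \<i> * complex_of_real (h \<bullet> \<eta>)) * (ex (- \<eta>) y * B \<eta>))" for h
  have rh: "rapid (\<lambda>\<eta>. - \<i> * complex_of_real (h \<bullet> \<eta>) * (ex (- \<eta>) y * B \<eta>))" for h
    using rapid_mult_bounded[OF rapid_inner_mult[OF rapid_ex_mult(1)[OF B], of 1 h], of "\<lambda>_. - \<i>" 1]
    by (simp add: inner_commute mult.assoc)
  have n2: "integrable lborel (\<lambda>\<eta>. (norm \<eta>)\<^sup>2 * cmod (B \<eta>))"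
  proof -
    have "rapid (\<lambda>\<eta>. complex_of_real ((norm \<eta>)\<^sup>2) * B \<eta>)"
    proof (rule rapid_mult[OF B, of _ 1 2])
      show "cmod (complex_of_real ((norm \<eta>)\<^sup>2)) \<le> 1 * japanese \<eta> powr 2" for \<eta> :: 'a
        using power_mono[OF norm_le_japanese[of \<eta>], of 2] by (simp add: powr_numeral norm_power)
    qed auto
    from integrable_norm[OF rapid_integrable[OF this]] show ?thesis by (simp add: norm_mult norm_power)
  qed
  have n1: "integrable lborel (\<lambda>\<eta>. norm \<eta> * cmod (B \<eta>))"
  proof -
    have "rapid (\<lambda>\<eta>. complex_of_real (norm \<eta>) * B \<eta>)"
      by (rule rapid_mult[OF B, of _ 1 1]) (auto simp: norm_le_japanese)
    from integrable_norm[OF rapid_integrable[OF this]] show ?thesis by (simp add: norm_mult)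
  qed
  have bl: "bounded_linear L"
  proof (rule bounded_linear_intro)
    show "L (h + k) = L h + L k" for h k
      unfolding L_def
      by (subst Bochner_Integration.integral_add[OF rapid_integrable[OF rh] rapid_integrable[OF rh], symmetric])
         (simp add: inner_add_left algebra_simps)
    show "L (r *\<^sub>R h) = r *\<^sub>R L h" for r h
      unfolding L_def integral_scaleR_right[symmetric] by (simp add: scaleR_conv_of_real algebra_simps)
    show "cmod (L h) \<le> norm h * (LINT \<eta>|lborel. norm \<eta> * cmod (B \<eta>))" for h
    proof -
      have "cmod (L h) \<le> (LINT \<eta>|lborel. norm h * (norm \<eta> * cmod (B \<eta>)))"
        unfolding L_def
        by (rule norm_integral_le[OF integrable_mult_right[OF n1]])
           (auto simp: norm_mult mult.assoc[symmetric] intro!: mult_right_mono Cauchy_Schwarz_ineq2)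
      then show ?thesis by simp
    qed
  qed
  have est: "cmod (IF B (y + h) - IF B y - L h) \<le> (norm h)\<^sup>2 * (LINT \<eta>|lborel. (norm \<eta>)\<^sup>2 * cmod (B \<eta>))" for h
  proof -
    have i: "integrable lborel (\<lambda>\<eta>. ex (- \<eta>) (y + h) * B \<eta>)" "integrable lborel (\<lambda>\<eta>. ex (- \<eta>) y * B \<eta>)"
      by (intro rapid_integrable rapid_ex_mult B)+
    have "IF B (y + h) - IF B y - L h =
      (LINT \<eta>|lborel. ex (- \<eta>) (y + h) * B \<eta> - ex (- \<eta>) y * B \<eta>
         - - \<i> * complex_of_real (h \<bullet> \<eta>) * (ex (- \<eta>) y * B \<eta>))"
      unfolding IF_def L_def using i rapid_integrable[OF rh[of h]] by simp
    also have "cmod \<dots> \<le> (LINT \<eta>|lborel. (norm h)\<^sup>2 * ((norm \<eta>)\<^sup>2 * cmod (B \<eta>)))"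
    proof (rule norm_integral_le)
      fix \<eta>
      have "ex (- \<eta>) (y + h) * B \<eta> - ex (- \<eta>) y * B \<eta> - - \<i> * complex_of_real (h \<bullet> \<eta>) * (ex (- \<eta>) y * B \<eta>)
        = ex (- \<eta>) y * B \<eta> * (exp (\<i> * complex_of_real (- (h \<bullet> \<eta>))) - 1 - \<i> * complex_of_real (- (h \<bullet> \<eta>)))"
        by (simp add: ex_add(2) algebra_simps) (simp add: ex_def)
      then have "cmod (ex (- \<eta>) (y + h) * B \<eta> - ex (- \<eta>) y * B \<eta> - - \<i> * complex_of_real (h \<bullet> \<eta>) * (ex (- \<eta>) y * B \<eta>))
        \<le> cmod (B \<eta>) * (- (h \<bullet> \<eta>))\<^sup>2"
        using exp_i_second_order[of "- (h \<bullet> \<eta>)"] by (simp only: norm_mult norm_ex mult_1 mult_left_mono norm_ge_zero)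
      also have "\<dots> \<le> cmod (B \<eta>) * ((norm h)\<^sup>2 * (norm \<eta>)\<^sup>2)"
        using power_mono[OF Cauchy_Schwarz_ineq2[of h \<eta>], of 2]
        by (intro mult_left_mono) (auto simp: power_mult_distrib)
      finally show "cmod (ex (- \<eta>) (y + h) * B \<eta> - ex (- \<eta>) y * B \<eta> - - \<i> * complex_of_real (h \<bullet> \<eta>) * (ex (- \<eta>) y * B \<eta>))
        \<le> (norm h)\<^sup>2 * ((norm \<eta>)\<^sup>2 * cmod (B \<eta>))" by (simp add: mult_ac)
    qed (use n2 in auto)
    finally show ?thesis by simp
  qed
  have d: "(IF B has_derivative L) (at y)"
    unfolding has_derivative_at
  proof (intro conjI bl)
    define M where "M = (LINT \<eta>|lborel. (norm \<eta>)\<^sup>2 * cmod (B \<eta>))"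
    have "(\<lambda>h::'a. norm h * M) \<midarrow>0\<rightarrow> norm (0::'a) * M" by (intro tendsto_intros)
    then have "(\<lambda>h::'a. norm h * M) \<midarrow>0\<rightarrow> 0" by simp
    then show "(\<lambda>h. cmod (IF B (y + h) - IF B y - L h) / norm h) \<midarrow>0\<rightarrow> 0"
    proof (rule Lim_null_comparison[rotated])
      show "\<forall>\<^sub>F h in at 0. norm (cmod (IF B (y + h) - IF B y - L h) / norm h) \<le> norm h * M"
        using est by (intro always_eventually) (auto simp: M_def divide_simps power2_eq_square mult_ac)
    qed
  qed
  then show "IF B differentiable (at y)" by (auto simp: differentiable_def)
  have "D b (IF B) y = - \<i> * L b" by (rule D_eq[OF d])
  also have "\<dots> = IF (\<lambda>\<eta>. complex_of_real (- (\<eta> \<bullet> b)) * B \<eta>) y"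
    unfolding L_def IF_def integral_mult_right_zero[symmetric]
    by (intro Bochner_Integration.integral_cong) (auto simp: inner_commute algebra_simps)
  finally show "D b (IF B) y = IF (\<lambda>\<eta>. complex_of_real (- (\<eta> \<bullet> b)) * B \<eta>) y" .
qed

lemma rapid_minus_inner: "rapid B \<Longrightarrow> rapid (\<lambda>\<eta>. complex_of_real (- (\<eta> \<bullet> b)) * B \<eta>)"
  using rapid_inner_mult[of B "-1" b] by simp

lemma smooth_on_IF: "rapid B \<Longrightarrow> smooth_on UNIV (IF B)"
proof -
  have "ck n UNIV (IF B)" if "rapid B" for n
    using that
  proof (induction n arbitrary: B)
    case (Suc n)
    have "D b (IF B) = IF (\<lambda>\<eta>. complex_of_real (- (\<eta> \<bullet> b)) * B \<eta>)" for b
      by (rule ext) (rule IF_derivative(2)[OF Suc.prems])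
    then show ?case
      using Suc.IH[OF rapid_minus_inner[OF Suc.prems]] IF_derivative(1)[OF Suc.prems] by simp
  qed simp
  then show "rapid B \<Longrightarrow> smooth_on UNIV (IF B)" by (simp add: smooth_on_ck)
qed

lemma D_IF: "rapid B \<Longrightarrow> D b (IF B) = IF (\<lambda>\<eta>. complex_of_real (- (\<eta> \<bullet> b)) * B \<eta>)"
  by (rule ext) (rule IF_derivative(2))

section \<open>Functions of two variables and their slices\<close>

lemma smooth_on_ex_joint:
  fixes f g :: "'a::euclidean_space \<Rightarrow> 'b::euclidean_space"
  assumes "open U" "bounded_linear f" "bounded_linear g"
  shows "smooth_on U (\<lambda>x. ex (f x) (y + g x))"
  unfolding ex_def
  using smooth_on_inner[OF assms(1,3,2), of y 0] assms(1) by (intro smooth_on_exp smooth_on_cmult) auto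

lemma smooth_on_fst:
  fixes f :: "'a::euclidean_space \<Rightarrow> complex"
  assumes "smooth_on UNIV f"
  shows "smooth_on UNIV (\<lambda>z :: 'a \<times> 'b::euclidean_space. f (fst z))"
proof -
  have "fst b \<in> insert 0 Basis" if "b \<in> Basis" for b :: "'a \<times> 'b"
    using that by (auto simp: Basis_prod_def)
  from smooth_on_compose_affine[OF open_UNIV open_UNIV bounded_linear_fst this assms, of 0]
  show ?thesis by simp
qed

lemma smooth_on_snd:
  fixes f :: "'b::euclidean_space \<Rightarrow> complex"
  assumes "smooth_on UNIV f"
  shows "smooth_on UNIV (\<lambda>z :: 'a::euclidean_space \<times> 'b. f (snd z))"
proof -
  have "snd b \<in> insert 0 Basis" if "b \<in> Basis" for b :: "'a \<times> 'b"
    using that by (auto simp: Basis_prod_def)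
  from smooth_on_compose_affine[OF open_UNIV open_UNIV bounded_linear_snd this assms, of 0]
  show ?thesis by simp
qed

lemma bounded_linear_Pair_0:
  "bounded_linear (\<lambda>x::'a::real_normed_vector. (x, 0::'b::real_normed_vector))"
  "bounded_linear (\<lambda>y::'b. (0::'a, y))"
  by (intro bounded_linear_Pair bounded_linear_ident bounded_linear_zero)+

lemma smooth_on_slice_fst:
  fixes p :: "'a::euclidean_space \<times> 'b::euclidean_space \<Rightarrow> complex"
  assumes "open V" "smooth_on V p" "open U" "\<And>x. x \<in> U \<Longrightarrow> (x, y) \<in> V"
  shows "smooth_on U (\<lambda>x. p (x, y))"
  using smooth_on_compose_affine[OF assms(3,1) bounded_linear_Pair_0(1) _ assms(2), where c="(0, y)"] assms(4)
  by simp

lemma D_slice_fst: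
  fixes p :: "'a::euclidean_space \<times> 'b::euclidean_space \<Rightarrow> complex"
  assumes "p differentiable (at (x, y))"
  shows "D b (\<lambda>x. p (x, y)) x = D (b, 0) p (x, y)"
proof -
  have "((\<lambda>x. (x, y)) has_derivative (\<lambda>h. (h, 0))) (at x)"
    by (auto intro!: has_derivative_Pair derivative_intros)
  from has_derivative_compose[OF this D_has_derivative[OF assms]]
  show ?thesis by (subst D_eq) auto
qed

lemma D_slice_snd:
  fixes p :: "'a::euclidean_space \<times> 'b::euclidean_space \<Rightarrow> complex"
  assumes "p differentiable (at (x, y))"
  shows "D b (\<lambda>y. p (x, y)) y = D (0, b) p (x, y)"
proof -
  have "((\<lambda>y. (x, y)) has_derivative (\<lambda>h. (0, h))) (at y)"
    by (auto intro!: has_derivative_Pair derivative_intros)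
  from has_derivative_compose[OF this D_has_derivative[OF assms]]
  show ?thesis by (subst D_eq) auto
qed

lemma iterD_slice_fst:
  fixes p :: "'a::euclidean_space \<times> 'b::euclidean_space \<Rightarrow> complex"
  assumes "open V" "smooth_on V p" "\<alpha> \<in> lists Basis" "(x, y) \<in> V"
  shows "iterD \<alpha> (\<lambda>x. p (x, y)) x = iterD (map (\<lambda>b. (b, 0)) \<alpha>) p (x, y)"
  using assms(3,4)
proof (induction \<alpha> arbitrary: x)
  case (Cons b \<alpha>)
  have "open ((\<lambda>x. (x, y)) -` V)"
    by (intro open_vimage assms(1) continuous_intros)
  then have "iterD (b # \<alpha>) (\<lambda>x. p (x, y)) x = D b (\<lambda>x. iterD (map (\<lambda>b. (b, 0)) \<alpha>) p (x, y)) x"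
    unfolding iterD_Cons by (rule D_cong_open) (use Cons in auto)
  also have "\<dots> = D (b, 0) (iterD (map (\<lambda>b. (b, 0)) \<alpha>) p) (x, y)"
    by (rule D_slice_fst, rule smooth_on_differentiable[OF smooth_on_iterD[OF assms(2)]])
       (use Cons in auto)
  finally show ?case by (simp add: iterD_Cons)
qed simp

section \<open>Decay of Fourier integrals and the inversion formula\<close>

lemma Fh_D:
  assumes g: "g \<in> test_functions" and b: "b \<in> Basis"
  shows "Fh (D b g) z = - complex_of_real (b \<bullet> z) * Fh g z"
proof -
  have t: "(\<lambda>x. ex z x * h x) \<in> test_functions" if "h \<in> test_functions" for h
    using test_functions_mult'[OF smooth_on_ex[OF open_UNIV] that] .
  have D: "D b (\<lambda>x. ex z x * g x) = (\<lambda>x. complex_of_real (b \<bullet> z) * (ex z x * g x) + ex z x * D b g x)"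
    using smooth_on_differentiable[OF test_functions_smooth[OF g]]
      smooth_on_differentiable[OF smooth_on_ex[OF open_UNIV, of z]]
    by (intro ext, subst D_mult) (auto simp: D_ex)
  have i: "integrable lborel (\<lambda>x. ex z x * g x)" "integrable lborel (\<lambda>x. ex z x * D b g x)"
    using t[OF g] t[OF test_functions_D[OF g b]] integrable_test by blast+
  have "(LINT x|lborel. D b (\<lambda>x. ex z x * g x) x) = 0"
    using t[OF g] test_functions_D[OF t[OF g] b]
    by (intro integral_D_eq_0)
       (auto simp: smooth_on_differentiable[OF test_functions_smooth] integrable_test test_functions_continuous)
  then have "complex_of_real (b \<bullet> z) * Fh g z + Fh (D b g) z = 0"
    using i by (simp add: D Fh_def)
  then show ?thesis by (simp add: eq_neg_iff_add_eq_0 add.commute)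
qed

text \<open>Integration by parts trades each power of the weight for one derivative. The constant
  depends on \<open>K\<close> and \<open>N\<close> only: later the function \<open>g\<close> varies
  with one or two frequencies, and the bound must be uniform in them.\<close>

lemma Fh_bound:
  fixes K :: "'a::euclidean_space set"
  assumes "compact K"
  obtains C where "0 \<le> C" "\<And>g M z. smooth_on UNIV g \<Longrightarrow> (\<And>x. x \<notin> K \<Longrightarrow> g x = 0) \<Longrightarrow>
    (\<And>x. x \<in> K \<Longrightarrow> dbound N g x M) \<Longrightarrow> cmod (Fh g z) \<le> C * M * japanese z powr (- real N)"
proof -
  let ?V = "measure lborel K" and ?n = "1 + real DIM('a)"
  have K: "emeasure lborel K < \<infinity>" using emeasure_compact_finite[OF assms] by simp
  have main: "japanese z ^ N * cmod (Fh g z) \<le> ?n ^ N * ?V * M"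
    if "smooth_on UNIV g" "\<And>x. x \<notin> K \<Longrightarrow> g x = 0" "\<And>x. x \<in> K \<Longrightarrow> dbound N g x M" for g M z
    using that
  proof (induction N arbitrary: g)
    case 0
    have "cmod (Fh g z) \<le> (LINT x|lborel. M * indicator K x)"
      unfolding Fh_def
    proof (rule norm_integral_le)
      show "integrable lborel (\<lambda>x. M * indicator K x :: real)"
        using assms K by (intro integrable_mult_right integrable_real_indicator) (auto simp: borel_compact)
    qed (use 0 in \<open>auto simp: norm_mult indicator_def\<close>)
    then show ?case by (simp add: mult.commute)
  next
    case (Suc N)
    have t: "g \<in> test_functions" by (rule test_functionsI[OF Suc.prems(1) assms Suc.prems(2)])
    have m: "dbound N g x M" if "x \<in> K" for x
      by (rule dbound_mono[OF Suc.prems(3)[OF that]]) auto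
    \<comment> \<open>Each coordinate of z is absorbed into a derivative by \<open>Fh_D\<close>, and
      the 1 leaves \<open>g\<close> as it is; hence the factor 1 + n per order.\<close>
    have z: "japanese z \<le> 1 + (\<Sum>b\<in>Basis. \<bar>b \<bullet> z\<bar>)"
      using japanese_le[of z] norm_le_l1[of z] by (simp add: inner_commute)
    have I: "japanese z ^ N * cmod (Fh (D b g) z) \<le> ?n ^ N * ?V * M" if b: "b \<in> Basis" for b
    proof (rule Suc.IH)
      show "D b g x = 0" if "x \<notin> K" for x
        using D_cong_open[of "- K" x g "\<lambda>_. 0"] that Suc.prems(2) compact_imp_closed[OF assms]
        by (auto simp: open_Compl)
    qed (use Suc.prems b in \<open>auto simp: smooth_on_D dbound_Suc\<close>)
    have "japanese z ^ Suc N * cmod (Fh g z) \<le> (1 + (\<Sum>b\<in>Basis. \<bar>b \<bullet> z\<bar>)) * (japanese z ^ N * cmod (Fh g z))"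
      using mult_right_mono[OF z, of "japanese z ^ N * cmod (Fh g z)"] by (simp add: mult.assoc)
    also have "\<dots> = japanese z ^ N * cmod (Fh g z) + (\<Sum>b\<in>Basis. japanese z ^ N * cmod (Fh (D b g) z))"
      using t by (simp add: Fh_D norm_mult algebra_simps sum_distrib_left)
    also have "\<dots> \<le> ?n ^ N * ?V * M + (\<Sum>b\<in>(Basis::'a set). ?n ^ N * ?V * M)"
      using Suc.IH[OF Suc.prems(1,2) m] I by (intro add_mono sum_mono) auto
    also have "\<dots> = ?n ^ Suc N * ?V * M" by (simp add: algebra_simps)
    finally show ?case .
  qed
  show ?thesis
  proof
    show "0 \<le> ?n ^ N * ?V" by simp
    fix g :: "'a \<Rightarrow> complex" and M z
    assume "smooth_on UNIV g" "\<And>x. x \<notin> K \<Longrightarrow> g x = 0" "\<And>x. x \<in> K \<Longrightarrow> dbound N g x M"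
    from main[OF this]
    show "cmod (Fh g z) \<le> ?n ^ N * ?V * M * japanese z powr (- real N)"
      by (simp add: powr_minus powr_realpow field_simps)
  qed
qed

lemma smooth_on_Fh_param:
  fixes p :: "'a::euclidean_space \<times> 'a \<Rightarrow> complex"
  assumes "smooth_on UNIV p" "\<psi> \<in> test_functions"
  shows "smooth_on UNIV (\<lambda>\<eta>. Fh (\<lambda>x. p (x, \<eta>) * \<psi> x) \<eta>)"
proof -
  have "smooth_on UNIV (\<lambda>z. ex (snd z) (0 + fst z) * (p z * \<psi> (fst z)))"
    by (intro smooth_on_mult smooth_on_ex_joint smooth_on_fst bounded_linear_fst bounded_linear_snd
        open_UNIV assms test_functions_smooth)
  from smooth_param_integral(1)[OF this test_functions_compact[OF assms(2)]]
  show ?thesis by (simp add: Fh_def fun_supp_zero)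
qed

lemma smooth_on_Fh: "\<psi> \<in> test_functions \<Longrightarrow> smooth_on UNIV (Fh \<psi>)"
  using smooth_on_Fh_param[OF smooth_on_const[of _ 1]] by simp

lemma smooth_on_measurable [measurable_dest]: "smooth_on UNIV f \<Longrightarrow> f \<in> borel_measurable borel"
  by (intro borel_measurable_continuous_onI smooth_on_continuous_on)

lemma rapid_Fh:
  assumes "\<psi> \<in> test_functions"
  shows "rapid (Fh \<psi>)"
  unfolding rapid_def
proof (intro conjI allI)
  show "Fh \<psi> \<in> borel_measurable borel"
    by (rule smooth_on_measurable[OF smooth_on_Fh[OF assms]])
  fix s :: real
  obtain N :: nat where N: "- s \<le> real N" using real_arch_simple by blast
  obtain C where C: "0 \<le> C" "\<And>g M z. smooth_on UNIV g \<Longrightarrow> (\<And>x. x \<notin> fun_supp \<psi> \<Longrightarrow> g x = 0) \<Longrightarrow>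
    (\<And>x. x \<in> fun_supp \<psi> \<Longrightarrow> dbound N g x M) \<Longrightarrow> cmod (Fh g z) \<le> C * M * japanese z powr (- real N)"
    using Fh_bound[OF test_functions_compact[OF assms]] by blast
  obtain M where M: "0 \<le> M" "\<And>x. x \<in> fun_supp \<psi> \<Longrightarrow> dbound N \<psi> x M"
    using smooth_on_dbound_compact[OF test_functions_smooth[OF assms] test_functions_compact[OF assms]]
    by blast
  have "cmod (Fh \<psi> z) \<le> C * M * japanese z powr s" for z
  proof -
    have "cmod (Fh \<psi> z) \<le> C * M * japanese z powr (- real N)"
      by (rule C(2)) (use assms M in \<open>auto simp: fun_supp_zero test_functions_smooth\<close>)
    also have "\<dots> \<le> C * M * japanese z powr s"
      using C M N by (intro mult_left_mono japanese_powr_mono) auto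
    finally show ?thesis .
  qed
  then show "\<exists>C. \<forall>z. cmod (Fh \<psi> z) \<le> C * japanese z powr s" by blast
qed

lemma test_functions_bounded:
  assumes "\<phi> \<in> test_functions" obtains M where "0 \<le> M" "\<And>x. cmod (\<phi> x) \<le> M"
proof -
  obtain M where M: "0 \<le> M" "\<And>x. x \<in> fun_supp \<phi> \<Longrightarrow> dbound 0 \<phi> x M"
    using smooth_on_dbound_compact[OF test_functions_smooth[OF assms] test_functions_compact[OF assms]]
    by blast
  have "cmod (\<phi> x) \<le> M" for x using M fun_supp_zero[of x \<phi>] by (cases "x \<in> fun_supp \<phi>") auto
  with M show ?thesis using that by blast
qed

lemma integrable_pair_mult:
  fixes f :: "'a::euclidean_space \<Rightarrow> complex" and g :: "'b::euclidean_space \<Rightarrow> complex"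
  assumes "integrable lborel f" "integrable lborel g"
  shows "integrable (lborel \<Otimes>\<^sub>M lborel) (\<lambda>(x, y). f x * g y)"
proof (rule lborel_pair.Fubini_integrable)
  have [measurable]: "f \<in> borel_measurable borel" "g \<in> borel_measurable borel" using assms by auto
  show "(\<lambda>(x, y). f x * g y) \<in> borel_measurable (lborel \<Otimes>\<^sub>M lborel)" by measurable
  show "integrable lborel (\<lambda>x. LINT y|lborel. cmod (case (x, y) of (x, y) \<Rightarrow> f x * g y))"
    using assms by (simp add: norm_mult integrable_norm)
qed (use assms in auto)

lemma integrable_pair_ex:
  fixes f g :: "'a::euclidean_space \<Rightarrow> complex"
  assumes "integrable lborel f" "integrable lborel g"
  shows "integrable (lborel \<Otimes>\<^sub>M lborel) (\<lambda>(y, \<eta>). f y * (ex (- \<eta>) y * g \<eta>))"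
proof (rule Bochner_Integration.integrable_bound[OF integrable_pair_mult[OF assms]])
  have [measurable]: "f \<in> borel_measurable borel" "g \<in> borel_measurable borel" using assms by auto
  have "(\<lambda>z. ex (- snd z) (fst z)) \<in> borel_measurable (borel :: ('a \<times> 'a) measure)"
    by (intro borel_measurable_continuous_onI continuous_intros)
  then have [measurable]: "(\<lambda>z. ex (- snd z) (fst z)) \<in> borel_measurable (lborel \<Otimes>\<^sub>M lborel :: ('a \<times> 'a) measure)"
    by (simp add: lborel_prod)
  show "(\<lambda>(y, \<eta>). f y * (ex (- \<eta>) y * g \<eta>)) \<in> borel_measurable (lborel \<Otimes>\<^sub>M lborel)"
    unfolding split_beta by measurable
qed (auto simp: norm_mult)

lemma IF_Fubini:
  fixes f B :: "'a::euclidean_space \<Rightarrow> complex"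
  assumes "integrable lborel f" "integrable lborel B"
  shows "(LINT y|lborel. f y * IF B y) = (LINT \<eta>|lborel. B \<eta> * Fh f (- \<eta>))"
proof -
  have "(LINT y|lborel. f y * IF B y) = (LINT y|lborel. LINT \<eta>|lborel. f y * (ex (- \<eta>) y * B \<eta>))"
    by (simp add: IF_def)
  also have "\<dots> = (LINT \<eta>|lborel. LINT y|lborel. f y * (ex (- \<eta>) y * B \<eta>))"
    by (rule lborel_pair.Fubini_integral[OF integrable_pair_ex[OF assms], symmetric])
  also have "\<dots> = (LINT \<eta>|lborel. LINT y|lborel. B \<eta> * (ex (- \<eta>) y * f y))"
    by (simp add: mult_ac)
  finally show ?thesis by (simp add: Fh_def)
qed

text \<open>The multiplication formula of the Fourier transform, with the dilation moved from one
  factor to the other: in the double integral of the character, the scaling can be attached to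
  either variable.\<close>

lemma Fh_swap:
  assumes "\<phi> \<in> test_functions" "\<psi> \<in> test_functions" "0 < \<epsilon>"
  shows "(LINT \<eta>|lborel. Fh \<phi> \<eta> * \<psi> (\<epsilon> *\<^sub>R \<eta>)) = (LINT x|lborel. \<phi> (\<epsilon> *\<^sub>R x) * Fh \<psi> x)"
proof -
  have [measurable]: "\<phi> \<in> borel_measurable borel" "\<psi> \<in> borel_measurable borel"
    "Fh \<phi> \<in> borel_measurable borel" "Fh \<psi> \<in> borel_measurable borel"
    using assms by (auto intro!: smooth_on_measurable smooth_on_Fh simp: test_functions_smooth)
  let ?J = "\<bar>inverse \<epsilon>\<bar> ^ DIM('a)"
  have "(LINT \<eta>|lborel. Fh \<phi> \<eta> * \<psi> (\<epsilon> *\<^sub>R \<eta>)) = ?J *\<^sub>R (LINT \<eta>|lborel. Fh \<phi> (inverse \<epsilon> *\<^sub>R \<eta>) * \<psi> \<eta>)"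
    using integral_affine(1)[of "\<lambda>\<eta>. Fh \<phi> \<eta> * \<psi> (\<epsilon> *\<^sub>R \<eta>)" "inverse \<epsilon>" 0] assms by simp
  also have "(LINT \<eta>|lborel. Fh \<phi> (inverse \<epsilon> *\<^sub>R \<eta>) * \<psi> \<eta>)
      = (LINT \<eta>|lborel. LINT x|lborel. ex (inverse \<epsilon> *\<^sub>R \<eta>) x * \<phi> x * \<psi> \<eta>)"
    by (simp add: Fh_def)
  also have "\<dots> = (LINT x|lborel. LINT \<eta>|lborel. ex (inverse \<epsilon> *\<^sub>R \<eta>) x * \<phi> x * \<psi> \<eta>)"
  proof (rule lborel_pair.Fubini_integral)
    show "integrable (lborel \<Otimes>\<^sub>M lborel) (\<lambda>(x, \<eta>). ex (inverse \<epsilon> *\<^sub>R \<eta>) x * \<phi> x * \<psi> \<eta>)"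
      unfolding lborel_prod
    proof (rule integrable_compact_supp[of "fun_supp \<phi> \<times> fun_supp \<psi>"])
      have "continuous_on S (\<lambda>z. \<phi> (fst z))" "continuous_on S (\<lambda>z. \<psi> (snd z))" for S :: "('a \<times> 'a) set"
        using continuous_on_subset[OF smooth_on_continuous_on[OF smooth_on_fst[OF test_functions_smooth[OF assms(1)]]]]
          continuous_on_subset[OF smooth_on_continuous_on[OF smooth_on_snd[OF test_functions_smooth[OF assms(2)]]]]
        by blast+
      then show "continuous_on (fun_supp \<phi> \<times> fun_supp \<psi>) (\<lambda>(x, \<eta>). ex (inverse \<epsilon> *\<^sub>R \<eta>) x * \<phi> x * \<psi> \<eta>)"
        unfolding split_beta by (intro continuous_intros)
          show "compact (fun_supp \<phi> \<times> fun_supp \<psi>)"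
        by (intro compact_Times test_functions_compact assms)
      show "(case z of (x, \<eta>) \<Rightarrow> ex (inverse \<epsilon> *\<^sub>R \<eta>) x * \<phi> x * \<psi> \<eta>) = 0"
        if "z \<notin> fun_supp \<phi> \<times> fun_supp \<psi>" for z
        using that fun_supp_zero[of "fst z" \<phi>] fun_supp_zero[of "snd z" \<psi>] by (cases z) auto
    qed
  qed
  also have "\<dots> = (LINT x|lborel. LINT \<eta>|lborel. \<phi> x * (ex (inverse \<epsilon> *\<^sub>R x) \<eta> * \<psi> \<eta>))"
    by (simp add: ex_def inner_commute mult_ac)
  also have "\<dots> = (LINT x|lborel. \<phi> x * Fh \<psi> (inverse \<epsilon> *\<^sub>R x))"
    by (simp add: Fh_def)
  also have "?J *\<^sub>R \<dots> = (LINT x|lborel. \<phi> (\<epsilon> *\<^sub>R x) * Fh \<psi> x)"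
    using integral_affine(1)[of "\<lambda>x. \<phi> (\<epsilon> *\<^sub>R x) * Fh \<psi> x" "inverse \<epsilon>" 0] assms by simp
  finally show ?thesis .
qed

text \<open>A dilated test function tends pointwise to its value at 0 and stays bounded; the
  countable family of dilations fits dominated convergence.\<close>

lemma scaled_integral_limit:
  fixes \<phi> :: "'a::euclidean_space \<Rightarrow> complex"
  assumes "\<phi> \<in> test_functions" "integrable lborel B" "f = (\<lambda>k. inverse (real (Suc k)))"
  shows "(\<lambda>k. LINT x|lborel. \<phi> (f k *\<^sub>R x) * B x) \<longlonglongrightarrow> \<phi> 0 * (LINT x|lborel. B x)"
proof -
  obtain M where M: "0 \<le> M" "\<And>x. cmod (\<phi> x) \<le> M" by (rule test_functions_bounded[OF assms(1)]) blast
  have [measurable]: "\<phi> \<in> borel_measurable borel" "B \<in> borel_measurable borel"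
    using assms by (auto intro!: smooth_on_measurable simp: test_functions_smooth)
  have "(\<lambda>k. LINT x|lborel. \<phi> (f k *\<^sub>R x) * B x) \<longlonglongrightarrow> (LINT x|lborel. \<phi> 0 * B x)"
  proof (rule integral_dominated_convergence[where w="\<lambda>x. M * cmod (B x)"])
    show "AE x in lborel. (\<lambda>k. \<phi> (f k *\<^sub>R x) * B x) \<longlonglongrightarrow> \<phi> 0 * B x"
    proof (intro AE_I2 tendsto_intros)
      fix x :: 'a
      have "(\<lambda>k. f k *\<^sub>R x) \<longlonglongrightarrow> 0 *\<^sub>R x"
        unfolding assms(3) by (rule tendsto_scaleR[OF LIMSEQ_inverse_real_of_nat tendsto_const])
      moreover have "isCont \<phi> 0"
        using test_functions_continuous[OF assms(1), of UNIV] by (simp add: continuous_on_eq_continuous_at)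
      ultimately show "(\<lambda>k. \<phi> (f k *\<^sub>R x)) \<longlonglongrightarrow> \<phi> 0"
        using isCont_tendsto_compose by fastforce
    qed
  qed (use assms M in \<open>auto simp: norm_mult intro!: AE_I2 mult_right_mono\<close>)
  then show ?thesis by simp
qed

text \<open>Letting the dilation tend to 0 in \<open>Fh_swap\<close> shows that the integral of
  \<open>Fh \<phi>\<close> is proportional to \<open>\<phi> 0\<close> with a factor that is the same
  for all \<phi>.\<close>

lemma Fourier_inversion_at_0:
  fixes \<phi> \<psi> :: "'a::euclidean_space \<Rightarrow> complex"
  assumes "\<phi> \<in> test_functions" "\<psi> \<in> test_functions"
  shows "\<psi> 0 * (LINT \<eta>|lborel. Fh \<phi> \<eta>) = \<phi> 0 * (LINT \<eta>|lborel. Fh \<psi> \<eta>)"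
proof -
  define f where "f = (\<lambda>k. inverse (real (Suc k)))"
  have "(\<lambda>k. LINT x|lborel. \<psi> (f k *\<^sub>R x) * Fh \<phi> x) \<longlonglongrightarrow> \<psi> 0 * (LINT x|lborel. Fh \<phi> x)"
    "(\<lambda>k. LINT x|lborel. \<phi> (f k *\<^sub>R x) * Fh \<psi> x) \<longlonglongrightarrow> \<phi> 0 * (LINT x|lborel. Fh \<psi> x)"
    by (intro scaled_integral_limit assms rapid_integrable rapid_Fh f_def)+
  moreover have "(LINT x|lborel. \<psi> (f k *\<^sub>R x) * Fh \<phi> x) = (LINT x|lborel. \<phi> (f k *\<^sub>R x) * Fh \<psi> x)" for k
    using Fh_swap[OF assms, of "f k"] by (simp add: f_def mult.commute)
  ultimately show ?thesis using LIMSEQ_unique by simp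
qed

lemma smooth_on_translate: "smooth_on UNIV f \<Longrightarrow> smooth_on UNIV (\<lambda>x. f (y + x))"
  using smooth_on_compose_affine[OF open_UNIV open_UNIV bounded_linear_ident] by auto

text \<open>The value of \<open>c\<close> is irrelevant here. Comparison with one fixed \<open>g\<close> gives the existence, and
  \<open>c = 0\<close> would contradict \<open>\<integral> g IF (Fh g) = \<integral> |Fh g|\<^sup>2 > 0\<close>.\<close>

lemma Fourier_inversion:
  obtains c where "c \<noteq> 0" "\<And>(\<phi> :: 'a::euclidean_space \<Rightarrow> complex) y. \<phi> \<in> test_functions \<Longrightarrow> IF (Fh \<phi>) y = c * \<phi> y"
proof -
  obtain \<beta> :: "'a \<Rightarrow> real" where \<beta>: "smooth_on UNIV (\<lambda>x. complex_of_real (\<beta> x))"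
    "\<And>x. x \<in> cball 0 1 \<Longrightarrow> \<beta> x = 1" "\<And>x. 0 < \<beta> x \<longleftrightarrow> x \<in> ball 0 2" "\<And>x. 0 \<le> \<beta> x" "\<And>x. \<beta> x \<le> 1"
  proof -
    have "0 \<le> (1::real)" "(1::real) < 2" by auto
    from bump_exists[OF this, of "0::'a"] that show ?thesis by blast
  qed
  define g where "g x = complex_of_real (\<beta> x)" for x
  have \<beta>0: "\<beta> x = 0" if "x \<notin> cball 0 2" for x
    using \<beta>(3)[of x] \<beta>(4)[of x] that by auto
  have g: "g \<in> test_functions" unfolding g_def
    by (rule test_functionsI[where K="cball 0 2"]) (use \<beta> \<beta>0 in auto)
  have g1: "g 0 = 1" using \<beta>(2)[of 0] by (simp add: g_def)
  define c where "c = (LINT \<eta>|lborel. Fh g \<eta>)"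
  have inv: "IF (Fh \<phi>) y = c * \<phi> y" if \<phi>: "\<phi> \<in> test_functions" for \<phi> :: "'a \<Rightarrow> complex" and y
  proof -
    have [measurable]: "\<phi> \<in> borel_measurable borel"
      using \<phi> by (auto intro!: smooth_on_measurable simp: test_functions_smooth)
    \<comment> \<open>Translation multiplies \<open>Fh\<close> by a character and so reduces
      inversion at y to inversion at 0.\<close>
    have "(\<lambda>x. \<phi> (y + x)) \<in> test_functions"
    proof (rule test_functionsI)
      show "compact ((\<lambda>x. x - y) ` fun_supp \<phi>)"
        by (intro compact_continuous_image continuous_intros test_functions_compact \<phi>)
      show "\<phi> (y + x) = 0" if "x \<notin> (\<lambda>x. x - y) ` fun_supp \<phi>" for x
        using that by (intro fun_supp_zero) (auto simp: image_iff algebra_simps)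
    qed (intro smooth_on_translate test_functions_smooth \<phi>)
    from Fourier_inversion_at_0[OF this g]
    have "(LINT \<eta>|lborel. Fh (\<lambda>x. \<phi> (y + x)) \<eta>) = \<phi> y * c" by (simp add: g1 c_def)
    moreover have "Fh (\<lambda>x. \<phi> (y + x)) \<eta> = ex (- \<eta>) y * Fh \<phi> \<eta>" for \<eta>
    proof -
      have "Fh \<phi> \<eta> = (LINT x|lborel. ex \<eta> (x + y) * \<phi> (x + y))"
        unfolding Fh_def by (rule integral_translate(1)[symmetric]) auto
      also have "\<dots> = ex \<eta> y * Fh (\<lambda>x. \<phi> (y + x)) \<eta>"
        unfolding Fh_def integral_mult_right_zero[symmetric]
        by (simp add: ex_add(2) add.commute mult_ac)
      finally show ?thesis by (simp add: mult.assoc[symmetric] ex_cancel)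
    qed
    ultimately show ?thesis by (simp add: IF_def mult.commute)
  qed
  moreover have "c \<noteq> 0"
  proof
    assume "c = 0"
    then have "0 = (LINT y|lborel. g y * IF (Fh g) y)" using inv[OF g] by simp
    also have "\<dots> = (LINT \<eta>|lborel. Fh g \<eta> * Fh g (- \<eta>))"
      by (intro IF_Fubini integrable_test g rapid_integrable rapid_Fh)
    also have "\<dots> = (LINT \<eta>|lborel. complex_of_real ((cmod (Fh g \<eta>))\<^sup>2))"
    proof (intro Bochner_Integration.integral_cong refl)
      fix \<eta>
      \<comment> \<open>As \<open>g\<close> is real-valued, reflecting the frequency is
        conjugation.\<close>
      have "Fh g (- \<eta>) = cnj (Fh g \<eta>)"
        using Bochner_Integration.integral_cnj[of lborel "\<lambda>x. ex \<eta> x * g x"] by (simp add: Fh_def cnj_ex g_def)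
      then show "Fh g \<eta> * Fh g (- \<eta>) = complex_of_real ((cmod (Fh g \<eta>))\<^sup>2)"
        by (simp only: complex_norm_square)
    qed
    finally have "0 = (LINT \<eta>|lborel. complex_of_real ((cmod (Fh g \<eta>))\<^sup>2))" .
    then have z: "(LINT \<eta>|lborel. (cmod (Fh g \<eta>))\<^sup>2) = 0"
      by (metis integral_complex_of_real of_real_eq_0_iff)
    have "0 < (LINT x|lborel. \<beta> x)"
    proof (rule integral_pos[of _ 0 1 1])
      show "integrable lborel \<beta>" using integrable_Re[OF integrable_test[OF g]] by (simp add: g_def)
    qed (use \<beta> in auto)
    moreover have "Fh g 0 = complex_of_real (LINT x|lborel. \<beta> x)" by (simp add: Fh_def g_def)
    ultimately have p: "0 < (cmod (Fh g 0))\<^sup>2" by simp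
    let ?h = "\<lambda>\<eta>. (cmod (Fh g \<eta>))\<^sup>2"
    have hc: "continuous_on UNIV ?h"
      by (intro continuous_intros smooth_on_continuous_on smooth_on_Fh g)
    have "open (?h -` {?h 0 / 2<..})" by (intro open_vimage hc) simp
    moreover have "0 \<in> ?h -` {?h 0 / 2<..}" using p by simp
    ultimately obtain r where r: "0 < r" "ball 0 r \<subseteq> ?h -` {?h 0 / 2<..}"
      by (meson open_contains_ball)
    have "0 < (LINT \<eta>|lborel. ?h \<eta>)"
    proof (rule integral_pos[of _ 0 r "?h 0 / 2"])
      have "rapid (\<lambda>\<eta>. Fh g (- \<eta>) * Fh g \<eta>)"
      proof -
        obtain C where C: "\<And>\<eta>. cmod (Fh g \<eta>) \<le> C * japanese \<eta> powr 0" by (rule rapid_bound[OF rapid_Fh[OF g]]) blast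
        have [measurable]: "Fh g \<in> borel_measurable borel" by (rule smooth_on_measurable[OF smooth_on_Fh[OF g]])
        show ?thesis
          by (rule rapid_mult_bounded[OF rapid_Fh[OF g], of _ C]) (use C in auto)
      qed
      from integrable_norm[OF rapid_integrable[OF this]]
      have "integrable lborel (\<lambda>\<eta>. cmod (Fh g (- \<eta>) * Fh g \<eta>))" .
      moreover have "Fh g (- \<eta>) = cnj (Fh g \<eta>)" for \<eta>
        using Bochner_Integration.integral_cnj[of lborel "\<lambda>x. ex \<eta> x * g x"] by (simp add: Fh_def cnj_ex g_def)
      ultimately show "integrable lborel ?h" by (simp add: norm_mult power2_eq_square)
    qed (use r p in auto)
    with z show False by simp
  qed
  ultimately show ?thesis using that by blast
qed

section \<open>Distributions\<close>

lemma dist_add: "v \<in> distributions \<Longrightarrow> \<phi> \<in> test_functions \<Longrightarrow> \<psi> \<in> test_functions \<Longrightarrow>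
    v (\<lambda>x. \<phi> x + \<psi> x) = v \<phi> + v \<psi>"
  by (simp add: distributions_def)

lemma dist_cmult: "v \<in> distributions \<Longrightarrow> \<phi> \<in> test_functions \<Longrightarrow> v (\<lambda>x. c * \<phi> x) = c * v \<phi>"
  by (simp add: distributions_def)

lemma dist_0: "v \<in> distributions \<Longrightarrow> v (\<lambda>x. 0) = 0"
  using dist_cmult[of v "\<lambda>x. 0" 0] by simp

lemma dist_diff: "v \<in> distributions \<Longrightarrow> \<phi> \<in> test_functions \<Longrightarrow> \<psi> \<in> test_functions \<Longrightarrow>
    v (\<lambda>x. \<phi> x - \<psi> x) = v \<phi> - v \<psi>"
  using dist_add[of v \<phi> "\<lambda>x. -1 * \<psi> x"] dist_cmult[of v \<psi> "-1"] test_functions_cmult[of \<psi> "-1"]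
  by simp

lemma test_functions_sum:
  "(\<And>i. i \<in> I \<Longrightarrow> \<phi> i \<in> test_functions) \<Longrightarrow> (\<lambda>x. \<Sum>i\<in>I. \<phi> i x) \<in> test_functions"
  by (induction I rule: infinite_finite_induct) (auto intro!: test_functions_add)

lemma dist_sum:
  assumes "v \<in> distributions" "\<And>i. i \<in> I \<Longrightarrow> \<phi> i \<in> test_functions"
  shows "v (\<lambda>x. \<Sum>i\<in>I. \<phi> i x) = (\<Sum>i\<in>I. v (\<phi> i))"
  using assms(2)
proof (induction I rule: infinite_finite_induct)
  case (insert i I)
  have "v (\<lambda>x. \<phi> i x + (\<Sum>i\<in>I. \<phi> i x)) = v (\<phi> i) + v (\<lambda>x. \<Sum>i\<in>I. \<phi> i x)"
    by (rule dist_add[OF assms(1)]) (use insert.prems in \<open>auto intro: test_functions_sum\<close>)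
  then show ?case using insert by simp
qed (simp_all add: dist_0[OF assms(1)])

lemma finite_multi_indices: "finite {\<alpha> \<in> lists (Basis :: 'a::euclidean_space set). length \<alpha> \<le> k}"
  using finite_lists_length_le[of "Basis :: 'a set" k] by (simp add: lists_eq_set)

text \<open>Replaces the sum of suprema in the definition by a single bound \<open>M\<close> on all
  derivatives. The constant picks up the number of multi-indices, and an absolute value because the
  given constant may be negative.\<close>

lemma dist_bound:
  assumes v: "v \<in> distributions" and K: "compact K"
  obtains C k where "0 \<le> C" "\<And>\<phi> M. \<phi> \<in> test_functions \<Longrightarrow> (\<And>x. x \<notin> K \<Longrightarrow> \<phi> x = 0) \<Longrightarrow> 0 \<le> M \<Longrightarrow>
    (\<And>x. x \<in> K \<Longrightarrow> dbound k \<phi> x M) \<Longrightarrow> cmod (v \<phi>) \<le> C * M"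
proof -
  have "\<forall>K. compact K \<longrightarrow> (\<exists>C k. \<forall>\<phi>\<in>test_functions. fun_supp \<phi> \<subseteq> K \<longrightarrow>
      cmod (v \<phi>) \<le> C * (\<Sum>\<alpha>\<in>{\<alpha> \<in> lists Basis. length \<alpha> \<le> k}. SUP x. cmod (iterD \<alpha> \<phi> x)))"
    using v unfolding distributions_def by (elim CollectE conjE)
  with K obtain C k where "\<forall>\<phi>\<in>test_functions. fun_supp \<phi> \<subseteq> K \<longrightarrow>
      cmod (v \<phi>) \<le> C * (\<Sum>\<alpha>\<in>{\<alpha> \<in> lists Basis. length \<alpha> \<le> k}. SUP x. cmod (iterD \<alpha> \<phi> x))"
    by presburger
  then have C: "\<And>\<phi>. \<phi> \<in> test_functions \<Longrightarrow> fun_supp \<phi> \<subseteq> K \<Longrightarrow>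
      cmod (v \<phi>) \<le> C * (\<Sum>\<alpha>\<in>{\<alpha> \<in> lists Basis. length \<alpha> \<le> k}. SUP x. cmod (iterD \<alpha> \<phi> x))"
    by blast
  let ?A = "{\<alpha> \<in> lists (Basis :: 'a set). length \<alpha> \<le> k}"
  show ?thesis
  proof (rule that[of "\<bar>C\<bar> * real (card ?A)" k])
    fix \<phi> :: "'a \<Rightarrow> complex" and M
    assume \<phi>: "\<phi> \<in> test_functions" "\<And>x. x \<notin> K \<Longrightarrow> \<phi> x = 0" "0 \<le> M" "\<And>x. x \<in> K \<Longrightarrow> dbound k \<phi> x M"
    have db: "dbound k \<phi> x M" for x
      using dbound_zero[of "- K" \<phi> x M k] \<phi> compact_imp_closed[OF K] by (cases "x \<in> K") auto
    have sup: "fun_supp \<phi> \<subseteq> K" using fun_supp_subset_iff[OF compact_imp_closed[OF K]] \<phi> by blast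
    have bd: "bdd_above (range (\<lambda>x. cmod (iterD \<alpha> \<phi> x)))" if "\<alpha> \<in> ?A" for \<alpha>
      using dboundD[OF db] that by (auto intro!: bdd_aboveI2[where M=M])
    have S1: "0 \<le> (SUP x. cmod (iterD \<alpha> \<phi> x))" if "\<alpha> \<in> ?A" for \<alpha>
      by (rule cSUP_upper2[OF bd[OF that] UNIV_I norm_ge_zero])
    have S2: "(SUP x. cmod (iterD \<alpha> \<phi> x)) \<le> M" if "\<alpha> \<in> ?A" for \<alpha>
      by (rule cSUP_least) (use that dboundD[OF db] in auto)
    have "cmod (v \<phi>) \<le> C * (\<Sum>\<alpha>\<in>?A. SUP x. cmod (iterD \<alpha> \<phi> x))" by (rule C[OF \<phi>(1) sup])
    also have "\<dots> \<le> \<bar>C\<bar> * (\<Sum>\<alpha>\<in>?A. SUP x. cmod (iterD \<alpha> \<phi> x))"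
      using S1 by (intro mult_right_mono sum_nonneg) auto
    also have "\<dots> \<le> \<bar>C\<bar> * (\<Sum>\<alpha>\<in>?A. M)" using S2 by (intro mult_left_mono sum_mono) auto
    finally show "cmod (v \<phi>) \<le> \<bar>C\<bar> * real (card ?A) * M" by simp
  qed simp
qed

text \<open>Converse of \<open>dist_bound\<close>: the sum of suprema is itself an admissible value
  of \<open>M\<close>.\<close>

lemma distributionsI:
  assumes add: "\<And>\<phi> \<psi>. \<phi> \<in> test_functions \<Longrightarrow> \<psi> \<in> test_functions \<Longrightarrow> v (\<lambda>x. \<phi> x + \<psi> x) = v \<phi> + v \<psi>"
    and cmult: "\<And>c \<phi>. \<phi> \<in> test_functions \<Longrightarrow> v (\<lambda>x. c * \<phi> x) = c * v \<phi>"
    and bound: "\<And>K. compact K \<Longrightarrow> \<exists>C k. 0 \<le> C \<and> (\<forall>\<phi> M. \<phi> \<in> test_functions \<longrightarrow> (\<forall>x. x \<notin> K \<longrightarrow> \<phi> x = 0) \<longrightarrow>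
       (\<forall>x. dbound k \<phi> x M) \<longrightarrow> cmod (v \<phi>) \<le> C * M)"
  shows "v \<in> distributions"
  unfolding distributions_def
proof (intro CollectI conjI ballI allI impI)
  fix K :: "'a set" assume K: "compact K"
  obtain C k where C: "0 \<le> C" "\<And>\<phi> M. \<phi> \<in> test_functions \<Longrightarrow> (\<And>x. x \<notin> K \<Longrightarrow> \<phi> x = 0) \<Longrightarrow>
       (\<And>x. dbound k \<phi> x M) \<Longrightarrow> cmod (v \<phi>) \<le> C * M"
    using bound[OF K] by blast
  let ?A = "{\<alpha> \<in> lists (Basis :: 'a set). length \<alpha> \<le> k}"
  have "cmod (v \<phi>) \<le> C * (\<Sum>\<alpha>\<in>?A. SUP x. cmod (iterD \<alpha> \<phi> x))"
    if \<phi>: "\<phi> \<in> test_functions" "fun_supp \<phi> \<subseteq> K" for \<phi>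
  proof (rule C(2)[OF \<phi>(1)])
    show "\<phi> x = 0" if "x \<notin> K" for x using that \<phi>(2) by (auto intro: fun_supp_zero)
    obtain M where M: "0 \<le> M" "\<And>x. x \<in> fun_supp \<phi> \<Longrightarrow> dbound k \<phi> x M"
      using smooth_on_dbound_compact[OF test_functions_smooth test_functions_compact] \<phi> by blast
    have db: "dbound k \<phi> x M" for x
      using dbound_zero[of "- fun_supp \<phi>" \<phi> x M k] M by (cases "x \<in> fun_supp \<phi>") (auto simp: fun_supp_zero open_Compl)
    have bd: "bdd_above (range (\<lambda>x. cmod (iterD \<alpha> \<phi> x)))" if "\<alpha> \<in> ?A" for \<alpha>
      using dboundD[OF db] that by (auto intro!: bdd_aboveI2[where M=M])
    show "dbound k \<phi> x (\<Sum>\<alpha>\<in>?A. SUP x. cmod (iterD \<alpha> \<phi> x))" for x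
      unfolding dbound_def
    proof (intro ballI impI)
      fix \<alpha> :: "'a list" assume "\<alpha> \<in> lists Basis" "length \<alpha> \<le> k"
      then have \<alpha>: "\<alpha> \<in> ?A" by simp
      have "cmod (iterD \<alpha> \<phi> x) \<le> (SUP x. cmod (iterD \<alpha> \<phi> x))"
        by (rule cSUP_upper[OF UNIV_I bd[OF \<alpha>]])
      also have "\<dots> \<le> (\<Sum>\<alpha>\<in>?A. SUP x. cmod (iterD \<alpha> \<phi> x))"
        by (rule member_le_sum[OF \<alpha>])
           (auto simp: finite_multi_indices intro!: cSUP_upper2[OF bd, where x=0])
      finally show "cmod (iterD \<alpha> \<phi> x) \<le> (\<Sum>\<alpha>\<in>?A. SUP x. cmod (iterD \<alpha> \<phi> x))" .
    qed
  qed
  then show "\<exists>C k. \<forall>\<phi>\<in>test_functions. fun_supp \<phi> \<subseteq> K \<longrightarrow>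
      cmod (v \<phi>) \<le> C * (\<Sum>\<alpha>\<in>{\<alpha> \<in> lists Basis. length \<alpha> \<le> k}. SUP x. cmod (iterD \<alpha> \<phi> x))"
    by blast
qed (use add cmult in auto)

text \<open>The fixed cutoff goes into the constant through the Leibniz rule, so \<open>h\<close>
  can be an exponential or an \<open>IF\<close>, without compact support of its own.\<close>

lemma dist_bound_localized:
  assumes v: "v \<in> distributions" and \<kappa>: "\<kappa> \<in> test_functions"
  obtains C k where "0 \<le> C" "\<And>h M. smooth_on UNIV h \<Longrightarrow> 0 \<le> M \<Longrightarrow>
    (\<And>x. x \<in> fun_supp \<kappa> \<Longrightarrow> dbound k h x M) \<Longrightarrow> cmod (v (\<lambda>x. h x * \<kappa> x)) \<le> C * M"
proof -
  obtain C k where C: "0 \<le> C" "\<And>\<phi> M. \<phi> \<in> test_functions \<Longrightarrow> (\<And>x. x \<notin> fun_supp \<kappa> \<Longrightarrow> \<phi> x = 0) \<Longrightarrow> 0 \<le> M \<Longrightarrow>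
    (\<And>x. x \<in> fun_supp \<kappa> \<Longrightarrow> dbound k \<phi> x M) \<Longrightarrow> cmod (v \<phi>) \<le> C * M"
    by (rule dist_bound[OF v test_functions_compact[OF \<kappa>]]) blast
  obtain A where A: "0 \<le> A" "\<And>x. x \<in> fun_supp \<kappa> \<Longrightarrow> dbound k \<kappa> x A"
    using smooth_on_dbound_compact[OF test_functions_smooth test_functions_compact] \<kappa> by blast
  show ?thesis
  proof (rule that[of "C * (2 ^ k * A)" k])
    fix h :: "'a \<Rightarrow> complex" and M
    assume h: "smooth_on UNIV h" "0 \<le> M" "\<And>x. x \<in> fun_supp \<kappa> \<Longrightarrow> dbound k h x M"
    have "cmod (v (\<lambda>x. h x * \<kappa> x)) \<le> C * (2 ^ k * (M * A))"
    proof (rule C(2))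
      show "dbound k (\<lambda>x. h x * \<kappa> x) x (2 ^ k * (M * A))" if "x \<in> fun_supp \<kappa>" for x
        by (rule dbound_mult[OF open_UNIV UNIV_I]) (use h A that \<kappa> in \<open>auto simp: test_functions_smooth\<close>)
    qed (use h A \<kappa> in \<open>auto simp: fun_supp_zero intro!: test_functions_mult'\<close>)
    then show "cmod (v (\<lambda>x. h x * \<kappa> x)) \<le> C * (2 ^ k * A) * M" by (simp add: mult_ac)
  qed (use C A in auto)
qed

section \<open>Moving a distribution under a frequency integral\<close>

lemma D_cmult_ex: "D b (\<lambda>y. c * ex z y) = (\<lambda>y. (c * complex_of_real (b \<bullet> z)) * ex z y)"
  using smooth_on_differentiable[OF smooth_on_ex[OF open_UNIV], of _ z]
  by (intro ext, subst D_mult) (auto simp: D_ex)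

lemma dbound_ex: "dbound N (\<lambda>y. c * ex z y) y (cmod c * japanese z ^ N)"
proof (induction N arbitrary: c)
  case (Suc N)
  have "dbound N (D b (\<lambda>y. c * ex z y)) y (cmod c * japanese z ^ Suc N)" if b: "b \<in> Basis" for b
  proof -
    have "cmod (c * complex_of_real (b \<bullet> z)) * japanese z ^ N \<le> cmod c * japanese z * japanese z ^ N"
      using inner_le_japanese[OF b, of z]
      by (intro mult_right_mono) (auto simp: norm_mult inner_commute intro!: mult_left_mono)
    then show ?thesis
      unfolding D_cmult_ex by (intro dbound_mono[OF Suc.IH]) (auto simp: mult_ac)
  qed
  moreover have "cmod (c * ex z y) \<le> cmod c * japanese z ^ Suc N"
    using mult_left_mono[OF one_le_power[OF japanese_ge_1[of z]], of "cmod c" "Suc N"]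
    by (simp add: norm_mult)
  ultimately show ?case by (auto simp: dbound_Suc)
qed (simp add: norm_mult)

lemma smooth_on_cmult_ex: "smooth_on UNIV (\<lambda>y. c * ex z y)"
  by (intro smooth_on_cmult smooth_on_ex open_UNIV)

text \<open>Differentiation in y multiplies the amplitude by a coordinate of -\<eta>, which leaves
  it continuous; hence the induction generalizes \<open>B\<close>, and the base case is uniform
  continuity on a compact product.\<close>

lemma dbound_ex_uniform:
  fixes B :: "'a::euclidean_space \<Rightarrow> complex"
  assumes B: "continuous_on UNIV B" and Q: "compact Q" and K: "compact K" and \<epsilon>: "0 < \<epsilon>"
  shows "\<exists>\<delta>>0. \<forall>\<eta>\<in>Q. \<forall>t\<in>Q. dist \<eta> t < \<delta> \<longrightarrow>
    (\<forall>y\<in>K. dbound N (\<lambda>y. B \<eta> * ex (- \<eta>) y - B t * ex (- t) y) y \<epsilon>)"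
  using B
proof (induction N arbitrary: B)
  case 0
  have "uniformly_continuous_on (Q \<times> K) (\<lambda>z. B (fst z) * ex (- fst z) (snd z))"
  proof (rule compact_uniformly_continuous)
    have "continuous_on (Q \<times> K) (\<lambda>z. B (fst z))"
      by (rule continuous_on_compose2[OF 0 continuous_on_fst[OF continuous_on_id]]) auto
    then show "continuous_on (Q \<times> K) (\<lambda>z. B (fst z) * ex (- fst z) (snd z))"
      by (intro continuous_intros)
  qed (intro compact_Times Q K)
  then obtain \<delta> where \<delta>: "0 < \<delta>" "\<And>z w. z \<in> Q \<times> K \<Longrightarrow> w \<in> Q \<times> K \<Longrightarrow> dist w z < \<delta> \<Longrightarrow>
      dist (B (fst w) * ex (- fst w) (snd w)) (B (fst z) * ex (- fst z) (snd z)) < \<epsilon>"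
    using \<epsilon> unfolding uniformly_continuous_on_def by metis
  show ?case
  proof (intro exI[of _ \<delta>] conjI ballI impI \<delta>(1))
    fix \<eta> t y assume "\<eta> \<in> Q" "t \<in> Q" "dist \<eta> t < \<delta>" "y \<in> K"
    then show "dbound 0 (\<lambda>y. B \<eta> * ex (- \<eta>) y - B t * ex (- t) y) y \<epsilon>"
      using \<delta>(2)[of "(t, y)" "(\<eta>, y)"] by (simp add: dist_Pair_Pair dist_norm)
  qed
next
  case (Suc N)
  define B' where "B' b \<eta> = B \<eta> * complex_of_real (b \<bullet> - \<eta>)" for b \<eta>
  have B': "continuous_on UNIV (B' b)" for b unfolding B'_def by (intro continuous_intros Suc.prems)
  have D: "D b (\<lambda>y. B \<eta> * ex (- \<eta>) y - B t * ex (- t) y) = (\<lambda>y. B' b \<eta> * ex (- \<eta>) y - B' b t * ex (- t) y)" for b \<eta> t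
  proof -
    have "D b (\<lambda>y. B \<eta> * ex (- \<eta>) y + (- B t) * ex (- t) y) x
        = D b (\<lambda>y. B \<eta> * ex (- \<eta>) y) x + D b (\<lambda>y. (- B t) * ex (- t) y) x" for x
      by (intro D_add smooth_on_differentiable[OF smooth_on_cmult_ex] UNIV_I)
    then show ?thesis unfolding D_cmult_ex by (simp add: B'_def fun_eq_iff algebra_simps)
  qed
  have N: "dbound n f x M \<Longrightarrow> cmod (f x) \<le> M" for n f x and M :: real
    using dboundD[of n f x M "[]"] by simp
  obtain \<delta>0 where \<delta>0: "0 < \<delta>0" "\<And>\<eta> t y. \<eta> \<in> Q \<Longrightarrow> t \<in> Q \<Longrightarrow> dist \<eta> t < \<delta>0 \<Longrightarrow> y \<in> K \<Longrightarrow>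
     dbound N (\<lambda>y. B \<eta> * ex (- \<eta>) y - B t * ex (- t) y) y \<epsilon>"
    using Suc.IH[OF Suc.prems] by blast
  have "\<forall>b. \<exists>\<delta>>0. \<forall>\<eta>\<in>Q. \<forall>t\<in>Q. dist \<eta> t < \<delta> \<longrightarrow>
    (\<forall>y\<in>K. dbound N (\<lambda>y. B' b \<eta> * ex (- \<eta>) y - B' b t * ex (- t) y) y \<epsilon>)"
    using Suc.IH[OF B'] by blast
  then obtain d where d: "\<And>b. 0 < d b" "\<And>b \<eta> t y. \<eta> \<in> Q \<Longrightarrow> t \<in> Q \<Longrightarrow> dist \<eta> t < d b \<Longrightarrow> y \<in> K \<Longrightarrow>
     dbound N (\<lambda>y. B' b \<eta> * ex (- \<eta>) y - B' b t * ex (- t) y) y \<epsilon>"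
    by metis
  let ?\<delta> = "Min (insert \<delta>0 (d ` Basis))"
  have "0 < ?\<delta>" using \<delta>0 d by (subst Min_gr_iff) auto
  moreover have "dbound (Suc N) (\<lambda>y. B \<eta> * ex (- \<eta>) y - B t * ex (- t) y) y \<epsilon>"
    if "\<eta> \<in> Q" "t \<in> Q" "dist \<eta> t < ?\<delta>" "y \<in> K" for \<eta> t y
    using that(3) N[OF \<delta>0(2)[OF that(1,2) _ that(4)]] d(2)[OF that(1,2) _ that(4)]
    unfolding dbound_Suc D by (subst (asm) Min_gr_iff) auto
  ultimately show ?case by blast
qed

text \<open>The Fourier transform of \<open>\<kappa> v\<close> in the usual sign convention, the
  sign of \<open>IF\<close> and opposite to that of \<open>Fh\<close>.\<close>

definition FD :: "'a::euclidean_space functional \<Rightarrow> ('a \<Rightarrow> complex) \<Rightarrow> 'a \<Rightarrow> complex" where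
  "FD v \<kappa> \<eta> = v (\<lambda>y. ex (- \<eta>) y * \<kappa> y)"

lemma test_ex_mult: "\<kappa> \<in> test_functions \<Longrightarrow> (\<lambda>y. ex z y * \<kappa> y) \<in> test_functions"
  by (rule test_functions_mult'[OF smooth_on_ex[OF open_UNIV]])

lemma continuous_on_FD:
  assumes v: "v \<in> distributions" and \<kappa>: "\<kappa> \<in> test_functions"
  shows "continuous_on UNIV (FD v \<kappa>)"
proof (rule continuous_at_imp_continuous_on, rule ballI)
  fix \<eta>0 :: 'a
  obtain C k where C: "0 \<le> C" "\<And>h M. smooth_on UNIV h \<Longrightarrow> 0 \<le> M \<Longrightarrow>
    (\<And>x. x \<in> fun_supp \<kappa> \<Longrightarrow> dbound k h x M) \<Longrightarrow> cmod (v (\<lambda>x. h x * \<kappa> x)) \<le> C * M"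
    by (rule dist_bound_localized[OF v \<kappa>]) blast
  show "isCont (FD v \<kappa>) \<eta>0"
    unfolding continuous_at_eps_delta
  proof (intro allI impI)
    fix \<epsilon> :: real assume \<epsilon>: "0 < \<epsilon>"
    \<comment> \<open>The 1 added to \<open>C\<close> guards against \<open>C = 0\<close>.\<close>
    define e where "e = \<epsilon> / (2 * (C + 1))"
    have e: "0 < e" "C * e < \<epsilon>" using \<epsilon> C(1) by (auto simp: e_def field_simps intro!: add_nonneg_pos)
    obtain \<delta> where \<delta>: "0 < \<delta>" "\<And>\<eta> t y. \<eta> \<in> cball \<eta>0 1 \<Longrightarrow> t \<in> cball \<eta>0 1 \<Longrightarrow> dist \<eta> t < \<delta> \<Longrightarrow> y \<in> fun_supp \<kappa> \<Longrightarrow>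
      dbound k (\<lambda>y. 1 * ex (- \<eta>) y - 1 * ex (- t) y) y e"
      using dbound_ex_uniform[OF continuous_on_const[of _ 1] compact_cball[of \<eta>0 1] test_functions_compact[OF \<kappa>] e(1), of k]
      by blast
    show "\<exists>d>0. \<forall>\<eta>. dist \<eta> \<eta>0 < d \<longrightarrow> dist (FD v \<kappa> \<eta>) (FD v \<kappa> \<eta>0) < \<epsilon>"
    proof (intro exI[of _ "min \<delta> 1"] conjI allI impI)
      fix \<eta> assume d: "dist \<eta> \<eta>0 < min \<delta> 1"
      have "FD v \<kappa> \<eta> - FD v \<kappa> \<eta>0 = v (\<lambda>y. (ex (- \<eta>) y - ex (- \<eta>0) y) * \<kappa> y)"
        unfolding FD_def using dist_diff[OF v test_ex_mult[OF \<kappa>] test_ex_mult[OF \<kappa>]]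
        by (simp add: left_diff_distrib)
      also have "cmod \<dots> \<le> C * e"
        by (rule C(2))
           (use e d \<delta>(2)[of \<eta> \<eta>0] in \<open>auto intro!: smooth_on_diff smooth_on_ex simp: dist_commute\<close>)
      finally show "dist (FD v \<kappa> \<eta>) (FD v \<kappa> \<eta>0) < \<epsilon>" using e by (simp add: dist_norm)
    qed (use \<delta> in auto)
  qed
qed

lemma FD_measurable: "v \<in> distributions \<Longrightarrow> \<kappa> \<in> test_functions \<Longrightarrow> FD v \<kappa> \<in> borel_measurable borel"
  by (intro borel_measurable_continuous_onI continuous_on_FD)

text \<open>The exponent depends on \<open>K\<close> only, the constant also on the cutoff: the
  bootstrap needs a common starting exponent for all cutoffs in a ball.\<close>

lemma FD_growth:
  assumes v: "v \<in> distributions" and K: "compact K"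
  obtains k where "\<And>\<kappa>. \<kappa> \<in> test_functions \<Longrightarrow> fun_supp \<kappa> \<subseteq> K \<Longrightarrow>
    \<exists>C. 0 \<le> C \<and> (\<forall>\<eta>. cmod (FD v \<kappa> \<eta>) \<le> C * japanese \<eta> powr real k)"
proof -
  obtain C k where C: "0 \<le> C" "\<And>\<phi> M. \<phi> \<in> test_functions \<Longrightarrow> (\<And>x. x \<notin> K \<Longrightarrow> \<phi> x = 0) \<Longrightarrow> 0 \<le> M \<Longrightarrow>
    (\<And>x. x \<in> K \<Longrightarrow> dbound k \<phi> x M) \<Longrightarrow> cmod (v \<phi>) \<le> C * M"
    by (rule dist_bound[OF v K]) blast
  show ?thesis
  proof (rule that[of k])
    fix \<kappa> :: "'a \<Rightarrow> complex" assume \<kappa>: "\<kappa> \<in> test_functions" "fun_supp \<kappa> \<subseteq> K"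
    obtain A where A: "0 \<le> A" "\<And>x. x \<in> K \<Longrightarrow> dbound k \<kappa> x A"
      using smooth_on_dbound_compact[OF test_functions_smooth K] \<kappa>(1) by blast
    have "cmod (FD v \<kappa> \<eta>) \<le> C * (2 ^ k * A) * japanese \<eta> powr real k" for \<eta>
    proof -
      have "cmod (FD v \<kappa> \<eta>) \<le> C * (2 ^ k * (japanese \<eta> ^ k * A))"
        unfolding FD_def
      proof (rule C(2))
        show "dbound k (\<lambda>y. ex (- \<eta>) y * \<kappa> y) x (2 ^ k * (japanese \<eta> ^ k * A))" if "x \<in> K" for x
          by (rule dbound_mult[OF open_UNIV UNIV_I]) (use A that \<kappa> dbound_ex[of k 1 "- \<eta>" x] in
              \<open>auto simp: test_functions_smooth smooth_on_ex\<close>)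
        show "ex (- \<eta>) x * \<kappa> x = 0" if "x \<notin> K" for x
          using that \<kappa>(2) fun_supp_zero[of x \<kappa>] by auto
      qed (use A \<kappa> in \<open>auto intro!: test_ex_mult\<close>)
      then show ?thesis by (simp add: powr_realpow mult_ac)
    qed
    then show "\<exists>C. 0 \<le> C \<and> (\<forall>\<eta>. cmod (FD v \<kappa> \<eta>) \<le> C * japanese \<eta> powr real k)"
      using A C by (intro exI[of _ "C * (2 ^ k * A)"]) auto
  qed
qed

lemma rapid_indicator: "rapid B \<Longrightarrow> A \<in> sets borel \<Longrightarrow> rapid (\<lambda>\<eta>. indicator A \<eta> * B \<eta>)"
  by (rule rapid_mult_bounded[of _ _ 1]) (auto simp: indicator_def)

lemma integrable_indicator_mult:
  fixes c :: "'b::{real_normed_field, banach, second_countable_topology}"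
  assumes "A \<in> sets M" "emeasure M A < \<infinity>"
  shows "integrable M (\<lambda>\<eta>. indicator A \<eta> * c)"
    and "(LINT \<eta>|M. indicator A \<eta> * c) = of_real (measure M A) * c"
proof -
  have eq: "(\<lambda>\<eta>. indicator A \<eta> * c) = (\<lambda>\<eta>. indicator A \<eta> *\<^sub>R c)" by (auto simp: indicator_def)
  have i: "integrable M (indicator A :: _ \<Rightarrow> real)" by (intro integrable_real_indicator assms)
  show "integrable M (\<lambda>\<eta>. indicator A \<eta> * c)"
    unfolding eq by (intro integrable_scaleR_left i)
  have "measure M (A \<inter> space M) = measure M A"
    using sets.sets_into_space[OF assms(1)] by (simp add: Int_absorb2)
  then show "(LINT \<eta>|M. indicator A \<eta> * c) = of_real (measure M A) * c"
    unfolding eq using i by (simp add: integral_scaleR_left scaleR_conv_of_real)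
qed

lemma integrable_japanese_rapid:
  assumes "rapid B"
  shows "integrable lborel (\<lambda>\<eta>. japanese \<eta> powr s * cmod (B \<eta>))"
proof -
  have "rapid (\<lambda>\<eta>. complex_of_real (japanese \<eta> powr s) * B \<eta>)"
    by (rule rapid_mult[OF assms, of _ 1 s]) auto
  from integrable_norm[OF rapid_integrable[OF this]] show ?thesis by (simp add: norm_mult)
qed

text \<open>Each derivative of \<open>IF B\<close> multiplies \<open>B\<close> by a coordinate of
  the frequency, which is at most the weight.\<close>

lemma dbound_IF:
  assumes "rapid B"
  shows "dbound N (IF B) y (LINT \<eta>|lborel. japanese \<eta> powr real N * cmod (B \<eta>))"
  using assms
proof (induction N arbitrary: B)
  case 0
  have "cmod (IF B y) \<le> (LINT \<eta>|lborel. cmod (B \<eta>))"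
    unfolding IF_def by (rule norm_integral_le) (use 0 rapid_integrable in \<open>auto simp: norm_mult\<close>)
  then show ?case by simp
next
  case (Suc N)
  let ?M = "LINT \<eta>|lborel. japanese \<eta> powr real (Suc N) * cmod (B \<eta>)"
  have "cmod (IF B y) \<le> ?M"
    unfolding IF_def
  proof (rule norm_integral_le[OF integrable_japanese_rapid[OF Suc.prems]])
    show "cmod (ex (- \<eta>) y * B \<eta>) \<le> japanese \<eta> powr real (Suc N) * cmod (B \<eta>)" for \<eta>
      using mult_right_mono[OF ge_one_powr_ge_zero[OF japanese_ge_1[of \<eta>], of "real (Suc N)"], of "cmod (B \<eta>)"]
      by (simp add: norm_mult)
  qed
  moreover have "dbound N (D b (IF B)) y ?M" if b: "b \<in> Basis" for b
  proof -
    let ?B = "\<lambda>\<eta>. complex_of_real (- (\<eta> \<bullet> b)) * B \<eta>"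
    have "(LINT \<eta>|lborel. japanese \<eta> powr real N * cmod (?B \<eta>)) \<le> ?M"
    proof (rule integral_mono)
      show "japanese \<eta> powr real N * cmod (?B \<eta>) \<le> japanese \<eta> powr real (Suc N) * cmod (B \<eta>)" for \<eta>
      proof -
        have "japanese \<eta> powr real N * (\<bar>\<eta> \<bullet> b\<bar> * cmod (B \<eta>)) \<le> japanese \<eta> powr real N * (japanese \<eta> * cmod (B \<eta>))"
          by (intro mult_left_mono mult_right_mono inner_le_japanese b) auto
        also have "\<dots> = japanese \<eta> powr real (Suc N) * cmod (B \<eta>)"
          using powr_add[of "japanese \<eta>" "real N" 1] by (simp add: mult.assoc add.commute)
        finally show ?thesis by (simp add: norm_mult)
      qed
    qed (intro integrable_japanese_rapid rapid_minus_inner Suc.prems)+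
    then show ?thesis
      unfolding D_IF[OF Suc.prems] by (rule dbound_mono[OF Suc.IH[OF rapid_minus_inner[OF Suc.prems]] order_refl])
  qed
  ultimately show ?case by (simp add: dbound_Suc)
qed

text \<open>The error made when the frequency integral over one cell is replaced by the value at its
  tag times the volume. Differentiation multiplies the amplitude by the same function of the
  frequency in both terms, so the estimate reproduces itself for every order.\<close>

lemma dbound_IF_box:
  fixes B :: "'a::euclidean_space \<Rightarrow> complex"
  assumes "rapid B" "A \<in> sets borel" "bounded A" "\<And>\<eta>. \<eta> \<in> A \<Longrightarrow> dbound N (\<lambda>y. B \<eta> * ex (- \<eta>) y - B t * ex (- t) y) y \<epsilon>" "0 \<le> \<epsilon>"
  shows "dbound N (\<lambda>y. IF (\<lambda>\<eta>. indicator A \<eta> * B \<eta>) y - of_real (measure lborel A) * B t * ex (- t) y) y (\<epsilon> * measure lborel A)"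
proof -
  have fin: "emeasure lborel A < \<infinity>" by (rule emeasure_bounded_finite[OF assms(3)])
  have iA: "integrable lborel (\<lambda>\<eta>. indicator A \<eta> * c)" 
    "(LINT \<eta>|lborel. indicator A \<eta> * c) = of_real (measure lborel A) * c"
    for c :: "'b::{real_normed_field, banach, second_countable_topology}"
    using integrable_indicator_mult[of A lborel c] fin assms(2) by auto
  have iA1: "(LINT \<eta>|lborel. indicator A \<eta>) = complex_of_real (measure lborel A)"
    using iA(2)[of 1] by simp
  have base: "cmod (IF (\<lambda>\<eta>. indicator A \<eta> * B \<eta>) y - of_real (measure lborel A) * B t * ex (- t) y)
      \<le> \<epsilon> * measure lborel A"
    if "rapid B" "\<And>\<eta>. \<eta> \<in> A \<Longrightarrow> cmod (B \<eta> * ex (- \<eta>) y - B t * ex (- t) y) \<le> \<epsilon>" for B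
  proof -
    have "IF (\<lambda>\<eta>. indicator A \<eta> * B \<eta>) y - of_real (measure lborel A) * B t * ex (- t) y
        = (LINT \<eta>|lborel. ex (- \<eta>) y * (indicator A \<eta> * B \<eta>) - indicator A \<eta> * (B t * ex (- t) y))"
      unfolding IF_def using rapid_integrable[OF rapid_ex_mult(1)[OF rapid_indicator[OF that(1) assms(2)]]]
      by (subst Bochner_Integration.integral_diff) (auto simp: iA(1) iA1 mult.assoc)
    also have "cmod \<dots> \<le> (LINT \<eta>|lborel. indicator A \<eta> * \<epsilon>)"
      by (rule norm_integral_le[OF iA(1)]) (use that(2) in \<open>auto simp: indicator_def mult.commute\<close>)
    finally show ?thesis by (simp add: iA mult.commute)
  qed
  show ?thesis
    using assms(1,4)
  proof (induction N arbitrary: B)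
    case 0
    then show ?case using base[of B] by simp
next
  case (Suc N)
  define B' where "B' b \<eta> = complex_of_real (- (\<eta> \<bullet> b)) * B \<eta>" for b \<eta>
  have r: "rapid (\<lambda>\<eta>. indicator A \<eta> * B \<eta>)" by (rule rapid_indicator[OF Suc.prems(1) assms(2)])
  have d1: "D b (\<lambda>y. B \<eta> * ex (- \<eta>) y - B t * ex (- t) y) = (\<lambda>y. B' b \<eta> * ex (- \<eta>) y - B' b t * ex (- t) y)" for b \<eta>
  proof -
    have "D b (\<lambda>y. B \<eta> * ex (- \<eta>) y + (- B t) * ex (- t) y) x
        = D b (\<lambda>y. B \<eta> * ex (- \<eta>) y) x + D b (\<lambda>y. (- B t) * ex (- t) y) x" for x
      by (intro D_add smooth_on_differentiable[OF smooth_on_cmult_ex] UNIV_I)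
    then show ?thesis unfolding D_cmult_ex by (simp add: B'_def fun_eq_iff algebra_simps inner_commute)
  qed
  have d2: "D b (\<lambda>y. IF (\<lambda>\<eta>. indicator A \<eta> * B \<eta>) y - of_real (measure lborel A) * B t * ex (- t) y)
     = (\<lambda>y. IF (\<lambda>\<eta>. indicator A \<eta> * B' b \<eta>) y - of_real (measure lborel A) * B' b t * ex (- t) y)" for b
  proof -
    have "D b (\<lambda>y. IF (\<lambda>\<eta>. indicator A \<eta> * B \<eta>) y + (- (of_real (measure lborel A) * B t)) * ex (- t) y) x
        = D b (IF (\<lambda>\<eta>. indicator A \<eta> * B \<eta>)) x + D b (\<lambda>y. (- (of_real (measure lborel A) * B t)) * ex (- t) y) x" for x
      by (intro D_add smooth_on_differentiable[OF smooth_on_cmult_ex] smooth_on_differentiable[OF smooth_on_IF] r UNIV_I)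
    then show ?thesis
      unfolding D_cmult_ex D_IF[OF r] by (simp add: B'_def fun_eq_iff algebra_simps inner_commute)
  qed
  have "dbound N (\<lambda>y. IF (\<lambda>\<eta>. indicator A \<eta> * B' b \<eta>) y - of_real (measure lborel A) * B' b t * ex (- t) y) y
      (\<epsilon> * measure lborel A)" if b: "b \<in> Basis" for b
  proof (rule Suc.IH)
    show "rapid (B' b)" unfolding B'_def by (rule rapid_minus_inner[OF Suc.prems(1)])
    show "dbound N (\<lambda>y. B' b \<eta> * ex (- \<eta>) y - B' b t * ex (- t) y) y \<epsilon>" if "\<eta> \<in> A" for \<eta>
      using Suc.prems(2)[OF that] b unfolding dbound_Suc d1 by blast
  qed
  moreover have "cmod (IF (\<lambda>\<eta>. indicator A \<eta> * B \<eta>) y - of_real (measure lborel A) * B t * ex (- t) y)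
      \<le> \<epsilon> * measure lborel A"
    by (rule base[OF Suc.prems(1)]) (use dboundD[OF Suc.prems(2), of _ "[]"] in auto)
  ultimately show ?case unfolding dbound_Suc d2 by simp
qed
qed

lemma integral_indicator_cbox:
  fixes f :: "'a::euclidean_space \<Rightarrow> complex"
  assumes "continuous_on UNIV f"
  shows "(LINT x|lborel. indicator (cbox a b) x * f x) = integral (cbox a b) f"
proof -
  have "set_integrable lborel (cbox a b) f"
    unfolding set_integrable_def
    by (rule borel_integrable_compact) (auto intro: continuous_on_subset[OF assms])
  moreover have "indicator (cbox a b) x *\<^sub>R f x = indicator (cbox a b) x * f x" for x
    by (simp add: indicator_def)
  ultimately show ?thesis
    using set_borel_integral_eq_integral(2)[of "cbox a b" f] by (simp add: set_lebesgue_integral_def)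
qed

text \<open>Both sides are additive over divisions of the box, and on a small box they differ by at most
  a multiple of \<open>\<epsilon>\<close> times its volume.\<close>

lemma dist_IF_cbox:
  fixes B :: "'a::euclidean_space \<Rightarrow> complex"
  assumes v: "v \<in> distributions" and \<kappa>: "\<kappa> \<in> test_functions" and B: "rapid B" "continuous_on UNIV B"
  shows "v (\<lambda>y. IF (\<lambda>\<eta>. indicator (cbox a b) \<eta> * B \<eta>) y * \<kappa> y)
    = (LINT \<eta>|lborel. indicator (cbox a b) \<eta> * (B \<eta> * FD v \<kappa> \<eta>))"
    (is "?L = ?R")
proof -
  let ?Q = "cbox a b" and ?g = "\<lambda>\<eta>. B \<eta> * FD v \<kappa> \<eta>"
  define V where "V A = v (\<lambda>y. IF (\<lambda>\<eta>. indicator A \<eta> * B \<eta>) y * \<kappa> y)" for A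
  obtain C k where C: "0 \<le> C" "\<And>h M. smooth_on UNIV h \<Longrightarrow> 0 \<le> M \<Longrightarrow>
    (\<And>x. x \<in> fun_supp \<kappa> \<Longrightarrow> dbound k h x M) \<Longrightarrow> cmod (v (\<lambda>x. h x * \<kappa> x)) \<le> C * M"
    by (rule dist_bound_localized[OF v \<kappa>]) blast
  have gc: "continuous_on UNIV ?g" by (intro continuous_intros B continuous_on_FD v \<kappa>)
  have test: "(\<lambda>y. IF (\<lambda>\<eta>. indicator A \<eta> * B \<eta>) y * \<kappa> y) \<in> test_functions" if "A \<in> sets borel" for A
    by (intro test_functions_mult' \<kappa> smooth_on_IF rapid_indicator B that)
  have main: "cmod (?L - ?R) \<le> (C + 1) * measure lborel ?Q * \<epsilon>" if \<epsilon>: "0 < \<epsilon>" for \<epsilon>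
  proof -
    obtain \<delta>1 where \<delta>1: "0 < \<delta>1" "\<And>\<eta> t y. \<eta> \<in> ?Q \<Longrightarrow> t \<in> ?Q \<Longrightarrow> dist \<eta> t < \<delta>1 \<Longrightarrow> y \<in> fun_supp \<kappa> \<Longrightarrow>
        dbound k (\<lambda>y. B \<eta> * ex (- \<eta>) y - B t * ex (- t) y) y \<epsilon>"
      using dbound_ex_uniform[OF B(2) compact_cbox[of a b] test_functions_compact[OF \<kappa>] \<epsilon>, of k] by blast
    have "uniformly_continuous_on ?Q ?g"
      by (rule compact_uniformly_continuous[OF continuous_on_subset[OF gc subset_UNIV] compact_cbox])
    then obtain \<delta>2 where \<delta>2: "0 < \<delta>2" "\<And>\<eta> t. \<eta> \<in> ?Q \<Longrightarrow> t \<in> ?Q \<Longrightarrow> dist \<eta> t < \<delta>2 \<Longrightarrow> dist (?g \<eta>) (?g t) < \<epsilon>"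
      using \<epsilon> unfolding uniformly_continuous_on_def by metis
    \<comment> \<open>One gauge serves two purposes: \<open>\<delta>1\<close> controls the
      derivatives that enter the bound for \<open>v\<close>, \<open>\<delta>2\<close> the scalar
      integrand on the right.\<close>
    have "gauge (\<lambda>x. ball x (min \<delta>1 \<delta>2) :: 'a set)" using \<delta>1 \<delta>2 by (intro gauge_ball) auto
    then obtain p where p: "p tagged_division_of ?Q" "(\<lambda>x. ball x (min \<delta>1 \<delta>2)) fine p"
      by (rule fine_division_exists)
    have fin: "finite p" using p(1) by auto
    have cb: "\<exists>c d. A = cbox c d" if "(t, A) \<in> p" for t A
      by (rule tagged_division_ofD(4)[OF p(1) that])
    have sp: "(\<Sum>(t, A)\<in>p. LINT x|lborel. indicator A x * f x) = (LINT x|lborel. indicator ?Q x * f x)"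
      if f: "continuous_on UNIV f" for f :: "'a \<Rightarrow> complex"
    proof -
      have "(LINT x|lborel. indicator ?Q x * f x) = integral ?Q f" by (rule integral_indicator_cbox[OF f])
      also have "\<dots> = (\<Sum>(t, A)\<in>p. integral A f)"
        by (rule integral_combine_tagged_division_topdown[OF _ p(1)])
           (auto intro!: integrable_continuous continuous_on_subset[OF f])
      also have "\<dots> = (\<Sum>(t, A)\<in>p. LINT x|lborel. indicator A x * f x)"
      proof (intro sum.cong refl, clarify)
        fix t A assume "(t, A) \<in> p"
        then obtain c d where "A = cbox c d" using cb by blast
        then show "integral A f = (LINT x|lborel. indicator A x * f x)"
          by (simp add: integral_indicator_cbox[OF f])
      qed
      finally show ?thesis by simp
    qed
    have "IF (\<lambda>\<eta>. indicator ?Q \<eta> * B \<eta>) y = (\<Sum>(t, A)\<in>p. IF (\<lambda>\<eta>. indicator A \<eta> * B \<eta>) y)" for y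
      using sp[of "\<lambda>\<eta>. ex (- \<eta>) y * B \<eta>"] B by (simp add: IF_def mult.left_commute continuous_intros)
    then have "?L = v (\<lambda>y. \<Sum>z\<in>p. IF (\<lambda>\<eta>. indicator (snd z) \<eta> * B \<eta>) y * \<kappa> y)"
      by (simp add: sum_distrib_right split_beta)
    also have "\<dots> = (\<Sum>z\<in>p. V (snd z))"
      unfolding V_def by (rule dist_sum[OF v]) (use cb test in force)
    finally have L: "?L = (\<Sum>z\<in>p. V (snd z))" .
    have R: "?R = (\<Sum>z\<in>p. LINT x|lborel. indicator (snd z) x * ?g x)"
      using sp[OF gc] by (simp add: split_beta)
    have est: "cmod (V A - (LINT x|lborel. indicator A x * ?g x)) \<le> (C + 1) * \<epsilon> * measure lborel A"
      if tA: "(t, A) \<in> p" for t A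
    proof -
      obtain c d where cd: "A = cbox c d" using cb[OF tA] by blast
      have A: "A \<subseteq> ?Q" "t \<in> A" "A \<subseteq> ball t (min \<delta>1 \<delta>2)"
        using tagged_division_ofD(2,3)[OF p(1) tA] fineD[OF p(2) tA] by auto
      have bor: "A \<in> sets borel" "bounded A" "emeasure lborel A < \<infinity>"
        unfolding cd by (auto intro: emeasure_lborel_cbox_finite simp del: infinity_ennreal_def)
      define h where "h y = IF (\<lambda>\<eta>. indicator A \<eta> * B \<eta>) y - of_real (measure lborel A) * B t * ex (- t) y" for y
      have hs: "smooth_on UNIV h"
        unfolding h_def by (intro smooth_on_diff smooth_on_cmult_ex smooth_on_IF rapid_indicator B bor open_UNIV)
      have "cmod (v (\<lambda>y. h y * \<kappa> y)) \<le> C * (\<epsilon> * measure lborel A)"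
      proof (rule C(2)[OF hs])
        show "dbound k h x (\<epsilon> * measure lborel A)" if "x \<in> fun_supp \<kappa>" for x
          unfolding h_def
        proof (rule dbound_IF_box[OF B(1) bor(1,2)])
          show "dbound k (\<lambda>y. B \<eta> * ex (- \<eta>) y - B t * ex (- t) y) x \<epsilon>" if "\<eta> \<in> A" for \<eta>
            using \<delta>1(2)[of \<eta> t x] A(1,2) subsetD[OF A(3) that] that \<open>x \<in> fun_supp \<kappa>\<close>
            by (auto simp: dist_commute)
        qed (use \<epsilon> in auto)
      qed (use \<epsilon> in auto)
      \<comment> \<open>By linearity \<open>v\<close> sends the tag value in function form to the
        tag value of the scalar integrand, so only the two cell errors remain.\<close>
      moreover have "v (\<lambda>y. h y * \<kappa> y) = V A - of_real (measure lborel A) * ?g t"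
      proof -
        have "v (\<lambda>y. h y * \<kappa> y) = v (\<lambda>y. IF (\<lambda>\<eta>. indicator A \<eta> * B \<eta>) y * \<kappa> y
            - (of_real (measure lborel A) * B t) * (ex (- t) y * \<kappa> y))"
          by (simp add: h_def algebra_simps)
        also have "\<dots> = V A - (of_real (measure lborel A) * B t) * FD v \<kappa> t"
          unfolding V_def FD_def
          by (subst dist_diff[OF v test[OF bor(1)] test_functions_cmult[OF test_ex_mult[OF \<kappa>]]])
             (simp add: dist_cmult[OF v test_ex_mult[OF \<kappa>]])
        finally show ?thesis by (simp add: mult.assoc)
      qed
      ultimately have 1: "cmod (V A - of_real (measure lborel A) * ?g t) \<le> C * (\<epsilon> * measure lborel A)" by simp
      have iA: "integrable lborel (\<lambda>\<eta>. indicator A \<eta> * c)"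
        "(LINT \<eta>|lborel. indicator A \<eta> * c) = of_real (measure lborel A) * c"
        for c :: "'b::{real_normed_field, banach, second_countable_topology}"
        using integrable_indicator_mult[of A lborel c] bor by auto
      have iA1: "(LINT \<eta>|lborel. indicator A \<eta>) = complex_of_real (measure lborel A)"
        using iA(2)[of 1] by simp
      have ig: "integrable lborel (\<lambda>x. indicator A x * ?g x)"
        by (rule integrable_compact_supp[of A])
           (auto simp: cd indicator_def intro!: continuous_on_eq[OF continuous_on_subset[OF gc subset_UNIV]])
      have "of_real (measure lborel A) * ?g t - (LINT x|lborel. indicator A x * ?g x)
          = (LINT x|lborel. indicator A x * ?g t - indicator A x * ?g x)"
        using iA(1) ig by (subst Bochner_Integration.integral_diff) (auto simp: iA1)
      also have "cmod \<dots> \<le> (LINT x|lborel. indicator A x * \<epsilon>)"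
      proof (rule norm_integral_le[OF iA(1)])
        show "cmod (indicator A x * ?g t - indicator A x * ?g x) \<le> indicator A x * \<epsilon>" for x
        proof (cases "x \<in> A")
          case True
          then have "dist (?g t) (?g x) < \<epsilon>" using A(1,2) subsetD[OF A(3) True] by (intro \<delta>2(2)) auto
          then show ?thesis using True by (simp add: dist_norm)
        qed simp
      qed
      finally have 2: "cmod (of_real (measure lborel A) * ?g t - (LINT x|lborel. indicator A x * ?g x))
          \<le> \<epsilon> * measure lborel A" by (simp add: iA(2) mult.commute)
      show ?thesis using norm_triangle_mono[OF 1 2] by (simp add: algebra_simps)
    qed
    have "cmod (?L - ?R) \<le> (\<Sum>z\<in>p. cmod (V (snd z) - (LINT x|lborel. indicator (snd z) x * ?g x)))"
      unfolding L R sum_subtractf[symmetric] by (rule norm_sum)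
    also have "\<dots> \<le> (\<Sum>z\<in>p. (C + 1) * \<epsilon> * measure lborel (snd z))"
      by (rule sum_mono) (use est in force)
    also have "\<dots> = (C + 1) * \<epsilon> * (\<Sum>(t, A)\<in>p. measure lborel A)"
      by (simp add: sum_distrib_left split_beta)
    also have "(\<Sum>(t, A)\<in>p. measure lborel A) = measure lborel ?Q"
      by (rule additive_content_tagged_division[OF p(1)])
    finally show ?thesis by (simp add: mult_ac)
  qed
  have "cmod (?L - ?R) \<le> 0"
  proof (rule field_le_epsilon)
    fix e :: real assume e: "0 < e"
    define K where "K = (C + 1) * measure lborel ?Q"
    have K: "0 \<le> K" using C by (simp add: K_def)
    have "cmod (?L - ?R) \<le> K * (e / (K + 1))"
      unfolding K_def by (rule main) (use e K K_def in auto)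
    also have "\<dots> \<le> e" using K e by (simp add: field_simps)
    finally show "cmod (?L - ?R) \<le> 0 + e" by simp
  qed
  then show ?thesis by simp
qed

text \<open>Exhausting the frequency space by boxes extends \<open>dist_IF_cbox\<close> to the whole
  space. On the left the tail of \<open>IF B\<close> becomes small in the seminorm that bounds
  \<open>v\<close>; on the right \<open>FD\<close> grows only polynomially against the decay of
  \<open>B\<close>.\<close>

theorem dist_IF:
  fixes B :: "'a::euclidean_space \<Rightarrow> complex"
  assumes v: "v \<in> distributions" and \<kappa>: "\<kappa> \<in> test_functions" and B: "rapid B" "continuous_on UNIV B"
  shows "v (\<lambda>y. IF B y * \<kappa> y) = (LINT \<eta>|lborel. B \<eta> * FD v \<kappa> \<eta>)"
proof -
  define Q where "Q n = cbox (- real n *\<^sub>R One) (real n *\<^sub>R One :: 'a)" for n :: nat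
  have Qb: "Q n \<in> sets borel" for n by (simp add: Q_def)
  obtain C k where C: "0 \<le> C" "\<And>h M. smooth_on UNIV h \<Longrightarrow> 0 \<le> M \<Longrightarrow>
    (\<And>x. x \<in> fun_supp \<kappa> \<Longrightarrow> dbound k h x M) \<Longrightarrow> cmod (v (\<lambda>x. h x * \<kappa> x)) \<le> C * M"
    by (rule dist_bound_localized[OF v \<kappa>]) blast
  have Fm[measurable]: "FD v \<kappa> \<in> borel_measurable borel" by (rule FD_measurable[OF v \<kappa>])
  have Bm[measurable]: "B \<in> borel_measurable borel" by (rule rapid_measurable[OF B(1)])
  have Qlim: "(\<lambda>n. indicator (Q n) x :: 'b::real_normed_field) \<longlonglongrightarrow> 1" for x
  proof -
    obtain m :: nat where m: "norm x \<le> real m" using real_arch_simple by blast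
    have "x \<in> Q n" if "m \<le> n" for n
      using that m Basis_le_norm[of _ x] by (force simp: Q_def mem_box)
    then show ?thesis
      by (intro tendsto_eventually) (auto simp: eventually_sequentially intro!: exI[of _ m])
  qed
  obtain l where l: "\<exists>C. 0 \<le> C \<and> (\<forall>\<eta>. cmod (FD v \<kappa> \<eta>) \<le> C * japanese \<eta> powr real l)"
    using FD_growth[OF v test_functions_compact[OF \<kappa>]] \<kappa> by (metis order_refl)
  then obtain C' where C': "\<And>\<eta>. cmod (FD v \<kappa> \<eta>) \<le> C' * japanese \<eta> powr real l" by blast
  have rg: "rapid (\<lambda>\<eta>. FD v \<kappa> \<eta> * B \<eta>)" by (rule rapid_mult[OF B(1) Fm C'])
  have lim1: "(\<lambda>n. LINT \<eta>|lborel. indicator (Q n) \<eta> * (B \<eta> * FD v \<kappa> \<eta>)) \<longlonglongrightarrow> (LINT \<eta>|lborel. B \<eta> * FD v \<kappa> \<eta>)"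
  proof (rule integral_dominated_convergence[where w="\<lambda>\<eta>. cmod (FD v \<kappa> \<eta> * B \<eta>)"])
    show "AE x in lborel. (\<lambda>n. indicator (Q n) x * (B x * FD v \<kappa> x)) \<longlonglongrightarrow> B x * FD v \<kappa> x"
      using tendsto_mult[OF Qlim tendsto_const] by auto
    show "AE x in lborel. cmod (indicator (Q n) x * (B x * FD v \<kappa> x)) \<le> cmod (FD v \<kappa> x * B x)" for n
      by (auto simp: indicator_def norm_mult mult.commute intro!: AE_I2)
    show "(\<lambda>\<eta>. indicator (Q n) \<eta> * (B \<eta> * FD v \<kappa> \<eta>)) \<in> borel_measurable lborel" for n
      using Qb[of n] by measurable
  qed (use integrable_norm[OF rapid_integrable[OF rg]] in auto)
  \<comment> \<open>The k-th power of the weight pays for the k derivatives of the tail that the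
    seminorm involves.\<close>
  define M where "M n = (LINT \<eta>|lborel. japanese \<eta> powr real k * cmod (indicator (- Q n) \<eta> * B \<eta>))" for n
  have M0: "M \<longlonglongrightarrow> 0"
  proof -
    have "M \<longlonglongrightarrow> (LINT \<eta>|(lborel :: 'a measure). (0::real))"
      unfolding M_def
    proof (rule integral_dominated_convergence[where w="\<lambda>\<eta>. japanese \<eta> powr real k * cmod (B \<eta>)"])
      show "AE x in lborel. (\<lambda>n. japanese x powr real k * cmod (indicator (- Q n) x * B x)) \<longlonglongrightarrow> 0"
      proof (rule AE_I2)
        fix x
        have "(\<lambda>n. japanese x powr real k * cmod ((1 - indicator (Q n) x) * B x))
          \<longlonglongrightarrow> japanese x powr real k * cmod ((1 - 1) * B x)"
          by (intro tendsto_intros Qlim)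
        then show "(\<lambda>n. japanese x powr real k * cmod (indicator (- Q n) x * B x)) \<longlonglongrightarrow> 0"
          by (simp add: indicator_compl)
      qed
      show "AE x in lborel. norm (japanese x powr real k * cmod (indicator (- Q n) x * B x)) \<le> japanese x powr real k * cmod (B x)" for n
        by (auto simp: indicator_def norm_mult intro!: AE_I2)
      show "(\<lambda>x. japanese x powr real k * cmod (indicator (- Q n) x * B x)) \<in> borel_measurable lborel" for n
        using Qb[of n] by measurable
    qed (use integrable_japanese_rapid[OF B(1)] in auto)
    then show ?thesis by simp
  qed
  have diff: "cmod (v (\<lambda>y. IF B y * \<kappa> y) - v (\<lambda>y. IF (\<lambda>\<eta>. indicator (Q n) \<eta> * B \<eta>) y * \<kappa> y)) \<le> C * M n" for n
  proof -
    have r: "rapid (\<lambda>\<eta>. indicator (Q n) \<eta> * B \<eta>)" "rapid (\<lambda>\<eta>. indicator (- Q n) \<eta> * B \<eta>)"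
      using Qb[of n] by (auto intro!: rapid_indicator B)
    have s: "IF B y - IF (\<lambda>\<eta>. indicator (Q n) \<eta> * B \<eta>) y = IF (\<lambda>\<eta>. indicator (- Q n) \<eta> * B \<eta>) y" for y
      unfolding IF_def
      using rapid_integrable[OF rapid_ex_mult(1)[OF B(1)]] rapid_integrable[OF rapid_ex_mult(1)[OF r(1)]]
      by (subst Bochner_Integration.integral_diff[symmetric]) (auto simp: indicator_compl algebra_simps)
    have "v (\<lambda>y. IF B y * \<kappa> y) - v (\<lambda>y. IF (\<lambda>\<eta>. indicator (Q n) \<eta> * B \<eta>) y * \<kappa> y)
        = v (\<lambda>y. IF B y * \<kappa> y - IF (\<lambda>\<eta>. indicator (Q n) \<eta> * B \<eta>) y * \<kappa> y)"
      by (rule dist_diff[symmetric, OF v]) (intro test_functions_mult' \<kappa> smooth_on_IF r B)+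
    also have "\<dots> = v (\<lambda>y. IF (\<lambda>\<eta>. indicator (- Q n) \<eta> * B \<eta>) y * \<kappa> y)"
      by (simp add: left_diff_distrib[symmetric] s)
    also have "cmod \<dots> \<le> C * M n"
      by (rule C(2)) (use dbound_IF[OF r(2), of k] r in \<open>auto simp: M_def intro!: smooth_on_IF\<close>)
    finally show ?thesis .
  qed
  have "(\<lambda>n. v (\<lambda>y. IF (\<lambda>\<eta>. indicator (Q n) \<eta> * B \<eta>) y * \<kappa> y)) \<longlonglongrightarrow> v (\<lambda>y. IF B y * \<kappa> y)"
  proof (rule LIM_zero_cancel, rule Lim_null_comparison)
    show "(\<lambda>n. C * M n) \<longlonglongrightarrow> 0" using tendsto_mult_left[OF M0, of C] by simp
    show "\<forall>\<^sub>F n in sequentially. cmod (v (\<lambda>y. IF (\<lambda>\<eta>. indicator (Q n) \<eta> * B \<eta>) y * \<kappa> y) - v (\<lambda>y. IF B y * \<kappa> y)) \<le> C * M n"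
      using diff by (auto simp: norm_minus_commute)
  qed
  moreover have "v (\<lambda>y. IF (\<lambda>\<eta>. indicator (Q n) \<eta> * B \<eta>) y * \<kappa> y)
      = (LINT \<eta>|lborel. indicator (Q n) \<eta> * (B \<eta> * FD v \<kappa> \<eta>))" for n
    unfolding Q_def by (rule dist_IF_cbox[OF v \<kappa> B])
  ultimately show ?thesis using LIMSEQ_unique lim1 by simp
qed

section \<open>Smoothness through decay of localized Fourier transforms\<close>

text \<open>The radius is explicit because the operator preserves it in both directions, and because
  global smoothness needs arbitrarily large balls about one point.\<close>

definition rapid_at :: "'a::euclidean_space functional \<Rightarrow> 'a \<Rightarrow> real \<Rightarrow> bool" where
  "rapid_at v x R \<longleftrightarrow> (\<forall>\<kappa>\<in>test_functions. fun_supp \<kappa> \<subseteq> ball x R \<longrightarrow> rapid (FD v \<kappa>))"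

lemma rapid_reflect:
  assumes "rapid B" shows "rapid (\<lambda>\<eta>. B (- \<eta>))"
proof -
  have [measurable]: "B \<in> borel_measurable borel" by (rule rapid_measurable[OF assms])
  have "\<exists>C. \<forall>\<eta>. cmod (B (- \<eta>)) \<le> C * japanese \<eta> powr s" for s
    using assms unfolding rapid_def by (metis japanese_minus)
  then show ?thesis unfolding rapid_def by auto
qed

lemma integral_reflect_lborel:
  fixes f :: "'a::euclidean_space \<Rightarrow> 'b::{banach, second_countable_topology}"
  assumes "f \<in> borel_measurable borel"
  shows "(LINT x|lborel. f (- x)) = (LINT x|lborel. f x)"
  using integral_affine(1)[OF assms, of "-1" 0] by simp

lemma fun_supp_mult_subset: "fun_supp (\<lambda>x. f x * g x) \<subseteq> fun_supp g"
  by (subst fun_supp_subset_iff) (auto simp: fun_supp_zero)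

text \<open>If \<open>f\<close> is the density on the ball, then \<open>f \<kappa>\<close> is a test
  function, and \<open>FD v \<kappa>\<close> is its transform with the frequency reflected.\<close>

lemma rapid_at_of_smooth:
  assumes "dist_smooth_on (ball x R) v"
  shows "rapid_at v x R"
  unfolding rapid_at_def
proof (intro ballI impI)
  fix \<kappa> assume \<kappa>: "\<kappa> \<in> test_functions" "fun_supp \<kappa> \<subseteq> ball x R"
  obtain f where f: "smooth_on (ball x R) f"
    "\<And>\<phi>. \<phi> \<in> test_functions \<Longrightarrow> fun_supp \<phi> \<subseteq> ball x R \<Longrightarrow> v \<phi> = dist_of_fun f \<phi>"
    using assms unfolding dist_smooth_on_def by blast
  have t: "(\<lambda>y. f y * \<kappa> y) \<in> test_functions"
    by (rule test_functions_mult[OF open_ball f(1) \<kappa>])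
  have "FD v \<kappa> \<eta> = Fh (\<lambda>y. f y * \<kappa> y) (- \<eta>)" for \<eta>
  proof -
    have "FD v \<kappa> \<eta> = dist_of_fun f (\<lambda>y. ex (- \<eta>) y * \<kappa> y)"
      unfolding FD_def
      by (rule f(2)[OF test_ex_mult[OF \<kappa>(1)] order_trans[OF fun_supp_mult_subset \<kappa>(2)]])
    then show ?thesis by (simp add: dist_of_fun_def Fh_def mult.left_commute)
  qed
  then have "FD v \<kappa> = (\<lambda>\<eta>. Fh (\<lambda>y. f y * \<kappa> y) (- \<eta>))" by (simp add: fun_eq_iff)
  then show "rapid (FD v \<kappa>)" using rapid_reflect[OF rapid_Fh[OF t]] by simp
qed

text \<open>The density comes from Fourier inversion for \<open>\<kappa> v\<close>, where \<kappa>
  is 1 on the smaller ball: expand a test function by inversion, apply \<open>v\<close> under the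
  integral by \<open>dist_IF\<close>, and return by Fubini.\<close>

lemma smooth_of_rapid_at:
  fixes v :: "'a::euclidean_space functional"
  assumes v: "v \<in> distributions" and R: "rapid_at v x R" "0 < r" "r < R"
  shows "dist_smooth_on (ball x r) v"
proof -
  obtain c where c: "c \<noteq> 0" "\<And>(\<phi> :: 'a \<Rightarrow> complex) y. \<phi> \<in> test_functions \<Longrightarrow> IF (Fh \<phi>) y = c * \<phi> y"
    using Fourier_inversion by metis
  obtain \<kappa> :: "'a \<Rightarrow> complex" where \<kappa>: "\<kappa> \<in> test_functions"
    "\<And>y. y \<in> cball x r \<Longrightarrow> \<kappa> y = 1" "fun_supp \<kappa> \<subseteq> cball x ((r + R) / 2)"
    by (rule bump_test_exists[of r "(r + R) / 2" x]) (use R in auto)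
  have "cball x ((r + R) / 2) \<subseteq> ball x R" using R by (auto simp: cball_subset_ball_iff)
  then have r: "rapid (FD v \<kappa>)" using R(1) \<kappa> unfolding rapid_at_def by blast
  \<comment> \<open>\<open>FD\<close> and \<open>IF\<close> carry the same sign in the exponent,
    hence the reflection.\<close>
  define f where "f y = inverse c * IF (\<lambda>\<eta>. FD v \<kappa> (- \<eta>)) y" for y
  have [measurable]: "FD v \<kappa> \<in> borel_measurable borel" by (rule rapid_measurable[OF r])
  have fs: "smooth_on UNIV f"
    unfolding f_def by (intro smooth_on_cmult smooth_on_IF rapid_reflect r open_UNIV)
  have "v \<phi> = dist_of_fun f \<phi>" if \<phi>: "\<phi> \<in> test_functions" "fun_supp \<phi> \<subseteq> ball x r" for \<phi>
  proof -
    have [measurable]: "Fh \<phi> \<in> borel_measurable borel" by (rule rapid_measurable[OF rapid_Fh[OF \<phi>(1)]])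
    have "\<phi> y = inverse c * IF (Fh \<phi>) y * \<kappa> y" for y
      using c \<phi>(1) \<kappa>(2)[of y] fun_supp_zero[of y \<phi>] subsetD[OF \<phi>(2), of y] by (cases "y \<in> ball x r") auto
    then have "\<phi> = (\<lambda>y. inverse c * (IF (Fh \<phi>) y * \<kappa> y))"
      unfolding fun_eq_iff by (simp add: mult.assoc)
    then have "v \<phi> = inverse c * v (\<lambda>y. IF (Fh \<phi>) y * \<kappa> y)"
      using dist_cmult[OF v, of "\<lambda>y. IF (Fh \<phi>) y * \<kappa> y" "inverse c"]
        test_functions_mult'[OF smooth_on_IF[OF rapid_Fh[OF \<phi>(1)]] \<kappa>(1)] by metis
    also have "v (\<lambda>y. IF (Fh \<phi>) y * \<kappa> y) = (LINT \<eta>|lborel. Fh \<phi> \<eta> * FD v \<kappa> \<eta>)"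
      by (intro dist_IF v \<kappa> rapid_Fh smooth_on_continuous_on smooth_on_Fh \<phi>)
    also have "\<dots> = (LINT \<eta>|lborel. Fh \<phi> (- \<eta>) * FD v \<kappa> (- \<eta>))"
      by (rule integral_reflect_lborel[symmetric]) measurable
    also have "\<dots> = (LINT y|lborel. \<phi> y * IF (\<lambda>\<eta>. FD v \<kappa> (- \<eta>)) y)"
      by (subst IF_Fubini[OF integrable_test[OF \<phi>(1)] rapid_integrable[OF rapid_reflect[OF r]]])
         (simp add: mult.commute)
    also have "inverse c * \<dots> = dist_of_fun f \<phi>"
      unfolding dist_of_fun_def f_def integral_mult_right_zero[symmetric] by (simp add: mult_ac)
    finally show ?thesis .
  qed
  then show ?thesis
    unfolding dist_smooth_on_def using smooth_on_subset[OF fs subset_UNIV] by blast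
qed

lemma dist_smooth_on_subset: "dist_smooth_on U v \<Longrightarrow> V \<subseteq> U \<Longrightarrow> dist_smooth_on V v"
  unfolding dist_smooth_on_def using smooth_on_subset by (metis order_trans)

lemma notin_singsupp_iff:
  assumes "v \<in> distributions"
  shows "x \<notin> singsupp v \<longleftrightarrow> (\<exists>R>0. rapid_at v x R)"
proof
  assume "x \<notin> singsupp v"
  then obtain U where U: "open U" "x \<in> U" "dist_smooth_on U v" unfolding singsupp_def by blast
  then obtain R where "0 < R" "ball x R \<subseteq> U" by (meson open_contains_ball)
  with U show "\<exists>R>0. rapid_at v x R" using rapid_at_of_smooth dist_smooth_on_subset by blast
next
  assume "\<exists>R>0. rapid_at v x R"
  then obtain R where R: "0 < R" "rapid_at v x R" by blast
  then have "dist_smooth_on (ball x (R / 2)) v" by (intro smooth_of_rapid_at[OF assms]) auto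
  moreover have "x \<in> ball x (R / 2)" using R by simp
  ultimately show "x \<notin> singsupp v" unfolding singsupp_def using open_ball by blast
qed

text \<open>Densities on balls of all radii have to be glued; two of them agree on the smaller ball
  by the fundamental lemma.\<close>

lemma dist_smooth_UNIV_iff:
  fixes v :: "'a::euclidean_space functional"
  assumes v: "v \<in> distributions"
  shows "dist_smooth_on UNIV v \<longleftrightarrow> (\<forall>R>0. rapid_at v 0 R)"
proof
  assume "dist_smooth_on UNIV v"
  then show "\<forall>R>0. rapid_at v 0 R" using rapid_at_of_smooth dist_smooth_on_subset by blast
next
  assume R: "\<forall>R>0. rapid_at v 0 R"
  have "dist_smooth_on (ball 0 r) v" if "0 < r" for r
    by (rule smooth_of_rapid_at[OF v, of 0 "r + 1"]) (use R that in auto)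
  then have "\<forall>r. \<exists>f. 0 < r \<longrightarrow> smooth_on (ball 0 r) f \<and>
      (\<forall>\<phi>\<in>test_functions. fun_supp \<phi> \<subseteq> ball 0 r \<longrightarrow> v \<phi> = dist_of_fun f \<phi>)"
    unfolding dist_smooth_on_def by blast
  then obtain f where f: "\<And>r. 0 < r \<Longrightarrow> smooth_on (ball 0 r) (f r)"
    "\<And>r \<phi>. 0 < r \<Longrightarrow> \<phi> \<in> test_functions \<Longrightarrow> fun_supp \<phi> \<subseteq> ball 0 r \<Longrightarrow> v \<phi> = dist_of_fun (f r) \<phi>"
    by metis
  have cint: "integrable lborel (\<lambda>x. f s x * \<phi> x)" if "0 < s" "\<phi> \<in> test_functions" "fun_supp \<phi> \<subseteq> ball 0 s" for s \<phi>
    by (intro integrable_test test_functions_mult[OF open_ball f(1)] that)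
  have eq: "f r y = f s y" if rs: "0 < r" "r \<le> s" and y: "y \<in> ball 0 r" for r s and y :: 'a
  proof -
    have "f r y - f s y = 0"
    proof (rule fundamental_lemma[OF open_ball _ _ y])
      show "continuous_on (ball 0 r) (\<lambda>x. f r x - f s x)"
        using rs by (intro continuous_intros continuous_on_subset[OF smooth_on_continuous_on[OF f(1)]]) auto
      fix \<phi> :: "'a \<Rightarrow> complex" assume \<phi>: "\<phi> \<in> test_functions" "fun_supp \<phi> \<subseteq> ball 0 r"
      moreover have "fun_supp \<phi> \<subseteq> ball 0 s" using \<phi> rs by auto
      ultimately show "(LINT x|lborel. (f r x - f s x) * \<phi> x) = 0"
        using f(2)[of r \<phi>] f(2)[of s \<phi>] rs cint[of r \<phi>] cint[of s \<phi>]
        by (simp add: dist_of_fun_def left_diff_distrib)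
    qed
    then show ?thesis by simp
  qed
  \<comment> \<open>Every x lies in the open ball of radius \<open>norm x + 1\<close>, whose density
    is therefore valid in a neighborhood of x.\<close>
  define F where "F x = f (norm x + 1) x" for x
  have F: "F x = f r x" if "0 < r" "x \<in> ball 0 r" for r x
  proof (cases "norm x + 1 \<le> r")
    case True
    then show ?thesis unfolding F_def by (intro eq) (auto simp: add_nonneg_pos)
  next
    case False
    then show ?thesis unfolding F_def by (intro eq[symmetric]) (use that in auto)
  qed
  have "smooth_on UNIV F"
    unfolding smooth_on_def
  proof (intro ballI)
    fix \<alpha> :: "'a list" and x :: 'a assume \<alpha>: "\<alpha> \<in> lists Basis"
    have r: "0 < norm x + 1" by (simp add: add_nonneg_pos)
    have "smooth_on (ball 0 (norm x + 1)) F"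
      by (rule smooth_on_cong[OF open_ball _ f(1)[OF r]]) (use F[OF r] in simp)
    then show "iterD \<alpha> F differentiable (at x)"
      using \<alpha> unfolding smooth_on_def by auto
  qed
  moreover have "v \<phi> = dist_of_fun F \<phi>" if \<phi>: "\<phi> \<in> test_functions" for \<phi>
  proof -
    obtain r where r: "0 < r" "fun_supp \<phi> \<subseteq> ball 0 r"
      using bounded_subset_ballD[OF compact_imp_bounded[OF test_functions_compact[OF \<phi>]], of 0] by blast
    have "f r x * \<phi> x = F x * \<phi> x" for x
      using F[OF r(1), of x] fun_supp_zero[of x \<phi>] subsetD[OF r(2), of x] by (cases "x \<in> ball 0 r") auto
    then have "(\<lambda>x. f r x * \<phi> x) = (\<lambda>x. F x * \<phi> x)" by (rule ext)
    then show ?thesis using f(2)[OF r(1) \<phi> r(2)] by (simp only: dist_of_fun_def)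
  qed
  ultimately show "dist_smooth_on UNIV v" unfolding dist_smooth_on_def by blast
qed

text \<open>Vanishing on small open sets has to be added up: finitely many balls cover the compact
  support of \<phi>, and bumps split off one ball at a time, in place of a partition of
  unity.\<close>

lemma dist_zero_off_supp:
  assumes v: "v \<in> distributions" and \<phi>: "\<phi> \<in> test_functions" "fun_supp \<phi> \<inter> dist_supp v = {}"
  shows "v \<phi> = 0"
proof -
  \<comment> \<open>The doubled radius leaves room for a bump that equals 1 on the ball of radius
    r.\<close>
  define G where "G x r \<longleftrightarrow> 0 < r \<and> (\<forall>\<psi>\<in>test_functions. fun_supp \<psi> \<subseteq> cball x (2 * r) \<longrightarrow> v \<psi> = 0)" for x r
  have "\<exists>r. G x r" if "x \<in> fun_supp \<phi>" for x
  proof -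
    have "x \<notin> dist_supp v" using that \<phi>(2) by blast
    then obtain U where U: "open U" "x \<in> U" "\<And>\<psi>. \<psi> \<in> test_functions \<Longrightarrow> fun_supp \<psi> \<subseteq> U \<Longrightarrow> v \<psi> = 0"
      unfolding dist_supp_def by blast
    then obtain e where "0 < e" "cball x e \<subseteq> U" by (meson open_contains_cball)
    then have "G x (e / 2)" using U(3) unfolding G_def by auto
    then show ?thesis ..
  qed
  then obtain r where r: "\<And>x. x \<in> fun_supp \<phi> \<Longrightarrow> G x (r x)" by metis
  obtain I where I: "I \<subseteq> fun_supp \<phi>" "finite I" "fun_supp \<phi> \<subseteq> (\<Union>x\<in>I. ball x (r x))"
  proof (rule compactE_image[OF test_functions_compact[OF \<phi>(1)], of "fun_supp \<phi>" "\<lambda>x. ball x (r x)"])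
    show "fun_supp \<phi> \<subseteq> (\<Union>x\<in>fun_supp \<phi>. ball x (r x))" using r by (force simp: G_def)
  qed (use that in auto)
  have "v \<psi> = 0" if "\<psi> \<in> test_functions" "\<And>x. x \<notin> (\<Union>x\<in>I. ball x (r x)) \<Longrightarrow> \<psi> x = 0" for \<psi>
    using I(2,1) that
  proof (induction I arbitrary: \<psi> rule: finite_induct)
    case empty
    then have "\<psi> = (\<lambda>x. 0)" by auto
    then show ?case using dist_0[OF v] by simp
  next
    case (insert a I)
    have G: "G a (r a)" using insert.prems(1) r by blast
    obtain \<kappa> :: "'a \<Rightarrow> complex" where \<kappa>: "\<kappa> \<in> test_functions"
      "\<And>y. y \<in> cball a (r a) \<Longrightarrow> \<kappa> y = 1" "fun_supp \<kappa> \<subseteq> cball a (2 * r a)"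
      by (rule bump_test_exists[of "r a" "2 * r a" a]) (use G in \<open>auto simp: G_def\<close>)
    have t: "(\<lambda>x. \<kappa> x * \<psi> x) \<in> test_functions" "(\<lambda>x. (1 - \<kappa> x) * \<psi> x) \<in> test_functions"
      by (intro test_functions_mult' insert.prems smooth_on_diff smooth_on_const test_functions_smooth \<kappa> open_UNIV)+
    have "v \<psi> = v (\<lambda>x. \<kappa> x * \<psi> x) + v (\<lambda>x. (1 - \<kappa> x) * \<psi> x)"
      by (subst dist_add[OF v t, symmetric]) (simp add: algebra_simps)
    moreover have "v (\<lambda>x. \<kappa> x * \<psi> x) = 0"
    proof -
      have "fun_supp (\<lambda>x. \<kappa> x * \<psi> x) \<subseteq> cball a (2 * r a)"
        using fun_supp_mult_subset[of \<psi> \<kappa>] \<kappa>(3) by (simp add: mult.commute)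
      then show ?thesis using G t(1) unfolding G_def by blast
    qed
    moreover have "v (\<lambda>x. (1 - \<kappa> x) * \<psi> x) = 0"
    proof (rule insert.IH)
      show "(1 - \<kappa> x) * \<psi> x = 0" if "x \<notin> (\<Union>x\<in>I. ball x (r x))" for x
        using that insert.prems(3)[of x] \<kappa>(2)[of x] by (cases "x \<in> ball a (r a)") auto
    qed (use insert.prems t in auto)
    ultimately show ?case by simp
  qed
  moreover have "\<phi> x = 0" if "x \<notin> (\<Union>x\<in>I. ball x (r x))" for x
    using fun_supp_zero[of x \<phi>] subsetD[OF I(3), of x] that by blast
  ultimately show ?thesis by (meson \<phi>(1))
qed

section \<open>Symbols\<close>

lemma symbol_smooth: "p \<in> symbol_class m \<Longrightarrow> smooth_on UNIV p"
  by (simp add: symbol_class_def)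

text \<open>In \<open>symbol_class\<close> the x-derivatives stand outermost, whereas the new one
  falls innermost; it is commuted past the \<theta>-derivatives. In \<open>symbol_D_snd\<close> the
  new derivative already stands in its place.\<close>

lemma symbol_D_fst:
  fixes p :: "'a::euclidean_space \<times> 'b::euclidean_space \<Rightarrow> complex"
  assumes p: "p \<in> symbol_class m" and b: "b \<in> Basis"
  shows "D (b, 0) p \<in> symbol_class m"
  unfolding symbol_class_def
proof (intro CollectI conjI ballI allI impI)
  show "smooth_on UNIV (D (b, 0) p)" using p b by (intro smooth_on_D symbol_smooth) auto
  fix \<alpha> :: "'a list" and \<beta> :: "'b list" and K :: "'a set"
  assume a: "\<alpha> \<in> lists Basis" "\<beta> \<in> lists Basis" "compact K"
  let ?A = "map (\<lambda>b. (b, 0)) \<alpha>" and ?B = "map (\<lambda>b. (0, b)) \<beta>"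
  have "iterD (?A @ ?B) (D (b, 0) p) = iterD ?A (D (b, 0) (iterD ?B p))"
    using a b p by (subst iterD_append, subst iterD_D_commute) (auto simp: symbol_smooth)
  also have "\<dots> = iterD (map (\<lambda>b. (b, 0)) (\<alpha> @ [b]) @ ?B) p"
    by (simp add: iterD_append iterD_Cons)
  finally have eq: "iterD (?A @ ?B) (D (b, 0) p) = iterD (map (\<lambda>b. (b, 0)) (\<alpha> @ [b]) @ ?B) p" .
  have "\<alpha> @ [b] \<in> lists Basis" using a b by simp
  then show "\<exists>C. \<forall>x\<in>K. \<forall>\<theta>. cmod (iterD (?A @ ?B) (D (b, 0) p) (x, \<theta>))
      \<le> C * japanese \<theta> powr (m - real (length \<beta>))"
    unfolding eq using p a unfolding symbol_class_def by blast
qed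

lemma symbol_D_snd:
  fixes p :: "'a::euclidean_space \<times> 'b::euclidean_space \<Rightarrow> complex"
  assumes p: "p \<in> symbol_class m" and b: "b \<in> Basis"
  shows "D (0, b) p \<in> symbol_class (m - 1)"
  unfolding symbol_class_def
proof (intro CollectI conjI ballI allI impI)
  show "smooth_on UNIV (D (0, b) p)" using p b by (intro smooth_on_D symbol_smooth) auto
  fix \<alpha> :: "'a list" and \<beta> :: "'b list" and K :: "'a set"
  assume a: "\<alpha> \<in> lists Basis" "\<beta> \<in> lists Basis" "compact K"
  let ?A = "map (\<lambda>b. (b, 0)) \<alpha>" and ?B = "map (\<lambda>b. (0, b)) \<beta>"
  have eq: "iterD (?A @ ?B) (D (0, b) p) = iterD (?A @ map (\<lambda>b. (0, b)) (\<beta> @ [b])) p"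
    by (simp add: iterD_append iterD_Cons)
  have "\<beta> @ [b] \<in> lists Basis" using a b by simp
  then have "\<exists>C. \<forall>x\<in>K. \<forall>\<theta>. cmod (iterD (?A @ map (\<lambda>b. (0, b)) (\<beta> @ [b])) p (x, \<theta>))
      \<le> C * japanese \<theta> powr (m - real (length (\<beta> @ [b])))"
    using p a unfolding symbol_class_def by blast
  then show "\<exists>C. \<forall>x\<in>K. \<forall>\<theta>. cmod (iterD (?A @ ?B) (D (0, b) p) (x, \<theta>))
      \<le> C * japanese \<theta> powr (m - 1 - real (length \<beta>))"
    unfolding eq by (simp add: algebra_simps)
qed

lemma symbol_iterD_fst:
  "p \<in> symbol_class m \<Longrightarrow> \<alpha> \<in> lists Basis \<Longrightarrow> iterD (map (\<lambda>b. (b, 0)) \<alpha>) p \<in> symbol_class m"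
  by (induction \<alpha>) (auto simp: iterD_Cons symbol_D_fst)

lemma symbol_bound_0:
  assumes "p \<in> symbol_class m" "compact K"
  obtains C where "0 \<le> C" "\<And>x \<theta>. x \<in> K \<Longrightarrow> cmod (p (x, \<theta>)) \<le> C * japanese \<theta> powr m"
proof -
  obtain C where C: "\<And>x \<theta>. x \<in> K \<Longrightarrow> cmod (p (x, \<theta>)) \<le> C * japanese \<theta> powr m"
    using assms(1)[unfolded symbol_class_def, THEN CollectD, THEN conjunct2, rule_format, of "[]" "[]" K] assms(2)
    by auto
  show ?thesis
  proof (rule that[of "\<bar>C\<bar>"])
    show "cmod (p (x, \<theta>)) \<le> \<bar>C\<bar> * japanese \<theta> powr m" if "x \<in> K" for x \<theta>
      by (rule order_trans[OF C[OF that]]) (auto intro!: mult_right_mono)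
  qed simp
qed

text \<open>Constants for single multi-indices become one constant for the whole family, because
  only finitely many multi-indices have length at most \<open>N\<close>.\<close>

lemma dbound_slice_family:
  fixes f :: "'c \<Rightarrow> 'a::euclidean_space \<Rightarrow> complex"
  assumes "\<And>\<alpha>. \<alpha> \<in> lists Basis \<Longrightarrow> \<exists>C\<ge>0. \<forall>i\<in>I. \<forall>x\<in>K. cmod (iterD \<alpha> (f i) x) \<le> C * w i"
    and "\<And>i. i \<in> I \<Longrightarrow> 0 \<le> w i"
  obtains C where "0 \<le> C" "\<And>i x. i \<in> I \<Longrightarrow> x \<in> K \<Longrightarrow> dbound N (f i) x (C * w i)"
proof -
  let ?A = "{\<alpha> \<in> lists (Basis :: 'a set). length \<alpha> \<le> N}"
  have "\<forall>\<alpha>\<in>?A. \<exists>C. 0 \<le> C \<and> (\<forall>i\<in>I. \<forall>x\<in>K. cmod (iterD \<alpha> (f i) x) \<le> C * w i)"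
    using assms(1) by blast
  from bchoice[OF this] obtain C where C0:
    "\<forall>\<alpha>\<in>?A. 0 \<le> C \<alpha> \<and> (\<forall>i\<in>I. \<forall>x\<in>K. cmod (iterD \<alpha> (f i) x) \<le> C \<alpha> * w i)" ..
  then have C: "\<And>\<alpha>. \<alpha> \<in> ?A \<Longrightarrow> 0 \<le> C \<alpha>"
    "\<And>\<alpha> i x. \<alpha> \<in> ?A \<Longrightarrow> i \<in> I \<Longrightarrow> x \<in> K \<Longrightarrow> cmod (iterD \<alpha> (f i) x) \<le> C \<alpha> * w i"
    by blast+
  show ?thesis
  proof (rule that[of "sum C ?A"])
    show "0 \<le> sum C ?A" using C(1) by (rule sum_nonneg)
    show "dbound N (f i) x (sum C ?A * w i)" if "i \<in> I" "x \<in> K" for i x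
      unfolding dbound_def
    proof (intro ballI impI)
      fix \<alpha> :: "'a list" assume "\<alpha> \<in> lists Basis" "length \<alpha> \<le> N"
      then have \<alpha>: "\<alpha> \<in> ?A" by simp
      have "C \<alpha> \<le> sum C ?A" by (rule member_le_sum[OF \<alpha>]) (use C(1) finite_multi_indices in auto)
      then have "C \<alpha> * w i \<le> sum C ?A * w i" by (intro mult_right_mono assms(2) that)
      with C(2)[OF \<alpha> that] show "cmod (iterD \<alpha> (f i) x) \<le> sum C ?A * w i" by linarith
    qed
  qed
qed

lemma symbol_dbound:
  fixes p :: "'a::euclidean_space \<times> 'b::euclidean_space \<Rightarrow> complex"
  assumes p: "p \<in> symbol_class m" and K: "compact K"
  obtains C where "0 \<le> C" "\<And>x \<theta>. x \<in> K \<Longrightarrow> dbound N (\<lambda>x. p (x, \<theta>)) x (C * japanese \<theta> powr m)"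
proof (rule dbound_slice_family[of UNIV K "\<lambda>\<theta> x. p (x, \<theta>)" "\<lambda>\<theta>. japanese \<theta> powr m" N])
  fix \<alpha> :: "'a list" assume \<alpha>: "\<alpha> \<in> lists Basis"
  obtain C where "0 \<le> C" "\<And>x \<theta>. x \<in> K \<Longrightarrow>
      cmod (iterD (map (\<lambda>b. (b, 0)) \<alpha>) p (x, \<theta>)) \<le> C * japanese \<theta> powr m"
    using symbol_bound_0[OF symbol_iterD_fst[OF p \<alpha>] K] by blast
  then show "\<exists>C\<ge>0. \<forall>\<theta>\<in>UNIV. \<forall>x\<in>K. cmod (iterD \<alpha> (\<lambda>x. p (x, \<theta>)) x) \<le> C * japanese \<theta> powr m"
    using iterD_slice_fst[OF open_UNIV symbol_smooth[OF p] \<alpha>] by auto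
qed (use that in auto)

text \<open>Mean value inequality along the segment from \<xi> to \<eta>, with a frequency
  derivative of order m - 1. One power of the distance is the length of the segment, the other |m -
  1| come from Peetre's inequality.\<close>

lemma symbol_increment:
  fixes p :: "'a::euclidean_space \<times> 'b::euclidean_space \<Rightarrow> complex"
  assumes p: "p \<in> symbol_class m" and K: "compact K"
  obtains C where "0 \<le> C" "\<And>x \<eta> \<xi>. x \<in> K \<Longrightarrow> cmod (p (x, \<eta>) - p (x, \<xi>)) \<le>
    C * (japanese \<xi> powr (m - 1) * japanese (\<eta> - \<xi>) powr (\<bar>m - 1\<bar> + 1))"
proof -
  have "\<forall>b\<in>Basis. \<exists>C. 0 \<le> C \<and> (\<forall>x\<in>K. \<forall>\<theta>. cmod (D (0, b) p (x, \<theta>)) \<le> C * japanese \<theta> powr (m - 1))"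
    using symbol_bound_0[OF symbol_D_snd[OF p] K] by metis
  then obtain C where C: "\<And>b. b \<in> Basis \<Longrightarrow> 0 \<le> C b"
    "\<And>b x \<theta>. b \<in> Basis \<Longrightarrow> x \<in> K \<Longrightarrow> cmod (D (0, b) p (x, \<theta>)) \<le> C b * japanese \<theta> powr (m - 1)"
    by metis
  let ?C = "sum C Basis * 2 powr \<bar>m - 1\<bar>"
  show ?thesis
  proof (rule that[of ?C])
    show "0 \<le> ?C" using C(1) by (auto intro!: mult_nonneg_nonneg sum_nonneg)
    fix x and \<eta> \<xi> :: 'b assume x: "x \<in> K"
    let ?B = "?C * (japanese \<xi> powr (m - 1) * japanese (\<eta> - \<xi>) powr \<bar>m - 1\<bar>)"
    define F where "F h \<theta> = \<i> * D (0, h) p (x, \<theta>)" for h \<theta>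
    have d: "((\<lambda>\<theta>. p (x, \<theta>)) has_derivative (\<lambda>h. F h \<theta>)) (at \<theta> within S)" for \<theta> S
    proof -
      have "((\<lambda>y. (x, y)) has_derivative (\<lambda>h. (0, h))) (at \<theta>)"
        by (auto intro!: has_derivative_Pair derivative_intros)
      from has_derivative_compose[OF this D_has_derivative[OF smooth_on_differentiable[OF symbol_smooth[OF p] UNIV_I]]]
      show ?thesis unfolding F_def by (rule has_derivative_at_withinI)
    qed
    have on: "onorm (\<lambda>h. F h \<theta>) \<le> ?B" if \<theta>: "\<theta> \<in> closed_segment \<xi> \<eta>" for \<theta>
    proof -
      \<comment> \<open>Points of the segment are no farther from \<xi> than \<eta> is, so Peetre's
        inequality holds uniformly on it.\<close>
      have "norm (\<theta> - \<xi>) \<le> norm (\<eta> - \<xi>)"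
        using segment_bound1[OF \<theta>] by simp
      then have le: "japanese (\<theta> - \<xi>) \<le> japanese (\<eta> - \<xi>)"
        by (auto simp: japanese_def intro!: power_mono)
      have w: "japanese \<theta> powr (m - 1) \<le> 2 powr \<bar>m - 1\<bar> * (japanese \<xi> powr (m - 1) * japanese (\<eta> - \<xi>) powr \<bar>m - 1\<bar>)"
        by (rule order_trans[OF Peetre[of \<theta> "m - 1" \<xi>]])
           (use le in \<open>auto intro!: mult_left_mono powr_mono2\<close>)
      show ?thesis
      proof (rule onorm_le)
        fix h
        interpret bounded_linear "\<lambda>h. F h \<theta>" by (rule has_derivative_bounded_linear[OF d[of \<theta> UNIV]])
        have "F h \<theta> = F (\<Sum>b\<in>Basis. (h \<bullet> b) *\<^sub>R b) \<theta>" by (simp add: euclidean_representation)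
        also have "\<dots> = (\<Sum>b\<in>Basis. (h \<bullet> b) *\<^sub>R F b \<theta>)" by (simp add: sum scaleR)
        also have "cmod \<dots> \<le> (\<Sum>b\<in>Basis. norm h * (C b * japanese \<theta> powr (m - 1)))"
          using C(2)[OF _ x] by (intro sum_norm_le) (auto simp: F_def norm_mult intro!: mult_mono Basis_le_norm)
        also have "\<dots> = sum C Basis * japanese \<theta> powr (m - 1) * norm h"
          by (simp add: sum_distrib_right sum_distrib_left mult_ac)
        also have "\<dots> \<le> ?B * norm h"
          using mult_left_mono[OF w, of "sum C Basis"] sum_nonneg[of Basis C] C(1)
          by (intro mult_right_mono) (auto simp: mult_ac)
        finally show "cmod (F h \<theta>) \<le> ?B * norm h" .
      qed
    qed
    have seg: "\<xi> + t *\<^sub>R (\<eta> - \<xi>) \<in> closed_segment \<xi> \<eta>" if "t \<in> {0..1}" for t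
      using that by (auto simp: in_segment algebra_simps intro!: exI[of _ t])
    have "cmod (p (x, \<xi> + (\<eta> - \<xi>)) - p (x, \<xi>)) \<le> norm (\<eta> - \<xi>) * ?B"
      by (rule differentiable_bound_segment[where G="closed_segment \<xi> \<eta>", OF seg d on[OF seg]])
    also have "\<dots> \<le> japanese (\<eta> - \<xi>) * ?B"
      using \<open>0 \<le> ?C\<close> by (intro mult_right_mono norm_le_japanese) auto
    finally show "cmod (p (x, \<eta>) - p (x, \<xi>)) \<le>
        ?C * (japanese \<xi> powr (m - 1) * japanese (\<eta> - \<xi>) powr (\<bar>m - 1\<bar> + 1))"
      by (simp add: powr_add mult_ac)
  qed
qed

lemma iterD_diff:
  assumes "open U" "smooth_on U f" "smooth_on U g" "\<alpha> \<in> lists Basis" "x \<in> U"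
  shows "iterD \<alpha> (\<lambda>x. f x - g x) x = iterD \<alpha> f x - iterD \<alpha> g x"
  using assms(4,5)
proof (induction \<alpha> arbitrary: x)
  case (Cons b \<alpha>)
  have d: "iterD \<alpha> f differentiable (at x)" "iterD \<alpha> g differentiable (at x)"
    using Cons smooth_on_differentiable[OF smooth_on_iterD[OF assms(2)]]
      smooth_on_differentiable[OF smooth_on_iterD[OF assms(3)]] by auto
  have "D b (iterD \<alpha> (\<lambda>x. f x - g x)) x = D b (\<lambda>x. iterD \<alpha> f x - iterD \<alpha> g x) x"
    by (rule D_cong_open[OF assms(1)]) (use Cons in auto)
  also have "\<dots> = D b (iterD \<alpha> f) x - D b (iterD \<alpha> g) x"
    by (subst D_eq[OF has_derivative_diff[OF D_has_derivative[OF d(1)] D_has_derivative[OF d(2)]]])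
       (simp add: algebra_simps)
  finally show ?case by (simp add: iterD_Cons)
qed simp

text \<open>The x-derivatives of \<open>p\<close> are symbols of the same order, so
  \<open>symbol_increment\<close> applies to each of them.\<close>

lemma symbol_increment_dbound:
  fixes p :: "'a::euclidean_space \<times> 'b::euclidean_space \<Rightarrow> complex"
  assumes p: "p \<in> symbol_class m" and K: "compact K"
  obtains C where "0 \<le> C" "\<And>x \<eta> \<xi>. x \<in> K \<Longrightarrow> dbound N (\<lambda>x. p (x, \<eta>) - p (x, \<xi>)) x
    (C * (japanese \<xi> powr (m - 1) * japanese (\<eta> - \<xi>) powr (\<bar>m - 1\<bar> + 1)))"
proof (rule dbound_slice_family[of UNIV K "\<lambda>(\<eta>, \<xi>) x. p (x, \<eta>) - p (x, \<xi>)"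
      "\<lambda>(\<eta>, \<xi>). japanese \<xi> powr (m - 1) * japanese (\<eta> - \<xi>) powr (\<bar>m - 1\<bar> + 1)" N])
  fix \<alpha> :: "'a list" assume \<alpha>: "\<alpha> \<in> lists Basis"
  let ?q = "iterD (map (\<lambda>b. (b, 0)) \<alpha>) p"
  obtain C where C: "0 \<le> C" "\<And>x \<eta> \<xi>. x \<in> K \<Longrightarrow>
      cmod (?q (x, \<eta>) - ?q (x, \<xi>)) \<le> C * (japanese \<xi> powr (m - 1) * japanese (\<eta> - \<xi>) powr (\<bar>m - 1\<bar> + 1))"
    using symbol_increment[OF symbol_iterD_fst[OF p \<alpha>] K] by blast
  have sl: "smooth_on UNIV (\<lambda>x. p (x, \<eta>))" for \<eta>
    by (rule smooth_on_slice_fst[OF open_UNIV symbol_smooth[OF p] open_UNIV]) auto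
  have "iterD \<alpha> (\<lambda>x. p (x, \<eta>) - p (x, \<xi>)) x = iterD \<alpha> (\<lambda>x. p (x, \<eta>)) x - iterD \<alpha> (\<lambda>x. p (x, \<xi>)) x" for x \<eta> \<xi>
    by (rule iterD_diff[OF open_UNIV sl sl \<alpha>]) simp
  then show "\<exists>C\<ge>0. \<forall>i\<in>UNIV. \<forall>x\<in>K. cmod (iterD \<alpha> ((\<lambda>(\<eta>, \<xi>) x. p (x, \<eta>) - p (x, \<xi>)) i) x)
      \<le> C * (case i of (\<eta>, \<xi>) \<Rightarrow> japanese \<xi> powr (m - 1) * japanese (\<eta> - \<xi>) powr (\<bar>m - 1\<bar> + 1))"
    using C iterD_slice_fst[OF open_UNIV symbol_smooth[OF p] \<alpha>] by auto
next
  fix C assume C: "0 \<le> C" "\<And>i x. i \<in> UNIV \<Longrightarrow> x \<in> K \<Longrightarrow>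
      dbound N ((\<lambda>(\<eta>, \<xi>) x. p (x, \<eta>) - p (x, \<xi>)) i) x
       (C * (case i of (\<eta>, \<xi>) \<Rightarrow> japanese \<xi> powr (m - 1) * japanese (\<eta> - \<xi>) powr (\<bar>m - 1\<bar> + 1)))"
  show thesis
    by (rule that[OF C(1)]) (use C(2)[of "(_, _)"] in auto)
qed auto

lemma integrable_japanese_translate:
  assumes "s \<le> - 2 * real DIM('a::euclidean_space)"
  shows "integrable lborel (\<lambda>\<eta>::'a. japanese (\<eta> - \<xi>) powr s)"
    and "(LINT \<eta>|lborel. japanese (\<eta> - \<xi>) powr s) = (LINT \<eta>|lborel. japanese (\<eta>::'a) powr s)"
  using integral_translate[of "\<lambda>\<eta>::'a. japanese \<eta> powr s" "- \<xi>"] integrable_japanese[OF assms]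
  by auto

text \<open>A kernel decaying in \<eta> - \<xi> transfers the order \<open>s\<close> from \<eta> to
  \<xi>: Peetre's inequality costs |s| powers of the distance, \<open>t\<close> admits further
  growth, and 2n powers remain for integrability. By translation invariance the remaining integral
  is independent of \<xi>.\<close>

lemma japanese_convolution:
  fixes \<xi> :: "'a::euclidean_space"
  assumes N: "\<bar>s\<bar> + t + 2 * real DIM('a) \<le> N"
    and g: "\<And>\<eta>. cmod (g \<eta>) \<le> C * (japanese \<eta> powr s * japanese (\<eta> - \<xi>) powr t * japanese (\<eta> - \<xi>) powr (- N))"
    and C: "0 \<le> C"
  shows "(LINT \<eta>|lborel. cmod (g \<eta>)) \<le> C * (2 powr \<bar>s\<bar> *
      (LINT \<eta>|lborel. japanese (\<eta>::'a) powr (- 2 * real DIM('a)))) * japanese \<xi> powr s"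
proof -
  let ?n = "- 2 * real DIM('a)"
  have b: "cmod (g \<eta>) \<le> (C * 2 powr \<bar>s\<bar> * japanese \<xi> powr s) * japanese (\<eta> - \<xi>) powr ?n" for \<eta>
  proof -
    have "japanese \<eta> powr s * japanese (\<eta> - \<xi>) powr t * japanese (\<eta> - \<xi>) powr (- N)
       \<le> 2 powr \<bar>s\<bar> * (japanese \<xi> powr s * japanese (\<eta> - \<xi>) powr \<bar>s\<bar>) * japanese (\<eta> - \<xi>) powr t
         * japanese (\<eta> - \<xi>) powr (- N)"
      by (intro mult_right_mono Peetre) auto
    also have "\<dots> = 2 powr \<bar>s\<bar> * japanese \<xi> powr s * japanese (\<eta> - \<xi>) powr (\<bar>s\<bar> + t - N)"
      by (simp add: powr_add[symmetric] mult.assoc)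
    also have "\<dots> \<le> 2 powr \<bar>s\<bar> * japanese \<xi> powr s * japanese (\<eta> - \<xi>) powr ?n"
      using N by (intro mult_left_mono japanese_powr_mono) auto
    finally have "C * (japanese \<eta> powr s * japanese (\<eta> - \<xi>) powr t * japanese (\<eta> - \<xi>) powr (- N))
       \<le> C * (2 powr \<bar>s\<bar> * japanese \<xi> powr s * japanese (\<eta> - \<xi>) powr ?n)"
      by (rule mult_left_mono[OF _ C])
    with g[of \<eta>] show ?thesis by (simp add: mult_ac)
  qed
  have i: "integrable lborel (\<lambda>\<eta>. (C * 2 powr \<bar>s\<bar> * japanese \<xi> powr s) * japanese (\<eta> - \<xi>) powr ?n)"
    by (intro integrable_mult_right integrable_japanese_translate) simp
  have "norm (LINT \<eta>|lborel. cmod (g \<eta>)) \<le> (LINT \<eta>|lborel. (C * 2 powr \<bar>s\<bar> * japanese \<xi> powr s) * japanese (\<eta> - \<xi>) powr ?n)"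
    by (rule norm_integral_le[OF i]) (use b in auto)
  then show ?thesis using integrable_japanese_translate(2)[of ?n \<xi>] by (simp add: mult_ac)
qed

section \<open>The transposed operator\<close>

text \<open>Up to the factor \<open>(2\<pi>)\<^bsup>-n\<^esup>\<close>, \<open>Op p \<psi>\<close> is the transpose of the operator with left symbol \<open>p\<close>
  applied to \<open>\<psi>\<close>.\<close>

definition Op :: "('a::euclidean_space \<times> 'a \<Rightarrow> complex) \<Rightarrow> ('a \<Rightarrow> complex) \<Rightarrow> 'a \<Rightarrow> complex" where
  "Op p \<psi> = IF (\<lambda>\<eta>. Fh (\<lambda>x. p (x, \<eta>) * \<psi> x) \<eta>)"

text \<open>The values are smooth functions of possibly non-compact support: proper support belongs
  to the whole transpose and need not hold for its oscillatory and smooth parts separately.\<close>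

definition linop :: "(('a::euclidean_space \<Rightarrow> complex) \<Rightarrow> 'a \<Rightarrow> complex) \<Rightarrow> bool" where
  "linop F \<longleftrightarrow> (\<forall>\<phi>\<in>test_functions. smooth_on UNIV (F \<phi>)) \<and>
     (\<forall>\<phi>\<in>test_functions. \<forall>\<psi>\<in>test_functions. F (\<lambda>x. \<phi> x + \<psi> x) = (\<lambda>y. F \<phi> y + F \<psi> y)) \<and>
     (\<forall>c. \<forall>\<phi>\<in>test_functions. F (\<lambda>x. c * \<phi> x) = (\<lambda>y. c * F \<phi> y))"

lemma linop_smooth: "linop F \<Longrightarrow> \<phi> \<in> test_functions \<Longrightarrow> smooth_on UNIV (F \<phi>)"
  and linop_add: "linop F \<Longrightarrow> \<phi> \<in> test_functions \<Longrightarrow> \<psi> \<in> test_functions \<Longrightarrow>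
    F (\<lambda>x. \<phi> x + \<psi> x) = (\<lambda>y. F \<phi> y + F \<psi> y)"
  and linop_cmult: "linop F \<Longrightarrow> \<phi> \<in> test_functions \<Longrightarrow> F (\<lambda>x. c * \<phi> x) = (\<lambda>y. c * F \<phi> y)"
  unfolding linop_def by blast+

text \<open>The operator \<open>F\<close> maps \<open>h e\<^bsup>-i\<langle>x,\<xi>\<rangle>\<^esup>\<close>, with \<open>h\<close> supported in \<open>K\<close>, to a function whose derivatives up
  to order \<open>n\<close> are \<open>O(\<langle>\<xi>\<rangle>\<^sup>s)\<close> on \<open>Y\<close>, uniformly in terms of finitely many derivatives of \<open>h\<close>.\<close>

definition est_const :: "'a::euclidean_space set \<Rightarrow> 'a set \<Rightarrow> real \<Rightarrow> nat \<Rightarrow> (('a \<Rightarrow> complex) \<Rightarrow> 'a \<Rightarrow> complex) \<Rightarrow>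
    real \<Rightarrow> nat \<Rightarrow> bool" where
  "est_const K Y s n F C N \<longleftrightarrow> 0 \<le> C \<and> (\<forall>h M \<xi> y. smooth_on UNIV h \<longrightarrow> (\<forall>x. x \<notin> K \<longrightarrow> h x = 0) \<longrightarrow> 0 \<le> M \<longrightarrow>
     (\<forall>x\<in>K. dbound N h x M) \<longrightarrow> y \<in> Y \<longrightarrow>
     dbound n (F (\<lambda>x. h x * ex (- \<xi>) x)) y (C * M * japanese \<xi> powr s))"

definition est :: "'a::euclidean_space set \<Rightarrow> 'a set \<Rightarrow> real \<Rightarrow> nat \<Rightarrow> (('a \<Rightarrow> complex) \<Rightarrow> 'a \<Rightarrow> complex) \<Rightarrow> bool" where
  "est K Y s n F \<longleftrightarrow> (\<exists>C N. est_const K Y s n F C N)"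

lemma est_constD: "est_const K Y s n F C N \<Longrightarrow> smooth_on UNIV h \<Longrightarrow> (\<And>x. x \<notin> K \<Longrightarrow> h x = 0) \<Longrightarrow> 0 \<le> M \<Longrightarrow>
     (\<And>x. x \<in> K \<Longrightarrow> dbound N h x M) \<Longrightarrow> y \<in> Y \<Longrightarrow>
     dbound n (F (\<lambda>x. h x * ex (- \<xi>) x)) y (C * M * japanese \<xi> powr s)"
  unfolding est_const_def by blast

lemma estI:
  assumes "0 \<le> C" "\<And>h M \<xi> y. smooth_on UNIV h \<Longrightarrow> (\<And>x. x \<notin> K \<Longrightarrow> h x = 0) \<Longrightarrow> 0 \<le> M \<Longrightarrow>
     (\<And>x. x \<in> K \<Longrightarrow> dbound N h x M) \<Longrightarrow> y \<in> Y \<Longrightarrow>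
     dbound n (F (\<lambda>x. h x * ex (- \<xi>) x)) y (C * M * japanese \<xi> powr s)"
  shows "est K Y s n F"
  unfolding est_def est_const_def using assms by (intro exI[of _ C] exI[of _ N]) blast

lemma estE:
  assumes "est K Y s n F"
  obtains C N where "0 \<le> C" "\<And>h M \<xi> y. smooth_on UNIV h \<Longrightarrow> (\<And>x. x \<notin> K \<Longrightarrow> h x = 0) \<Longrightarrow> 0 \<le> M \<Longrightarrow>
     (\<And>x. x \<in> K \<Longrightarrow> dbound N h x M) \<Longrightarrow> y \<in> Y \<Longrightarrow>
     dbound n (F (\<lambda>x. h x * ex (- \<xi>) x)) y (C * M * japanese \<xi> powr s)"
  using assms unfolding est_def est_const_def by blast

lemma test_mult_ex:
  "compact K \<Longrightarrow> smooth_on UNIV h \<Longrightarrow> (\<And>x. x \<notin> K \<Longrightarrow> h x = 0) \<Longrightarrow> (\<lambda>x. h x * ex z x) \<in> test_functions"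
  by (rule test_functionsI[of _ K]) (auto intro!: smooth_on_mult smooth_on_ex)

lemma est_mono:
  fixes K :: "'a::euclidean_space set"
  assumes "est K Y s n F" "s \<le> s'"
  shows "est K Y s' n F"
proof -
  obtain C N where C: "0 \<le> C" "\<And>h M \<xi> y. smooth_on UNIV h \<Longrightarrow> (\<And>x. x \<notin> K \<Longrightarrow> h x = 0) \<Longrightarrow> 0 \<le> M \<Longrightarrow>
     (\<And>x. x \<in> K \<Longrightarrow> dbound N h x M) \<Longrightarrow> y \<in> Y \<Longrightarrow>
     dbound n (F (\<lambda>x. h x * ex (- \<xi>) x)) y (C * M * japanese \<xi> powr s)"
    using estE[OF assms(1)] by blast
  show ?thesis
  proof (rule estI[of C K N])
    fix h M y and \<xi> :: 'a assume h: "smooth_on UNIV h" "\<And>x. x \<notin> K \<Longrightarrow> h x = 0" "0 \<le> M"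
      "\<And>x. x \<in> K \<Longrightarrow> dbound N h x M" "y \<in> Y"
    have "C * M * japanese \<xi> powr s \<le> C * M * japanese \<xi> powr s'"
      using C(1) h(3) assms(2) by (intro mult_left_mono japanese_powr_mono) auto
    with C(2)[OF h] show "dbound n (F (\<lambda>x. h x * ex (- \<xi>) x)) y (C * M * japanese \<xi> powr s')"
      by (rule dbound_mono[OF _ order_refl])
  qed (rule C(1))
qed

lemma est_cong:
  fixes K :: "'a::euclidean_space set"
  assumes "compact K" "est K Y s n F" "\<And>\<psi>. \<psi> \<in> test_functions \<Longrightarrow> F \<psi> = G \<psi>"
  shows "est K Y s n G"
proof -
  obtain C N where C: "0 \<le> C" "\<And>h M \<xi> y. smooth_on UNIV h \<Longrightarrow> (\<And>x. x \<notin> K \<Longrightarrow> h x = 0) \<Longrightarrow> 0 \<le> M \<Longrightarrow>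
     (\<And>x. x \<in> K \<Longrightarrow> dbound N h x M) \<Longrightarrow> y \<in> Y \<Longrightarrow>
     dbound n (F (\<lambda>x. h x * ex (- \<xi>) x)) y (C * M * japanese \<xi> powr s)"
    using estE[OF assms(2)] by blast
  show ?thesis
  proof (rule estI[of C K N])
    fix h M y and \<xi> :: 'a assume h: "smooth_on UNIV h" "\<And>x. x \<notin> K \<Longrightarrow> h x = 0" "0 \<le> M"
      "\<And>x. x \<in> K \<Longrightarrow> dbound N h x M" "y \<in> Y"
    show "dbound n (G (\<lambda>x. h x * ex (- \<xi>) x)) y (C * M * japanese \<xi> powr s)"
      using C(2)[OF h] assms(3)[OF test_mult_ex[OF assms(1) h(1,2)]] by simp
  qed (rule C(1))
qed

lemma est_add:
  fixes K :: "'a::euclidean_space set"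
  assumes K: "compact K" and F: "est K Y s n F" "linop F" and G: "est K Y s n G" "linop G"
  shows "est K Y s n (\<lambda>\<psi> y. F \<psi> y + G \<psi> y)"
proof -
  obtain C N where C: "0 \<le> C" "\<And>h M \<xi> y. smooth_on UNIV h \<Longrightarrow> (\<And>x. x \<notin> K \<Longrightarrow> h x = 0) \<Longrightarrow> 0 \<le> M \<Longrightarrow>
     (\<And>x. x \<in> K \<Longrightarrow> dbound N h x M) \<Longrightarrow> y \<in> Y \<Longrightarrow>
     dbound n (F (\<lambda>x. h x * ex (- \<xi>) x)) y (C * M * japanese \<xi> powr s)"
    using estE[OF F(1)] by blast
  obtain C' N' where C': "0 \<le> C'" "\<And>h M \<xi> y. smooth_on UNIV h \<Longrightarrow> (\<And>x. x \<notin> K \<Longrightarrow> h x = 0) \<Longrightarrow> 0 \<le> M \<Longrightarrow>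
     (\<And>x. x \<in> K \<Longrightarrow> dbound N' h x M) \<Longrightarrow> y \<in> Y \<Longrightarrow>
     dbound n (G (\<lambda>x. h x * ex (- \<xi>) x)) y (C' * M * japanese \<xi> powr s)"
    using estE[OF G(1)] by blast
  show ?thesis
  proof (rule estI[of "C + C'" K "max N N'"])
    fix h M y and \<xi> :: 'a assume h: "smooth_on UNIV h" "\<And>x. x \<notin> K \<Longrightarrow> h x = 0" "0 \<le> M"
      "\<And>x. x \<in> K \<Longrightarrow> dbound (max N N') h x M" "y \<in> Y"
    have N: "dbound N h x M" "dbound N' h x M" if "x \<in> K" for x
      using dbound_mono[OF h(4)[OF that]] by auto
    have t: "(\<lambda>x. h x * ex (- \<xi>) x) \<in> test_functions" by (rule test_mult_ex[OF K h(1,2)])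
    have "dbound n (\<lambda>y. F (\<lambda>x. h x * ex (- \<xi>) x) y + G (\<lambda>x. h x * ex (- \<xi>) x) y) y
       (C * M * japanese \<xi> powr s + C' * M * japanese \<xi> powr s)"
      by (rule dbound_add[OF open_UNIV UNIV_I linop_smooth[OF F(2) t] linop_smooth[OF G(2) t]
            C(2)[OF h(1,2,3) N(1) h(5)] C'(2)[OF h(1,2,3) N(2) h(5)]])
    then show "dbound n (\<lambda>y. F (\<lambda>x. h x * ex (- \<xi>) x) y + G (\<lambda>x. h x * ex (- \<xi>) x) y) y
       ((C + C') * M * japanese \<xi> powr s)" by (simp add: algebra_simps)
  qed (use C C' in auto)
qed

text \<open>The Leibniz rule needs bounds for the derivatives of \<kappa> on \<open>Y\<close>;
  either alternative of the last hypothesis provides them.\<close>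

lemma est_mult:
  fixes K :: "'a::euclidean_space set"
  assumes K: "compact K" and F: "est K Y s n F" "linop F" and \<kappa>: "smooth_on UNIV \<kappa>" "compact Y \<or> \<kappa> = (\<lambda>x. c)"
  shows "est K Y s n (\<lambda>\<psi> y. \<kappa> y * F \<psi> y)"
proof -
  obtain C N where C: "0 \<le> C" "\<And>h M \<xi> y. smooth_on UNIV h \<Longrightarrow> (\<And>x. x \<notin> K \<Longrightarrow> h x = 0) \<Longrightarrow> 0 \<le> M \<Longrightarrow>
     (\<And>x. x \<in> K \<Longrightarrow> dbound N h x M) \<Longrightarrow> y \<in> Y \<Longrightarrow>
     dbound n (F (\<lambda>x. h x * ex (- \<xi>) x)) y (C * M * japanese \<xi> powr s)"
    using estE[OF F(1)] by blast
  have "\<exists>W\<ge>0. \<forall>y\<in>Y. dbound n \<kappa> y W"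
  proof (cases "compact Y")
    case True
    then show ?thesis using smooth_on_dbound_compact[OF \<kappa>(1)] by (metis subset_UNIV)
  next
    case False
    then have k: "\<kappa> = (\<lambda>x. c)" using \<kappa> by blast
    obtain W where "0 \<le> W" "dbound n (\<lambda>x::'a. c) 0 W"
      using smooth_on_dbound_compact[OF smooth_on_const[of UNIV c], of "{0::'a}" n] by auto
    moreover have "iterD \<alpha> (\<lambda>x. c) y = iterD \<alpha> (\<lambda>x. c) 0" for \<alpha> and y :: 'a
    proof -
      have "\<exists>c'. iterD \<alpha> (\<lambda>x. c) = (\<lambda>x. c')" by (induction \<alpha>) (auto simp: iterD_Cons)
      then show ?thesis by auto
    qed
    ultimately show ?thesis unfolding k dbound_def by metis
  qed
  then obtain W where W: "0 \<le> W" "\<And>y. y \<in> Y \<Longrightarrow> dbound n \<kappa> y W" by blast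
  show ?thesis
  proof (rule estI[of "2 ^ n * W * C" K N])
    fix h M y and \<xi> :: 'a assume h: "smooth_on UNIV h" "\<And>x. x \<notin> K \<Longrightarrow> h x = 0" "0 \<le> M"
      "\<And>x. x \<in> K \<Longrightarrow> dbound N h x M" "y \<in> Y"
    have t: "(\<lambda>x. h x * ex (- \<xi>) x) \<in> test_functions" by (rule test_mult_ex[OF K h(1,2)])
    from dbound_mult[OF open_UNIV UNIV_I \<kappa>(1) linop_smooth[OF F(2) t] W(2)[OF h(5)] C(2)[OF h]]
    show "dbound n (\<lambda>y. \<kappa> y * F (\<lambda>x. h x * ex (- \<xi>) x) y) y (2 ^ n * W * C * M * japanese \<xi> powr s)"
      by (simp add: mult_ac)
  qed (use W C in auto)
qed

lemma finite_uniform_est: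
  fixes K :: "'a::euclidean_space set"
  assumes "finite B" "\<And>b. b \<in> B \<Longrightarrow> est K Y s n (F b)"
  obtains C N where "0 \<le> C" "\<And>b. b \<in> B \<Longrightarrow> est_const K Y s n (F b) C N"
proof -
  have "\<forall>b\<in>B. \<exists>C N. est_const K Y s n (F b) C N" using assms(2) unfolding est_def by blast
  then obtain C N where Q: "\<And>b. b \<in> B \<Longrightarrow> est_const K Y s n (F b) (C b) (N b)" by metis
  then have C0: "\<And>b. b \<in> B \<Longrightarrow> 0 \<le> C b" unfolding est_const_def by blast
  show ?thesis
  proof (rule that[of "sum C B" "sum N B"])
    show S: "0 \<le> sum C B" using C0 by (rule sum_nonneg)
    fix b assume b: "b \<in> B"
    show "est_const K Y s n (F b) (sum C B) (sum N B)"
      unfolding est_const_def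
    proof (intro conjI allI impI S)
      fix h M y and \<xi> :: 'a assume h: "smooth_on UNIV h" "\<forall>x. x \<notin> K \<longrightarrow> h x = 0" "0 \<le> M"
        "\<forall>x\<in>K. dbound (sum N B) h x M" "y \<in> Y"
      have "N b \<le> sum N B" by (rule member_le_sum[OF b]) (use assms in auto)
      then have N: "dbound (N b) h x M" if "x \<in> K" for x
        using dbound_mono[of "sum N B" h x M "N b"] h(4) that by auto
      have "C b \<le> sum C B" by (rule member_le_sum[OF b]) (use assms C0 in auto)
      then have "C b * M * japanese \<xi> powr s \<le> sum C B * M * japanese \<xi> powr s"
        using h(3) by (intro mult_right_mono) auto
      moreover have "dbound n (F b (\<lambda>x. h x * ex (- \<xi>) x)) y (C b * M * japanese \<xi> powr s)"
        by (rule est_constD[OF Q[OF b] h(1) _ h(3) N h(5)]) (use h(2) in auto)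
      ultimately show "dbound n (F b (\<lambda>x. h x * ex (- \<xi>) x)) y (sum C B * M * japanese \<xi> powr s)"
        by (rule dbound_mono[OF _ order_refl, rotated])
    qed
  qed
qed

lemma est_Suc:
  fixes K :: "'a::euclidean_space set"
  assumes F: "est K Y s 0 F" and D: "\<And>b. b \<in> Basis \<Longrightarrow> est K Y s n (\<lambda>\<psi>. D b (F \<psi>))"
  shows "est K Y s (Suc n) F"
proof -
  obtain C N where C: "0 \<le> C" "\<And>h M \<xi> y. smooth_on UNIV h \<Longrightarrow> (\<And>x. x \<notin> K \<Longrightarrow> h x = 0) \<Longrightarrow> 0 \<le> M \<Longrightarrow>
     (\<And>x. x \<in> K \<Longrightarrow> dbound N h x M) \<Longrightarrow> y \<in> Y \<Longrightarrow>
     dbound 0 (F (\<lambda>x. h x * ex (- \<xi>) x)) y (C * M * japanese \<xi> powr s)"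
    using estE[OF F] by blast
  obtain C' N' where C': "0 \<le> C'"
    and C'': "\<And>b. b \<in> Basis \<Longrightarrow> est_const K Y s n (\<lambda>\<psi>. D b (F \<psi>)) C' N'"
    by (rule finite_uniform_est[OF finite_Basis D]) blast+
  show ?thesis
  proof (rule estI[of "C + C'" K "max N N'"])
    fix h M y and \<xi> :: 'a assume h: "smooth_on UNIV h" "\<And>x. x \<notin> K \<Longrightarrow> h x = 0" "0 \<le> M"
      "\<And>x. x \<in> K \<Longrightarrow> dbound (max N N') h x M" "y \<in> Y"
    have N: "dbound N h x M" "dbound N' h x M" if "x \<in> K" for x
      using dbound_mono[OF h(4)[OF that]] by auto
    have le: "C * M * japanese \<xi> powr s \<le> (C + C') * M * japanese \<xi> powr s"
      "C' * M * japanese \<xi> powr s \<le> (C + C') * M * japanese \<xi> powr s"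
      using C(1) C' h(3) by (intro mult_right_mono; simp)+
    show "dbound (Suc n) (F (\<lambda>x. h x * ex (- \<xi>) x)) y ((C + C') * M * japanese \<xi> powr s)"
      unfolding dbound_Suc
    proof (intro conjI ballI)
      show "cmod (F (\<lambda>x. h x * ex (- \<xi>) x) y) \<le> (C + C') * M * japanese \<xi> powr s"
        using C(2)[OF h(1,2,3) N(1) h(5), of \<xi>] le(1) unfolding dbound_0 by linarith
      show "dbound n (D b (F (\<lambda>x. h x * ex (- \<xi>) x))) y ((C + C') * M * japanese \<xi> powr s)"
        if "b \<in> Basis" for b
        by (rule dbound_mono[OF est_constD[OF C''[OF that] h(1,2,3) N(2) h(5)] order_refl le(2)])
    qed
  qed (use C C' in auto)
qed

text \<open>The derivative falls either on \<open>h\<close>, which costs one more derivative of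
  \<open>h\<close>, or on the exponential, which costs a coordinate of \<xi>; hence the order rises
  by one.\<close>

lemma est_D_argument:
  fixes K :: "'a::euclidean_space set"
  assumes K: "compact K" and F: "est K Y s n F" "linop F" and b: "b \<in> Basis"
  shows "est K Y (s + 1) n (\<lambda>\<psi>. F (D b \<psi>))"
proof -
  obtain C N where C: "0 \<le> C" "\<And>h M \<xi> y. smooth_on UNIV h \<Longrightarrow> (\<And>x. x \<notin> K \<Longrightarrow> h x = 0) \<Longrightarrow> 0 \<le> M \<Longrightarrow>
     (\<And>x. x \<in> K \<Longrightarrow> dbound N h x M) \<Longrightarrow> y \<in> Y \<Longrightarrow>
     dbound n (F (\<lambda>x. h x * ex (- \<xi>) x)) y (C * M * japanese \<xi> powr s)"
    using estE[OF F(1)] by blast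
  show ?thesis
  proof (rule estI[of "C + C" K "Suc N"])
    fix h M y and \<xi> :: 'a assume h: "smooth_on UNIV h" "\<And>x. x \<notin> K \<Longrightarrow> h x = 0" "0 \<le> M"
      "\<And>x. x \<in> K \<Longrightarrow> dbound (Suc N) h x M" "y \<in> Y"
    let ?e = "ex (- \<xi>)" and ?J = "japanese \<xi> powr (s + 1)"
    have Dh: "smooth_on UNIV (D b h)" "\<And>x. x \<notin> K \<Longrightarrow> D b h x = 0"
    proof -
      show "smooth_on UNIV (D b h)" by (rule smooth_on_D[OF h(1) b])
      show "D b h x = 0" if "x \<notin> K" for x
        using D_cong_open[of "- K" x h "\<lambda>_. 0"] that h(2) compact_imp_closed[OF K] by (auto simp: open_Compl)
    qed
    have t: "(\<lambda>x. h x * ?e x) \<in> test_functions" "(\<lambda>x. D b h x * ?e x) \<in> test_functions"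
      by (rule test_mult_ex[OF K]; use h Dh in auto)+
    let ?c = "complex_of_real (b \<bullet> - \<xi>)"
    have "D b (\<lambda>x. h x * ?e x) = (\<lambda>x. D b h x * ?e x + ?c * (h x * ?e x))"
      using smooth_on_differentiable[OF h(1)] smooth_on_differentiable[OF smooth_on_ex[OF open_UNIV, of "- \<xi>"]]
      by (intro ext, subst D_mult) (auto simp: D_ex)
    then have eq: "F (D b (\<lambda>x. h x * ?e x)) = (\<lambda>y. F (\<lambda>x. D b h x * ?e x) y + ?c * F (\<lambda>x. h x * ?e x) y)"
      by (simp only: linop_add[OF F(2) t(2) test_functions_cmult[OF t(1)]] linop_cmult[OF F(2) t(1)])
    have 1: "dbound n (F (\<lambda>x. D b h x * ?e x)) y (C * M * ?J)"
    proof -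
      have "dbound n (F (\<lambda>x. D b h x * ?e x)) y (C * M * japanese \<xi> powr s)"
        by (rule C(2)[OF Dh h(3) _ h(5)]) (use h(4) b in \<open>auto simp: dbound_Suc\<close>)
      then show ?thesis
        using C(1) h(3) by (rule_tac dbound_mono[OF _ order_refl]) (auto intro!: mult_left_mono japanese_powr_mono)
    qed
    have 2: "dbound n (\<lambda>y. ?c * F (\<lambda>x. h x * ?e x) y) y (C * M * ?J)"
    proof -
      have "dbound n (F (\<lambda>x. h x * ?e x)) y (C * M * japanese \<xi> powr s)"
        by (rule C(2)[OF h(1,2,3) _ h(5)]) (auto intro: dbound_mono[OF h(4)])
      from dbound_cmult[OF open_UNIV UNIV_I linop_smooth[OF F(2) t(1)] this, of ?c]
      have "dbound n (\<lambda>y. ?c * F (\<lambda>x. h x * ?e x) y) y (cmod ?c * (C * M * japanese \<xi> powr s))" .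
      moreover have "cmod ?c * (C * M * japanese \<xi> powr s) \<le> C * M * ?J"
      proof -
        have "cmod ?c \<le> japanese \<xi>" using inner_le_japanese[OF b, of \<xi>] by (simp add: inner_commute)
        then have "cmod ?c * (C * M * japanese \<xi> powr s) \<le> japanese \<xi> * (C * M * japanese \<xi> powr s)"
          using C(1) h(3) by (intro mult_right_mono) auto
        then show ?thesis by (simp add: powr_add mult_ac)
      qed
      ultimately show ?thesis by (rule dbound_mono[OF _ order_refl])
    qed
    have "dbound n (\<lambda>y. F (\<lambda>x. D b h x * ?e x) y + ?c * F (\<lambda>x. h x * ?e x) y) y (C * M * ?J + C * M * ?J)"
      by (rule dbound_add[OF open_UNIV UNIV_I linop_smooth[OF F(2) t(2)]
            smooth_on_cmult[OF open_UNIV linop_smooth[OF F(2) t(1)]] 1 2])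
    then show "dbound n (F (D b (\<lambda>x. h x * ?e x))) y ((C + C) * M * ?J)"
      unfolding eq by (simp add: algebra_simps)
  qed (use C in auto)
qed

section \<open>Estimates for the oscillatory part of the transpose\<close>

lemma symbol_slice: "p \<in> symbol_class m \<Longrightarrow> smooth_on UNIV (\<lambda>x. p (x, \<eta>))"
  by (rule smooth_on_slice_fst[OF open_UNIV symbol_smooth open_UNIV]) auto

lemma symbol_slice_test:
  "p \<in> symbol_class m \<Longrightarrow> \<psi> \<in> test_functions \<Longrightarrow> (\<lambda>x. p (x, \<eta>) * \<psi> x) \<in> test_functions"
  by (rule test_functions_mult'[OF symbol_slice])

text \<open>The frequency \<eta> of the symbol and the frequency z of the transform are kept apart:
  z is \<eta> for a single test function and \<eta> - \<xi> for one modulated by the frequency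
  \<xi>.\<close>

lemma Fh_symbol_bound:
  fixes K :: "'a::euclidean_space set"
  assumes p: "p \<in> symbol_class m" and K: "compact K"
  obtains C where "0 \<le> C" "\<And>g M (\<eta>::'a) z. smooth_on UNIV g \<Longrightarrow> (\<And>x. x \<notin> K \<Longrightarrow> g x = 0) \<Longrightarrow>
    (\<And>x. x \<in> K \<Longrightarrow> dbound N g x M) \<Longrightarrow>
    cmod (Fh (\<lambda>x. p (x, \<eta>) * g x) z) \<le> C * M * japanese \<eta> powr m * japanese z powr (- real N)"
proof -
  obtain C where C: "0 \<le> C" "\<And>g M z. smooth_on UNIV g \<Longrightarrow> (\<And>x. x \<notin> K \<Longrightarrow> g x = 0) \<Longrightarrow>
    (\<And>x. x \<in> K \<Longrightarrow> dbound N g x M) \<Longrightarrow> cmod (Fh g z) \<le> C * M * japanese z powr (- real N)"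
    using Fh_bound[OF K, of N] by blast
  obtain C' where C': "0 \<le> C'" "\<And>x \<theta>. x \<in> K \<Longrightarrow> dbound N (\<lambda>x. p (x, \<theta>)) x (C' * japanese \<theta> powr m)"
    using symbol_dbound[OF p K] by blast
  show ?thesis
  proof (rule that[of "C * (2 ^ N * C')"])
    fix g :: "'a \<Rightarrow> complex" and M \<eta> z
    assume g: "smooth_on UNIV g" "\<And>x. x \<notin> K \<Longrightarrow> g x = 0" "\<And>x. x \<in> K \<Longrightarrow> dbound N g x M"
    have "cmod (Fh (\<lambda>x. p (x, \<eta>) * g x) z) \<le> C * (2 ^ N * (C' * japanese \<eta> powr m * M)) * japanese z powr (- real N)"
    proof (rule C(2))
      show "dbound N (\<lambda>x. p (x, \<eta>) * g x) x (2 ^ N * (C' * japanese \<eta> powr m * M))" if "x \<in> K" for x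
        by (rule dbound_mult[OF open_UNIV UNIV_I symbol_slice[OF p] g(1) C'(2)[OF that] g(3)[OF that]])
    qed (use g p in \<open>auto intro!: smooth_on_mult symbol_slice\<close>)
    then show "cmod (Fh (\<lambda>x. p (x, \<eta>) * g x) z)
        \<le> C * (2 ^ N * C') * M * japanese \<eta> powr m * japanese z powr (- real N)"
      by (simp add: mult_ac)
  qed (use C C' in auto)
qed

text \<open>With z = \<eta> in \<open>Fh_symbol_bound\<close> the decay of the transform beats the
  growth of the symbol, so the integral defining \<open>Op\<close> converges absolutely.\<close>

lemma rapid_amplitude:
  fixes p :: "'a::euclidean_space \<times> 'a \<Rightarrow> complex"
  assumes p: "p \<in> symbol_class m" and \<psi>: "\<psi> \<in> test_functions"
  shows "rapid (\<lambda>\<eta>. Fh (\<lambda>x. p (x, \<eta>) * \<psi> x) \<eta>)"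
  unfolding rapid_def
proof (intro conjI allI)
  show "(\<lambda>\<eta>. Fh (\<lambda>x. p (x, \<eta>) * \<psi> x) \<eta>) \<in> borel_measurable borel"
    by (rule smooth_on_measurable[OF smooth_on_Fh_param[OF symbol_smooth[OF p] \<psi>]])
  fix s :: real
  obtain N :: nat where N: "m - s \<le> real N" using real_arch_simple by blast
  obtain C where C: "0 \<le> C" "\<And>g M (\<eta>::'a) z. smooth_on UNIV g \<Longrightarrow> (\<And>x. x \<notin> fun_supp \<psi> \<Longrightarrow> g x = 0) \<Longrightarrow>
    (\<And>x. x \<in> fun_supp \<psi> \<Longrightarrow> dbound N g x M) \<Longrightarrow>
    cmod (Fh (\<lambda>x. p (x, \<eta>) * g x) z) \<le> C * M * japanese \<eta> powr m * japanese z powr (- real N)"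
    using Fh_symbol_bound[OF p test_functions_compact[OF \<psi>], of N] by blast
  obtain M where M: "0 \<le> M" "\<And>x. x \<in> fun_supp \<psi> \<Longrightarrow> dbound N \<psi> x M"
    using smooth_on_dbound_compact[OF test_functions_smooth[OF \<psi>] test_functions_compact[OF \<psi>]] by blast
  have "cmod (Fh (\<lambda>x. p (x, \<eta>) * \<psi> x) \<eta>) \<le> C * M * japanese \<eta> powr s" for \<eta>
  proof -
    have "cmod (Fh (\<lambda>x. p (x, \<eta>) * \<psi> x) \<eta>) \<le> C * M * japanese \<eta> powr m * japanese \<eta> powr (- real N)"
      by (rule C(2)[OF test_functions_smooth[OF \<psi>] fun_supp_zero[where f=\<psi>] M(2)])
    also have "\<dots> = C * M * japanese \<eta> powr (m - real N)"
      by (simp add: powr_add[symmetric] mult.assoc)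
    also have "\<dots> \<le> C * M * japanese \<eta> powr s"
      using C(1) M(1) N by (intro mult_left_mono japanese_powr_mono) auto
    finally show ?thesis .
  qed
  then show "\<exists>C. \<forall>\<eta>. cmod (Fh (\<lambda>x. p (x, \<eta>) * \<psi> x) \<eta>) \<le> C * japanese \<eta> powr s" by blast
qed

lemma IF_add: "rapid A \<Longrightarrow> rapid B \<Longrightarrow> IF (\<lambda>\<eta>. A \<eta> + B \<eta>) y = IF A y + IF B y"
  unfolding IF_def
  by (simp add: distrib_left Bochner_Integration.integral_add rapid_integrable rapid_ex_mult)

lemma IF_cmult: "IF (\<lambda>\<eta>. c * B \<eta>) y = c * IF B y"
  unfolding IF_def by (simp add: mult.left_commute[of _ c])

lemma Fh_add: "f \<in> test_functions \<Longrightarrow> g \<in> test_functions \<Longrightarrow> Fh (\<lambda>x. f x + g x) z = Fh f z + Fh g z"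
  unfolding Fh_def
  by (simp add: distrib_left Bochner_Integration.integral_add integrable_test test_ex_mult)

lemma Fh_cmult: "Fh (\<lambda>x. c * f x) z = c * Fh f z"
  unfolding Fh_def by (simp add: mult.left_commute[of _ c])

lemma linop_Op:
  assumes p: "p \<in> symbol_class m"
  shows "linop (Op p)"
  unfolding linop_def
proof (intro conjI ballI allI)
  fix \<phi> \<psi> :: "'a \<Rightarrow> complex" and c assume \<phi>: "\<phi> \<in> test_functions"
  show "smooth_on UNIV (Op p \<phi>)" unfolding Op_def by (intro smooth_on_IF rapid_amplitude[OF p \<phi>])
  show "Op p (\<lambda>x. c * \<phi> x) = (\<lambda>y. c * Op p \<phi> y)"
    unfolding Op_def by (simp add: fun_eq_iff mult.left_commute[of _ c] Fh_cmult IF_cmult)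
  assume \<psi>: "\<psi> \<in> test_functions"
  have "Fh (\<lambda>x. p (x, \<eta>) * (\<phi> x + \<psi> x)) \<eta> = Fh (\<lambda>x. p (x, \<eta>) * \<phi> x) \<eta> + Fh (\<lambda>x. p (x, \<eta>) * \<psi> x) \<eta>" for \<eta>
    using Fh_add[OF symbol_slice_test[OF p \<phi>] symbol_slice_test[OF p \<psi>]] by (simp add: distrib_left)
  then show "Op p (\<lambda>x. \<phi> x + \<psi> x) = (\<lambda>y. Op p \<phi> y + Op p \<psi> y)"
    unfolding Op_def by (simp add: fun_eq_iff IF_add[OF rapid_amplitude[OF p \<phi>] rapid_amplitude[OF p \<psi>]])
qed

text \<open>Differentiation in y multiplies the amplitude by -\<eta>\<bullet>b, which by parts in x
  becomes a derivative of the product of symbol and test function. The new symbol has the same order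
  as \<open>p\<close>.\<close>

lemma D_Op:
  assumes p: "p \<in> symbol_class m" and \<psi>: "\<psi> \<in> test_functions" and b: "b \<in> Basis"
  shows "D b (Op p \<psi>) = (\<lambda>y. Op p (D b \<psi>) y + Op (D (b, 0) p) \<psi> y)"
proof -
  have Dp: "D (b, 0) p \<in> symbol_class m" by (rule symbol_D_fst[OF p b])
  have D\<psi>: "D b \<psi> \<in> test_functions" by (rule test_functions_D[OF \<psi> b])
  have "complex_of_real (- (\<eta> \<bullet> b)) * Fh (\<lambda>x. p (x, \<eta>) * \<psi> x) \<eta>
      = Fh (\<lambda>x. p (x, \<eta>) * D b \<psi> x) \<eta> + Fh (\<lambda>x. D (b, 0) p (x, \<eta>) * \<psi> x) \<eta>" for \<eta>
  proof -
    have "D b (\<lambda>x. p (x, \<eta>) * \<psi> x) = (\<lambda>x. p (x, \<eta>) * D b \<psi> x + D (b, 0) p (x, \<eta>) * \<psi> x)"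
      using smooth_on_differentiable[OF symbol_slice[OF p]] smooth_on_differentiable[OF test_functions_smooth[OF \<psi>]]
        D_slice_fst[OF smooth_on_differentiable[OF symbol_smooth[OF p]]]
      by (intro ext, subst D_mult) auto
    then show ?thesis
      using Fh_D[OF symbol_slice_test[OF p \<psi>] b, of \<eta> \<eta>]
        Fh_add[OF symbol_slice_test[OF p D\<psi>] symbol_slice_test[OF Dp \<psi>], of \<eta> \<eta> \<eta>]
      by (simp add: inner_commute)
  qed
  then show ?thesis
    unfolding Op_def D_IF[OF rapid_amplitude[OF p \<psi>]]
    by (simp add: fun_eq_iff IF_add[OF rapid_amplitude[OF p D\<psi>] rapid_amplitude[OF Dp \<psi>]])
qed

text \<open>Modulation shifts the transform to \<eta> - \<xi>, so the integrand is concentrated near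
  \<eta> = \<xi>, where the symbol has size <\<xi>>^m.\<close>

lemma est_Op_order:
  fixes K :: "'a::euclidean_space set"
  assumes p: "p \<in> symbol_class m" and K: "compact K"
  shows "est K UNIV m 0 (Op p)"
proof -
  obtain N :: nat where N: "\<bar>m\<bar> + 0 + 2 * real DIM('a) \<le> real N" using real_arch_simple by blast
  obtain C where C: "0 \<le> C" "\<And>g M (\<eta>::'a) z. smooth_on UNIV g \<Longrightarrow> (\<And>x. x \<notin> K \<Longrightarrow> g x = 0) \<Longrightarrow>
    (\<And>x. x \<in> K \<Longrightarrow> dbound N g x M) \<Longrightarrow>
    cmod (Fh (\<lambda>x. p (x, \<eta>) * g x) z) \<le> C * M * japanese \<eta> powr m * japanese z powr (- real N)"
    using Fh_symbol_bound[OF p K, of N] by blast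
  let ?c = "2 powr \<bar>m\<bar> * (LINT \<eta>|lborel. japanese (\<eta>::'a) powr (- 2 * real DIM('a)))"
  show ?thesis
  proof (rule estI[of "C * ?c" K N])
    show "0 \<le> C * ?c" using C(1) by (intro mult_nonneg_nonneg integral_nonneg) auto
    fix h :: "'a \<Rightarrow> complex" and M \<xi> y
    assume h: "smooth_on UNIV h" "\<And>x. x \<notin> K \<Longrightarrow> h x = 0" "0 \<le> M" "\<And>x. x \<in> K \<Longrightarrow> dbound N h x M"
    have t: "(\<lambda>x. h x * ex (- \<xi>) x) \<in> test_functions" by (rule test_mult_ex[OF K h(1,2)])
    let ?B = "\<lambda>\<eta>. Fh (\<lambda>x. p (x, \<eta>) * (h x * ex (- \<xi>) x)) \<eta>"
    have B: "?B \<eta> = Fh (\<lambda>x. p (x, \<eta>) * h x) (\<eta> - \<xi>)" for \<eta>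
      unfolding Fh_def using ex_add(1)[of \<eta> "- \<xi>"] by (simp add: mult_ac)
    have "cmod (Op p (\<lambda>x. h x * ex (- \<xi>) x) y) \<le> (LINT \<eta>|lborel. cmod (?B \<eta>))"
      unfolding Op_def IF_def
      by (rule norm_integral_le[OF integrable_norm[OF rapid_integrable[OF rapid_amplitude[OF p t]]]])
         (simp add: norm_mult)
    also have "\<dots> \<le> (C * M) * ?c * japanese \<xi> powr m"
    proof (rule japanese_convolution[OF N])
      show "cmod (?B \<eta>) \<le> C * M * (japanese \<eta> powr m * japanese (\<eta> - \<xi>) powr 0 * japanese (\<eta> - \<xi>) powr (- real N))" for \<eta>
        unfolding B using C(2)[OF h(1,2,4), of \<eta> "\<eta> - \<xi>"] by (simp add: mult_ac)
    qed (use C h in auto)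
    finally show "dbound 0 (Op p (\<lambda>x. h x * ex (- \<xi>) x)) y (C * ?c * M * japanese \<xi> powr m)"
      by (simp add: mult_ac)
  qed
qed

text \<open>By \<open>D_Op\<close> a derivative leads to \<open>Op\<close> of another symbol of the
  same class, so the hypothesis is made for the whole class. Each derivative of the output costs one
  order in \<xi>, from the derivative of the modulated test function.\<close>

lemma est_Op_derivatives:
  fixes K :: "'a::euclidean_space set"
  assumes K: "compact K" and 0: "\<And>p. p \<in> symbol_class m \<Longrightarrow> est K Y s 0 (Op p)" and p: "p \<in> symbol_class m"
  shows "est K Y (s + real n) n (Op p)"
  using p
proof (induction n arbitrary: p)
  case 0
  then show ?case using assms(2) by simp
next
  case (Suc n)
  show ?case
  proof (rule est_Suc)
    show "est K Y (s + real (Suc n)) 0 (Op p)" by (rule est_mono[OF assms(2)[OF Suc.prems]]) simp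
    fix b :: 'a assume b: "b \<in> Basis"
    have Dp: "D (b, 0) p \<in> symbol_class m" by (rule symbol_D_fst[OF Suc.prems b])
    have 1: "est K Y (s + real (Suc n)) n (\<lambda>\<psi>. Op p (D b \<psi>))"
      using est_D_argument[OF K Suc.IH[OF Suc.prems] linop_Op[OF Suc.prems] b] by (simp add: add_ac)
    have l: "linop (\<lambda>\<psi>. Op p (D b \<psi>))"
    proof -
      have D: "D b (\<lambda>x. \<phi> x + \<psi> x) = (\<lambda>x. D b \<phi> x + D b \<psi> x)" "D b (\<lambda>x. c * \<phi> x) = (\<lambda>x. c * D b \<phi> x)"
        if "\<phi> \<in> test_functions" "\<psi> \<in> test_functions" for \<phi> \<psi> :: "'a \<Rightarrow> complex" and c
        using smooth_on_differentiable[OF test_functions_smooth[OF that(1)]]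
          smooth_on_differentiable[OF test_functions_smooth[OF that(2)]]
        by (auto simp: fun_eq_iff D_add D_mult)
      show ?thesis
        using linop_Op[OF Suc.prems] test_functions_D[OF _ b] unfolding linop_def by (simp add: D)
    qed
    have 2: "est K Y (s + real (Suc n)) n (Op (D (b, 0) p))"
      by (rule est_mono[OF Suc.IH[OF Dp]]) simp
    show "est K Y (s + real (Suc n)) n (\<lambda>\<psi>. D b (Op p \<psi>))"
      by (rule est_cong[OF K est_add[OF K 1 l 2 linop_Op[OF Dp]]]) (simp add: D_Op[OF Suc.prems _ b])
  qed
qed

text \<open>Integration by parts in the frequency: a coordinate of x - y times the exponential of
  i<x - y, \<eta>> is the \<open>D\<close>-derivative of that exponential in \<eta>, and moving it
  to the symbol lowers the order by one. The point y is both the evaluation point and the zero of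
  the factor.\<close>

lemma Op_shift:
  fixes y :: "'a::euclidean_space"
  assumes p: "p \<in> symbol_class m" and \<psi>: "\<psi> \<in> test_functions" and b: "b \<in> Basis"
  shows "Op p (\<lambda>x. complex_of_real ((x - y) \<bullet> b) * \<psi> x) y = - Op (D (0, b) p) \<psi> y"
proof -
  let ?K = "fun_supp \<psi>"
  have Dp: "D (0, b) p \<in> symbol_class (m - 1)" by (rule symbol_D_snd[OF p b])
  have lin: "smooth_on UNIV (\<lambda>x. complex_of_real ((x - y) \<bullet> b))"
    using smooth_on_inner[OF open_UNIV bounded_linear_ident bounded_linear_zero, of "- y" b] by simp
  define \<psi>' where "\<psi>' x = complex_of_real ((x - y) \<bullet> b) * \<psi> x" for x
  have \<psi>': "\<psi>' \<in> test_functions" unfolding \<psi>'_def[abs_def] by (rule test_functions_mult'[OF lin \<psi>])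
  \<comment> \<open>\<open>E (x, \<eta>)\<close> is the exponential of i<x - y, \<eta>> with y
    fixed, a jointly smooth function of both arguments.\<close>
  define E where "E z = ex (snd z) (- y + fst z)" for z :: "'a \<times> 'a"
  define F where "F z = E z * (p z * \<psi> (fst z))" for z
  define H where "H \<eta> = (LINT x|lborel. F (x, \<eta>))" for \<eta>
  have Es: "smooth_on UNIV E"
    unfolding E_def by (intro smooth_on_ex_joint bounded_linear_fst bounded_linear_snd open_UNIV)
  have Fs: "smooth_on UNIV F"
    unfolding F_def
    by (intro smooth_on_mult Es smooth_on_fst open_UNIV symbol_smooth[OF p] test_functions_smooth[OF \<psi>])
  have F0: "F (x, \<eta>) = 0" if "x \<notin> ?K" for x \<eta> using that by (simp add: F_def fun_supp_zero)
  have E: "E (x, \<eta>) = ex (- \<eta>) y * ex \<eta> x" for x \<eta>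
    using ex_add(2)[of \<eta> "- y" x] by (simp add: E_def ex_minus)
  have HI: "(LINT x|lborel. E (x, \<eta>) * g x) = ex (- \<eta>) y * Fh g \<eta>" for g \<eta>
    unfolding Fh_def E by (simp add: mult.assoc)
  have H: "H = (\<lambda>\<eta>. ex (- \<eta>) y * Fh (\<lambda>x. p (x, \<eta>) * \<psi> x) \<eta>)"
    unfolding H_def F_def by (simp add: HI)
  have Eeq: "E (x, \<eta>) = ex (x - y) \<eta>" for x \<eta>
    by (simp add: E_def ex_commute[of \<eta> "x - y"])
  have DE: "D (0, b) E (x, \<eta>) = complex_of_real ((x - y) \<bullet> b) * E (x, \<eta>)" for x \<eta>
  proof -
    have "D (0, b) E (x, \<eta>) = D b (\<lambda>\<eta>. E (x, \<eta>)) \<eta>"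
      by (rule D_slice_snd[symmetric]) (rule smooth_on_differentiable[OF Es UNIV_I])
    also have "(\<lambda>\<eta>. E (x, \<eta>)) = ex (x - y)" using Eeq by (simp add: fun_eq_iff)
    finally show ?thesis by (simp only: D_ex Eeq inner_commute)
  qed
  have DF: "D (0, b) F (x, \<eta>) = E (x, \<eta>) * (p (x, \<eta>) * \<psi>' x) + E (x, \<eta>) * (D (0, b) p (x, \<eta>) * \<psi> x)" for x \<eta>
  proof -
    have d: "f differentiable (at z)" if "smooth_on UNIV f" for f z
      using smooth_on_differentiable[OF that] by simp
    have "D (0, b) (\<lambda>z. \<psi> (fst z)) (x, \<eta>) = D b (\<lambda>\<eta>::'a. \<psi> x) \<eta>"
      by (subst D_slice_snd[symmetric]) (auto intro!: d smooth_on_fst test_functions_smooth[OF \<psi>])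
    then have 0: "D (0, b) (\<lambda>z. \<psi> (fst z)) (x, \<eta>) = 0" by simp
    have "D (0, b) F (x, \<eta>) = D (0, b) E (x, \<eta>) * (p (x, \<eta>) * \<psi> x) + E (x, \<eta>) * D (0, b) (\<lambda>z. p z * \<psi> (fst z)) (x, \<eta>)"
      unfolding F_def
      by (subst D_mult) (auto intro!: d smooth_on_mult smooth_on_fst Es symbol_smooth[OF p] test_functions_smooth[OF \<psi>])
    also have "D (0, b) (\<lambda>z. p z * \<psi> (fst z)) (x, \<eta>) = D (0, b) p (x, \<eta>) * \<psi> x"
      by (subst D_mult) (auto intro!: d smooth_on_fst symbol_smooth[OF p] test_functions_smooth[OF \<psi>] simp: 0)
    finally show ?thesis by (simp add: DE \<psi>'_def mult_ac)
  qed
  have int: "integrable lborel (\<lambda>x. E (x, \<eta>) * (q (x, \<eta>) * \<phi> x))"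
    if "q \<in> symbol_class l" "\<phi> \<in> test_functions" for q l \<phi> \<eta>
    unfolding E mult.assoc
    by (intro integrable_mult_right integrable_test test_ex_mult symbol_slice_test[OF that])
  have DH: "D b H = (\<lambda>\<eta>. ex (- \<eta>) y * Fh (\<lambda>x. p (x, \<eta>) * \<psi>' x) \<eta> + ex (- \<eta>) y * Fh (\<lambda>x. D (0, b) p (x, \<eta>) * \<psi> x) \<eta>)"
  proof -
    have "D b H = (\<lambda>\<eta>. LINT x|lborel. D (0, b) F (x, \<eta>))"
      unfolding H_def by (rule smooth_param_integral(2)[OF Fs test_functions_compact[OF \<psi>] F0 b])
    then show ?thesis
      unfolding DF using int[OF p \<psi>'] int[OF Dp \<psi>] by (simp add: HI)
  qed
  have Hs: "smooth_on UNIV H"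
    unfolding H_def by (rule smooth_param_integral(1)[OF Fs test_functions_compact[OF \<psi>] F0])
  have i: "integrable lborel (\<lambda>\<eta>. ex (- \<eta>) y * Fh (\<lambda>x. q (x, \<eta>) * \<phi> x) \<eta>)"
    if "q \<in> symbol_class l" "\<phi> \<in> test_functions" for q l \<phi>
    by (intro rapid_integrable rapid_ex_mult(1) rapid_amplitude[OF that])
  \<comment> \<open>The integral of \<open>H\<close> is \<open>Op p \<psi> y\<close>. Its derivative
    integrates to 0, and the product rule splits this into the derivative of the exponential and
    that of the symbol.\<close>
  have "(LINT \<eta>|lborel. D b H \<eta>) = 0"
  proof (rule integral_D_eq_0)
    show "integrable lborel H" unfolding H by (rule i[OF p \<psi>])
    show "integrable lborel (D b H)" unfolding DH using i[OF p \<psi>'] i[OF Dp \<psi>] by simp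
  qed (use Hs b in \<open>auto intro!: smooth_on_differentiable smooth_on_continuous_on smooth_on_D\<close>)
  then have "Op p \<psi>' y + Op (D (0, b) p) \<psi> y = 0"
    unfolding DH Op_def IF_def using i[OF p \<psi>'] i[OF Dp \<psi>] by simp
  then show ?thesis unfolding \<psi>'_def[abs_def] by (simp add: add_eq_0_iff2)
qed

lemma est_subset: "est K Y s n F \<Longrightarrow> Y' \<subseteq> Y \<Longrightarrow> est K Y' s n F"
  unfolding est_def est_const_def by (meson subsetD)

lemma est_order_0: "est K Y s n F \<Longrightarrow> est K Y s 0 F"
proof -
  assume "est K Y s n F"
  then obtain C N where "est_const K Y s n F C N" unfolding est_def by blast
  then have "est_const K Y s 0 F C N"
    unfolding est_const_def using dbound_mono[OF _ le0 order_refl] by blast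
  then show ?thesis unfolding est_def by blast
qed

lemma linop_sum:
  assumes F: "linop F" and "\<And>i. i \<in> I \<Longrightarrow> f i \<in> test_functions"
  shows "F (\<lambda>x. \<Sum>i\<in>I. f i x) = (\<lambda>y. \<Sum>i\<in>I. F (f i) y)"
  using assms(2)
proof (induction I rule: infinite_finite_induct)
  case (insert i I)
  have "F (\<lambda>x. f i x + (\<Sum>i\<in>I. f i x)) = (\<lambda>y. F (f i) y + F (\<lambda>x. \<Sum>i\<in>I. f i x) y)"
    by (rule linop_add[OF F]) (use insert.prems in \<open>auto intro: test_functions_sum\<close>)
  then show ?case using insert by simp
qed (use linop_cmult[OF F test_functions_0, of 0] in simp_all)

text \<open>A smooth substitute for |z|^-2: the bump added to the denominator keeps it positive at 0
  and vanishes outside the ball of radius \<delta>.\<close>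

lemma regularized_inverse_square:
  assumes "0 < \<delta>"
  obtains \<omega> :: "'a::euclidean_space \<Rightarrow> complex" where "smooth_on UNIV \<omega>"
    "\<And>z. \<delta> \<le> norm z \<Longrightarrow> complex_of_real ((norm z)\<^sup>2) * \<omega> z = 1"
proof -
  obtain \<beta> :: "'a \<Rightarrow> real" where \<beta>: "smooth_on UNIV (\<lambda>x. complex_of_real (\<beta> x))"
    "\<And>x. x \<in> cball 0 0 \<Longrightarrow> \<beta> x = 1" "\<And>x. 0 < \<beta> x \<longleftrightarrow> x \<in> ball 0 \<delta>" "\<And>x. 0 \<le> \<beta> x" "\<And>x. \<beta> x \<le> 1"
    by (rule bump_exists[OF order_refl assms, of "0::'a"]) blast
  have pos: "0 < (norm z)\<^sup>2 + \<beta> z" for z :: 'a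
    using \<beta>(2)[of 0] \<beta>(4)[of z] by (cases "z = 0") (auto simp: add_pos_nonneg)
  show ?thesis
  proof
    have "smooth_on UNIV (\<lambda>z::'a. complex_of_real ((norm z)\<^sup>2) + complex_of_real (\<beta> z))"
      using smooth_on_norm_sq[OF open_UNIV, of "0::'a"] by (intro smooth_on_add \<beta> open_UNIV) simp
    then show "smooth_on UNIV (\<lambda>z. inverse (complex_of_real ((norm z)\<^sup>2 + \<beta> z)))"
      unfolding of_real_add
    proof (rule smooth_on_inverse[OF open_UNIV])
      show "complex_of_real ((norm z)\<^sup>2) + complex_of_real (\<beta> z) \<noteq> 0" for z :: 'a
        unfolding of_real_add[symmetric] of_real_eq_0_iff using pos[of z] by linarith
    qed
    fix z :: 'a assume z: "\<delta> \<le> norm z"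
    then have "\<beta> z = 0" using \<beta>(3)[of z] \<beta>(4)[of z] by auto
    moreover have "complex_of_real (norm z) \<noteq> 0" using z assms by auto
    ultimately show "complex_of_real ((norm z)\<^sup>2) * inverse (complex_of_real ((norm z)\<^sup>2 + \<beta> z)) = 1"
      by simp
  qed
qed

lemma iterD_translate:
  assumes "smooth_on UNIV f" "\<alpha> \<in> lists Basis"
  shows "iterD \<alpha> (\<lambda>x. f (c + x)) x = iterD \<alpha> f (c + x)"
  using assms(2)
proof (induction \<alpha> arbitrary: x)
  case (Cons b \<alpha>)
  have "D b (\<lambda>x. iterD \<alpha> f (c + x)) x = D b (iterD \<alpha> f) (c + x)"
  proof -
    have "((\<lambda>x. c + x) has_derivative (\<lambda>h. h)) (at x)" by (auto intro!: derivative_eq_intros)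
    from has_derivative_compose[OF this D_has_derivative]
    show ?thesis using smooth_on_differentiable[OF smooth_on_iterD[OF assms(1)]] Cons
      by (subst D_eq) (auto simp: mult.assoc[symmetric])
  qed
  moreover have "iterD \<alpha> (\<lambda>x. f (c + x)) = (\<lambda>x. iterD \<alpha> f (c + x))" using Cons by auto
  ultimately show ?case by (simp add: iterD_Cons)
qed simp

lemma dbound_translate:
  "smooth_on UNIV f \<Longrightarrow> dbound N f (c + x) M \<Longrightarrow> dbound N (\<lambda>x. f (c + x)) x M"
  by (simp only: dbound_def iterD_translate simp_thms cong: ball_cong)

text \<open>Off the diagonal the order drops by 2 for each factor \<open>|x - y|\<^sup>2\<close> that is split off the amplitude.\<close>

lemma est_Op_off_diagonal:
  fixes K Y :: "'a::euclidean_space set"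
  assumes K: "compact K" and Y: "compact Y" and \<delta>: "0 < \<delta>" "\<And>x y. x \<in> K \<Longrightarrow> y \<in> Y \<Longrightarrow> \<delta> \<le> norm (x - y)"
    and p: "p \<in> symbol_class m"
  shows "est K Y s 0 (Op p)"
proof -
  obtain \<omega> :: "'a \<Rightarrow> complex" where \<omega>: "smooth_on UNIV \<omega>"
    "\<And>z. \<delta> \<le> norm z \<Longrightarrow> complex_of_real ((norm z)\<^sup>2) * \<omega> z = 1"
    by (rule regularized_inverse_square[OF \<delta>(1)]) blast
  \<comment> \<open>Induction on the number k of factors to be split off; for k = 0 the order of the
    symbol is at most \<open>s\<close> and the general bound suffices.\<close>
  have "est K Y s 0 (Op p)" if "p \<in> symbol_class m" "m \<le> s + 2 * real k" for k m and p :: "'a \<times> 'a \<Rightarrow> complex"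
    using that
  proof (induction k arbitrary: p m)
    case 0
    then show ?case by (intro est_mono[OF est_subset[OF est_Op_order[OF _ K]]]) auto
  next
    case (Suc k)
    let ?q = "\<lambda>b. D (0, b) (D (0, b) p)"
    have q: "?q b \<in> symbol_class (m - 1 - 1)" if "b \<in> Basis" for b
      by (intro symbol_D_snd Suc.prems that)
    have "est K Y s 0 (Op (?q b))" if "b \<in> Basis" for b
      by (rule Suc.IH[OF q[OF that]]) (use Suc.prems in simp)
    then obtain C N where C: "0 \<le> C" and CN: "\<And>b. b \<in> Basis \<Longrightarrow> est_const K Y s 0 (Op (?q b)) C N"
      by (rule finite_uniform_est[OF finite_Basis]) blast+
    \<comment> \<open>Since x - y ranges over a compact set, dividing by |x - y|^2 costs a constant
      that is uniform in y.\<close>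
    have "compact ((\<lambda>z. fst z - snd z) ` (K \<times> Y))"
      by (intro compact_continuous_image compact_Times K Y continuous_intros)
    then obtain W where W: "0 \<le> W" "\<And>z. z \<in> (\<lambda>z. fst z - snd z) ` (K \<times> Y) \<Longrightarrow> dbound N \<omega> z W"
      using smooth_on_dbound_compact[OF \<omega>(1)] by (metis subset_UNIV)
    show ?case
    proof (rule estI[of "real DIM('a) * (C * (2 ^ N * W))" K N])
      fix h M y and \<xi> :: 'a assume h: "smooth_on UNIV h" "\<And>x. x \<notin> K \<Longrightarrow> h x = 0" "0 \<le> M"
        "\<And>x. x \<in> K \<Longrightarrow> dbound N h x M" "y \<in> Y"
      define h' where "h' x = \<omega> (- y + x) * h x" for x
      define \<psi>' where "\<psi>' x = h' x * ex (- \<xi>) x" for x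
      let ?l = "\<lambda>b x. complex_of_real ((x - y) \<bullet> b)"
      have \<omega>s: "smooth_on UNIV (\<lambda>x. \<omega> (- y + x))" by (rule smooth_on_translate[OF \<omega>(1)])
      have h': "smooth_on UNIV h'" "\<And>x. x \<notin> K \<Longrightarrow> h' x = 0"
        unfolding h'_def[abs_def] by (rule smooth_on_mult[OF open_UNIV \<omega>s h(1)]) (simp add: h(2))
      have db: "dbound N h' x (2 ^ N * (W * M))" if "x \<in> K" for x
        unfolding h'_def
      proof (rule dbound_mult[OF open_UNIV UNIV_I \<omega>s h(1) _ h(4)[OF that]])
        have "dbound N \<omega> (- y + x) W" using W(2)[of "x - y"] that h(5) by force
        then show "dbound N (\<lambda>x. \<omega> (- y + x)) x W" by (rule dbound_translate[OF \<omega>(1)])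
      qed
      have \<psi>': "\<psi>' \<in> test_functions" unfolding \<psi>'_def[abs_def] by (rule test_mult_ex[OF K h'])
      have ls: "smooth_on UNIV (?l b)" for b
        using smooth_on_inner[OF open_UNIV bounded_linear_ident bounded_linear_zero, of "- y" b] by simp
      have t1: "(\<lambda>x. ?l b x * \<psi>' x) \<in> test_functions" for b by (rule test_functions_mult'[OF ls \<psi>'])
      have t2: "(\<lambda>x. ?l b x * (?l b x * \<psi>' x)) \<in> test_functions" for b by (rule test_functions_mult'[OF ls t1])
      \<comment> \<open>On \<open>K\<close> the factor \<omega> cancels |x - y|^2. As a sum of
        squared coordinates the latter can be removed by two applications of
        \<open>Op_shift\<close>, whose signs cancel.\<close>
      have "h x * ex (- \<xi>) x = (\<Sum>b\<in>Basis. ?l b x * (?l b x * \<psi>' x))" for x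
      proof -
        have "(\<Sum>b\<in>Basis. ?l b x * (?l b x * \<psi>' x)) = complex_of_real (\<Sum>b\<in>Basis. ((x - y) \<bullet> b) * ((x - y) \<bullet> b)) * \<psi>' x"
          by (simp add: sum_distrib_right mult.assoc)
        also have "(\<Sum>b\<in>Basis. ((x - y) \<bullet> b) * ((x - y) \<bullet> b)) = (norm (x - y))\<^sup>2"
          unfolding power2_norm_eq_inner by (rule euclidean_inner[symmetric])
        also have "complex_of_real ((norm (x - y))\<^sup>2) * \<psi>' x = h x * ex (- \<xi>) x"
        proof (cases "x \<in> K")
          case True
          have "complex_of_real ((norm (x - y))\<^sup>2) * \<omega> (x - y) = 1" by (rule \<omega>(2)[OF \<delta>(2)[OF True h(5)]])
          then show ?thesis by (simp add: \<psi>'_def h'_def mult.assoc[symmetric])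
        qed (simp add: \<psi>'_def h'_def h(2))
        finally show ?thesis by simp
      qed
      then have "Op p (\<lambda>x. h x * ex (- \<xi>) x) y = (\<Sum>b\<in>Basis. Op p (\<lambda>x. ?l b x * (?l b x * \<psi>' x)) y)"
        using linop_sum[OF linop_Op[OF Suc.prems(1)], of Basis "\<lambda>b x. ?l b x * (?l b x * \<psi>' x)"] t2 by simp
      also have "\<dots> = (\<Sum>b\<in>Basis. Op (?q b) \<psi>' y)"
      proof (rule sum.cong[OF refl])
        fix b :: 'a assume b: "b \<in> Basis"
        show "Op p (\<lambda>x. ?l b x * (?l b x * \<psi>' x)) y = Op (?q b) \<psi>' y"
          using Op_shift[OF Suc.prems(1) t1 b, of y b] Op_shift[OF symbol_D_snd[OF Suc.prems(1) b] \<psi>' b, of y] by simp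
      qed
      also have "cmod \<dots> \<le> (\<Sum>b\<in>(Basis::'a set). C * (2 ^ N * (W * M)) * japanese \<xi> powr s)"
      proof (rule sum_norm_le)
        fix b :: 'a assume b: "b \<in> Basis"
        have "dbound 0 (Op (?q b) (\<lambda>x. h' x * ex (- \<xi>) x)) y (C * (2 ^ N * (W * M)) * japanese \<xi> powr s)"
          by (rule est_constD[OF CN[OF b] h' _ db h(5)]) (use W h in auto)
        then show "cmod (Op (?q b) \<psi>' y) \<le> C * (2 ^ N * (W * M)) * japanese \<xi> powr s"
          by (simp add: \<psi>'_def[abs_def])
      qed
      finally show "dbound 0 (Op p (\<lambda>x. h x * ex (- \<xi>) x)) y (real DIM('a) * (C * (2 ^ N * W)) * M * japanese \<xi> powr s)"
        by (simp add: mult_ac)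
    qed (use C W in auto)
  qed
  moreover obtain k :: nat where "(m - s) / 2 \<le> real k" using real_arch_simple by blast
  ultimately show ?thesis using p by (simp add: field_simps)
qed

section \<open>The part with smooth kernel\<close>

definition Sop :: "('a::euclidean_space \<times> 'a \<Rightarrow> complex) \<Rightarrow> ('a \<Rightarrow> complex) \<Rightarrow> 'a \<Rightarrow> complex" where
  "Sop s \<psi> y = (LINT x|lborel. s (x, y) * \<psi> x)"

lemma Sop_integrable:
  fixes s :: "'a::euclidean_space \<times> 'a \<Rightarrow> complex"
  assumes "smooth_on UNIV s" "\<psi> \<in> test_functions"
  shows "integrable lborel (\<lambda>x. s (x, y) * \<psi> x)"
  by (intro integrable_test test_functions_mult' assms smooth_on_slice_fst[OF open_UNIV assms(1) open_UNIV]) auto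

lemma linop_Sop:
  fixes s :: "'a::euclidean_space \<times> 'a \<Rightarrow> complex"
  assumes s: "smooth_on UNIV s"
  shows "linop (Sop s)"
  unfolding linop_def
proof (intro conjI ballI allI)
  fix \<phi> \<psi> :: "'a \<Rightarrow> complex" and c assume \<phi>: "\<phi> \<in> test_functions"
  have "smooth_on UNIV (\<lambda>z. s z * \<phi> (fst z))"
    by (intro smooth_on_mult s smooth_on_fst test_functions_smooth[OF \<phi>] open_UNIV)
  from smooth_param_integral(1)[OF this test_functions_compact[OF \<phi>]]
  show "smooth_on UNIV (Sop s \<phi>)" by (simp add: Sop_def[abs_def] fun_supp_zero)
  show "Sop s (\<lambda>x. c * \<phi> x) = (\<lambda>y. c * Sop s \<phi> y)"
    by (simp add: Sop_def fun_eq_iff mult.left_commute[of _ c])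
  assume \<psi>: "\<psi> \<in> test_functions"
  show "Sop s (\<lambda>x. \<phi> x + \<psi> x) = (\<lambda>y. Sop s \<phi> y + Sop s \<psi> y)"
    by (simp add: Sop_def fun_eq_iff distrib_left Bochner_Integration.integral_add Sop_integrable s \<phi> \<psi>)
qed

lemma D_Sop:
  fixes s :: "'a::euclidean_space \<times> 'a \<Rightarrow> complex"
  assumes s: "smooth_on UNIV s" and \<psi>: "\<psi> \<in> test_functions" and b: "b \<in> Basis"
  shows "D b (Sop s \<psi>) = Sop (D (0, b) s) \<psi>"
proof -
  let ?\<psi> = "\<lambda>z :: 'a \<times> 'a. \<psi> (fst z)"
  have sm: "smooth_on UNIV ?\<psi>" by (rule smooth_on_fst[OF test_functions_smooth[OF \<psi>]])
  have "D (0, b) ?\<psi> (x, y) = D b (\<lambda>y::'a. \<psi> x) y" for x y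
    by (subst D_slice_snd[symmetric, OF smooth_on_differentiable[OF sm UNIV_I]]) simp
  then have "D (0, b) (\<lambda>z. s z * ?\<psi> z) (x, y) = D (0, b) s (x, y) * \<psi> x" for x y
    by (subst D_mult) (auto intro!: smooth_on_differentiable[OF sm] smooth_on_differentiable[OF s])
  then show ?thesis
    using smooth_param_integral(2)[OF smooth_on_mult[OF open_UNIV s sm] test_functions_compact[OF \<psi>] _ b]
    by (simp add: Sop_def[abs_def] fun_supp_zero)
qed

text \<open>For fixed y this is a Fourier transform at -\<xi> of a function supported in
  \<open>K\<close>, with derivatives bounded uniformly for y in \<open>Y\<close>; hence every order
  \<open>t\<close> is reached. Derivatives in y only change the kernel.\<close>

lemma est_Sop:
  fixes K Y :: "'a::euclidean_space set"
  assumes K: "compact K" and Y: "compact Y" and s: "smooth_on UNIV s"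
  shows "est K Y t n (Sop s)"
  using s
proof (induction n arbitrary: s)
  case (0 s)
  obtain N :: nat where N: "- t \<le> real N" using real_arch_simple by blast
  obtain C where C: "0 \<le> C" "\<And>g M z. smooth_on UNIV g \<Longrightarrow> (\<And>x. x \<notin> K \<Longrightarrow> g x = 0) \<Longrightarrow>
    (\<And>x. x \<in> K \<Longrightarrow> dbound N g x M) \<Longrightarrow> cmod (Fh g z) \<le> C * M * japanese z powr (- real N)"
    using Fh_bound[OF K, of N] by blast
  obtain W where W: "0 \<le> W" "\<And>z. z \<in> K \<times> Y \<Longrightarrow> dbound N s z W"
    using smooth_on_dbound_compact[OF 0 compact_Times[OF K Y]] by (metis subset_UNIV)
  have sl: "smooth_on UNIV (\<lambda>x. s (x, y))" for y
    by (rule smooth_on_slice_fst[OF open_UNIV 0 open_UNIV]) auto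
  have Ws: "dbound N (\<lambda>x. s (x, y)) x W" if "x \<in> K" "y \<in> Y" for x y
    unfolding dbound_def
  proof (intro ballI impI)
    fix \<alpha> :: "'a list" assume a: "\<alpha> \<in> lists Basis" "length \<alpha> \<le> N"
    then show "cmod (iterD \<alpha> (\<lambda>x. s (x, y)) x) \<le> W"
      unfolding iterD_slice_fst[OF open_UNIV 0 a(1) UNIV_I] using that
      by (intro dboundD[OF W(2)]) auto
  qed
  show ?case
  proof (rule estI[of "C * (2 ^ N * W)" K N])
    fix h M y and \<xi> :: 'a assume h: "smooth_on UNIV h" "\<And>x. x \<notin> K \<Longrightarrow> h x = 0" "0 \<le> M"
        "\<And>x. x \<in> K \<Longrightarrow> dbound N h x M" "y \<in> Y"
    have "Sop s (\<lambda>x. h x * ex (- \<xi>) x) y = Fh (\<lambda>x. s (x, y) * h x) (- \<xi>)"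
      by (simp add: Sop_def Fh_def mult_ac)
    also have "cmod \<dots> \<le> C * (2 ^ N * (W * M)) * japanese (- \<xi>) powr (- real N)"
    proof (rule C(2))
      show "dbound N (\<lambda>x. s (x, y) * h x) x (2 ^ N * (W * M))" if "x \<in> K" for x
        by (rule dbound_mult[OF open_UNIV UNIV_I sl h(1) Ws[OF that h(5)] h(4)[OF that]])
    qed (use h sl in \<open>auto intro!: smooth_on_mult\<close>)
    also have "\<dots> \<le> C * (2 ^ N * (W * M)) * japanese \<xi> powr t"
      using C W h(3) N by (auto intro!: mult_left_mono japanese_powr_mono)
    finally show "dbound 0 (Sop s (\<lambda>x. h x * ex (- \<xi>) x)) y (C * (2 ^ N * W) * M * japanese \<xi> powr t)"
      by (simp add: mult_ac)
  qed (use C W in auto)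
next
  case (Suc n s)
  have z: "est K Y t 0 (Sop s)"
    by (rule est_order_0) (rule Suc.IH[OF Suc.prems])
  show ?case
  proof (rule est_Suc[OF z])
    fix b :: 'a assume b: "b \<in> Basis"
    have "smooth_on UNIV (D (0, b) s)" using Suc.prems b by (intro smooth_on_D) auto
    from est_cong[OF K Suc.IH[OF this]] show "est K Y t n (\<lambda>\<psi>. D b (Sop s \<psi>))"
      using D_Sop[OF Suc.prems _ b] by simp
  qed
qed

section \<open>From the Schwartz kernel to the transposed operator\<close>

lemma integral_pair_mult:
  fixes f :: "'a::euclidean_space \<Rightarrow> complex" and g :: "'b::euclidean_space \<Rightarrow> complex"
  assumes "integrable lborel f" "integrable lborel g"
  shows "(LINT z|lborel. f (fst z) * g (snd z)) = (LINT x|lborel. f x) * (LINT y|lborel. g y)"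
proof -
  have "(LINT z|lborel. f (fst z) * g (snd z)) = (LINT (x, y)|(lborel \<Otimes>\<^sub>M lborel). f x * g y)"
    by (simp add: lborel_prod case_prod_unfold)
  also have "\<dots> = (LINT x|lborel. LINT y|lborel. f x * g y)"
    by (rule lborel_pair.integral_fst[symmetric, OF integrable_pair_mult[OF assms]])
  finally show ?thesis by simp
qed

lemma continuous_on_compose_smooth:
  "smooth_on UNIV f \<Longrightarrow> continuous_on S g \<Longrightarrow> continuous_on S (\<lambda>x. f (g x))"
  by (rule continuous_on_compose2[OF smooth_on_continuous_on]) auto

definition tensor :: "('a \<Rightarrow> complex) \<Rightarrow> ('a \<Rightarrow> complex) \<Rightarrow> 'a \<times> 'a \<Rightarrow> complex" where
  "tensor \<psi> \<phi> = (\<lambda>(x, y). \<psi> x * \<phi> y)"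

lemma tensor_test:
  fixes \<phi> \<psi> :: "'a::euclidean_space \<Rightarrow> complex"
  assumes "\<phi> \<in> test_functions" "\<psi> \<in> test_functions"
  shows "tensor \<psi> \<phi> \<in> test_functions" "fun_supp (tensor \<psi> \<phi>) \<subseteq> fun_supp \<psi> \<times> fun_supp \<phi>"
proof -
  have z: "tensor \<psi> \<phi> z = 0" if "z \<notin> fun_supp \<psi> \<times> fun_supp \<phi>" for z
    using that fun_supp_zero[of "fst z" \<psi>] fun_supp_zero[of "snd z" \<phi>] by (cases z) (auto simp: tensor_def)
  show "tensor \<psi> \<phi> \<in> test_functions"
  proof (rule test_functionsI[OF _ compact_Times[OF test_functions_compact[OF assms(2)] test_functions_compact[OF assms(1)]] z])
    show "smooth_on UNIV (tensor \<psi> \<phi>)"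
      unfolding tensor_def split_beta
      by (intro smooth_on_mult smooth_on_fst smooth_on_snd test_functions_smooth assms open_UNIV)
  qed
  show "fun_supp (tensor \<psi> \<phi>) \<subseteq> fun_supp \<psi> \<times> fun_supp \<phi>"
    by (subst fun_supp_subset_iff) (auto intro: closed_Times z)
qed

text \<open>The cutoff makes the integrand continuous with compact support, so Fubini applies; at
  fixed frequency the phase factors and the integrals over x and y separate.\<close>

lemma regularized_integral:
  fixes p :: "'a::euclidean_space \<times> 'a \<Rightarrow> complex"
  assumes p: "p \<in> symbol_class m" and \<phi>: "\<phi> \<in> test_functions" and \<psi>: "\<psi> \<in> test_functions"
    and \<rho>: "\<rho> \<in> test_functions" and \<epsilon>: "0 < \<epsilon>"
  shows "(LINT ((x, y), \<xi>)|lborel. \<rho> (\<epsilon> *\<^sub>R \<xi>) * exp (\<i> * complex_of_real ((x - y) \<bullet> \<xi>)) *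
      p (x, \<xi>) * tensor \<psi> \<phi> (x, y))
    = (LINT \<xi>|lborel. \<rho> (\<epsilon> *\<^sub>R \<xi>) * (Fh (\<lambda>x. p (x, \<xi>) * \<psi> x) \<xi> * Fh \<phi> (- \<xi>)))"
proof -
  define G where "G z \<xi> = \<rho> (\<epsilon> *\<^sub>R \<xi>) * (ex \<xi> (fst z) * (p (fst z, \<xi>) * \<psi> (fst z))) * (ex (- \<xi>) (snd z) * \<phi> (snd z))"
    for z :: "'a \<times> 'a" and \<xi> :: 'a
  have eq: "(\<lambda>((x, y), \<xi>). \<rho> (\<epsilon> *\<^sub>R \<xi>) * exp (\<i> * complex_of_real ((x - y) \<bullet> \<xi>)) *
      p (x, \<xi>) * tensor \<psi> \<phi> (x, y)) = (\<lambda>w. case w of (z, \<xi>) \<Rightarrow> G z \<xi>)"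
  proof (rule ext)
    fix w :: "('a \<times> 'a) \<times> 'a"
    obtain x y \<xi> where w: "w = ((x, y), \<xi>)" by (metis surj_pair)
    have "exp (\<i> * complex_of_real ((x - y) \<bullet> \<xi>)) = ex \<xi> x * ex (- \<xi>) y"
      by (simp add: ex_def exp_add[symmetric] inner_diff_left algebra_simps)
    then show "(\<lambda>((x, y), \<xi>). \<rho> (\<epsilon> *\<^sub>R \<xi>) * exp (\<i> * complex_of_real ((x - y) \<bullet> \<xi>)) *
      p (x, \<xi>) * tensor \<psi> \<phi> (x, y)) w = (case w of (z, \<xi>) \<Rightarrow> G z \<xi>)"
      by (simp add: w G_def tensor_def mult_ac)
  qed
  let ?K = "(\<lambda>\<xi>. inverse \<epsilon> *\<^sub>R \<xi>) ` fun_supp \<rho>"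
  have K: "compact ((fun_supp \<psi> \<times> fun_supp \<phi>) \<times> ?K)"
    by (intro compact_Times compact_continuous_image test_functions_compact \<phi> \<psi> \<rho> continuous_intros)
  have "integrable lborel (\<lambda>w. case w of (z, \<xi>) \<Rightarrow> G z \<xi>)"
  proof (rule integrable_compact_supp[OF K])
    show "continuous_on ((fun_supp \<psi> \<times> fun_supp \<phi>) \<times> ?K) (\<lambda>w. case w of (z, \<xi>) \<Rightarrow> G z \<xi>)"
      unfolding split_beta G_def
      by (intro continuous_intros continuous_on_compose_smooth[OF test_functions_smooth[OF \<phi>]]
          continuous_on_compose_smooth[OF test_functions_smooth[OF \<psi>]]
          continuous_on_compose_smooth[OF test_functions_smooth[OF \<rho>]]
          continuous_on_compose_smooth[OF symbol_smooth[OF p]])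
    fix w assume w: "w \<notin> (fun_supp \<psi> \<times> fun_supp \<phi>) \<times> ?K"
    obtain x y \<xi> where xy: "w = ((x, y), \<xi>)" by (metis surj_pair)
    have "\<epsilon> *\<^sub>R \<xi> \<notin> fun_supp \<rho>" if "\<xi> \<notin> ?K" 
    proof
      assume "\<epsilon> *\<^sub>R \<xi> \<in> fun_supp \<rho>"
      then have "inverse \<epsilon> *\<^sub>R (\<epsilon> *\<^sub>R \<xi>) \<in> ?K" by (rule imageI)
      with that \<epsilon> show False by simp
    qed
    with w have "x \<notin> fun_supp \<psi> \<or> y \<notin> fun_supp \<phi> \<or> \<epsilon> *\<^sub>R \<xi> \<notin> fun_supp \<rho>"
      unfolding xy by blast
    then show "(case w of (z, \<xi>) \<Rightarrow> G z \<xi>) = 0"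
      unfolding xy by (auto simp: G_def dest: fun_supp_zero)
  qed
  then have int: "integrable (lborel \<Otimes>\<^sub>M lborel) (\<lambda>(z, \<xi>). G z \<xi>)" by (simp add: lborel_prod)
  have "(LINT w|lborel. (case w of (z, \<xi>) \<Rightarrow> G z \<xi>)) = (LINT \<xi>|lborel. LINT z|lborel. G z \<xi>)"
    using lborel_pair.integral_snd[OF int] by (simp add: lborel_prod)
  also have "\<dots> = (LINT \<xi>|lborel. \<rho> (\<epsilon> *\<^sub>R \<xi>) * (Fh (\<lambda>x. p (x, \<xi>) * \<psi> x) \<xi> * Fh \<phi> (- \<xi>)))"
  proof (intro Bochner_Integration.integral_cong refl)
    fix \<xi> :: 'a
    have "(LINT z|lborel. G z \<xi>) = (LINT z|lborel. (\<rho> (\<epsilon> *\<^sub>R \<xi>) * (ex \<xi> (fst z) * (p (fst z, \<xi>) * \<psi> (fst z)))) * (ex (- \<xi>) (snd z) * \<phi> (snd z)))"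
      by (simp add: G_def)
    also have "\<dots> = (LINT x|lborel. \<rho> (\<epsilon> *\<^sub>R \<xi>) * (ex \<xi> x * (p (x, \<xi>) * \<psi> x))) * (LINT y|lborel. ex (- \<xi>) y * \<phi> y)"
      by (rule integral_pair_mult)
         (intro integrable_mult_right integrable_test test_ex_mult symbol_slice_test[OF p \<psi>] \<phi>)+
    finally show "(LINT z|lborel. G z \<xi>) = \<rho> (\<epsilon> *\<^sub>R \<xi>) * (Fh (\<lambda>x. p (x, \<xi>) * \<psi> x) \<xi> * Fh \<phi> (- \<xi>))"
      by (simp add: Fh_def)
  qed
  finally show ?thesis unfolding eq .
qed

text \<open>The normalization in \<open>osc_integral\<close>; the estimates only use that it is not
  0.\<close>

definition cn :: "'a::euclidean_space itself \<Rightarrow> complex" where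
  "cn _ = complex_of_real (1 / (2 * pi) ^ DIM('a))"

lemma cn_nonzero: "cn TYPE('a::euclidean_space) \<noteq> 0"
  by (simp add: cn_def)

text \<open>On tensor products the integrals over x and y already decay rapidly in the frequency, so
  removing the regularization leaves an absolutely convergent integral. As the limit is given, one
  cutoff and one sequence of \<epsilon> identify it.\<close>

lemma osc_integral_eq:
  fixes p :: "'a::euclidean_space \<times> 'a \<Rightarrow> complex"
  assumes p: "p \<in> symbol_class m" and L: "osc_integral (\<lambda>((x, y), \<xi>). p (x, \<xi>)) L"
    and \<phi>: "\<phi> \<in> test_functions" and \<psi>: "\<psi> \<in> test_functions"
  shows "L (tensor \<psi> \<phi>) = cn TYPE('a) * (LINT y|lborel. \<phi> y * Op p \<psi> y)"
proof -
  have "0 \<le> (1::real)" "(1::real) < 2" by auto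
  then obtain \<rho> :: "'a \<Rightarrow> complex" where \<rho>: "\<rho> \<in> test_functions" "\<And>x. x \<in> cball 0 1 \<Longrightarrow> \<rho> x = 1"
    "\<And>x. x \<notin> ball 0 2 \<Longrightarrow> \<rho> x = 0" "fun_supp \<rho> \<subseteq> cball 0 2" "\<And>x. cmod (\<rho> x) \<le> 1"
    by (rule bump_test_exists[of 1 2 "0::'a"]) blast
  have "\<forall>\<^sub>F x in nhds 0. \<rho> x = 1"
    unfolding eventually_nhds using \<rho>(2) by (intro exI[of _ "ball 0 1"]) auto
  then have cut: "cutoff \<rho>" using \<rho>(1) by (simp add: cutoff_def)
  let ?B = "\<lambda>\<xi>. Fh (\<lambda>x. p (x, \<xi>) * \<psi> x) \<xi> * Fh \<phi> (- \<xi>)"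
  let ?I = "\<lambda>\<epsilon>. LINT ((x, y), \<xi>)|lborel. \<rho> (\<epsilon> *\<^sub>R \<xi>) * exp (\<i> * complex_of_real ((x - y) \<bullet> \<xi>)) *
      p (x, \<xi>) * tensor \<psi> \<phi> (x, y)"
  have lim: "((\<lambda>\<epsilon>. cn TYPE('a) * ?I \<epsilon>) \<longlongrightarrow> L (tensor \<psi> \<phi>)) (at_right 0)"
    using L[unfolded osc_integral_def, THEN conjunct2, rule_format, OF tensor_test(1)[OF \<phi> \<psi>] cut]
    by (simp only: cn_def prod.case)
  define f where "f = (\<lambda>k. inverse (real (Suc k)))"
  have "filterlim f (at_right 0) sequentially"
    unfolding f_def
    by (rule filterlim_compose[OF filterlim_inverse_at_right_top
          filterlim_compose[OF filterlim_real_sequentially filterlim_Suc]])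
  from filterlim_compose[OF lim this]
  have "(\<lambda>k. cn TYPE('a) * ?I (f k)) \<longlonglongrightarrow> L (tensor \<psi> \<phi>)" .
  moreover have "?I (f k) = (LINT \<xi>|lborel. \<rho> (f k *\<^sub>R \<xi>) * ?B \<xi>)" for k
    by (rule regularized_integral[OF p \<phi> \<psi> \<rho>(1)]) (simp add: f_def)
  ultimately have lim1: "(\<lambda>k. cn TYPE('a) * (LINT \<xi>|lborel. \<rho> (f k *\<^sub>R \<xi>) * ?B \<xi>)) \<longlonglongrightarrow> L (tensor \<psi> \<phi>)"
    by (simp only:)
  have rB: "rapid ?B"
  proof -
    obtain C where C: "\<And>\<eta>. cmod (Fh (\<lambda>x. p (x, \<eta>) * \<psi> x) \<eta>) \<le> C * japanese \<eta> powr 0"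
      by (rule rapid_bound[OF rapid_amplitude[OF p \<psi>]]) blast
    show ?thesis
      by (rule rapid_mult[OF rapid_reflect[OF rapid_Fh[OF \<phi>]] rapid_measurable[OF rapid_amplitude[OF p \<psi>]] C])
  qed
  have "(\<lambda>k. cn TYPE('a) * (LINT \<xi>|lborel. \<rho> (f k *\<^sub>R \<xi>) * ?B \<xi>)) \<longlonglongrightarrow> cn TYPE('a) * (\<rho> 0 * (LINT \<xi>|lborel. ?B \<xi>))"
    by (intro tendsto_mult_left scaled_integral_limit[OF \<rho>(1) rapid_integrable[OF rB] f_def])
  then have "L (tensor \<psi> \<phi>) = cn TYPE('a) * (LINT \<xi>|lborel. ?B \<xi>)"
    using LIMSEQ_unique[OF lim1] \<rho>(2)[of 0] by simp
  also have "(LINT \<xi>|lborel. ?B \<xi>) = (LINT y|lborel. \<phi> y * Op p \<psi> y)"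
    unfolding Op_def
    by (rule IF_Fubini[symmetric, OF integrable_test[OF \<phi>] rapid_integrable[OF rapid_amplitude[OF p \<psi>]]])
  finally show ?thesis .
qed

text \<open>The transpose of the operator as a map into functions: the part belonging to the left
  symbol plus the smooth kernel by which the Schwartz kernel differs from it.\<close>

definition Tr :: "('a::euclidean_space \<times> 'a \<Rightarrow> complex) \<Rightarrow> ('a \<times> 'a \<Rightarrow> complex) \<Rightarrow> ('a \<Rightarrow> complex) \<Rightarrow> 'a \<Rightarrow> complex" where
  "Tr p s \<psi> y = cn TYPE('a) * Op p \<psi> y + Sop s \<psi> y"

lemma linop_Tr:
  assumes "p \<in> symbol_class m" "smooth_on UNIV s"
  shows "linop (Tr p s)"
  using linop_Op[OF assms(1)] linop_Sop[OF assms(2)]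
  unfolding linop_def Tr_def[abs_def]
  by (auto simp: fun_eq_iff algebra_simps intro!: smooth_on_add smooth_on_mult)

lemma left_symbol_transpose:
  fixes P :: "'a::euclidean_space operator"
  assumes "left_symbol m P p"
  obtains s where "smooth_on UNIV s"
    "\<And>\<phi> \<psi>. \<phi> \<in> test_functions \<Longrightarrow> \<psi> \<in> test_functions \<Longrightarrow> P \<phi> \<psi> = (LINT y|lborel. Tr p s \<psi> y * \<phi> y)"
proof -
  from assms obtain K L where p: "p \<in> symbol_class m" and K: "schwartz_kernel P K"
    and L: "osc_integral (\<lambda>((x, y), \<xi>). p (x, \<xi>)) L" and sm: "dist_smooth_on UNIV (\<lambda>\<Phi>. K \<Phi> - L \<Phi>)"
    unfolding left_symbol_def by blast
  obtain s where s: "smooth_on UNIV s" "\<And>\<Phi>. \<Phi> \<in> test_functions \<Longrightarrow> K \<Phi> - L \<Phi> = dist_of_fun s \<Phi>"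
    using sm unfolding dist_smooth_on_def by auto
  have "P \<phi> \<psi> = (LINT y|lborel. Tr p s \<psi> y * \<phi> y)"
    if \<phi>: "\<phi> \<in> test_functions" and \<psi>: "\<psi> \<in> test_functions" for \<phi> \<psi>
  proof -
    have "P \<phi> \<psi> = K (tensor \<psi> \<phi>)" using K \<phi> \<psi> unfolding schwartz_kernel_def tensor_def by blast
    also have "\<dots> = L (tensor \<psi> \<phi>) + dist_of_fun s (tensor \<psi> \<phi>)"
      using s(2)[OF tensor_test(1)[OF \<phi> \<psi>]] by (simp add: algebra_simps)
    also have "dist_of_fun s (tensor \<psi> \<phi>) = (LINT y|lborel. \<phi> y * Sop s \<psi> y)"
    proof -
      have "integrable lborel (\<lambda>z. s z * tensor \<psi> \<phi> z)"
        by (rule integrable_test[OF test_functions_mult'[OF s(1) tensor_test(1)[OF \<phi> \<psi>]]])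
      moreover have e: "(\<lambda>z. s z * tensor \<psi> \<phi> z) = (\<lambda>(x, y). \<phi> y * (s (x, y) * \<psi> x))"
        by (auto simp: tensor_def)
      ultimately have i: "integrable (lborel \<Otimes>\<^sub>M lborel) (\<lambda>(x, y). \<phi> y * (s (x, y) * \<psi> x))"
        by (simp add: lborel_prod)
      have "dist_of_fun s (tensor \<psi> \<phi>) = (LINT y|lborel. LINT x|lborel. \<phi> y * (s (x, y) * \<psi> x))"
        unfolding dist_of_fun_def e using lborel_pair.integral_snd[OF i] by (simp add: lborel_prod)
      then show ?thesis by (simp add: Sop_def)
    qed
    also have "L (tensor \<psi> \<phi>) = cn TYPE('a) * (LINT y|lborel. \<phi> y * Op p \<psi> y)"
      by (rule osc_integral_eq[OF p L \<phi> \<psi>])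
    also have "cn TYPE('a) * (LINT y|lborel. \<phi> y * Op p \<psi> y) + (LINT y|lborel. \<phi> y * Sop s \<psi> y)
        = (LINT y|lborel. Tr p s \<psi> y * \<phi> y)"
    proof -
      have "integrable lborel (\<lambda>y. \<phi> y * Op p \<psi> y)" "integrable lborel (\<lambda>y. \<phi> y * Sop s \<psi> y)"
        using integrable_test[OF test_functions_mult'[OF linop_smooth[OF linop_Op[OF p] \<psi>] \<phi>]]
          integrable_test[OF test_functions_mult'[OF linop_smooth[OF linop_Sop[OF s(1)] \<psi>] \<phi>]]
        by (simp_all add: mult.commute)
      then show ?thesis
        by (subst integral_mult_right_zero[symmetric], subst Bochner_Integration.integral_add[symmetric])
           (auto simp: Tr_def algebra_simps)
    qed
    finally show ?thesis .
  qed
  with s(1) that show ?thesis by blast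
qed

text \<open>The kernel witnessing proper support and the one behind \<open>Tr\<close> are compared
  only through their values on tensor products. The compact set is the second projection of the
  kernel support over \<open>C\<close>; test functions supported off it pair to zero with
  \<open>Tr p s \<psi>\<close>, and the fundamental lemma turns this into vanishing at
  points.\<close>

lemma properly_supported_transpose:
  fixes P :: "'a::euclidean_space operator"
  assumes P: "properly_supported P" and p: "p \<in> symbol_class m" and s: "smooth_on UNIV s"
    and rep: "\<And>\<phi> \<psi>. \<phi> \<in> test_functions \<Longrightarrow> \<psi> \<in> test_functions \<Longrightarrow> P \<phi> \<psi> = (LINT y|lborel. Tr p s \<psi> y * \<phi> y)"
    and C: "compact C"
  shows "\<exists>K. compact K \<and> (\<forall>\<psi>\<in>test_functions. fun_supp \<psi> \<subseteq> C \<longrightarrow> (\<forall>y. y \<notin> K \<longrightarrow> Tr p s \<psi> y = 0))"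
proof -
  obtain k where k: "schwartz_kernel P k" "proper_map (top_of_set (dist_supp k)) euclidean fst"
    using P unfolding properly_supported_def by blast
  have kd: "k \<in> distributions" using k(1) unfolding schwartz_kernel_def by blast
  have "compactin (top_of_set (dist_supp k)) {z \<in> topspace (top_of_set (dist_supp k)). fst z \<in> C}"
    by (rule compactin_proper_map_preimage[OF k(2)]) (use C in simp)
  then have "compact {z \<in> dist_supp k. fst z \<in> C}" by (simp add: compactin_subtopology)
  then have K: "compact (snd ` {z \<in> dist_supp k. fst z \<in> C})"
    by (intro compact_continuous_image continuous_intros)
  let ?K = "snd ` {z \<in> dist_supp k. fst z \<in> C}"
  have "Tr p s \<psi> y = 0" if \<psi>: "\<psi> \<in> test_functions" "fun_supp \<psi> \<subseteq> C" and y: "y \<notin> ?K" for \<psi> y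
  proof (rule fundamental_lemma[of "- ?K" "Tr p s \<psi>"])
    show "open (- ?K)" using compact_imp_closed[OF K] by (simp add: open_Compl)
    show "continuous_on (- ?K) (Tr p s \<psi>)"
      using smooth_on_continuous_on[OF linop_smooth[OF linop_Tr[OF p s] \<psi>(1)]] by (rule continuous_on_subset) simp
    fix \<phi> :: "'a \<Rightarrow> complex" assume \<phi>: "\<phi> \<in> test_functions" "fun_supp \<phi> \<subseteq> - ?K"
    have "(LINT y|lborel. Tr p s \<psi> y * \<phi> y) = k (tensor \<psi> \<phi>)"
      using rep[OF \<phi>(1) \<psi>(1)] k(1) \<phi>(1) \<psi>(1) unfolding schwartz_kernel_def tensor_def by metis
    also have "\<dots> = 0"
    proof (rule dist_zero_off_supp[OF kd tensor_test(1)[OF \<phi>(1) \<psi>(1)]])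
      show "fun_supp (tensor \<psi> \<phi>) \<inter> dist_supp k = {}"
        using tensor_test(2)[OF \<phi>(1) \<psi>(1)] \<psi>(2) \<phi>(2) by force
    qed
    finally show "(LINT y|lborel. Tr p s \<psi> y * \<phi> y) = 0" .
  qed (use y in simp)
  with K show ?thesis by blast
qed

text \<open>The definite description in \<open>apply_op\<close> is resolved by the fundamental
  lemma: two densities representing the same functional coincide.\<close>

lemma apply_op_eq:
  fixes P :: "'a::euclidean_space operator"
  assumes rep: "\<And>\<phi>. \<phi> \<in> test_functions \<Longrightarrow> P \<phi> \<psi> = (LINT y|lborel. g y * \<phi> y)" and g: "g \<in> test_functions"
  shows "apply_op P u \<psi> = u g"
proof -
  have "(THE g. g \<in> test_functions \<and> (\<forall>\<phi>\<in>test_functions. transpose_op P \<psi> \<phi> = dist_of_fun g \<phi>)) = g"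
  proof (rule the_equality)
    show "g \<in> test_functions \<and> (\<forall>\<phi>\<in>test_functions. transpose_op P \<psi> \<phi> = dist_of_fun g \<phi>)"
      using g rep by (simp add: transpose_op_def dist_of_fun_def)
    fix g' assume g': "g' \<in> test_functions \<and> (\<forall>\<phi>\<in>test_functions. transpose_op P \<psi> \<phi> = dist_of_fun g' \<phi>)"
    have "g' y - g y = 0" for y
    proof (rule fundamental_lemma[OF open_UNIV, of "\<lambda>y. g' y - g y"])
      show "continuous_on UNIV (\<lambda>y. g' y - g y)"
        by (intro continuous_intros test_functions_continuous g) (use g' in blast)
      fix \<phi> :: "'a \<Rightarrow> complex" assume \<phi>: "\<phi> \<in> test_functions"
      have "integrable lborel (\<lambda>y. f y * \<phi> y)" if "f \<in> test_functions" for f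
        by (intro integrable_test test_functions_mult' test_functions_smooth that \<phi>)
      then show "(LINT y|lborel. (g' y - g y) * \<phi> y) = 0"
        using rep[OF \<phi>] g' g \<phi> by (simp add: transpose_op_def dist_of_fun_def left_diff_distrib)
    qed simp
    then show "g' = g" by (simp add: fun_eq_iff)
  qed
  then show ?thesis by (simp add: apply_op_def)
qed

section \<open>Microlocal comparison of a distribution with its image\<close>

text \<open>The action \<open>v = Pu\<close> of a properly supported operator, seen only through its transpose.\<close>

locale proper_transpose =
  fixes p s :: "'a::euclidean_space \<times> 'a \<Rightarrow> complex" and m :: real and u v :: "'a functional"
  assumes p: "p \<in> symbol_class m" and s: "smooth_on UNIV s"
    and proper: "\<And>C. compact C \<Longrightarrow> \<exists>K. compact K \<and>
      (\<forall>\<psi>\<in>test_functions. fun_supp \<psi> \<subseteq> C \<longrightarrow> (\<forall>y. y \<notin> K \<longrightarrow> Tr p s \<psi> y = 0))"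
    and u: "u \<in> distributions" and v: "\<And>\<psi>. \<psi> \<in> test_functions \<Longrightarrow> v \<psi> = u (Tr p s \<psi>)"
begin

lemma linop_cn_Op: "linop (\<lambda>\<psi> y. cn TYPE('a) * Op p \<psi> y)"
  using linop_Op[OF p] unfolding linop_def
  by (auto simp: fun_eq_iff algebra_simps intro!: smooth_on_mult)

lemma Tr_test: "\<psi> \<in> test_functions \<Longrightarrow> Tr p s \<psi> \<in> test_functions"
  using proper[OF test_functions_compact, of \<psi>] linop_smooth[OF linop_Tr[OF p s], of \<psi>]
  by (blast intro: test_functionsI)

lemma est_Tr:
  assumes "est K Y t n (Op p)" "compact K" "compact Y"
  shows "est K Y t n (Tr p s)"
proof -
  have "est K Y t n (\<lambda>\<psi> y. cn TYPE('a) * Op p \<psi> y)"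
    by (rule est_mult[OF assms(2,1) linop_Op[OF p]]) (use assms(3) in auto)
  from est_add[OF assms(2) this linop_cn_Op est_Sop[OF assms(2,3) s] linop_Sop[OF s]]
  show ?thesis by (simp add: Tr_def[abs_def])
qed

text \<open>Continuity of the transpose between test functions with supports in fixed compact sets
  is the case \<xi> = 0 of \<open>est\<close>, where the exponential and the weight are both
  1.\<close>

lemma v_distribution: "v \<in> distributions"
proof (rule distributionsI)
  show "v (\<lambda>x. \<phi> x + \<psi> x) = v \<phi> + v \<psi>" if "\<phi> \<in> test_functions" "\<psi> \<in> test_functions" for \<phi> \<psi>
    using that dist_add[OF u Tr_test Tr_test] by (simp add: v test_functions_add linop_add[OF linop_Tr[OF p s]])
  show "v (\<lambda>x. c * \<phi> x) = c * v \<phi>" if "\<phi> \<in> test_functions" for c \<phi>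
    using that dist_cmult[OF u Tr_test] by (simp add: v test_functions_cmult linop_cmult[OF linop_Tr[OF p s]])
  fix K :: "'a set" assume K: "compact K"
  obtain K' where K': "compact K'" "\<And>\<psi> y. \<psi> \<in> test_functions \<Longrightarrow> fun_supp \<psi> \<subseteq> K \<Longrightarrow> y \<notin> K' \<Longrightarrow> Tr p s \<psi> y = 0"
    using proper[OF K] by blast
  obtain C k where C: "0 \<le> C" "\<And>\<phi> M. \<phi> \<in> test_functions \<Longrightarrow> (\<And>x. x \<notin> K' \<Longrightarrow> \<phi> x = 0) \<Longrightarrow> 0 \<le> M \<Longrightarrow>
    (\<And>x. x \<in> K' \<Longrightarrow> dbound k \<phi> x M) \<Longrightarrow> cmod (u \<phi>) \<le> C * M"
    by (rule dist_bound[OF u K'(1)]) blast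
  have "est K K' (m + real k) k (Op p)"
    by (rule est_Op_derivatives[OF K est_subset[OF est_Op_order[OF _ K]] p]) auto
  from est_Tr[OF this K K'(1)] obtain C' N where CN: "est_const K K' (m + real k) k (Tr p s) C' N"
    unfolding est_def by blast
  have C': "0 \<le> C'" using CN unfolding est_const_def by blast
  have "cmod (v \<phi>) \<le> C * C' * M"
    if \<phi>: "\<phi> \<in> test_functions" "\<And>x. x \<notin> K \<Longrightarrow> \<phi> x = 0" "\<And>x. dbound N \<phi> x M" for \<phi> M
  proof -
    have M: "0 \<le> M" using dbound_nonneg[OF \<phi>(3)[of 0]] .
    have sup: "fun_supp \<phi> \<subseteq> K" using fun_supp_subset_iff[OF compact_imp_closed[OF K]] \<phi>(2) by blast
    have "cmod (u (Tr p s \<phi>)) \<le> C * (C' * M)"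
    proof (rule C(2)[OF Tr_test[OF \<phi>(1)] K'(2)[OF \<phi>(1) sup]])
      show "dbound k (Tr p s \<phi>) y (C' * M)" if "y \<in> K'" for y
        using est_constD[OF CN test_functions_smooth[OF \<phi>(1)] \<phi>(2) M \<phi>(3) that, of 0]
        by (simp add: japanese_def)
    qed (use C' M in auto)
    then show ?thesis by (simp add: v \<phi>(1) mult.assoc)
  qed
  then show "\<exists>C k. 0 \<le> C \<and> (\<forall>\<phi> M. \<phi> \<in> test_functions \<longrightarrow> (\<forall>x. x \<notin> K \<longrightarrow> \<phi> x = 0) \<longrightarrow>
       (\<forall>x. dbound k \<phi> x M) \<longrightarrow> cmod (v \<phi>) \<le> C * M)"
    using C(1) C' by (intro exI[of _ "C * C'"] exI[of _ N]) auto
qed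

end

text \<open>The bounds of a symbol of order \<open>\<rho>\<close>; derivatives in \<open>\<xi>\<close> are never needed.\<close>

definition amplitudes :: "'a::euclidean_space set \<Rightarrow> real \<Rightarrow> ('a \<Rightarrow> 'a \<Rightarrow> complex) \<Rightarrow> bool" where
  "amplitudes K \<rho> h \<longleftrightarrow> (\<forall>\<xi>. smooth_on UNIV (h \<xi>) \<and> (\<forall>x. x \<notin> K \<longrightarrow> h \<xi> x = 0)) \<and>
     (\<forall>N. \<exists>C\<ge>0. \<forall>\<xi>. \<forall>x\<in>K. dbound N (h \<xi>) x (C * japanese \<xi> powr \<rho>))"

lemma amplitudesD:
  assumes "amplitudes K \<rho> h"
  shows "smooth_on UNIV (h \<xi>)" "x \<notin> K \<Longrightarrow> h \<xi> x = 0"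
  using assms unfolding amplitudes_def by blast+

lemma amplitudes_bound:
  assumes "amplitudes K \<rho> h"
  obtains C where "0 \<le> C" "\<And>\<xi> x. x \<in> K \<Longrightarrow> dbound N (h \<xi>) x (C * japanese \<xi> powr \<rho>)"
  using assms unfolding amplitudes_def by meson

lemma est_amplitudes:
  assumes F: "est K Y t n F" and h: "amplitudes K \<rho> h"
  obtains C where "0 \<le> C" "\<And>\<xi> y. y \<in> Y \<Longrightarrow> dbound n (F (\<lambda>x. h \<xi> x * ex (- \<xi>) x)) y (C * japanese \<xi> powr (t + \<rho>))"
proof -
  obtain C N where CN: "est_const K Y t n F C N" using F unfolding est_def by blast
  then have C: "0 \<le> C" unfolding est_const_def by blast
  obtain C' where C': "0 \<le> C'" "\<And>\<xi> x. x \<in> K \<Longrightarrow> dbound N (h \<xi>) x (C' * japanese \<xi> powr \<rho>)"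
    using amplitudes_bound[OF h] by blast
  show ?thesis
  proof (rule that[of "C * C'"])
    fix \<xi> y assume y: "y \<in> Y"
    have "dbound n (F (\<lambda>x. h \<xi> x * ex (- \<xi>) x)) y (C * (C' * japanese \<xi> powr \<rho>) * japanese \<xi> powr t)"
      by (rule est_constD[OF CN amplitudesD[OF h] _ C'(2) y]) (use C' in auto)
    then show "dbound n (F (\<lambda>x. h \<xi> x * ex (- \<xi>) x)) y (C * C' * japanese \<xi> powr (t + \<rho>))"
      by (simp add: powr_add mult_ac)
  qed (use C C' in auto)
qed

lemma Fh_shift: "Fh (\<lambda>x. g x * ex (- \<xi>) x) \<eta> = Fh g (\<eta> - \<xi>)"
  unfolding Fh_def using ex_add(1)[of \<eta> "- \<xi>"] by (simp add: mult_ac)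

lemma amplitudes_test: "compact K \<Longrightarrow> amplitudes K \<rho> h \<Longrightarrow> (\<lambda>x. h \<xi> x * ex z x) \<in> test_functions"
  unfolding amplitudes_def by (rule test_mult_ex[of K]) auto

context proper_transpose
begin

text \<open>The transposed test function is cut by \<kappa>. The part under 1 - \<kappa> lives at
  positive distance from the support of \<open>h \<xi>\<close> and has arbitrarily low order, like
  the part from the smooth kernel; the remaining oscillatory part becomes the frequency integral by
  \<open>dist_IF\<close>.\<close>

lemma reduction_to_diagonal:
  assumes r: "0 \<le> r" "r < r'" and h: "amplitudes (cball x0 r) \<rho> h"
    and \<kappa>: "\<kappa> \<in> test_functions" "\<And>x. x \<in> cball x0 r' \<Longrightarrow> \<kappa> x = 1"
  shows "\<exists>C. \<forall>\<xi>. cmod (v (\<lambda>x. h \<xi> x * ex (- \<xi>) x)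
      - cn TYPE('a) * (LINT \<eta>|lborel. Fh (\<lambda>x. p (x, \<eta>) * h \<xi> x) (\<eta> - \<xi>) * FD u \<kappa> \<eta>)) \<le> C * japanese \<xi> powr t"
proof -
  let ?K = "cball x0 r" and ?\<kappa>' = "\<lambda>y. 1 - \<kappa> y"
  define \<psi> where "\<psi> \<xi> x = h \<xi> x * ex (- \<xi>) x" for \<xi> x
  have K: "compact ?K" by simp
  have \<psi>: "\<psi> \<xi> \<in> test_functions" for \<xi> unfolding \<psi>_def[abs_def] by (rule amplitudes_test[OF K h])
  have \<psi>K: "fun_supp (\<psi> \<xi>) \<subseteq> ?K" for \<xi>
    by (subst fun_supp_subset_iff) (use amplitudesD(2)[OF h] in \<open>auto simp: \<psi>_def\<close>)
  have \<kappa>'s: "smooth_on UNIV ?\<kappa>'" by (intro smooth_on_diff smooth_on_const test_functions_smooth \<kappa> open_UNIV)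
  obtain K' where K': "compact K'" "\<And>\<psi> y. \<psi> \<in> test_functions \<Longrightarrow> fun_supp \<psi> \<subseteq> ?K \<Longrightarrow> y \<notin> K' \<Longrightarrow> Tr p s \<psi> y = 0"
    using proper[OF K] by blast
  obtain Ca ka where a: "0 \<le> Ca" "\<And>\<phi> M. \<phi> \<in> test_functions \<Longrightarrow> (\<And>x. x \<notin> K' \<Longrightarrow> \<phi> x = 0) \<Longrightarrow> 0 \<le> M \<Longrightarrow>
    (\<And>x. x \<in> K' \<Longrightarrow> dbound ka \<phi> x M) \<Longrightarrow> cmod (u \<phi>) \<le> Ca * M"
    by (rule dist_bound[OF u K'(1)]) blast
  obtain Cb kb where b: "0 \<le> Cb" "\<And>g M. smooth_on UNIV g \<Longrightarrow> 0 \<le> M \<Longrightarrow>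
    (\<And>x. x \<in> fun_supp \<kappa> \<Longrightarrow> dbound kb g x M) \<Longrightarrow> cmod (u (\<lambda>x. g x * \<kappa> x)) \<le> Cb * M"
    by (rule dist_bound_localized[OF u \<kappa>(1)]) blast
  \<comment> \<open>Outside \<open>K'\<close> the transposed function vanishes, and on the ball of
    radius r' the factor 1 - \<kappa> does. Only this compact set remains, at distance at least r' -
    r from the support of \<open>h \<xi>\<close>.\<close>
  define Y where "Y = K' - ball x0 r'"
  have Y: "compact Y" unfolding Y_def by (rule compact_diff[OF K'(1) open_ball])
  have sep: "r' - r \<le> norm (x - y)" if "x \<in> ?K" "y \<in> Y" for x y
    using that norm_triangle_ineq4[of "x0 - x" "y - x"] dist_triangle[of x0 y x]
    by (auto simp: Y_def dist_norm)
  \<comment> \<open>The order \<rho> of the amplitudes and the \<open>ka\<close> derivatives that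
    the bound for \<open>u\<close> involves are subtracted in advance, so that the total is
    t.\<close>
  have "est ?K Y (t - \<rho> - real ka) 0 (Op q)" if "q \<in> symbol_class m" for q
    by (rule est_Op_off_diagonal[OF K Y _ sep that]) (use r in auto)
  from est_Op_derivatives[OF K this p, of ka]
  have "est ?K Y (t - \<rho>) ka (Op p)" by simp
  from est_mult[OF K est_Tr[OF this K Y] linop_Tr[OF p s] \<kappa>'s]
  have "est ?K Y (t - \<rho>) ka (\<lambda>\<psi> y. ?\<kappa>' y * Tr p s \<psi> y)" using Y by blast
  from est_amplitudes[OF this h]
  obtain C1 where C1: "0 \<le> C1"
    "\<And>\<xi> y. y \<in> Y \<Longrightarrow> dbound ka (\<lambda>y. ?\<kappa>' y * Tr p s (\<psi> \<xi>) y) y (C1 * japanese \<xi> powr t)"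
    unfolding \<psi>_def[abs_def] by auto
  obtain C2 where C2: "0 \<le> C2"
    "\<And>\<xi> y. y \<in> fun_supp \<kappa> \<Longrightarrow> dbound kb (Sop s (\<psi> \<xi>)) y (C2 * japanese \<xi> powr t)"
    using est_amplitudes[OF est_Sop[OF K test_functions_compact[OF \<kappa>(1)] s, of "t - \<rho>" kb] h]
    unfolding \<psi>_def[abs_def] by auto
  have "cmod (v (\<psi> \<xi>) - cn TYPE('a) * (LINT \<eta>|lborel. Fh (\<lambda>x. p (x, \<eta>) * h \<xi> x) (\<eta> - \<xi>) * FD u \<kappa> \<eta>))
      \<le> (Ca * C1 + Cb * C2) * japanese \<xi> powr t" for \<xi>
  proof -
    have Ts: "smooth_on UNIV (Op p (\<psi> \<xi>))" "smooth_on UNIV (Sop s (\<psi> \<xi>))" "smooth_on UNIV (Tr p s (\<psi> \<xi>))"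
      by (intro linop_smooth[OF linop_Op[OF p] \<psi>] linop_smooth[OF linop_Sop[OF s] \<psi>] linop_smooth[OF linop_Tr[OF p s] \<psi>])+
    have t1: "(\<lambda>y. ?\<kappa>' y * Tr p s (\<psi> \<xi>) y) \<in> test_functions" by (rule test_functions_mult'[OF \<kappa>'s Tr_test[OF \<psi>]])
    have t2: "(\<lambda>y. Op p (\<psi> \<xi>) y * \<kappa> y) \<in> test_functions" "(\<lambda>y. Sop s (\<psi> \<xi>) y * \<kappa> y) \<in> test_functions"
      by (intro test_functions_mult' Ts \<kappa>)+
    \<comment> \<open>Each of the three summands is compactly supported, so \<open>u\<close> may be
      applied to them separately.\<close>
    have "Tr p s (\<psi> \<xi>) = (\<lambda>y. (cn TYPE('a) * (Op p (\<psi> \<xi>) y * \<kappa> y) + Sop s (\<psi> \<xi>) y * \<kappa> y) + ?\<kappa>' y * Tr p s (\<psi> \<xi>) y)"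
      by (simp add: fun_eq_iff Tr_def algebra_simps)
    then have "v (\<psi> \<xi>) = u (\<lambda>y. (cn TYPE('a) * (Op p (\<psi> \<xi>) y * \<kappa> y) + Sop s (\<psi> \<xi>) y * \<kappa> y) + ?\<kappa>' y * Tr p s (\<psi> \<xi>) y)"
      using v[OF \<psi>] by metis
    also have "\<dots> = cn TYPE('a) * u (\<lambda>y. Op p (\<psi> \<xi>) y * \<kappa> y) + u (\<lambda>y. Sop s (\<psi> \<xi>) y * \<kappa> y)
        + u (\<lambda>y. ?\<kappa>' y * Tr p s (\<psi> \<xi>) y)"
      by (subst dist_add[OF u test_functions_add[OF test_functions_cmult[OF t2(1)] t2(2)] t1],
          subst dist_add[OF u test_functions_cmult[OF t2(1)] t2(2)], subst dist_cmult[OF u t2(1)]) (rule refl)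
    also have "u (\<lambda>y. Op p (\<psi> \<xi>) y * \<kappa> y) = (LINT \<eta>|lborel. Fh (\<lambda>x. p (x, \<eta>) * \<psi> \<xi> x) \<eta> * FD u \<kappa> \<eta>)"
      unfolding Op_def
      by (rule dist_IF[OF u \<kappa>(1) rapid_amplitude[OF p \<psi>] smooth_on_continuous_on[OF smooth_on_Fh_param[OF symbol_smooth[OF p] \<psi>]]])
    also have "(\<lambda>\<eta>. Fh (\<lambda>x. p (x, \<eta>) * \<psi> \<xi> x) \<eta> * FD u \<kappa> \<eta>) = (\<lambda>\<eta>. Fh (\<lambda>x. p (x, \<eta>) * h \<xi> x) (\<eta> - \<xi>) * FD u \<kappa> \<eta>)"
      using Fh_shift[of "\<lambda>x. p (x, _) * h \<xi> x" \<xi>] by (simp add: \<psi>_def mult.assoc)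
    finally have eq: "v (\<psi> \<xi>) - cn TYPE('a) * (LINT \<eta>|lborel. Fh (\<lambda>x. p (x, \<eta>) * h \<xi> x) (\<eta> - \<xi>) * FD u \<kappa> \<eta>)
       = u (\<lambda>y. Sop s (\<psi> \<xi>) y * \<kappa> y) + u (\<lambda>y. ?\<kappa>' y * Tr p s (\<psi> \<xi>) y)"
      by simp
    have 1: "cmod (u (\<lambda>y. ?\<kappa>' y * Tr p s (\<psi> \<xi>) y)) \<le> Ca * (C1 * japanese \<xi> powr t)"
    proof (rule a(2)[OF t1])
      show "?\<kappa>' y * Tr p s (\<psi> \<xi>) y = 0" if "y \<notin> K'" for y using K'(2)[OF \<psi> \<psi>K that] by simp
      show "dbound ka (\<lambda>y. ?\<kappa>' y * Tr p s (\<psi> \<xi>) y) y (C1 * japanese \<xi> powr t)" if "y \<in> K'" for y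
      proof (cases "y \<in> ball x0 r'")
        case True
        show ?thesis by (rule dbound_zero[OF open_ball _ True]) (use \<kappa>(2) C1 in auto)
      next
        case False
        then show ?thesis using that C1(2) unfolding Y_def by blast
      qed
    qed (use C1 in auto)
    have 2: "cmod (u (\<lambda>y. Sop s (\<psi> \<xi>) y * \<kappa> y)) \<le> Cb * (C2 * japanese \<xi> powr t)"
      by (rule b(2)[OF Ts(2) _ C2(2)]) (use C2 in auto)
    show ?thesis unfolding eq using norm_triangle_mono[OF 2 1] by (simp add: algebra_simps)
  qed
  then show ?thesis unfolding \<psi>_def[abs_def] by blast
qed

end

section \<open>From rapid decay for u to rapid decay for Pu\<close>

lemma Fh_amplitudes:
  assumes K: "compact K" and h: "amplitudes K \<rho> h"
  obtains C where "0 \<le> C" "\<And>\<xi> z. cmod (Fh (h \<xi>) z) \<le> C * japanese \<xi> powr \<rho> * japanese z powr (- real N)"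
proof -
  obtain C where C: "0 \<le> C" "\<And>g M z. smooth_on UNIV g \<Longrightarrow> (\<And>x. x \<notin> K \<Longrightarrow> g x = 0) \<Longrightarrow>
    (\<And>x. x \<in> K \<Longrightarrow> dbound N g x M) \<Longrightarrow> cmod (Fh g z) \<le> C * M * japanese z powr (- real N)"
    using Fh_bound[OF K, of N] by blast
  obtain C' where C': "0 \<le> C'" "\<And>\<xi> x. x \<in> K \<Longrightarrow> dbound N (h \<xi>) x (C' * japanese \<xi> powr \<rho>)"
    using amplitudes_bound[OF h] by blast
  show ?thesis
  proof (rule that[of "C * C'"])
    show "cmod (Fh (h \<xi>) z) \<le> C * C' * japanese \<xi> powr \<rho> * japanese z powr (- real N)" for \<xi> z
    proof -
      have "cmod (Fh (h \<xi>) z) \<le> C * (C' * japanese \<xi> powr \<rho>) * japanese z powr (- real N)"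
        by (rule C(2)[OF amplitudesD[OF h] C'(2)])
      then show ?thesis by (simp add: mult.assoc)
    qed
  qed (use C C' in auto)
qed

text \<open>The gap between a compact subset and the boundary of the ball is where the later cutoffs
  descend from 1 to 0.\<close>

lemma inner_radius:
  assumes "compact K" "K \<subseteq> ball x R" "0 < R"
  obtains r where "0 \<le> r" "r < R" "K \<subseteq> cball x r"
proof (cases "K = {}")
  case True
  then show ?thesis using that[of 0] assms by auto
next
  case False
  have "continuous_on K (\<lambda>y. dist x y)" by (intro continuous_intros)
  then obtain y where y: "y \<in> K" "\<And>z. z \<in> K \<Longrightarrow> dist x z \<le> dist x y"
    using continuous_attains_sup[OF assms(1) False] by blast
  show ?thesis by (rule that[of "dist x y"]) (use y assms in auto)
qed

lemma amplitudes_const: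
  assumes "\<kappa> \<in> test_functions" "fun_supp \<kappa> \<subseteq> K" "compact K"
  shows "amplitudes K 0 (\<lambda>\<xi>. \<kappa>)"
  unfolding amplitudes_def
proof (intro conjI allI impI)
  show "\<kappa> x = 0" if "x \<notin> K" for x using that assms(2) by (intro fun_supp_zero[of x \<kappa>]) blast
  fix N
  obtain C where "0 \<le> C" "\<And>x. x \<in> K \<Longrightarrow> dbound N \<kappa> x C"
    using smooth_on_dbound_compact[OF test_functions_smooth[OF assms(1)] assms(3)] by blast
  then show "\<exists>C\<ge>0. \<forall>\<xi>::'a. \<forall>x\<in>K. dbound N \<kappa> x (C * japanese \<xi> powr 0)" by auto
qed (rule test_functions_smooth[OF assms(1)])

text \<open>The amplitude varies with \<xi>, so the left-hand side is not a value of one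
  \<open>FD\<close>. Fourier inversion under a fixed cutoff turns it into an integral of
  \<open>FD v \<kappa>\<close> against the transform of \<open>h \<xi>\<close>, which decays in
  \<eta> - \<xi>.\<close>

lemma rapid_at_amplitudes:
  fixes v :: "'a::euclidean_space functional"
  assumes v: "v \<in> distributions" "rapid_at v x0 R" and r: "0 \<le> r" "r < R"
    and h: "amplitudes (cball x0 r) \<rho> h"
  shows "\<exists>C. \<forall>\<xi>. cmod (v (\<lambda>x. h \<xi> x * ex (- \<xi>) x)) \<le> C * japanese \<xi> powr t"
proof -
  obtain c where c: "c \<noteq> 0" "\<And>(\<phi> :: 'a \<Rightarrow> complex) y. \<phi> \<in> test_functions \<Longrightarrow> IF (Fh \<phi>) y = c * \<phi> y"
    using Fourier_inversion by metis
  have "r < (r + R) / 2" using r by simp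
  then obtain \<kappa> :: "'a \<Rightarrow> complex" where \<kappa>: "\<kappa> \<in> test_functions" "\<And>x. x \<in> cball x0 r \<Longrightarrow> \<kappa> x = 1"
    "\<And>x. x \<notin> ball x0 ((r + R) / 2) \<Longrightarrow> \<kappa> x = 0" "fun_supp \<kappa> \<subseteq> cball x0 ((r + R) / 2)" "\<And>x. cmod (\<kappa> x) \<le> 1"
    by (rule bump_test_exists[OF r(1)]) blast
  have "cball x0 ((r + R) / 2) \<subseteq> ball x0 R" using r by (auto simp: cball_subset_ball_iff)
  then have rap: "rapid (FD v \<kappa>)" using v(2) \<kappa> unfolding rapid_at_def by blast
  \<comment> \<open>Decay of this order compensates the order \<rho> of the amplitudes.\<close>
  define \<sigma> where "\<sigma> = t - \<rho>"
  obtain N :: nat where N: "\<bar>\<sigma>\<bar> + 0 + 2 * real DIM('a) \<le> real N" using real_arch_simple by blast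
  obtain C1 where C1: "0 \<le> C1" "\<And>\<xi> z. cmod (Fh (h \<xi>) z) \<le> C1 * japanese \<xi> powr \<rho> * japanese z powr (- real N)"
    using Fh_amplitudes[OF compact_cball h] by blast
  obtain C2 where C2: "0 \<le> C2" "\<And>\<eta>. cmod (FD v \<kappa> \<eta>) \<le> C2 * japanese \<eta> powr \<sigma>"
    by (rule rapid_bound[OF rap]) blast
  let ?c = "2 powr \<bar>\<sigma>\<bar> * (LINT \<eta>|lborel. japanese (\<eta>::'a) powr (- 2 * real DIM('a)))"
  have "cmod (v (\<lambda>x. h \<xi> x * ex (- \<xi>) x)) \<le> cmod (inverse c) * (C1 * C2 * ?c) * japanese \<xi> powr t" for \<xi>
  proof -
    define \<psi> where "\<psi> x = h \<xi> x * ex (- \<xi>) x" for x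
    have \<psi>: "\<psi> \<in> test_functions" unfolding \<psi>_def[abs_def] by (rule amplitudes_test[OF compact_cball h])
    have "\<psi> x = inverse c * (IF (Fh \<psi>) x * \<kappa> x)" for x
      using c \<psi> \<kappa>(2)[of x] amplitudesD(2)[OF h, of x \<xi>] by (cases "x \<in> cball x0 r") (auto simp: \<psi>_def)
    then have "v \<psi> = v (\<lambda>x. inverse c * (IF (Fh \<psi>) x * \<kappa> x))" by metis
    also have "\<dots> = inverse c * v (\<lambda>x. IF (Fh \<psi>) x * \<kappa> x)"
      by (rule dist_cmult[OF v(1) test_functions_mult'[OF smooth_on_IF[OF rapid_Fh[OF \<psi>]] \<kappa>(1)]])
    also have "v (\<lambda>x. IF (Fh \<psi>) x * \<kappa> x) = (LINT \<eta>|lborel. Fh \<psi> \<eta> * FD v \<kappa> \<eta>)"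
      by (rule dist_IF[OF v(1) \<kappa>(1) rapid_Fh[OF \<psi>] smooth_on_continuous_on[OF smooth_on_Fh[OF \<psi>]]])
    finally have eq: "v \<psi> = inverse c * (LINT \<eta>|lborel. Fh \<psi> \<eta> * FD v \<kappa> \<eta>)" .
    have "cmod (LINT \<eta>|lborel. Fh \<psi> \<eta> * FD v \<kappa> \<eta>) \<le> (LINT \<eta>|lborel. cmod (Fh \<psi> \<eta> * FD v \<kappa> \<eta>))"
      by (rule integral_norm_bound)
    also have "\<dots> \<le> (C1 * C2 * japanese \<xi> powr \<rho>) * ?c * japanese \<xi> powr \<sigma>"
    proof (rule japanese_convolution[OF N])
      fix \<eta>
      have "cmod (Fh \<psi> \<eta> * FD v \<kappa> \<eta>) \<le> (C1 * japanese \<xi> powr \<rho> * japanese (\<eta> - \<xi>) powr (- real N)) * (C2 * japanese \<eta> powr \<sigma>)"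
        unfolding norm_mult \<psi>_def[abs_def] Fh_shift
        by (rule mult_mono[OF C1(2) C2(2)]) (use C1(1) in auto)
      then show "cmod (Fh \<psi> \<eta> * FD v \<kappa> \<eta>) \<le> C1 * C2 * japanese \<xi> powr \<rho> *
          (japanese \<eta> powr \<sigma> * japanese (\<eta> - \<xi>) powr 0 * japanese (\<eta> - \<xi>) powr (- real N))"
        by (simp add: mult_ac)
    qed (use C1 C2 in auto)
    also have "\<dots> = C1 * C2 * ?c * japanese \<xi> powr t"
      by (simp add: \<sigma>_def powr_diff)
    finally have "cmod (inverse c) * cmod (LINT \<eta>|lborel. Fh \<psi> \<eta> * FD v \<kappa> \<eta>)
        \<le> cmod (inverse c) * (C1 * C2 * ?c * japanese \<xi> powr t)"
      by (rule mult_left_mono) simp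
    then show ?thesis unfolding \<psi>_def[symmetric, abs_def] eq norm_mult by (simp add: mult.assoc)
  qed
  then show ?thesis by blast
qed

lemma rapidI:
  assumes "B \<in> borel_measurable borel" "\<And>s. \<exists>C. \<forall>\<eta>. cmod (B \<eta>) \<le> C * japanese \<eta> powr s"
  shows "rapid B"
  using assms unfolding rapid_def by blast

context proper_transpose
begin

text \<open>For the constant family \<kappa>0 the frequency integral pairs
  \<open>FD u \<kappa>\<close> with a kernel of size <\<eta>>^m that decays rapidly in \<eta> -
  \<xi>; decay of order t - m for \<open>FD u \<kappa>\<close> yields order t.\<close>

lemma rapid_at_image:
  assumes R: "0 < R" and rap: "rapid_at u x0 R"
  shows "rapid_at v x0 R"
  unfolding rapid_at_def
proof (intro ballI impI)
  fix \<kappa>0 :: "'a \<Rightarrow> complex" assume \<kappa>0: "\<kappa>0 \<in> test_functions" "fun_supp \<kappa>0 \<subseteq> ball x0 R"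
  obtain r where r: "0 \<le> r" "r < R" "fun_supp \<kappa>0 \<subseteq> cball x0 r"
    using inner_radius[OF test_functions_compact[OF \<kappa>0(1)] \<kappa>0(2) R] by blast
  define r' where "r' = (r + R) / 2"
  \<comment> \<open>Four nested radii: for the support of \<kappa>0, the plateau of \<kappa>, the
    support of \<kappa>, and the given ball.\<close>
  have r': "0 \<le> r'" "r < r'" "r' < (r' + R) / 2" "(r' + R) / 2 < R" using r by (auto simp: r'_def)
  obtain \<kappa> :: "'a \<Rightarrow> complex" where \<kappa>: "\<kappa> \<in> test_functions" "\<And>x. x \<in> cball x0 r' \<Longrightarrow> \<kappa> x = 1"
    "\<And>x. x \<notin> ball x0 ((r' + R) / 2) \<Longrightarrow> \<kappa> x = 0" "fun_supp \<kappa> \<subseteq> cball x0 ((r' + R) / 2)" "\<And>x. cmod (\<kappa> x) \<le> 1"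
    by (rule bump_test_exists[OF r'(1,3)]) blast
  have "cball x0 ((r' + R) / 2) \<subseteq> ball x0 R" using r' by (auto simp: cball_subset_ball_iff)
  then have rapu: "rapid (FD u \<kappa>)" using rap \<kappa> unfolding rapid_at_def by blast
  have h: "amplitudes (cball x0 r) 0 (\<lambda>\<xi>. \<kappa>0)" by (rule amplitudes_const[OF \<kappa>0(1) r(3) compact_cball])
  show "rapid (FD v \<kappa>0)"
  proof (rule rapidI[OF FD_measurable[OF v_distribution \<kappa>0(1)]])
    fix t
    obtain C where C: "\<And>\<xi>. cmod (v (\<lambda>x. \<kappa>0 x * ex (- \<xi>) x)
      - cn TYPE('a) * (LINT \<eta>|lborel. Fh (\<lambda>x. p (x, \<eta>) * \<kappa>0 x) (\<eta> - \<xi>) * FD u \<kappa> \<eta>)) \<le> C * japanese \<xi> powr t"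
      using reduction_to_diagonal[OF r(1) r'(2) h \<kappa>(1,2), of t] by blast
    obtain N :: nat where N: "\<bar>t\<bar> + 0 + 2 * real DIM('a) \<le> real N" using real_arch_simple by blast
    obtain C1 where C1: "0 \<le> C1" "\<And>g M (\<eta>::'a) z. smooth_on UNIV g \<Longrightarrow> (\<And>x. x \<notin> cball x0 r \<Longrightarrow> g x = 0) \<Longrightarrow>
      (\<And>x. x \<in> cball x0 r \<Longrightarrow> dbound N g x M) \<Longrightarrow>
      cmod (Fh (\<lambda>x. p (x, \<eta>) * g x) z) \<le> C1 * M * japanese \<eta> powr m * japanese z powr (- real N)"
      using Fh_symbol_bound[OF p compact_cball] by blast
    obtain M where M: "0 \<le> M" "\<And>x. x \<in> cball x0 r \<Longrightarrow> dbound N \<kappa>0 x M"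
      using smooth_on_dbound_compact[OF test_functions_smooth[OF \<kappa>0(1)] compact_cball] by blast
    obtain C2 where C2: "0 \<le> C2" "\<And>\<eta>. cmod (FD u \<kappa> \<eta>) \<le> C2 * japanese \<eta> powr (t - m)"
      by (rule rapid_bound[OF rapu]) blast
    let ?c = "2 powr \<bar>t\<bar> * (LINT \<eta>|lborel. japanese (\<eta>::'a) powr (- 2 * real DIM('a)))"
    have "cmod (FD v \<kappa>0 \<xi>) \<le> (C + cmod (cn TYPE('a)) * (C1 * M * C2 * ?c)) * japanese \<xi> powr t" for \<xi>
    proof -
      let ?I = "LINT \<eta>|lborel. Fh (\<lambda>x. p (x, \<eta>) * \<kappa>0 x) (\<eta> - \<xi>) * FD u \<kappa> \<eta>"
      have "cmod ?I \<le> (LINT \<eta>|lborel. cmod (Fh (\<lambda>x. p (x, \<eta>) * \<kappa>0 x) (\<eta> - \<xi>) * FD u \<kappa> \<eta>))"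
        by (rule integral_norm_bound)
      also have "\<dots> \<le> (C1 * M * C2) * ?c * japanese \<xi> powr t"
      proof (rule japanese_convolution[OF N])
        fix \<eta>
        have "cmod (Fh (\<lambda>x. p (x, \<eta>) * \<kappa>0 x) (\<eta> - \<xi>) * FD u \<kappa> \<eta>)
          \<le> (C1 * M * japanese \<eta> powr m * japanese (\<eta> - \<xi>) powr (- real N)) * (C2 * japanese \<eta> powr (t - m))"
          unfolding norm_mult
          by (rule mult_mono[OF C1(2)[OF amplitudesD[OF h] M(2)] C2(2)]) (use C1(1) M(1) in auto)
        also have "\<dots> = C1 * M * C2 * (japanese \<eta> powr t * japanese (\<eta> - \<xi>) powr 0 * japanese (\<eta> - \<xi>) powr (- real N))"
          by (simp add: powr_diff mult_ac)
        finally show "cmod (Fh (\<lambda>x. p (x, \<eta>) * \<kappa>0 x) (\<eta> - \<xi>) * FD u \<kappa> \<eta>)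
          \<le> C1 * M * C2 * (japanese \<eta> powr t * japanese (\<eta> - \<xi>) powr 0 * japanese (\<eta> - \<xi>) powr (- real N))" .
      qed (use C1 M C2 in auto)
      finally have I: "cmod (cn TYPE('a) * ?I) \<le> cmod (cn TYPE('a)) * (C1 * M * C2 * ?c * japanese \<xi> powr t)"
        unfolding norm_mult by (rule mult_left_mono) simp
      have "FD v \<kappa>0 \<xi> = (v (\<lambda>x. \<kappa>0 x * ex (- \<xi>) x) - cn TYPE('a) * ?I) + cn TYPE('a) * ?I"
        by (simp add: FD_def mult.commute)
      then have "cmod (FD v \<kappa>0 \<xi>) \<le> C * japanese \<xi> powr t + cmod (cn TYPE('a)) * (C1 * M * C2 * ?c * japanese \<xi> powr t)"
        using norm_triangle_mono[OF C[of \<xi>] I] by simp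
      then show ?thesis by (simp add: algebra_simps)
    qed
    then show "\<exists>C. \<forall>\<xi>. cmod (FD v \<kappa>0 \<xi>) \<le> C * japanese \<xi> powr t" by blast
  qed
qed

end

section \<open>Elliptic amplitudes and the gain of one order\<close>

lemma dbound_slice:
  assumes "open V" "smooth_on V f" "(x, y) \<in> V" "dbound N f (x, y) M"
  shows "dbound N (\<lambda>x. f (x, y)) x M"
  unfolding dbound_def
proof (intro ballI impI)
  fix \<alpha> :: "'a list" assume a: "\<alpha> \<in> lists Basis" "length \<alpha> \<le> N"
  then show "cmod (iterD \<alpha> (\<lambda>x. f (x, y)) x) \<le> M"
    unfolding iterD_slice_fst[OF assms(1,2) a(1) assms(3)]
    by (intro dboundD[OF assms(4)]) auto
qed

text \<open>Homogeneity reduces 1/q to x in \<open>K\<close> and unit \<xi>, a compact set on which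
  all x-derivatives are bounded. The sharp truncation in \<xi> is admissible, as
  \<open>amplitudes\<close> imposes no regularity in \<xi>.\<close>

lemma elliptic_amplitudes:
  fixes q :: "'a::euclidean_space \<times> 'a \<Rightarrow> complex"
  assumes q: "smooth_on {(x, \<xi>). \<xi> \<noteq> 0} q"
    and hom: "\<And>x \<xi> t. \<xi> \<noteq> 0 \<Longrightarrow> 0 < t \<Longrightarrow> q (x, t *\<^sub>R \<xi>) = complex_of_real (t powr m) * q (x, \<xi>)"
    and nz: "\<And>x \<xi>. \<xi> \<noteq> 0 \<Longrightarrow> q (x, \<xi>) \<noteq> 0"
    and \<kappa>: "\<kappa> \<in> test_functions" "fun_supp \<kappa> \<subseteq> K" and K: "compact K" and R: "1 \<le> R"
  shows "amplitudes K (- m) (\<lambda>\<xi> x. if R \<le> norm \<xi> then inverse (q (x, \<xi>)) * \<kappa> x else 0)"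
proof -
  let ?U = "{(x::'a, \<xi>::'a). \<xi> \<noteq> 0}"
  define Q where "Q z = inverse (q z)" for z
  have "?U = UNIV \<times> - {0}" by auto
  then have U: "open ?U" by (simp only: open_Times open_UNIV open_Compl closed_singleton)
  have Qs: "smooth_on ?U Q" unfolding Q_def[abs_def] by (rule smooth_on_inverse[OF U q]) (use nz in auto)
  have sl: "smooth_on UNIV (\<lambda>x. Q (x, \<xi>))" if "\<xi> \<noteq> 0" for \<xi>
    by (rule smooth_on_slice_fst[OF U Qs open_UNIV]) (use that in auto)
  have \<kappa>0: "\<kappa> x = 0" if "x \<notin> K" for x
    using fun_supp_zero[of x \<kappa>] \<kappa>(2) that by blast
  have "\<exists>C\<ge>0. \<forall>\<xi>. \<forall>x\<in>K. dbound N (\<lambda>x. if R \<le> norm \<xi> then Q (x, \<xi>) * \<kappa> x else 0) x (C * japanese \<xi> powr (- m))" for N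
  proof -
    have "K \<times> sphere 0 1 \<subseteq> ?U" by auto
    then obtain W where W: "0 \<le> W" "\<And>z. z \<in> K \<times> sphere 0 1 \<Longrightarrow> dbound N Q z W"
      using smooth_on_dbound_compact[OF Qs compact_Times[OF K compact_sphere]] by blast
    obtain M where M: "0 \<le> M" "\<And>x. x \<in> K \<Longrightarrow> dbound N \<kappa> x M"
      using smooth_on_dbound_compact[OF test_functions_smooth[OF \<kappa>(1)] K] by blast
    have main: "dbound N (\<lambda>x. Q (x, \<xi>)) x (2 powr \<bar>m\<bar> * W * japanese \<xi> powr (- m))"
      if \<xi>: "1 \<le> norm \<xi>" and x: "x \<in> K" for \<xi> x
    proof -
      define \<theta> where "\<theta> = inverse (norm \<xi>) *\<^sub>R \<xi>"
      have n: "0 < norm \<xi>" "norm \<theta> = 1" "\<theta> \<noteq> 0" "norm \<xi> *\<^sub>R \<theta> = \<xi>"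
      proof -
        have "norm \<xi> \<noteq> 0" using \<xi> by linarith
        then show "0 < norm \<xi>" "norm \<theta> = 1" "\<theta> \<noteq> 0" "norm \<xi> *\<^sub>R \<theta> = \<xi>"
          by (auto simp: \<theta>_def)
      qed
      have Qe: "Q (x, \<xi>) = complex_of_real (norm \<xi> powr (- m)) * Q (x, \<theta>)" for x
        using hom[OF n(3,1), of x] n(4) by (simp add: Q_def powr_minus)
      have "dbound N (\<lambda>x. Q (x, \<theta>)) x W"
        by (rule dbound_slice[OF U Qs]) (use W(2)[of "(x, \<theta>)"] n x in auto)
      from dbound_cmult[OF open_UNIV UNIV_I sl[OF n(3)] this, of "complex_of_real (norm \<xi> powr (- m))"]
      have "dbound N (\<lambda>x. Q (x, \<xi>)) x (norm \<xi> powr (- m) * W)" unfolding Qe by simp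
      moreover have "norm \<xi> powr (- m) * W \<le> 2 powr \<bar>m\<bar> * W * japanese \<xi> powr (- m)"
      proof -
        \<comment> \<open>For |\<xi>| \<ge> 1 the weight lies between |\<xi>| and 2|\<xi>|; which
          side is used depends on the sign of m.\<close>
        have "norm \<xi> powr (- m) \<le> 2 powr \<bar>m\<bar> * japanese \<xi> powr (- m)"
        proof (cases "0 \<le> m")
          case True
          have "japanese \<xi> powr m \<le> (2 * norm \<xi>) powr m"
            using japanese_le[of \<xi>] \<xi> True by (intro powr_mono2) auto
          then show ?thesis using True n(1) by (simp add: powr_mult powr_minus field_simps)
        next
          case False
          have "norm \<xi> powr (- m) \<le> japanese \<xi> powr (- m)"
            using False norm_le_japanese[of \<xi>] by (intro powr_mono2) auto
          also have "\<dots> \<le> 2 powr \<bar>m\<bar> * japanese \<xi> powr (- m)"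
            using mult_right_mono[OF ge_one_powr_ge_zero[of 2 "\<bar>m\<bar>"], of "japanese \<xi> powr (- m)"] by simp
          finally show ?thesis .
        qed
        from mult_right_mono[OF this W(1)] show ?thesis by (simp add: mult_ac)
      qed
      ultimately show ?thesis by (rule dbound_mono[OF _ order_refl])
    qed
    show ?thesis
    proof (intro exI[of _ "2 ^ N * (2 powr \<bar>m\<bar> * W * M)"] conjI allI ballI)
      fix \<xi> x assume x: "x \<in> K"
      show "dbound N (\<lambda>x. if R \<le> norm \<xi> then Q (x, \<xi>) * \<kappa> x else 0) x (2 ^ N * (2 powr \<bar>m\<bar> * W * M) * japanese \<xi> powr (- m))"
      proof (cases "R \<le> norm \<xi>")
        case True
        then have \<xi>: "1 \<le> norm \<xi>" "\<xi> \<noteq> 0" using R by auto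
        from dbound_mult[OF open_UNIV UNIV_I sl[OF \<xi>(2)] test_functions_smooth[OF \<kappa>(1)] main[OF \<xi>(1) x] M(2)[OF x]]
        show ?thesis using True by (simp add: mult_ac)
      next
        case False
        then show ?thesis
          using dbound_zero[OF open_UNIV, of "\<lambda>x::'a. 0" x] W M by simp
      qed
    qed (use W M in simp)
  qed
  moreover have "smooth_on UNIV (\<lambda>x. if R \<le> norm \<xi> then Q (x, \<xi>) * \<kappa> x else 0)" for \<xi>
  proof (cases "R \<le> norm \<xi>")
    case True
    then have "\<xi> \<noteq> 0" using R by auto
    with True show ?thesis by (simp add: smooth_on_mult sl test_functions_smooth[OF \<kappa>(1)])
  qed simp
  ultimately show ?thesis unfolding amplitudes_def Q_def using \<kappa>0 by simp
qed

context proper_transpose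
begin

text \<open>For large \<xi> the product p(x,\<eta>) h splits into \<kappa>0 and an error. The first
  contributes \<open>c\<close> times \<open>FD u \<kappa>0\<close> by Fourier inversion; the error
  gives a term one order below the bound for \<open>FD u \<kappa>\<close>. As the pairing of
  \<open>v\<close> with the amplitude decays rapidly, solving for \<open>FD u \<kappa>0\<close>
  gives the gain.\<close>

lemma bootstrap_step:
  assumes q: "smooth_on {(x, \<xi>). \<xi> \<noteq> 0} q"
    and hom: "\<And>x \<xi> t. \<xi> \<noteq> 0 \<Longrightarrow> 0 < t \<Longrightarrow> q (x, t *\<^sub>R \<xi>) = complex_of_real (t powr m) * q (x, \<xi>)"
    and nz: "\<And>x \<xi>. \<xi> \<noteq> 0 \<Longrightarrow> q (x, \<xi>) \<noteq> 0"
    and e: "e \<in> symbol_class (m - 1)" and R0: "1 \<le> R0" "\<And>x \<xi>. R0 \<le> norm \<xi> \<Longrightarrow> p (x, \<xi>) = q (x, \<xi>) + e (x, \<xi>)"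
    and R: "0 < R" and rap: "rapid_at v x0 R"
    and dec: "\<And>\<kappa>. \<kappa> \<in> test_functions \<Longrightarrow> fun_supp \<kappa> \<subseteq> ball x0 R \<Longrightarrow> \<exists>C. \<forall>\<xi>. cmod (FD u \<kappa> \<xi>) \<le> C * japanese \<xi> powr \<sigma>"
    and \<kappa>0: "\<kappa>0 \<in> test_functions" "fun_supp \<kappa>0 \<subseteq> ball x0 R"
  shows "\<exists>C. \<forall>\<xi>. cmod (FD u \<kappa>0 \<xi>) \<le> C * japanese \<xi> powr (\<sigma> - 1)"
proof -
  obtain c where c: "c \<noteq> 0" "\<And>(\<phi> :: 'a \<Rightarrow> complex) y. \<phi> \<in> test_functions \<Longrightarrow> IF (Fh \<phi>) y = c * \<phi> y"
    using Fourier_inversion by metis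
  obtain r where r: "0 \<le> r" "r < R" "fun_supp \<kappa>0 \<subseteq> cball x0 r"
    using inner_radius[OF test_functions_compact[OF \<kappa>0(1)] \<kappa>0(2) R] by blast
  let ?K = "cball x0 r"
  define r' where "r' = (r + R) / 2"
  have r': "0 \<le> r'" "r < r'" "r' < (r' + R) / 2" "(r' + R) / 2 < R" using r by (auto simp: r'_def)
  obtain \<kappa> :: "'a \<Rightarrow> complex" where \<kappa>: "\<kappa> \<in> test_functions" "\<And>x. x \<in> cball x0 r' \<Longrightarrow> \<kappa> x = 1"
    "\<And>x. x \<notin> ball x0 ((r' + R) / 2) \<Longrightarrow> \<kappa> x = 0" "fun_supp \<kappa> \<subseteq> cball x0 ((r' + R) / 2)" "\<And>x. cmod (\<kappa> x) \<le> 1"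
    by (rule bump_test_exists[OF r'(1,3)]) blast
  have "cball x0 ((r' + R) / 2) \<subseteq> ball x0 R" using r' by (auto simp: cball_subset_ball_iff)
  then obtain Cu where Cu: "\<And>\<eta>. cmod (FD u \<kappa> \<eta>) \<le> Cu * japanese \<eta> powr \<sigma>"
    using dec[OF \<kappa>(1)] \<kappa>(4) by blast
  have Cu0: "0 \<le> Cu"
    using order_trans[OF norm_ge_zero Cu[of 0]] by (simp add: zero_le_mult_iff)
  define h where "h \<xi> x = (if R0 \<le> norm \<xi> then inverse (q (x, \<xi>)) * \<kappa>0 x else 0)" for \<xi> x
  have h: "amplitudes ?K (- m) h"
    unfolding h_def[abs_def] by (rule elliptic_amplitudes[OF q hom nz \<kappa>0(1) r(3) compact_cball R0(1)])
  \<comment> \<open>For large \<xi> this is p(x,\<eta>) - q(x,\<xi>), arranged as an increment of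
    \<open>p\<close> plus the remainder \<open>e\<close> of order m - 1.\<close>
  define d where "d \<xi> \<eta> x = p (x, \<eta>) - p (x, \<xi>) + e (x, \<xi>)" for \<xi> \<eta> x
  let ?I = "\<lambda>\<xi>. LINT \<eta>|lborel. Fh (\<lambda>x. p (x, \<eta>) * h \<xi> x) (\<eta> - \<xi>) * FD u \<kappa> \<eta>"
  let ?J = "\<lambda>\<xi>. LINT \<eta>|lborel. Fh (\<lambda>x. d \<xi> \<eta> x * h \<xi> x) (\<eta> - \<xi>) * FD u \<kappa> \<eta>"
  \<comment> \<open>The growth exponent of \<open>symbol_increment_dbound\<close>; the number N of
    derivatives is chosen large enough to absorb it.\<close>
  define a where "a = \<bar>m - 1\<bar> + 1"
  obtain C1 where C1: "\<And>\<xi>. cmod (v (\<lambda>x. h \<xi> x * ex (- \<xi>) x) - cn TYPE('a) * ?I \<xi>) \<le> C1 * japanese \<xi> powr (\<sigma> - 1)"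
    using reduction_to_diagonal[OF r(1) r'(2) h \<kappa>(1,2), of "\<sigma> - 1"] by blast
  obtain C2 where C2: "\<And>\<xi>. cmod (v (\<lambda>x. h \<xi> x * ex (- \<xi>) x)) \<le> C2 * japanese \<xi> powr (\<sigma> - 1)"
    using rapid_at_amplitudes[OF v_distribution rap r(1,2) h, of "\<sigma> - 1"] by blast
  have fdm: "FD u \<kappa> \<in> borel_measurable borel" by (rule FD_measurable[OF u \<kappa>(1)])
  have split: "?I \<xi> = c * FD u \<kappa>0 \<xi> + ?J \<xi>" if \<xi>: "R0 \<le> norm \<xi>" for \<xi>
  proof -
    have n\<xi>: "\<xi> \<noteq> 0" using \<xi> R0(1) by auto
    define \<psi> where "\<psi> x = \<kappa>0 x * ex (- \<xi>) x" for x
    have \<psi>: "\<psi> \<in> test_functions" using test_ex_mult[OF \<kappa>0(1), of "- \<xi>"] by (simp add: \<psi>_def[abs_def] mult.commute)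
    have hs: "h \<xi> \<in> test_functions" by (rule test_functionsI[OF amplitudesD(1)[OF h] compact_cball amplitudesD(2)[OF h]])
    have t: "(\<lambda>x. h \<xi> x * ex (- \<xi>) x) \<in> test_functions" by (rule amplitudes_test[OF compact_cball h])
    have dh: "(\<lambda>x. d \<xi> \<eta> x * h \<xi> x) \<in> test_functions" for \<eta>
      unfolding d_def
      by (intro test_functions_mult'[OF _ hs] smooth_on_add smooth_on_diff symbol_slice[OF p] symbol_slice[OF e] open_UNIV)
    have "p (x, \<eta>) * h \<xi> x = \<kappa>0 x + d \<xi> \<eta> x * h \<xi> x" for x \<eta>
      using \<xi> nz[OF n\<xi>, of x] R0(2)[OF \<xi>, of x] by (simp add: h_def d_def field_simps)
    then have F: "Fh (\<lambda>x. p (x, \<eta>) * h \<xi> x) (\<eta> - \<xi>) = Fh \<psi> \<eta> + Fh (\<lambda>x. d \<xi> \<eta> x * h \<xi> x) (\<eta> - \<xi>)" for \<eta>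
      unfolding \<psi>_def[abs_def] Fh_shift by (simp add: Fh_add[OF \<kappa>0(1) dh])
    have i1: "integrable lborel (\<lambda>\<eta>. Fh (\<lambda>x. p (x, \<eta>) * h \<xi> x) (\<eta> - \<xi>) * FD u \<kappa> \<eta>)"
    proof -
      have "Fh (\<lambda>x. p (x, \<eta>) * (h \<xi> x * ex (- \<xi>) x)) \<eta> = Fh (\<lambda>x. p (x, \<eta>) * h \<xi> x) (\<eta> - \<xi>)" for \<eta>
        using Fh_shift[of "\<lambda>x. p (x, \<eta>) * h \<xi> x" \<xi> \<eta>] by (simp add: mult.assoc)
      then show ?thesis
        using rapid_integrable[OF rapid_mult[OF rapid_amplitude[OF p t] fdm Cu]] by (simp add: mult.commute)
    qed
    have i2: "integrable lborel (\<lambda>\<eta>. Fh \<psi> \<eta> * FD u \<kappa> \<eta>)"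
      using rapid_integrable[OF rapid_mult[OF rapid_Fh[OF \<psi>] fdm Cu]] by (simp add: mult.commute)
    have "?J \<xi> = (LINT \<eta>|lborel. Fh (\<lambda>x. p (x, \<eta>) * h \<xi> x) (\<eta> - \<xi>) * FD u \<kappa> \<eta> - Fh \<psi> \<eta> * FD u \<kappa> \<eta>)"
      unfolding F by (simp add: distrib_right)
    also have "\<dots> = ?I \<xi> - (LINT \<eta>|lborel. Fh \<psi> \<eta> * FD u \<kappa> \<eta>)"
      by (rule Bochner_Integration.integral_diff[OF i1 i2])
    also have "(LINT \<eta>|lborel. Fh \<psi> \<eta> * FD u \<kappa> \<eta>) = u (\<lambda>y. IF (Fh \<psi>) y * \<kappa> y)"
      by (rule dist_IF[symmetric, OF u \<kappa>(1) rapid_Fh[OF \<psi>] smooth_on_continuous_on[OF smooth_on_Fh[OF \<psi>]]])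
    \<comment> \<open>Inversion returns a multiple of \<psi>, on whose support \<kappa> is 1, so
      \<kappa> drops out.\<close>
    also have "(\<lambda>y. IF (Fh \<psi>) y * \<kappa> y) = (\<lambda>y. c * (ex (- \<xi>) y * \<kappa>0 y))"
    proof
      fix y
      show "IF (Fh \<psi>) y * \<kappa> y = c * (ex (- \<xi>) y * \<kappa>0 y)"
      proof (cases "y \<in> cball x0 r")
        case True
        then have "\<kappa> y = 1" using r'(2) by (intro \<kappa>(2)) auto
        then show ?thesis by (simp add: c(2)[OF \<psi>] \<psi>_def mult.commute)
      next
        case False
        then have "\<kappa>0 y = 0" using r(3) fun_supp_zero[of y \<kappa>0] by blast
        then show ?thesis by (simp add: c(2)[OF \<psi>] \<psi>_def)
      qed
    qed
    also have "u \<dots> = c * FD u \<kappa>0 \<xi>"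
      unfolding FD_def by (rule dist_cmult[OF u test_ex_mult[OF \<kappa>0(1)]])
    finally show ?thesis by simp
  qed
  obtain CJ where CJ: "\<And>\<xi>. cmod (?J \<xi>) \<le> CJ * japanese \<xi> powr (\<sigma> - 1)"
  proof -
    obtain N :: nat where N: "\<bar>\<sigma>\<bar> + a + 2 * real DIM('a) \<le> real N" using real_arch_simple by blast
    obtain F where F: "0 \<le> F" "\<And>g M z. smooth_on UNIV g \<Longrightarrow> (\<And>x. x \<notin> ?K \<Longrightarrow> g x = 0) \<Longrightarrow>
      (\<And>x. x \<in> ?K \<Longrightarrow> dbound N g x M) \<Longrightarrow> cmod (Fh g z) \<le> F * M * japanese z powr (- real N)"
      by (rule Fh_bound[OF compact_cball[of x0 r], where N=N]) blast
    obtain H where H: "0 \<le> H" "\<And>\<xi> x. x \<in> ?K \<Longrightarrow> dbound N (h \<xi>) x (H * japanese \<xi> powr (- m))"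
      using amplitudes_bound[OF h] by blast
    obtain A where A: "0 \<le> A" "\<And>x \<eta> \<xi>. x \<in> ?K \<Longrightarrow> dbound N (\<lambda>x. p (x, \<eta>) - p (x, \<xi>)) x
      (A * (japanese \<xi> powr (m - 1) * japanese (\<eta> - \<xi>) powr a))"
      using symbol_increment_dbound[OF p compact_cball] unfolding a_def by blast
    obtain B where B: "0 \<le> B" "\<And>x \<theta>. x \<in> ?K \<Longrightarrow> dbound N (\<lambda>x. e (x, \<theta>)) x (B * japanese \<theta> powr (m - 1))"
      using symbol_dbound[OF e compact_cball] by blast
    let ?c = "2 powr \<bar>\<sigma>\<bar> * (LINT \<eta>|lborel. japanese (\<eta>::'a) powr (- 2 * real DIM('a)))"
    let ?D = "F * (2 ^ N * ((A + B) * H)) * Cu"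
    have "cmod (?J \<xi>) \<le> ?D * ?c * japanese \<xi> powr (\<sigma> - 1)" for \<xi>
    proof -
      have "cmod (?J \<xi>) \<le> (LINT \<eta>|lborel. cmod (Fh (\<lambda>x. d \<xi> \<eta> x * h \<xi> x) (\<eta> - \<xi>) * FD u \<kappa> \<eta>))"
        by (rule integral_norm_bound)
      also have "\<dots> \<le> (?D * japanese \<xi> powr (- 1)) * ?c * japanese \<xi> powr \<sigma>"
      proof (rule japanese_convolution[OF N])
        fix \<eta>
        let ?w = "japanese (\<eta> - \<xi>) powr a"
        \<comment> \<open>A factor of at least 1 lets the remainder \<open>e\<close> share the bound
          for the increment.\<close>
        have w1: "1 \<le> ?w" using japanese_ge_1[of "\<eta> - \<xi>"] by (intro ge_one_powr_ge_zero) (auto simp: a_def)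
        have sd: "smooth_on UNIV (d \<xi> \<eta>)"
          unfolding d_def[abs_def]
          by (intro smooth_on_add smooth_on_diff symbol_slice[OF p] symbol_slice[OF e] open_UNIV)
        have dd: "dbound N (d \<xi> \<eta>) x ((A + B) * (japanese \<xi> powr (m - 1) * ?w))" if x: "x \<in> ?K" for x
        proof -
          have "dbound N (d \<xi> \<eta>) x (A * (japanese \<xi> powr (m - 1) * ?w) + B * japanese \<xi> powr (m - 1))"
            unfolding d_def[abs_def]
            by (rule dbound_add[OF open_UNIV UNIV_I smooth_on_diff[OF open_UNIV symbol_slice[OF p] symbol_slice[OF p]]
                  symbol_slice[OF e] A(2)[OF x] B(2)[OF x]])
          moreover have "B * japanese \<xi> powr (m - 1) \<le> B * japanese \<xi> powr (m - 1) * ?w"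
            using mult_left_mono[OF w1, of "B * japanese \<xi> powr (m - 1)"] B(1) by simp
          ultimately show ?thesis by (rule_tac dbound_mono[OF _ order_refl]) (auto simp: algebra_simps)
        qed
        have "cmod (Fh (\<lambda>x. d \<xi> \<eta> x * h \<xi> x) (\<eta> - \<xi>))
          \<le> F * (2 ^ N * (((A + B) * (japanese \<xi> powr (m - 1) * ?w)) * (H * japanese \<xi> powr (- m)))) * japanese (\<eta> - \<xi>) powr (- real N)"
        proof (rule F(2))
          show "smooth_on UNIV (\<lambda>x. d \<xi> \<eta> x * h \<xi> x)" by (rule smooth_on_mult[OF open_UNIV sd amplitudesD(1)[OF h]])
          show "d \<xi> \<eta> x * h \<xi> x = 0" if "x \<notin> ?K" for x using amplitudesD(2)[OF h that] by simp
          show "dbound N (\<lambda>x. d \<xi> \<eta> x * h \<xi> x) x (2 ^ N * (((A + B) * (japanese \<xi> powr (m - 1) * ?w)) * (H * japanese \<xi> powr (- m))))"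
            if "x \<in> ?K" for x
            by (rule dbound_mult[OF open_UNIV UNIV_I sd amplitudesD(1)[OF h] dd[OF that] H(2)[OF that]])
        qed
        also have "\<dots> = F * (2 ^ N * ((A + B) * H)) * (japanese \<xi> powr (m - 1) * japanese \<xi> powr (- m)) * (?w * japanese (\<eta> - \<xi>) powr (- real N))"
          by (simp add: mult_ac)
        also have "japanese \<xi> powr (m - 1) * japanese \<xi> powr (- m) = japanese \<xi> powr (- 1)"
          by (simp add: powr_add[symmetric])
        finally have "cmod (Fh (\<lambda>x. d \<xi> \<eta> x * h \<xi> x) (\<eta> - \<xi>) * FD u \<kappa> \<eta>)
          \<le> (F * (2 ^ N * ((A + B) * H)) * japanese \<xi> powr (- 1) * (?w * japanese (\<eta> - \<xi>) powr (- real N))) * (Cu * japanese \<eta> powr \<sigma>)"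
          unfolding norm_mult by (rule mult_mono[OF _ Cu]) (use F(1) A(1) B(1) H(1) in auto)
        then show "cmod (Fh (\<lambda>x. d \<xi> \<eta> x * h \<xi> x) (\<eta> - \<xi>) * FD u \<kappa> \<eta>)
          \<le> ?D * japanese \<xi> powr (- 1) * (japanese \<eta> powr \<sigma> * ?w * japanese (\<eta> - \<xi>) powr (- real N))"
          by (simp add: mult_ac)
      qed (use F(1) A(1) B(1) H(1) Cu0 in auto)
      also have "\<dots> = ?D * ?c * (japanese \<xi> powr (- 1) * japanese \<xi> powr \<sigma>)" by (simp add: mult_ac)
      also have "japanese \<xi> powr (- 1) * japanese \<xi> powr \<sigma> = japanese \<xi> powr (\<sigma> - 1)"
        by (simp add: powr_diff)
      finally show ?thesis .
    qed
    with that show ?thesis by blast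
  qed
  let ?k = "cn TYPE('a) * c"
  have k: "0 < cmod ?k" using cn_nonzero[where 'a='a] c(1) by simp
  have large: "cmod (FD u \<kappa>0 \<xi>) \<le> (C1 + C2 + cmod (cn TYPE('a)) * CJ) / cmod ?k * japanese \<xi> powr (\<sigma> - 1)"
    if \<xi>: "R0 \<le> norm \<xi>" for \<xi>
  proof -
    let ?v = "v (\<lambda>x. h \<xi> x * ex (- \<xi>) x)"
    have "?k * FD u \<kappa>0 \<xi> = ?v - (?v - cn TYPE('a) * ?I \<xi>) - cn TYPE('a) * ?J \<xi>"
      unfolding split[OF \<xi>] by (simp add: algebra_simps)
    then have "cmod (?k * FD u \<kappa>0 \<xi>) \<le> cmod ?v + cmod (?v - cn TYPE('a) * ?I \<xi>) + cmod (cn TYPE('a) * ?J \<xi>)"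
      using norm_triangle_ineq4[of "?v - (?v - cn TYPE('a) * ?I \<xi>)" "cn TYPE('a) * ?J \<xi>"]
        norm_triangle_ineq4[of ?v "?v - cn TYPE('a) * ?I \<xi>"] by simp
    also have "\<dots> \<le> C2 * japanese \<xi> powr (\<sigma> - 1) + C1 * japanese \<xi> powr (\<sigma> - 1)
        + cmod (cn TYPE('a)) * (CJ * japanese \<xi> powr (\<sigma> - 1))"
      unfolding norm_mult[of "cn TYPE('a)"] by (intro add_mono C1 C2 mult_left_mono CJ) simp
    finally have "cmod ?k * cmod (FD u \<kappa>0 \<xi>) \<le> (C1 + C2 + cmod (cn TYPE('a)) * CJ) * japanese \<xi> powr (\<sigma> - 1)"
      by (simp add: norm_mult algebra_simps)
    then show ?thesis using k by (simp only: pos_le_divide_eq times_divide_eq_left mult.commute[of "cmod ?k"])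
  qed
  \<comment> \<open>Below \<open>R0\<close> the truncated amplitude says nothing about
    \<open>FD u \<kappa>0\<close>; a bound there comes from continuity on a compact ball.\<close>
  have "compact ((\<lambda>\<xi>. cmod (FD u \<kappa>0 \<xi>) / japanese \<xi> powr (\<sigma> - 1)) ` cball 0 R0)"
    by (intro compact_continuous_image continuous_intros continuous_on_subset[OF continuous_on_FD[OF u \<kappa>0(1)]]
        compact_cball) auto
  then obtain S where "\<forall>z\<in>(\<lambda>\<xi>. cmod (FD u \<kappa>0 \<xi>) / japanese \<xi> powr (\<sigma> - 1)) ` cball 0 R0. norm z \<le> S"
    using compact_imp_bounded bounded_iff by metis
  then have S: "cmod (FD u \<kappa>0 \<xi>) \<le> S * japanese \<xi> powr (\<sigma> - 1)" if "\<not> R0 \<le> norm \<xi>" for \<xi>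
    using that by (fastforce simp: field_simps)
  let ?L = "(C1 + C2 + cmod (cn TYPE('a)) * CJ) / cmod ?k"
  have "cmod (FD u \<kappa>0 \<xi>) \<le> max ?L S * japanese \<xi> powr (\<sigma> - 1)" for \<xi>
  proof -
    have "?L * japanese \<xi> powr (\<sigma> - 1) \<le> max ?L S * japanese \<xi> powr (\<sigma> - 1)"
      "S * japanese \<xi> powr (\<sigma> - 1) \<le> max ?L S * japanese \<xi> powr (\<sigma> - 1)"
      by (intro mult_right_mono; simp)+
    then show ?thesis using large[of \<xi>] S[of \<xi>] order_trans by blast
  qed
  then show ?thesis by blast
qed

text \<open>\<open>FD_growth\<close> supplies one starting exponent for all cutoffs in the ball, and
  each step lowers it by 1. The induction keeps the cutoff arbitrary, since a step for one cutoff
  uses the bound for a wider one.\<close>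

lemma rapid_at_preimage:
  assumes q: "smooth_on {(x, \<xi>). \<xi> \<noteq> 0} q"
    and hom: "\<And>x \<xi> t. \<xi> \<noteq> 0 \<Longrightarrow> 0 < t \<Longrightarrow> q (x, t *\<^sub>R \<xi>) = complex_of_real (t powr m) * q (x, \<xi>)"
    and nz: "\<And>x \<xi>. \<xi> \<noteq> 0 \<Longrightarrow> q (x, \<xi>) \<noteq> 0"
    and e: "e \<in> symbol_class (m - 1)" and R0: "1 \<le> R0" "\<And>x \<xi>. R0 \<le> norm \<xi> \<Longrightarrow> p (x, \<xi>) = q (x, \<xi>) + e (x, \<xi>)"
    and R: "0 < R" and rap: "rapid_at v x0 R"
  shows "rapid_at u x0 R"
proof -
  obtain k where k: "\<And>\<kappa>. \<kappa> \<in> test_functions \<Longrightarrow> fun_supp \<kappa> \<subseteq> cball x0 R \<Longrightarrow>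
    \<exists>C. 0 \<le> C \<and> (\<forall>\<eta>. cmod (FD u \<kappa> \<eta>) \<le> C * japanese \<eta> powr real k)"
    using FD_growth[OF u compact_cball] by blast
  have dec: "\<exists>C. \<forall>\<xi>. cmod (FD u \<kappa> \<xi>) \<le> C * japanese \<xi> powr (real k - real j)"
    if "\<kappa> \<in> test_functions" "fun_supp \<kappa> \<subseteq> ball x0 R" for j \<kappa>
    using that
  proof (induction j arbitrary: \<kappa>)
    case 0
    have "fun_supp \<kappa> \<subseteq> cball x0 R" using 0(2) ball_subset_cball by blast
    then show ?case using k[OF 0(1)] by auto
  next
    case (Suc j)
    have "\<exists>C. \<forall>\<xi>. cmod (FD u \<kappa> \<xi>) \<le> C * japanese \<xi> powr ((real k - real j) - 1)"
      by (rule bootstrap_step[OF q hom nz e R0 R rap Suc.IH Suc.prems])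
    then show ?case by (simp add: algebra_simps)
  qed
  show ?thesis
    unfolding rapid_at_def
  proof (intro ballI impI)
    fix \<kappa> :: "'a \<Rightarrow> complex" assume \<kappa>: "\<kappa> \<in> test_functions" "fun_supp \<kappa> \<subseteq> ball x0 R"
    show "rapid (FD u \<kappa>)"
    proof (rule rapidI[OF FD_measurable[OF u \<kappa>(1)]])
      fix t
      obtain j :: nat where j: "real k - t \<le> real j" using real_arch_simple by blast
      obtain C where C: "\<And>\<xi>. cmod (FD u \<kappa> \<xi>) \<le> C * japanese \<xi> powr (real k - real j)"
        using dec[OF \<kappa>, of j] by blast
      have "0 \<le> C" using order_trans[OF norm_ge_zero C[of 0]] by (simp add: zero_le_mult_iff)
      then have "C * japanese \<xi> powr (real k - real j) \<le> C * japanese \<xi> powr t" for \<xi> :: 'a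
        using j by (intro mult_left_mono japanese_powr_mono) auto
      then show "\<exists>C. \<forall>\<xi>. cmod (FD u \<kappa> \<xi>) \<le> C * japanese \<xi> powr t" using C order_trans by blast
    qed
  qed
qed

end

text \<open>Ellipticity supplies a left symbol together with its expansion, so symbol and principal
  part match. Rapid decay then passes between \<open>u\<close> and \<open>apply_op P u\<close>, and
  both claims follow from their characterizations by \<open>rapid_at\<close>.\<close>

theorem elliptic_regularity:
  fixes P :: "'a::euclidean_space operator"
  assumes P: "properly_supported P" and ell: "elliptic m P" and u: "u \<in> distributions"
  shows "(dist_smooth_on UNIV (apply_op P u) \<longrightarrow> dist_smooth_on UNIV u) \<and>
    singsupp (apply_op P u) = singsupp u"
proof -
  obtain p q where pq: "left_symbol m P p" "classical_expansion m p q"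
    and nz: "\<And>x \<xi>. \<xi> \<noteq> 0 \<Longrightarrow> q 0 (x, \<xi>) \<noteq> 0"
    using ell unfolding elliptic_def principal_symbol_def by blast
  have p: "p \<in> symbol_class m" using pq(1) unfolding left_symbol_def by blast
  have q: "smooth_on {(x, \<xi>). \<xi> \<noteq> 0} (q 0)"
    and hom: "\<And>x \<xi> t. \<xi> \<noteq> 0 \<Longrightarrow> 0 < t \<Longrightarrow> q 0 (x, t *\<^sub>R \<xi>) = complex_of_real (t powr m) * q 0 (x, \<xi>)"
    using pq(2) unfolding classical_expansion_def by (blast, fastforce)
  obtain \<phi> where \<phi>: "cutoff \<phi>"
    "\<And>N. (\<lambda>(x, \<xi>). p (x, \<xi>) - (\<Sum>j<N. (1 - \<phi> \<xi>) * q j (x, \<xi>))) \<in> symbol_class (m - real N)"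
    using pq(2) unfolding classical_expansion_def by blast
  \<comment> \<open>The remainder of the expansion with \<open>N = 1\<close>, of order m - 1. Beyond
    the support of \<phi> the factor 1 - \<phi> is 1, which is where \<open>p\<close> equals its
    principal part plus \<open>e\<close>.\<close>
  define e where "e = (\<lambda>(x, \<xi>). p (x, \<xi>) - (1 - \<phi> \<xi>) * q 0 (x, \<xi>))"
  have e: "e \<in> symbol_class (m - 1)" using \<phi>(2)[of 1] by (simp add: e_def)
  have \<phi>t: "\<phi> \<in> test_functions" using \<phi>(1) by (simp add: cutoff_def)
  obtain R1 where R1: "fun_supp \<phi> \<subseteq> ball 0 R1"
    using bounded_subset_ballD[OF compact_imp_bounded[OF test_functions_compact[OF \<phi>t]], of 0] by blast
  have R0: "p (x, \<xi>) = q 0 (x, \<xi>) + e (x, \<xi>)" if "max 1 R1 \<le> norm \<xi>" for x \<xi>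
  proof -
    have "\<phi> \<xi> = 0" using subsetD[OF R1, of \<xi>] that fun_supp_zero[of \<xi> \<phi>] by (cases "\<xi> \<in> fun_supp \<phi>") auto
    then show ?thesis by (simp add: e_def)
  qed
  obtain s where s: "smooth_on UNIV s"
    "\<And>\<phi> \<psi>. \<phi> \<in> test_functions \<Longrightarrow> \<psi> \<in> test_functions \<Longrightarrow> P \<phi> \<psi> = (LINT y|lborel. Tr p s \<psi> y * \<phi> y)"
    using left_symbol_transpose[OF pq(1)] by blast
  have proper: "\<exists>K. compact K \<and> (\<forall>\<psi>\<in>test_functions. fun_supp \<psi> \<subseteq> C \<longrightarrow> (\<forall>y. y \<notin> K \<longrightarrow> Tr p s \<psi> y = 0))"
    if "compact C" for C
    by (rule properly_supported_transpose[OF P p s(1) s(2) that])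
  have test: "Tr p s \<psi> \<in> test_functions" if \<psi>: "\<psi> \<in> test_functions" for \<psi>
  proof -
    obtain K where K: "compact K" "\<forall>\<psi>'\<in>test_functions. fun_supp \<psi>' \<subseteq> fun_supp \<psi> \<longrightarrow> (\<forall>y. y \<notin> K \<longrightarrow> Tr p s \<psi>' y = 0)"
      using proper[OF test_functions_compact[OF \<psi>]] by blast
    have K0: "Tr p s \<psi> y = 0" if "y \<notin> K" for y using K(2) \<psi> that by simp
    show ?thesis by (rule test_functionsI[OF linop_smooth[OF linop_Tr[OF p s(1)] \<psi>] K(1) K0])
  qed
  interpret proper_transpose p s m u "apply_op P u"
  proof
    show "apply_op P u \<psi> = u (Tr p s \<psi>)" if "\<psi> \<in> test_functions" for \<psi>
      by (rule apply_op_eq[of P \<psi> "Tr p s \<psi>" u]) (simp_all add: s(2) test that)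
  qed (use p s(1) proper u in auto)
  \<comment> \<open>The radius is the same on both sides, so one equivalence serves the local and
    the global characterization.\<close>
  have iff: "rapid_at (apply_op P u) x R = rapid_at u x R" if "0 < R" for x R
    using rapid_at_image[OF that, where ?x0.0 = x]
      rapid_at_preimage[OF q hom nz e max.cobounded1 R0 that, where ?x0.0 = x]
    by blast
  have "x \<notin> singsupp (apply_op P u) \<longleftrightarrow> x \<notin> singsupp u" for x
    unfolding notin_singsupp_iff[OF v_distribution] notin_singsupp_iff[OF u] using iff by auto
  then have "singsupp (apply_op P u) = singsupp u" by blast
  moreover have "dist_smooth_on UNIV (apply_op P u) = dist_smooth_on UNIV u"
    unfolding dist_smooth_UNIV_iff[OF v_distribution] dist_smooth_UNIV_iff[OF u] using iff by auto
  ultimately show ?thesis by simp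
qed

theorem theorem5p9:
  fixes m :: real
    and P :: "(real ^ 'n) operator"
    and u :: "(real ^ 'n) functional"
  assumes "P \<in> PsiDO m"
    and "properly_supported P"
    and "classical m P"
    and "elliptic m P"
    and "u \<in> distributions"
  shows "(dist_smooth_on UNIV (apply_op P u) \<longrightarrow> dist_smooth_on UNIV u) \<and>
         singsupp (apply_op P u) = singsupp u"
  by (rule elliptic_regularity[OF assms(2,4,5)])

end
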